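(* Let $n\ge 2$, $1\le s\le n$, and let $u_{sn}=v_{11}+\cdots+v_{ss}\in A_u(n)$, considered as a non-commutative random variable with respect to the Haar functional of $A_u(n)$. Then: (1) $u_{sn}=z\,o_{sn}$ (as an equality of $*$-distributions), where $o_{sn}=u_{11}+\cdots+u_{ss}\in A_o(n)$ is taken with respect to the Haar functional of $A_o(n)$, and $z$ is a Haar-unitary free from $o_{sn}$. (2) The variable $u_{nn}$ is circular. (3) For fixed $s$, the variable $(n/s)^{1/2}u_{sn}$ is asymptotically circular as $n\to\infty$, i.e. its $*$-moments converge to those of a circular variable.
   Context: $A_u(n)$ is the universal (unital) $C^*$-algebra generated by $n^2$ elements $v_{ij}$, $1\le i,j\le n$, subject to the relations making both $v=(v_{ij})$ and $v^t=(v_{ji})$ unitary matrices. $A_o(n)$ is the universal (unital) $C^*$-algebra generated by $n^2$ elements $u_{ij}$, $1\le i,j\le n$, subject to the relations $u_{ij}=u_{ij}^*$ and $uu^t=u^tu=1$ for $u=(u_{ij})$. Both are Hopf $C^*$-algebras with comultiplication $\Delta(w_{ij})=\sum_k w_{ik}\otimes w_{kj}$ on generators ($w=v$ or $u$). The Haar functional of such an algebra $A$ is the unique positive unital linear form $\int:A\to\mathbb{C}$ satisfying $(\mathrm{id}\otimes\int)\Delta(a)=(\int\otimes\mathrm{id})\Delta(a)=(\int a)\,1$ for all $a$. The single-indexed-by-pair variable $u_{sn}$ (an element of $A_u(n)$) should not be confused with the generators $u_{ij}$ of $A_o(n)$. A Haar-unitary is a unitary $z$ with $\int z^m=0$ for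 all $m\in\mathbb{Z}\setminus\{0\}$; freeness is Voiculescu's ($*$-)freeness. A semicircular variable is a self-adjoint variable with law of density $\frac1{2\pi}\sqrt{4-x^2}$ on $[-2,2]$; a circular variable is one with the $*$-distribution of $(x+iy)/\sqrt2$ with $x,y$ free semicircular. *)

theory Defs
  imports
    "HOL-Analysis.Analysis"
    "HOL-Library.Poly_Mapping"
    "HOL-Library.Product_Plus"
    "HOL-Algebra.Module"
begin

section \<open>Unital *-algebras, states, non-commutative random variables\<close>

definition complex_ring :: "complex ring" where
  "complex_ring = \<lparr>carrier = UNIV, mult = (*), one = 1, zero = 0, add = (+)\<rparr>"

record 'a star_alg = "(complex, 'a) module" +
  star :: "'a \<Rightarrow> 'a"

record 'a cstar = "'a star_alg" +
  cnorm :: "'a \<Rightarrow> real"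

locale star_algebra = ring A + module complex_ring A
  for A :: "('a, 'm) star_alg_scheme" (structure) +
  assumes smult_mult_left:
      "x \<in> carrier A \<Longrightarrow> y \<in> carrier A \<Longrightarrow> (c \<odot> x) \<otimes> y = c \<odot> (x \<otimes> y)"
    and smult_mult_right:
      "x \<in> carrier A \<Longrightarrow> y \<in> carrier A \<Longrightarrow> x \<otimes> (c \<odot> y) = c \<odot> (x \<otimes> y)"
    and star_closed: "x \<in> carrier A \<Longrightarrow> star A x \<in> carrier A"
    and star_star: "x \<in> carrier A \<Longrightarrow> star A (star A x) = x"
    and star_add:
      "x \<in> carrier A \<Longrightarrow> y \<in> carrier A \<Longrightarrow> star A (x \<oplus> y) = star A x \<oplus> star A y"
    and star_mult:
      "x \<in> carrier A \<Longrightarrow> y \<in> carrier A \<Longrightarrow> star A (x \<otimes> y) = star A y \<otimes> star A x"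
    and star_smult: "x \<in> carrier A \<Longrightarrow> star A (c \<odot> x) = cnj c \<odot> star A x"

definition linear_map ::
  "('a, 'm) star_alg_scheme \<Rightarrow> ('b, 'n) star_alg_scheme \<Rightarrow> ('a \<Rightarrow> 'b) \<Rightarrow> bool" where
  "linear_map A B f \<longleftrightarrow> f \<in> carrier A \<rightarrow> carrier B \<and>
     (\<forall>x\<in>carrier A. \<forall>y\<in>carrier A. f (x \<oplus>\<^bsub>A\<^esub> y) = f x \<oplus>\<^bsub>B\<^esub> f y) \<and>
     (\<forall>c. \<forall>x\<in>carrier A. f (c \<odot>\<^bsub>A\<^esub> x) = c \<odot>\<^bsub>B\<^esub> f x)"

definition unital_star_hom ::
  "('a, 'm) star_alg_scheme \<Rightarrow> ('b, 'n) star_alg_scheme \<Rightarrow> ('a \<Rightarrow> 'b) \<Rightarrow> bool" where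
  "unital_star_hom A B f \<longleftrightarrow> linear_map A B f \<and> f \<one>\<^bsub>A\<^esub> = \<one>\<^bsub>B\<^esub> \<and>
     (\<forall>x\<in>carrier A. \<forall>y\<in>carrier A. f (x \<otimes>\<^bsub>A\<^esub> y) = f x \<otimes>\<^bsub>B\<^esub> f y) \<and>
     (\<forall>x\<in>carrier A. f (star A x) = star B (f x))"

text \<open>Positive unital linear functionals.\<close>

definition state :: "('a, 'm) star_alg_scheme \<Rightarrow> ('a \<Rightarrow> complex) \<Rightarrow> bool" where
  "state A \<phi> \<longleftrightarrow>
     (\<forall>x\<in>carrier A. \<forall>y\<in>carrier A. \<phi> (x \<oplus>\<^bsub>A\<^esub> y) = \<phi> x + \<phi> y) \<and>
     (\<forall>c. \<forall>x\<in>carrier A. \<phi> (c \<odot>\<^bsub>A\<^esub> x) = c * \<phi> x) \<and>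
     \<phi> \<one>\<^bsub>A\<^esub> = 1 \<and>
     (\<forall>x\<in>carrier A. \<phi> (star A x \<otimes>\<^bsub>A\<^esub> x) \<in> \<real>\<^sub>\<ge>\<^sub>0)"

definition star_prob_space :: "('a, 'm) star_alg_scheme \<Rightarrow> ('a \<Rightarrow> complex) \<Rightarrow> bool" where
  "star_prob_space A \<phi> \<longleftrightarrow> star_algebra A \<and> state A \<phi>"

text \<open>The *-moment of a variable \<open>a\<close> at a word in the letters \<open>a\<close> (coded by \<open>False\<close>) and
  \<open>a*\<close> (coded by \<open>True\<close>). The *-distribution of \<open>a\<close> is the family of its *-moments.\<close>

definition star_moment ::
  "('a, 'm) star_alg_scheme \<Rightarrow> ('a \<Rightarrow> complex) \<Rightarrow> 'a \<Rightarrow> bool list \<Rightarrow> complex" where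
  "star_moment A \<phi> a w =
     \<phi> (foldr (\<lambda>e x. (if e then star A a else a) \<otimes>\<^bsub>A\<^esub> x) w \<one>\<^bsub>A\<^esub>)"

definition same_star_distribution ::
  "('a, 'm) star_alg_scheme \<Rightarrow> ('a \<Rightarrow> complex) \<Rightarrow> 'a \<Rightarrow>
   ('b, 'n) star_alg_scheme \<Rightarrow> ('b \<Rightarrow> complex) \<Rightarrow> 'b \<Rightarrow> bool" where
  "same_star_distribution A \<phi> a B \<psi> b \<longleftrightarrow> (\<forall>w. star_moment A \<phi> a w = star_moment B \<psi> b w)"

definition unital_star_subalgebra :: "('a, 'm) star_alg_scheme \<Rightarrow> 'a set \<Rightarrow> bool" where
  "unital_star_subalgebra A S \<longleftrightarrow> S \<subseteq> carrier A \<and> \<one>\<^bsub>A\<^esub> \<in> S \<and>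
     (\<forall>x\<in>S. \<forall>y\<in>S. x \<oplus>\<^bsub>A\<^esub> y \<in> S \<and> x \<otimes>\<^bsub>A\<^esub> y \<in> S) \<and>
     (\<forall>c. \<forall>x\<in>S. c \<odot>\<^bsub>A\<^esub> x \<in> S) \<and> (\<forall>x\<in>S. star A x \<in> S)"

definition generated_star_subalgebra :: "('a, 'm) star_alg_scheme \<Rightarrow> 'a set \<Rightarrow> 'a set" where
  "generated_star_subalgebra A X = \<Inter>{S. unital_star_subalgebra A S \<and> X \<subseteq> S}"

text \<open>Voiculescu freeness of a family of subalgebras: alternating products of centred elements
  are centred. An element \<open>(i, a)\<close> of the list is a factor \<open>a\<close> taken from the algebra \<open>S i\<close>.\<close>

definition free_subalgebras ::
  "('a, 'm) star_alg_scheme \<Rightarrow> ('a \<Rightarrow> complex) \<Rightarrow> ('i \<Rightarrow> 'a set) \<Rightarrow> bool" where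
  "free_subalgebras A \<phi> S \<longleftrightarrow>
     (\<forall>xs. xs \<noteq> [] \<and> (\<forall>(i, a)\<in>set xs. a \<in> S i \<and> \<phi> a = 0) \<and> distinct_adj (map fst xs) \<longrightarrow>
        \<phi> (foldr (\<otimes>\<^bsub>A\<^esub>) (map snd xs) \<one>\<^bsub>A\<^esub>) = 0)"

definition star_free ::
  "('a, 'm) star_alg_scheme \<Rightarrow> ('a \<Rightarrow> complex) \<Rightarrow> 'a \<Rightarrow> 'a \<Rightarrow> bool" where
  "star_free A \<phi> a b \<longleftrightarrow>
     free_subalgebras A \<phi> (\<lambda>i::bool. generated_star_subalgebra A {if i then a else b})"

definition haar_unitary :: "('a, 'm) star_alg_scheme \<Rightarrow> ('a \<Rightarrow> complex) \<Rightarrow> 'a \<Rightarrow> bool" where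
  "haar_unitary A \<phi> z \<longleftrightarrow> z \<in> carrier A \<and>
     star A z \<otimes>\<^bsub>A\<^esub> z = \<one>\<^bsub>A\<^esub> \<and> z \<otimes>\<^bsub>A\<^esub> star A z = \<one>\<^bsub>A\<^esub> \<and>
     (\<forall>m::int. m \<noteq> 0 \<longrightarrow> \<phi> (z [^]\<^bsub>A\<^esub> m) = 0)"

text \<open>The law of a self-adjoint variable is encoded by its moments; a compactly supported measure
  on the line is determined by them.\<close>

definition semicircular :: "('a, 'm) star_alg_scheme \<Rightarrow> ('a \<Rightarrow> complex) \<Rightarrow> 'a \<Rightarrow> bool" where
  "semicircular A \<phi> x \<longleftrightarrow> x \<in> carrier A \<and> star A x = x \<and>
     (\<forall>k::nat. \<phi> (x [^]\<^bsub>A\<^esub> k) =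
        of_real (integral {-2..2} (\<lambda>t. t ^ k * (sqrt (4 - t\<^sup>2) / (2 * pi)))))"

text \<open>Existential statements over *-probability spaces range over those whose elements are coded
  by complex sequences. This loses no generality: only the *-subalgebra generated by finitely many
  variables matters, and it has at most the cardinality of the continuum.\<close>

type_synonym space = "(nat \<Rightarrow> complex) star_alg"

definition circular :: "('a, 'm) star_alg_scheme \<Rightarrow> ('a \<Rightarrow> complex) \<Rightarrow> 'a \<Rightarrow> bool" where
  "circular A \<phi> a \<longleftrightarrow> a \<in> carrier A \<and>
     (\<exists>(B :: space) \<psi> x y. star_prob_space B \<psi> \<and>
        semicircular B \<psi> x \<and> semicircular B \<psi> y \<and> star_free B \<psi> x y \<and>
        same_star_distribution A \<phi> a B \<psi>
          (complex_of_real (1 / sqrt 2) \<odot>\<^bsub>B\<^esub> (x \<oplus>\<^bsub>B\<^esub> \<i> \<odot>\<^bsub>B\<^esub> y)))"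


section \<open>Monoid *-algebras and C*-completions\<close>

text \<open>For a monoid with involution, \<open>'m \<Rightarrow>\<^sub>0 complex\<close> with its convolution product is the monoid
  *-algebra. Words in letters and starred letters give the free *-algebra, and pairs of words its
  algebraic tensor square.\<close>

class involutive_monoid = monoid_add +
  fixes invol :: "'a \<Rightarrow> 'a"
  assumes invol_invol: "invol (invol x) = x"
    and invol_add: "invol (x + y) = invol y + invol x"

datatype 'g word = Word (letters: "('g \<times> bool) list")

instantiation word :: (type) involutive_monoid
begin

definition "0 = Word []"
definition "v + w = Word (letters v @ letters w)"
definition "invol w = Word (rev (map (\<lambda>(g, e). (g, \<not> e)) (letters w)))"

instance
  by standard
    (auto simp: zero_word_def plus_word_def invol_word_def rev_map comp_def split_def)

end

instantiation prod :: (involutive_monoid, involutive_monoid) involutive_monoid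
begin

definition "invol p = (invol (fst p), invol (snd p))"

instance
  by standard (auto simp: invol_prod_def invol_invol invol_add)

end

definition scalar :: "complex \<Rightarrow> ('m::monoid_add \<Rightarrow>\<^sub>0 complex)" where
  "scalar c = Poly_Mapping.single 0 c"

definition pstar :: "('m::involutive_monoid \<Rightarrow>\<^sub>0 complex) \<Rightarrow> ('m \<Rightarrow>\<^sub>0 complex)" where
  "pstar x = (\<Sum>m\<in>Poly_Mapping.keys x.
     Poly_Mapping.single (invol m) (cnj (Poly_Mapping.lookup x m)))"

definition monoid_algebra :: "'m set \<Rightarrow> ('m \<Rightarrow>\<^sub>0 complex) set" where
  "monoid_algebra M = {x. Poly_Mapping.keys x \<subseteq> M}"

definition cstar_seminorm ::
  "'m::involutive_monoid set \<Rightarrow> (('m \<Rightarrow>\<^sub>0 complex) \<Rightarrow> real) \<Rightarrow> bool" where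
  "cstar_seminorm M p \<longleftrightarrow>
     (\<forall>x\<in>monoid_algebra M. 0 \<le> p x) \<and>
     (\<forall>c. \<forall>x\<in>monoid_algebra M. p (scalar c * x) = cmod c * p x) \<and>
     (\<forall>x\<in>monoid_algebra M. \<forall>y\<in>monoid_algebra M. p (x + y) \<le> p x + p y) \<and>
     (\<forall>x\<in>monoid_algebra M. \<forall>y\<in>monoid_algebra M. p (x * y) \<le> p x * p y) \<and>
     (\<forall>x\<in>monoid_algebra M. p (pstar x * x) = (p x)\<^sup>2)"

text \<open>The largest C*-seminorm killing the relators \<open>R\<close>. The separated completion for it is the
  universal C*-algebra with generators and relations given by \<open>M\<close> and \<open>R\<close>, since C*-seminorms
  vanishing on \<open>R\<close> are the same as norms in *-representations satisfying the relations.\<close>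

definition universal_seminorm ::
  "'m::involutive_monoid set \<Rightarrow> ('m \<Rightarrow>\<^sub>0 complex) set \<Rightarrow> ('m \<Rightarrow>\<^sub>0 complex) \<Rightarrow> real" where
  "universal_seminorm M R x = Sup {p x | p. cstar_seminorm M p \<and> (\<forall>r\<in>R. p r = 0)}"

definition cauchy_seq ::
  "'m set \<Rightarrow> (('m \<Rightarrow>\<^sub>0 complex) \<Rightarrow> real) \<Rightarrow> (nat \<Rightarrow> ('m \<Rightarrow>\<^sub>0 complex)) \<Rightarrow> bool" where
  "cauchy_seq M p x \<longleftrightarrow> range x \<subseteq> monoid_algebra M \<and>
     (\<forall>e>0. \<exists>N. \<forall>k\<ge>N. \<forall>l\<ge>N. p (x k - x l) < e)"

definition limit_class ::
  "'m set \<Rightarrow> (('m \<Rightarrow>\<^sub>0 complex) \<Rightarrow> real) \<Rightarrow> (nat \<Rightarrow> ('m \<Rightarrow>\<^sub>0 complex)) \<Rightarrow>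
   (nat \<Rightarrow> ('m \<Rightarrow>\<^sub>0 complex)) set" where
  "limit_class M p x = {y. cauchy_seq M p y \<and> (\<lambda>k. p (y k - x k)) \<longlonglongrightarrow> 0}"

definition representative :: "'a set \<Rightarrow> 'a" where
  "representative X = (SOME x. x \<in> X)"

text \<open>The separated completion of the monoid *-algebra of \<open>M\<close> for a C*-seminorm \<open>p\<close>: Cauchy
  sequences modulo null sequences.\<close>

definition completion ::
  "'m::involutive_monoid set \<Rightarrow> (('m \<Rightarrow>\<^sub>0 complex) \<Rightarrow> real) \<Rightarrow>
   (nat \<Rightarrow> ('m \<Rightarrow>\<^sub>0 complex)) set cstar" where
  "completion M p =
    \<lparr>carrier = limit_class M p ` {x. cauchy_seq M p x},
     mult = (\<lambda>X Y. limit_class M p (\<lambda>k. representative X k * representative Y k)),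
     one = limit_class M p (\<lambda>k. 1),
     zero = limit_class M p (\<lambda>k. 0),
     add = (\<lambda>X Y. limit_class M p (\<lambda>k. representative X k + representative Y k)),
     smult = (\<lambda>c X. limit_class M p (\<lambda>k. scalar c * representative X k)),
     star = (\<lambda>X. limit_class M p (\<lambda>k. pstar (representative X k))),
     cnorm = (\<lambda>X. lim (\<lambda>k. p (representative X k)))\<rparr>"

definition embed ::
  "'m set \<Rightarrow> (('m \<Rightarrow>\<^sub>0 complex) \<Rightarrow> real) \<Rightarrow> ('m \<Rightarrow>\<^sub>0 complex) \<Rightarrow>
   (nat \<Rightarrow> ('m \<Rightarrow>\<^sub>0 complex)) set" where
  "embed M p x = limit_class M p (\<lambda>k. x)"


section \<open>The minimal C*-tensor square\<close>

definition alg_tensor ::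
  "('m \<Rightarrow>\<^sub>0 complex) \<Rightarrow> ('m \<Rightarrow>\<^sub>0 complex) \<Rightarrow> ('m \<times> 'm \<Rightarrow>\<^sub>0 complex)" where
  "alg_tensor x y = (\<Sum>u\<in>Poly_Mapping.keys x. \<Sum>v\<in>Poly_Mapping.keys y.
     Poly_Mapping.single (u, v) (Poly_Mapping.lookup x u * Poly_Mapping.lookup y v))"

definition product_functional ::
  "'m set \<Rightarrow> (('m \<Rightarrow>\<^sub>0 complex) \<Rightarrow> real) \<Rightarrow>
   ((nat \<Rightarrow> ('m \<Rightarrow>\<^sub>0 complex)) set \<Rightarrow> complex) \<Rightarrow>
   ((nat \<Rightarrow> ('m \<Rightarrow>\<^sub>0 complex)) set \<Rightarrow> complex) \<Rightarrow>
   ('m \<times> 'm \<Rightarrow>\<^sub>0 complex) \<Rightarrow> complex" where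
  "product_functional M p \<phi> \<psi> t = (\<Sum>(u, v)\<in>Poly_Mapping.keys t. Poly_Mapping.lookup t (u, v) *
     \<phi> (embed M p (Poly_Mapping.single u 1)) * \<psi> (embed M p (Poly_Mapping.single v 1)))"

text \<open>The spatial seminorm of \<open>t\<close>: the supremum over pairs of states of its operator norm in the
  tensor product of the two GNS representations, computed on the dense subspace
  of vectors \<open>y \<Omega>\<close>, where \<open>\<Omega>\<close> is the tensor product of the two cyclic vectors.\<close>

definition spatial_seminorm ::
  "'m::involutive_monoid set \<Rightarrow> (('m \<Rightarrow>\<^sub>0 complex) \<Rightarrow> real) \<Rightarrow>
   ('m \<times> 'm \<Rightarrow>\<^sub>0 complex) \<Rightarrow> real" where
  "spatial_seminorm M p t =
     Sup {sqrt (Re (product_functional M p \<phi> \<psi> (pstar (t * y) * (t * y)))) | \<phi> \<psi> y.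
        state (completion M p) \<phi> \<and> state (completion M p) \<psi> \<and> y \<in> monoid_algebra (M \<times> M) \<and>
        product_functional M p \<phi> \<psi> (pstar y * y) = 1}"

definition tensor_square ::
  "'m::involutive_monoid set \<Rightarrow> (('m \<Rightarrow>\<^sub>0 complex) \<Rightarrow> real) \<Rightarrow>
   (nat \<Rightarrow> ('m \<times> 'm \<Rightarrow>\<^sub>0 complex)) set cstar" where
  "tensor_square M p = completion (M \<times> M) (spatial_seminorm M p)"

definition tensor ::
  "'m::involutive_monoid set \<Rightarrow> (('m \<Rightarrow>\<^sub>0 complex) \<Rightarrow> real) \<Rightarrow>
   (nat \<Rightarrow> ('m \<Rightarrow>\<^sub>0 complex)) set \<Rightarrow> (nat \<Rightarrow> ('m \<Rightarrow>\<^sub>0 complex)) set \<Rightarrow>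
   (nat \<Rightarrow> ('m \<times> 'm \<Rightarrow>\<^sub>0 complex)) set" where
  "tensor M p a b = limit_class (M \<times> M) (spatial_seminorm M p)
     (\<lambda>k. alg_tensor (representative a k) (representative b k))"

definition bounded_linear_map :: "'a cstar \<Rightarrow> 'b cstar \<Rightarrow> ('a \<Rightarrow> 'b) \<Rightarrow> bool" where
  "bounded_linear_map A B f \<longleftrightarrow> linear_map A B f \<and>
     (\<exists>C. \<forall>x\<in>carrier A. cnorm B (f x) \<le> C * cnorm A x)"

text \<open>Here \<open>S\<close> is the map \<open>id \<otimes> h\<close>, respectively \<open>h \<otimes> id\<close>; boundedness makes it unique.\<close>

definition right_slice ::
  "'m::involutive_monoid set \<Rightarrow> (('m \<Rightarrow>\<^sub>0 complex) \<Rightarrow> real) \<Rightarrow>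
   ((nat \<Rightarrow> ('m \<Rightarrow>\<^sub>0 complex)) set \<Rightarrow> complex) \<Rightarrow>
   ((nat \<Rightarrow> ('m \<times> 'm \<Rightarrow>\<^sub>0 complex)) set \<Rightarrow> (nat \<Rightarrow> ('m \<Rightarrow>\<^sub>0 complex)) set) \<Rightarrow> bool" where
  "right_slice M p h S \<longleftrightarrow> bounded_linear_map (tensor_square M p) (completion M p) S \<and>
     (\<forall>a\<in>carrier (completion M p). \<forall>b\<in>carrier (completion M p).
        S (tensor M p a b) = h b \<odot>\<^bsub>completion M p\<^esub> a)"

definition left_slice ::
  "'m::involutive_monoid set \<Rightarrow> (('m \<Rightarrow>\<^sub>0 complex) \<Rightarrow> real) \<Rightarrow>
   ((nat \<Rightarrow> ('m \<Rightarrow>\<^sub>0 complex)) set \<Rightarrow> complex) \<Rightarrow>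
   ((nat \<Rightarrow> ('m \<times> 'm \<Rightarrow>\<^sub>0 complex)) set \<Rightarrow> (nat \<Rightarrow> ('m \<Rightarrow>\<^sub>0 complex)) set) \<Rightarrow> bool" where
  "left_slice M p h S \<longleftrightarrow> bounded_linear_map (tensor_square M p) (completion M p) S \<and>
     (\<forall>a\<in>carrier (completion M p). \<forall>b\<in>carrier (completion M p).
        S (tensor M p a b) = h a \<odot>\<^bsub>completion M p\<^esub> b)"


section \<open>The Hopf C*-algebras \<open>A\<^sub>u(n)\<close> and \<open>A\<^sub>o(n)\<close>\<close>

text \<open>Generators are labelled by pairs \<open>(i, j)\<close>, a letter tagged \<open>True\<close> being an adjoint.\<close>

type_synonym free_alg = "(nat \<times> nat) word \<Rightarrow>\<^sub>0 complex"
type_synonym elem = "(nat \<Rightarrow> free_alg) set"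

definition gen :: "nat \<Rightarrow> nat \<Rightarrow> free_alg" where
  "gen i j = Poly_Mapping.single (Word [((i, j), False)]) 1"

definition words :: "nat \<Rightarrow> (nat \<times> nat) word set" where
  "words n = {w. fst ` set (letters w) \<subseteq> {1..n} \<times> {1..n}}"

definition delta :: "nat \<Rightarrow> nat \<Rightarrow> free_alg" where
  "delta i j = (if i = j then 1 else 0)"

text \<open>The relators expressing \<open>w w* = 1\<close> and \<open>w* w = 1\<close> for an \<open>n \<times> n\<close> matrix \<open>w\<close>.\<close>

definition unitary_relators :: "nat \<Rightarrow> (nat \<Rightarrow> nat \<Rightarrow> free_alg) \<Rightarrow> free_alg set" where
  "unitary_relators n w =
     {(\<Sum>k=1..n. w i k * pstar (w j k)) - delta i j | i j. i \<in> {1..n} \<and> j \<in> {1..n}} \<union>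
     {(\<Sum>k=1..n. pstar (w k i) * w k j) - delta i j | i j. i \<in> {1..n} \<and> j \<in> {1..n}}"

definition relators_u :: "nat \<Rightarrow> free_alg set" where
  "relators_u n = unitary_relators n gen \<union> unitary_relators n (\<lambda>i j. gen j i)"

definition relators_o :: "nat \<Rightarrow> free_alg set" where
  "relators_o n =
     {gen i j - pstar (gen i j) | i j. i \<in> {1..n} \<and> j \<in> {1..n}} \<union>
     {(\<Sum>k=1..n. gen i k * gen j k) - delta i j | i j. i \<in> {1..n} \<and> j \<in> {1..n}} \<union>
     {(\<Sum>k=1..n. gen k i * gen k j) - delta i j | i j. i \<in> {1..n} \<and> j \<in> {1..n}}"

definition norm_u :: "nat \<Rightarrow> free_alg \<Rightarrow> real" where
  "norm_u n = universal_seminorm (words n) (relators_u n)"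

definition norm_o :: "nat \<Rightarrow> free_alg \<Rightarrow> real" where
  "norm_o n = universal_seminorm (words n) (relators_o n)"

definition A_u :: "nat \<Rightarrow> elem cstar" where
  "A_u n = completion (words n) (norm_u n)"

definition A_o :: "nat \<Rightarrow> elem cstar" where
  "A_o n = completion (words n) (norm_o n)"

definition v_gen :: "nat \<Rightarrow> nat \<Rightarrow> nat \<Rightarrow> elem" where
  "v_gen n i j = embed (words n) (norm_u n) (gen i j)"

definition u_gen :: "nat \<Rightarrow> nat \<Rightarrow> nat \<Rightarrow> elem" where
  "u_gen n i j = embed (words n) (norm_o n) (gen i j)"

definition comultiplication ::
  "nat \<Rightarrow> (free_alg \<Rightarrow> real) \<Rightarrow>
   (elem \<Rightarrow> (nat \<Rightarrow> ((nat \<times> nat) word \<times> (nat \<times> nat) word \<Rightarrow>\<^sub>0 complex)) set) \<Rightarrow> bool" where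
  "comultiplication n p \<Delta> \<longleftrightarrow>
     unital_star_hom (completion (words n) p) (tensor_square (words n) p) \<Delta> \<and>
     (\<forall>i\<in>{1..n}. \<forall>j\<in>{1..n}. \<Delta> (embed (words n) p (gen i j)) =
        finsum (tensor_square (words n) p)
          (\<lambda>k. tensor (words n) p (embed (words n) p (gen i k)) (embed (words n) p (gen k j)))
          {1..n})"

definition haar_functional ::
  "nat \<Rightarrow> (free_alg \<Rightarrow> real) \<Rightarrow> (elem \<Rightarrow> complex) \<Rightarrow> bool" where
  "haar_functional n p h \<longleftrightarrow> state (completion (words n) p) h \<and>
     (\<exists>\<Delta> S T. comultiplication n p \<Delta> \<and>
        right_slice (words n) p h S \<and> left_slice (words n) p h T \<and>
        (\<forall>a\<in>carrier (completion (words n) p).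
           S (\<Delta> a) = h a \<odot>\<^bsub>completion (words n) p\<^esub> \<one>\<^bsub>completion (words n) p\<^esub> \<and>
           T (\<Delta> a) = h a \<odot>\<^bsub>completion (words n) p\<^esub> \<one>\<^bsub>completion (words n) p\<^esub>))"

definition haar_u :: "nat \<Rightarrow> (elem \<Rightarrow> complex) \<Rightarrow> bool" where
  "haar_u n h \<longleftrightarrow> haar_functional n (norm_u n) h"

definition haar_o :: "nat \<Rightarrow> (elem \<Rightarrow> complex) \<Rightarrow> bool" where
  "haar_o n h \<longleftrightarrow> haar_functional n (norm_o n) h"

definition u_var :: "nat \<Rightarrow> nat \<Rightarrow> elem" where
  "u_var s n = finsum (A_u n) (\<lambda>i. v_gen n i i) {1..s}"

definition o_var :: "nat \<Rightarrow> nat \<Rightarrow> elem" where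
  "o_var s n = finsum (A_o n) (\<lambda>i. u_gen n i i) {1..s}"

end

theory Submission
  imports Defs
begin

text \<open>By invariance, the Haar functional sends the matrix of a word in the generators to the orthogonal
  projection onto the fixed vectors of a tensor power of the fundamental corepresentation. Conversely,
  let \<open>E w\<close> be the projection onto the span \<open>V w\<close> of the vectors of those noncrossing pairings that match the
  letters of \<open>w\<close>. These spans are closed under tensor products, contractions and adjoints, which makes
  \<open>w \<mapsto> E w\<close> a state on the free *-algebra killing the relators; hence it extends to the universal
  C*-algebra, and it must be the Haar functional. The same construction for other
  systems of colours yields all auxiliary spaces.

  (1) Give \<open>z\<close>, \<open>z\<^sup>*\<close> and the entries of \<open>o\<close> separate colours. Blocks of different colour are free because an
  innermost arch of a pairing stays inside a block. A pairing matches a word in \<open>z o\<close> and \<open>o z\<^sup>*\<close>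
  exactly if its arches between entries of \<open>o\<close> match the corresponding word in \<open>v\<close> and \<open>v\<^sup>*\<close>.

  (2) For \<open>n \<ge> 2\<close> the pairing vectors are linearly independent, so the moments of \<open>u\<^sub>n\<^sub>n\<close>, traces of
  projections, count matching noncrossing pairings. In the same way a sum of two diagonal entries
  of a self-adjoint colour has Catalan moments, so it is semicircular; two such colours are free.

  (3) The Gram matrix of the pairing vectors is asymptotically a multiple of the identity, so that the
  rescaled partial traces converge to the same numbers.\<close>

section \<open>Noncrossing pairings\<close>

text \<open>The Haar functional is pinned down by two matrix identities instead of an invariance
  proof for the candidate. For one star pattern let \<open>H\<close> be the matrix of Haar values,
  \<open>E\<close> the projection and \<open>U\<close> the matrix of entries. Left invariance says
  \<open>H U = H\<close> up to elements of norm zero; applying the pairing state gives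
  \<open>H E = H\<close>. By the relations the columns of \<open>E\<close> are fixed by
  \<open>U\<close>; applying the Haar functional gives \<open>H E = E\<close>. The candidate only
  has to be bounded by the universal norm. Two obstacles shape the rest. The universal norm is a
  supremum over abstract C*-seminorms, with no representations at hand, so its finiteness comes from
  norm estimates for sums of squares. And the spaces \<open>V w\<close> are known only through
  spanning vectors, so projections are handled as kernels on finite sets of index lists, and closure
  properties are proved by adding or removing an arch between neighbouring points. Binary trees make
  pairings noncrossing by construction; the induction on such arches is built on top of
  them.\<close>

datatype pairing = Empty | Arch pairing pairing

fun arcs :: "pairing \<Rightarrow> nat" where
  "arcs Empty = 0"
| "arcs (Arch l r) = Suc (arcs l + arcs r)"

text \<open>\<open>Arch l r\<close> joins the first point to the one that follows the points of
  \<open>l\<close>. The relation \<open>R\<close> is left open because the same tree is read in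
  three ways: colours joined to dual colours, equal indices, opposite signs.\<close>

fun fits :: "('a \<Rightarrow> 'a \<Rightarrow> bool) \<Rightarrow> pairing \<Rightarrow> 'a list \<Rightarrow> bool" where
  "fits R Empty xs \<longleftrightarrow> xs = []"
| "fits R (Arch l r) xs \<longleftrightarrow>
     (\<exists>a ys b zs. xs = a # ys @ b # zs \<and> R a b \<and> fits R l ys \<and> fits R r zs)"

lemma fits_length: "fits R t xs \<Longrightarrow> length xs = 2 * arcs t"
  by (induction R t xs rule: fits.induct) auto

lemma append_Cons_eq_same_length:
  "length ys = length ys' \<Longrightarrow> ys @ b # zs = ys' @ b' # zs' \<longleftrightarrow> ys = ys' \<and> b = b' \<and> zs = zs'"
  by auto

lemma fits_Arch_split:
  assumes "length ys = 2 * arcs l"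
  shows "fits R (Arch l r) (a # ys @ b # zs) \<longleftrightarrow> R a b \<and> fits R l ys \<and> fits R r zs"
proof
  assume "fits R (Arch l r) (a # ys @ b # zs)"
  then obtain ys' b' zs' where "ys @ b # zs = ys' @ b' # zs'" "R a b'" "fits R l ys'" "fits R r zs'"
    by auto
  moreover from this have "ys = ys' \<and> b = b' \<and> zs = zs'"
    using assms fits_length append_Cons_eq_same_length by metis
  ultimately show "R a b \<and> fits R l ys \<and> fits R r zs" by simp
qed auto

text \<open>Adds an arch between two new neighbouring points that come after \<open>j\<close> old
  ones. In the right subtree the position drops by the points of \<open>l\<close> and the two feet
  of the outer arch. The second equation is a default that \<open>j \<le> 2 * arcs t\<close>
  excludes.\<close>

fun insert_arch :: "nat \<Rightarrow> pairing \<Rightarrow> pairing" where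
  "insert_arch 0 t = Arch Empty t"
| "insert_arch (Suc j) Empty = Arch Empty Empty"
| "insert_arch (Suc j) (Arch l r) =
     (if j \<le> 2 * arcs l then Arch (insert_arch j l) r else Arch l (insert_arch (j - 2 * arcs l - 1) r))"

lemma arcs_insert_arch: "j \<le> 2 * arcs t \<Longrightarrow> arcs (insert_arch j t) = Suc (arcs t)"
  by (induction j t rule: insert_arch.induct) auto

lemma split_list_length:
  assumes "n < length xs"
  obtains ys b zs where "xs = ys @ b # zs" "length ys = n"
  using assms that[of "take n xs" "xs ! n" "drop (Suc n) xs"] by (simp add: id_take_nth_drop)

text \<open>Splitting off the outermost arch leaves the new one inside \<open>l\<close> or inside
  \<open>r\<close>; lists of the wrong length fit neither side.\<close>

lemma fits_insert_arch:
  assumes "length xs = j" "j \<le> 2 * arcs t"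
  shows "fits R (insert_arch j t) (xs @ a # b # ys) \<longleftrightarrow> R a b \<and> fits R t (xs @ ys)"
  using assms
proof (induction j t arbitrary: xs ys rule: insert_arch.induct)
  case (1 t)
  then show ?case by (simp add: fits_Arch_split[of "[]", simplified])
next
  case (2 j)
  then show ?case by simp
next
  case (3 j l r)
  then obtain x xs' where xs: "xs = x # xs'" "length xs' = j"
    by (cases xs) auto
  show ?case
  proof (cases "length (xs @ ys) = 2 * arcs (Arch l r)")
    case False
    moreover have "length (xs @ a # b # ys) \<noteq> 2 * arcs (insert_arch (Suc j) (Arch l r))"
      using False 3(4) by (subst arcs_insert_arch) auto
    ultimately show ?thesis using fits_length by metis
  next
    case len: True
    show ?thesis
    proof (cases "j \<le> 2 * arcs l")
      case True
      have "2 * arcs l - j < length ys" using len xs True by auto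
      then obtain ys1 d ys2 where ys: "ys = ys1 @ d # ys2" "length ys1 = 2 * arcs l - j"
        by (rule split_list_length)
      have 1: "fits R (insert_arch (Suc j) (Arch l r)) (xs @ a # b # ys) \<longleftrightarrow>
          R x d \<and> fits R (insert_arch j l) (xs' @ a # b # ys1) \<and> fits R r ys2"
        using fits_Arch_split[of "xs' @ a # b # ys1" "insert_arch j l" R r x d ys2] True xs ys
        by (simp add: arcs_insert_arch)
      have 2: "fits R (Arch l r) (xs @ ys) \<longleftrightarrow> R x d \<and> fits R l (xs' @ ys1) \<and> fits R r ys2"
        using fits_Arch_split[of "xs' @ ys1" l R r x d ys2] True xs ys by simp
      show ?thesis using 1 2 3(1)[OF True xs(2) True] by blast
    next
      case False
      then have "2 * arcs l < length xs'" using xs by simp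
      then obtain ys1 d ys2 where ys: "xs' = ys1 @ d # ys2" "length ys1 = 2 * arcs l"
        by (rule split_list_length)
      have 1: "fits R (insert_arch (Suc j) (Arch l r)) (xs @ a # b # ys) \<longleftrightarrow>
          R x d \<and> fits R l ys1 \<and> fits R (insert_arch (j - 2 * arcs l - 1) r) (ys2 @ a # b # ys)"
        using fits_Arch_split[of ys1 l R "insert_arch (j - 2 * arcs l - 1) r" x d "ys2 @ a # b # ys"] False xs ys
        by simp
      have 2: "fits R (Arch l r) (xs @ ys) \<longleftrightarrow> R x d \<and> fits R l ys1 \<and> fits R r (ys2 @ ys)"
        using fits_Arch_split[of ys1 l R r x d "ys2 @ ys"] False xs ys by simp
      have "length ys2 = j - 2 * arcs l - 1" using xs ys by auto
      moreover have "j - 2 * arcs l - 1 \<le> 2 * arcs r" using 3(4) False by simp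
      ultimately show ?thesis using 1 2 3(2)[OF False, of ys2 ys] by blast
    qed
  qed
qed

text \<open>Going down the left subtrees ends at an arch that encloses nothing.\<close>

lemma insert_arch_exists:
  assumes "t \<noteq> Empty"
  obtains j t' where "t = insert_arch j t'" "j \<le> 2 * arcs t'"
proof -
  have "\<exists>j t'. t = insert_arch j t' \<and> j \<le> 2 * arcs t'" using assms
  proof (induction t)
    case (Arch l r)
    show ?case
    proof (cases "l = Empty")
      case True
      then have "Arch l r = insert_arch 0 r" by simp
      then show ?thesis by (intro exI conjI) auto
    next
      case False
      with Arch obtain j l' where "l = insert_arch j l'" "j \<le> 2 * arcs l'" by blast
      then show ?thesis by (intro exI[of _ "Suc j"] exI[of _ "Arch l' r"]) auto
    qed
  qed simp
  with that show thesis by blast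
qed

text \<open>The working induction: unlike structural induction on the tree, it changes a word or a
  tensor only at two adjacent places.\<close>

lemma pairing_insert_induct [case_names Empty insert]:
  assumes "P Empty" and "\<And>j t. j \<le> 2 * arcs t \<Longrightarrow> P t \<Longrightarrow> P (insert_arch j t)"
  shows "P t"
proof (induction "arcs t" arbitrary: t)
  case 0
  then show ?case using assms(1) by (cases t) auto
next
  case (Suc n)
  then have "t \<noteq> Empty" by auto
  then obtain j t' where "t = insert_arch j t'" "j \<le> 2 * arcs t'" by (rule insert_arch_exists)
  then show ?case using Suc assms(2)[of j t'] by (simp add: arcs_insert_arch)
qed

lemma fits_insert_archE:
  assumes "fits R (insert_arch j t) zs" "j \<le> 2 * arcs t"
  obtains xs a b ys where "zs = xs @ a # b # ys" "length xs = j" "R a b" "fits R t (xs @ ys)"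
proof -
  have len: "length zs = 2 * arcs t + 2"
    using fits_length[OF assms(1)] arcs_insert_arch[OF assms(2)] by simp
  then have "j < length zs" using assms(2) by simp
  then obtain xs a us where 1: "zs = xs @ a # us" "length xs = j" by (rule split_list_length)
  then have "us \<noteq> []" using len assms(2) by auto
  then obtain b ys where "us = b # ys" by (cases us) auto
  with 1 that[of xs a b ys] assms fits_insert_arch[of xs j t R a b ys] show thesis by auto
qed

section \<open>Dyck words of pairings\<close>

fun dyck :: "pairing \<Rightarrow> bool list" where
  "dyck Empty = []"
| "dyck (Arch l r) = True # dyck l @ False # dyck r"

lemma length_dyck [simp]: "length (dyck t) = 2 * arcs t"
  by (induction t) auto

text \<open>Binary value with the leading bit first; on words of equal length its order is the
  lexicographic one.\<close>

fun bits :: "bool list \<Rightarrow> nat" where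
  "bits [] = 0"
| "bits (b # bs) = (if b then 2 ^ length bs else 0) + bits bs"

lemma bits_less: "bits bs < 2 ^ length bs"
  by (induction bs) auto

lemma bits_append: "bits (xs @ ys) = bits xs * 2 ^ length ys + bits ys"
  by (induction xs) (auto simp: algebra_simps power_add)

text \<open>Among the words with an up and a down step at the ends of each arch, the Dyck word
  is the lexicographically largest.\<close>

lemma fits_dyck_bits:
  "fits (\<noteq>) t D \<Longrightarrow> bits D \<le> bits (dyck t) \<and> (bits D = bits (dyck t) \<longrightarrow> D = dyck t)"
proof (induction t arbitrary: D)
  case (Arch l r)
  then obtain a ys b zs where D: "D = a # ys @ b # zs" "a \<noteq> b" "fits (\<noteq>) l ys" "fits (\<noteq>) r zs"
    by auto
  have len: "length ys = 2 * arcs l" "length zs = 2 * arcs r" using D fits_length by blast+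
  have l: "bits ys \<le> bits (dyck l)" "bits ys = bits (dyck l) \<Longrightarrow> ys = dyck l"
    using Arch.IH(1)[OF D(3)] by auto
  have r: "bits zs \<le> bits (dyck r)" "bits zs = bits (dyck r) \<Longrightarrow> zs = dyck r"
    using Arch.IH(2)[OF D(4)] by auto
  show ?case
  proof (cases a)
    case False
    have "bits D < bits (dyck (Arch l r))"
      using bits_less[of "ys @ b # zs"] False D(1) len by simp
    then show ?thesis by linarith
  next
    case True
    then have D': "D = True # ys @ False # zs" using D by simp
    show ?thesis
    proof (cases "ys = dyck l")
      case True
      then show ?thesis using D' r by (auto simp: bits_append len)
    next
      case False
      then have less: "Suc (bits ys) \<le> bits (dyck l)" using l by force
      have "bits ys * 2 ^ length (False # zs) + bits (False # zs) < Suc (bits ys) * 2 ^ length (False # zs)"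
        using bits_less[of "False # zs"] by simp
      also have "\<dots> \<le> bits (dyck l) * 2 ^ length (False # zs)"
        using less by (rule mult_right_mono) simp
      finally have "bits D < bits (dyck (Arch l r))"
        using D' by (simp add: bits_append len)
      then show ?thesis by linarith
    qed
  qed
qed simp

lemma fits_dyck_append: "fits (\<noteq>) t (dyck t)"
  by (induction t) auto

lemma diff_eq_Suc: "(a::nat) - b = Suc c \<Longrightarrow> c = a - Suc b"
  by simp

text \<open>If the left parts had different sizes, the shorter Dyck word followed by a down step
  would be a prefix of the longer one. Its height is -1, while prefixes of Dyck words have
  nonnegative height.\<close>

lemma dyck_inj: "dyck s = dyck t \<Longrightarrow> s = t"
proof (induction s arbitrary: t)
  case Empty
  then show ?case by (cases t) auto
next
  case (Arch l r)
  then obtain l' r' where t: "t = Arch l' r'" by (cases t) auto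
  have *: False if "dyck l @ False # zs = dyck l' @ False # zs'" "arcs l < arcs l'" for l l' zs zs'
  proof -
    define h where "h xs = int (count_list xs True) - int (count_list xs False)" for xs :: "bool list"
    have app: "h (xs @ ys) = h xs + h ys" for xs ys by (simp add: h_def)
    have bal: "h (dyck t) = 0" for t by (induction t) (auto simp: app h_def)
    have pre: "h (take k (dyck t)) \<ge> 0" for k t
    proof (induction t arbitrary: k)
      case (Arch l r)
      have [simp]: "h (True # xs) = 1 + h xs" "h (False # xs) = h xs - 1" "h [] = 0" for xs
        by (auto simp: h_def)
      have "h (take (k - 1) (dyck l)) \<ge> 0" "h (take (k - 2 - 2 * arcs l) (dyck r)) \<ge> 0"
        using Arch by blast+
      then show ?case
        by (cases "k - 1 - 2 * arcs l"; cases k) (auto simp: app bal take_Cons' diff_diff_add dest!: diff_eq_Suc)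
    qed (simp add: h_def)
    have "take (Suc (2 * arcs l)) (dyck l') = dyck l @ [False]"
    proof -
      have "take (Suc (2 * arcs l)) (dyck l' @ False # zs') = take (Suc (2 * arcs l)) (dyck l')"
        using that(2) by simp
      moreover have "take (Suc (2 * arcs l)) (dyck l @ False # zs) = dyck l @ [False]" by simp
      ultimately show ?thesis using that(1) by simp
    qed
    then have "h (dyck l @ [False]) \<ge> 0" using pre[of "Suc (2 * arcs l)" l'] by simp
    then show False by (simp add: app bal) (simp add: h_def)
  qed
  have eq: "dyck l @ False # dyck r = dyck l' @ False # dyck r'" using Arch.prems t by simp
  have "arcs l = arcs l'" using *[OF eq] *[OF eq[symmetric]] by (meson linorder_neqE_nat)
  then have "dyck l = dyck l'" "dyck r = dyck r'" using eq by auto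
  then show ?case using Arch.IH t by blast
qed

lemma dyck_insert_arch:
  "j \<le> 2 * arcs t \<Longrightarrow> dyck (insert_arch j t) = take j (dyck t) @ True # False # drop j (dyck t)"
  by (induction j t rule: insert_arch.induct) (auto simp: Suc_diff_le not_le take_Cons' drop_Cons')

text \<open>On Dyck words an insertion splices in an up and a down step, so the exchange becomes a
  computation with \<open>take\<close> and \<open>drop\<close>. The shift by 2 is the length of the
  arch inserted at the earlier place.\<close>

lemma insert_arch_commute:
  assumes "i \<le> j" "j \<le> 2 * arcs t"
  shows "insert_arch (j + 2) (insert_arch i t) = insert_arch i (insert_arch j t)"
proof (rule dyck_inj)
  show "dyck (insert_arch (j + 2) (insert_arch i t)) = dyck (insert_arch i (insert_arch j t))"
    using assms by (simp add: dyck_insert_arch arcs_insert_arch take_drop min_def Suc_diff_le)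
qed

section \<open>Concatenation and reflection of pairings\<close>

fun join :: "pairing \<Rightarrow> pairing \<Rightarrow> pairing" where
  "join Empty t = t"
| "join (Arch l r) t = Arch l (join r t)"

lemma arcs_join [simp]: "arcs (join s t) = arcs s + arcs t"
  by (induction s) auto

lemma fits_join:
  assumes "length xs = 2 * arcs s"
  shows "fits R (join s t) (xs @ ys) \<longleftrightarrow> fits R s xs \<and> fits R t ys"
  using assms
proof (induction s arbitrary: xs)
  case (Arch l r)
  then obtain a us where xs: "xs = a # us" by (cases xs) auto
  then have "2 * arcs l < length us" using Arch.prems by auto
  then obtain vs b ws where us: "us = vs @ b # ws" "length vs = 2 * arcs l" by (rule split_list_length)
  have "fits R (join (Arch l r) t) (xs @ ys) \<longleftrightarrow> R a b \<and> fits R l vs \<and> fits R (join r t) (ws @ ys)"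
    using fits_Arch_split[of vs l R "join r t" a b "ws @ ys"] xs us by simp
  moreover have "length ws = 2 * arcs r" using Arch.prems xs us by simp
  moreover have "fits R (Arch l r) xs \<longleftrightarrow> R a b \<and> fits R l vs \<and> fits R r ws"
    using fits_Arch_split[of vs l R r a b ws] xs us by simp
  ultimately show ?case using Arch.IH(2) by blast
qed simp

fun mirror :: "pairing \<Rightarrow> pairing" where
  "mirror Empty = Empty"
| "mirror (Arch l r) = join (mirror r) (Arch (mirror l) Empty)"

lemma arcs_mirror [simp]: "arcs (mirror t) = arcs t"
  by (induction t) auto

lemma fits_mirror: "fits R (mirror t) (rev xs) \<longleftrightarrow> fits (\<lambda>a b. R b a) t xs"
proof (induction t arbitrary: xs)
  case (Arch l r)
  show ?case
  proof (cases "length xs = 2 * arcs (Arch l r)")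
    case False
    then have "length (rev xs) \<noteq> 2 * arcs (mirror (Arch l r))" by simp
    with False show ?thesis using fits_length by blast
  next
    case True
    then obtain a us where xs: "xs = a # us" by (cases xs) auto
    then have "2 * arcs l < length us" using True by auto
    then obtain vs b ws where us: "us = vs @ b # ws" "length vs = 2 * arcs l" by (rule split_list_length)
    have ws: "length (rev ws) = 2 * arcs (mirror r)" using True xs us by simp
    have "fits R (mirror (Arch l r)) (rev xs) \<longleftrightarrow> fits R (mirror r) (rev ws) \<and> fits R (Arch (mirror l) Empty) (b # rev vs @ a # [])"
      using fits_join[OF ws, of R "Arch (mirror l) Empty" "b # rev vs @ [a]"] xs us by simp
    also have "fits R (Arch (mirror l) Empty) (b # rev vs @ a # []) \<longleftrightarrow> R b a \<and> fits R (mirror l) (rev vs)"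
      using us by (subst fits_Arch_split) auto
    finally show ?thesis
      using Arch fits_Arch_split[OF us(2), of "\<lambda>a b. R b a" r a b ws] xs us by blast
  qed
qed simp

lemma fits_ArchI: "R a b \<Longrightarrow> fits R l ys \<Longrightarrow> fits R r zs \<Longrightarrow> fits R (Arch l r) (a # ys @ b # zs)"
  by auto

lemma fits_map:
  "fits R t (map f xs) \<longleftrightarrow> fits (\<lambda>a b. R (f a) (f b)) t xs"
proof (induction t arbitrary: xs)
  case (Arch l r)
  show ?case (is "?L \<longleftrightarrow> ?R")
  proof
    assume ?L
    then obtain a ys b zs where *: "map f xs = a # ys @ b # zs" "R a b" "fits R l ys" "fits R r zs" by auto
    then obtain a' ys' b' zs' where "xs = a' # ys' @ b' # zs'" "a = f a'" "ys = map f ys'" "b = f b'" "zs = map f zs'"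
      by (auto simp: map_eq_append_conv map_eq_Cons_conv)
    with * Arch show ?R using fits_ArchI[of "\<lambda>a b. R (f a) (f b)"] by blast
  next
    assume ?R
    then obtain a ys b zs where *: "xs = a # ys @ b # zs" "R (f a) (f b)"
      "fits (\<lambda>a b. R (f a) (f b)) l ys" "fits (\<lambda>a b. R (f a) (f b)) r zs" by auto
    from * have "map f xs = f a # map f ys @ f b # map f zs" by simp
    with * Arch show ?L using fits_ArchI[of R "f a" "f b" l "map f ys" r "map f zs"] by simp
  qed
qed simp

text \<open>Which positions are joined depends on the tree alone, so two relations can be tested
  separately.\<close>

lemma fits_conj:
  "fits (\<lambda>a b. R a b \<and> S a b) t xs \<longleftrightarrow> fits R t xs \<and> fits S t xs"
proof (induction t arbitrary: xs rule: pairing_insert_induct)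
  case (insert j t)
  show ?case
  proof (cases "length xs = 2 * arcs t + 2")
    case False
    then have "length xs \<noteq> 2 * arcs (insert_arch j t)" using insert(1) by (simp add: arcs_insert_arch)
    then show ?thesis using fits_length by blast
  next
    case True
    then have "j < length xs" using insert by simp
    then obtain us a vs where 1: "xs = us @ a # vs" "length us = j" by (rule split_list_length)
    then have "vs \<noteq> []" using True insert by auto
    then obtain b ws where 2: "vs = b # ws" by (cases vs) auto
    show ?thesis using 1 2 insert by (simp add: fits_insert_arch) blast
  qed
qed auto

lemma fits_zip:
  assumes "length xs = length ys"
  shows "fits (\<lambda>p q. R (fst p) (fst q) \<and> S (snd p) (snd q)) t (zip xs ys) \<longleftrightarrow> fits R t xs \<and> fits S t ys"
  using fits_map[of R t fst "zip xs ys"] fits_map[of S t snd "zip xs ys"] assms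
  by (simp add: fits_conj)

lemma fits_replicate: "length xs = 2 * arcs t \<Longrightarrow> R a a \<Longrightarrow> \<forall>x\<in>set xs. x = a \<Longrightarrow> fits R t xs"
proof (induction t arbitrary: xs)
  case (Arch l r)
  from Arch.prems obtain x us where xs: "xs = x # us" by (cases xs) auto
  then have "2 * arcs l < length us" using Arch.prems by auto
  then obtain vs b ws where us: "us = vs @ b # ws" "length vs = 2 * arcs l" by (rule split_list_length)
  have "R x b" "fits R l vs" "fits R r ws" using Arch xs us by auto
  then show ?case unfolding xs us by (rule fits_ArchI)
qed simp

lemma nth_append_insert2:
  assumes "length xs = k"
  shows "(xs @ a # b # ys) ! (if m < k then m else m + 2) = (xs @ ys) ! m"
  using assms by (auto simp: nth_append)

text \<open>Contracting two neighbouring points of a pairing either removes an arch, or joins the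
  partners of the two points, the label of the contracted points being read off at position \<open>m\<close>.\<close>

lemma contract_neighbours:
  assumes "j + 2 \<le> 2 * arcs t"
  shows "(\<exists>t'. t = insert_arch j t' \<and> j \<le> 2 * arcs t') \<or>
    (\<exists>t' m s. Suc (arcs t') = arcs t \<and> m < 2 * arcs t' \<and>
      (\<forall>dual :: 'a \<Rightarrow> 'a. (\<forall>p. dual (dual p) = p) \<longrightarrow>
        (\<forall>xs ys p. length xs = j \<longrightarrow>
          (fits (\<lambda>p q. q = dual p) t (xs @ p # dual p # ys) \<longleftrightarrow>
             fits (\<lambda>p q. q = dual p) t' (xs @ ys) \<and> (xs @ ys) ! m = (if s then p else dual p)))))"
    (is "?A j t \<or> ?B j t")
  using assms
proof (induction t arbitrary: j rule: pairing_insert_induct)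
  case (insert k t)
  have split2: "\<exists>us a b vs. zs = us @ a # b # vs \<and> length us = i" if "i + 2 \<le> length zs" for zs :: "'a list" and i
  proof -
    have "i < length zs" using that by simp
    then obtain us a vs where 1: "zs = us @ a # vs" "length us = i" by (rule split_list_length)
    then have "vs \<noteq> []" using that by auto
    then obtain b ws where "vs = b # ws" by (cases vs) auto
    with 1 show ?thesis by blast
  qed
  \<comment> \<open>The arch inserted last occupies the positions \<open>k\<close> and
    \<open>Suc k\<close>, the contracted points are at \<open>j\<close> and \<open>Suc j\<close>:
    the two pairs coincide, share one point, or are disjoint.\<close>
  consider "k = j" | "k = Suc j" | "j = Suc k" | "j + 2 \<le> k" | "k + 2 \<le> j" by linarith
  then show ?case
  proof cases
    case 1
    then show ?thesis using insert by blast
  next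
    case 2
    \<comment> \<open>The second contracted point is joined to its right neighbour, whose label is
      therefore \<open>p\<close>; after the contraction this neighbour stands at position
      \<open>j\<close>.\<close>
    have "?B j (insert_arch k t)"
    proof (intro exI[of _ t] exI[of _ j] exI[of _ True] conjI allI impI)
      show "Suc (arcs t) = arcs (insert_arch k t)" using insert by (simp add: arcs_insert_arch)
      show "j < 2 * arcs t" using insert 2 by simp
      fix dual :: "'a \<Rightarrow> 'a" and xs ys :: "'a list" and p :: 'a
      assume d: "\<forall>p. dual (dual p) = p" and len: "length xs = j"
      show "fits (\<lambda>p q. q = dual p) (insert_arch k t) (xs @ p # dual p # ys) \<longleftrightarrow>
             fits (\<lambda>p q. q = dual p) t (xs @ ys) \<and> (xs @ ys) ! j = (if True then p else dual p)"
      proof (cases ys)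
        case Nil
        have "\<not> fits (\<lambda>p q. q = dual p) (insert_arch k t) (xs @ p # dual p # ys)"
          using Nil insert 2 len fits_length[of "\<lambda>p q. q = dual p" "insert_arch k t" "xs @ p # dual p # ys"]
          by (auto simp: arcs_insert_arch)
        moreover have "\<not> fits (\<lambda>p q. q = dual p) t (xs @ ys)"
          using Nil insert 2 len fits_length[of "\<lambda>p q. q = dual p" t "xs @ ys"] by auto
        ultimately show ?thesis by blast
      next
        case (Cons y zs)
        have "fits (\<lambda>p q. q = dual p) (insert_arch k t) ((xs @ [p]) @ dual p # y # zs) \<longleftrightarrow>
          y = dual (dual p) \<and> fits (\<lambda>p q. q = dual p) t ((xs @ [p]) @ zs)"
          using 2 len insert by (intro fits_insert_arch) auto
        then show ?thesis using Cons d len by (auto simp: nth_append)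
      qed
    qed
    then show ?thesis by blast
  next
    case 3
    \<comment> \<open>Mirror image: the first contracted point is joined to its left neighbour at
      position \<open>k\<close>, whose label is therefore \<open>dual p\<close>.\<close>
    have "?B j (insert_arch k t)"
    proof (intro exI[of _ t] exI[of _ k] exI[of _ False] conjI allI impI)
      show "Suc (arcs t) = arcs (insert_arch k t)" using insert by (simp add: arcs_insert_arch)
      show "k < 2 * arcs t" using insert 3 by (simp add: arcs_insert_arch)
      fix dual :: "'a \<Rightarrow> 'a" and xs ys :: "'a list" and p :: 'a
      assume d: "\<forall>p. dual (dual p) = p" and len: "length xs = j"
      then obtain us y where xs: "xs = us @ [y]" "length us = k" using 3 by (cases xs rule: rev_cases) auto
      have "fits (\<lambda>p q. q = dual p) (insert_arch k t) (us @ y # p # dual p # ys) \<longleftrightarrow>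
          p = dual y \<and> fits (\<lambda>p q. q = dual p) t (us @ dual p # ys)"
        using 3 xs insert by (intro fits_insert_arch) auto
      then show "fits (\<lambda>p q. q = dual p) (insert_arch k t) (xs @ p # dual p # ys) \<longleftrightarrow>
             fits (\<lambda>p q. q = dual p) t (xs @ ys) \<and> (xs @ ys) ! k = (if False then p else dual p)"
        using xs d by (auto simp: nth_append)
    qed
    then show ?thesis by blast
  next
    case 4
    then have j: "j + 2 \<le> 2 * arcs t" using insert by simp
    consider "?A j t" | "?B j t" using insert.IH[OF j] by blast
    then show ?thesis
    proof cases
      case 1
      then obtain t1 where t1: "t = insert_arch j t1" "j \<le> 2 * arcs t1" by blast
      have "insert_arch (k - 2 + 2) (insert_arch j t1) = insert_arch j (insert_arch (k - 2) t1)"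
        using 4 t1 insert by (intro insert_arch_commute) (auto simp: arcs_insert_arch)
      moreover have "k - 2 + 2 = k" using 4 by simp
      ultimately have "insert_arch k t = insert_arch j (insert_arch (k - 2) t1)" using t1 by (simp only:)
      moreover have "j \<le> 2 * arcs (insert_arch (k - 2) t1)"
        using t1 insert 4 by (simp add: arcs_insert_arch)
      ultimately show ?thesis by blast
    next
      case 2
      then obtain t' m s where t': "Suc (arcs t') = arcs t" "m < 2 * arcs t'"
        and f: "\<And>(dual :: 'a \<Rightarrow> 'a) xs ys p. (\<forall>p. dual (dual p) = p) \<Longrightarrow> length xs = j \<Longrightarrow>
          fits (\<lambda>p q. q = dual p) t (xs @ p # dual p # ys) \<longleftrightarrow>
             fits (\<lambda>p q. q = dual p) t' (xs @ ys) \<and> (xs @ ys) ! m = (if s then p else dual p)" by blast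
      let ?m = "if m < k - 2 then m else m + 2"
      have k: "k - 2 \<le> 2 * arcs t'" using insert t' by simp
      have "?B j (insert_arch k t)"
      proof (intro exI[of _ "insert_arch (k - 2) t'"] exI[of _ ?m] exI[of _ s] conjI allI impI)
        show "Suc (arcs (insert_arch (k - 2) t')) = arcs (insert_arch k t)"
          using k insert t' by (simp add: arcs_insert_arch)
        show "?m < 2 * arcs (insert_arch (k - 2) t')" using k t' by (simp add: arcs_insert_arch)
        fix dual :: "'a \<Rightarrow> 'a" and xs ys :: "'a list" and p :: 'a
        assume d: "\<forall>p. dual (dual p) = p" and len: "length xs = j"
        show "fits (\<lambda>p q. q = dual p) (insert_arch k t) (xs @ p # dual p # ys) \<longleftrightarrow>
             fits (\<lambda>p q. q = dual p) (insert_arch (k - 2) t') (xs @ ys) \<and> (xs @ ys) ! ?m = (if s then p else dual p)"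
        proof (cases "length (xs @ ys) = 2 * arcs t")
          case False
          then show ?thesis
            using fits_length[of "\<lambda>p q. q = dual p" "insert_arch k t" "xs @ p # dual p # ys"]
              fits_length[of "\<lambda>p q. q = dual p" "insert_arch (k - 2) t'" "xs @ ys"] k insert t'
            by (auto simp: arcs_insert_arch)
        next
          case True
          then have "(k - 2 - j) + 2 \<le> length ys" using len insert 4 k t' by simp
          from split2[OF this] obtain ys1 a b ys2 where ys: "ys = ys1 @ a # b # ys2" "length ys1 = k - 2 - j" by blast
          have "fits (\<lambda>p q. q = dual p) (insert_arch k t) ((xs @ p # dual p # ys1) @ a # b # ys2) \<longleftrightarrow>
            b = dual a \<and> fits (\<lambda>p q. q = dual p) t ((xs @ p # dual p # ys1) @ ys2)"
            using len ys 4 insert by (intro fits_insert_arch) auto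
          moreover have "fits (\<lambda>p q. q = dual p) t (xs @ p # dual p # (ys1 @ ys2)) \<longleftrightarrow>
             fits (\<lambda>p q. q = dual p) t' (xs @ (ys1 @ ys2)) \<and> (xs @ (ys1 @ ys2)) ! m = (if s then p else dual p)"
            by (rule f[OF d len])
          moreover have "fits (\<lambda>p q. q = dual p) (insert_arch (k - 2) t') ((xs @ ys1) @ a # b # ys2) \<longleftrightarrow>
            b = dual a \<and> fits (\<lambda>p q. q = dual p) t' ((xs @ ys1) @ ys2)"
            using len ys 4 k by (intro fits_insert_arch) auto
          moreover have "((xs @ ys1) @ a # b # ys2) ! ?m = ((xs @ ys1) @ ys2) ! m"
            using len ys 4 by (intro nth_append_insert2) simp
          ultimately show ?thesis using ys by auto
        qed
      qed
      then show ?thesis by blast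
    qed
  next
    case 5
    then have j: "j - 2 + 2 \<le> 2 * arcs t" using insert by (simp add: arcs_insert_arch)
    consider "?A (j - 2) t" | "?B (j - 2) t" using insert.IH[OF j] by blast
    then show ?thesis
    proof cases
      case 1
      then obtain t1 where t1: "t = insert_arch (j - 2) t1" "j - 2 \<le> 2 * arcs t1" by blast
      have "insert_arch (j - 2 + 2) (insert_arch k t1) = insert_arch k (insert_arch (j - 2) t1)"
        using 5 t1 by (intro insert_arch_commute) auto
      moreover have "j - 2 + 2 = j" using 5 by simp
      ultimately have "insert_arch k t = insert_arch j (insert_arch k t1)" using t1 by (simp only:)
      moreover have "j \<le> 2 * arcs (insert_arch k t1)"
        using t1 5 by (simp add: arcs_insert_arch)
      ultimately show ?thesis by blast
    next
      case 2
      then obtain t' m s where t': "Suc (arcs t') = arcs t" "m < 2 * arcs t'"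
        and f: "\<And>(dual :: 'a \<Rightarrow> 'a) xs ys p. (\<forall>p. dual (dual p) = p) \<Longrightarrow> length xs = j - 2 \<Longrightarrow>
          fits (\<lambda>p q. q = dual p) t (xs @ p # dual p # ys) \<longleftrightarrow>
             fits (\<lambda>p q. q = dual p) t' (xs @ ys) \<and> (xs @ ys) ! m = (if s then p else dual p)" by blast
      let ?m = "if m < k then m else m + 2"
      have k: "k \<le> 2 * arcs t'" using insert t' 5 j by simp
      have "?B j (insert_arch k t)"
      proof (intro exI[of _ "insert_arch k t'"] exI[of _ ?m] exI[of _ s] conjI allI impI)
        show "Suc (arcs (insert_arch k t')) = arcs (insert_arch k t)"
          using k insert t' by (simp add: arcs_insert_arch)
        show "?m < 2 * arcs (insert_arch k t')" using k t' by (simp add: arcs_insert_arch)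
        fix dual :: "'a \<Rightarrow> 'a" and xs ys :: "'a list" and p :: 'a
        assume d: "\<forall>p. dual (dual p) = p" and len: "length xs = j"
        from split2[of k xs] len 5 obtain us a b vs where xs: "xs = us @ a # b # vs" "length us = k" by auto
        have "fits (\<lambda>p q. q = dual p) (insert_arch k t) (us @ a # b # (vs @ p # dual p # ys)) \<longleftrightarrow>
            b = dual a \<and> fits (\<lambda>p q. q = dual p) t (us @ (vs @ p # dual p # ys))"
          using xs insert by (intro fits_insert_arch) auto
        moreover have "fits (\<lambda>p q. q = dual p) t ((us @ vs) @ p # dual p # ys) \<longleftrightarrow>
             fits (\<lambda>p q. q = dual p) t' ((us @ vs) @ ys) \<and> ((us @ vs) @ ys) ! m = (if s then p else dual p)"
          using xs len by (intro f[OF d]) simp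
        moreover have "fits (\<lambda>p q. q = dual p) (insert_arch k t') (us @ a # b # (vs @ ys)) \<longleftrightarrow>
            b = dual a \<and> fits (\<lambda>p q. q = dual p) t' (us @ (vs @ ys))"
          using xs k by (intro fits_insert_arch) auto
        moreover have "(us @ a # b # (vs @ ys)) ! ?m = (us @ (vs @ ys)) ! m"
          using xs by (intro nth_append_insert2) simp
        ultimately show "fits (\<lambda>p q. q = dual p) (insert_arch k t) (xs @ p # dual p # ys) \<longleftrightarrow>
             fits (\<lambda>p q. q = dual p) (insert_arch k t') (xs @ ys) \<and> (xs @ ys) ! ?m = (if s then p else dual p)"
          using xs by simp
      qed
      then show ?thesis by blast
    qed
  qed
qed simp

section \<open>Projection kernels\<close>

text \<open>Functions on \<open>X\<close> are represented by total functions; the last clause makes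
  membership independent of the values off \<open>X\<close>.\<close>

definition function_space :: "'a set \<Rightarrow> ('a \<Rightarrow> complex) set \<Rightarrow> bool" where
  "function_space X S \<longleftrightarrow> (\<lambda>_. 0) \<in> S \<and> (\<forall>f\<in>S. \<forall>g\<in>S. (\<lambda>x. f x + g x) \<in> S) \<and>
     (\<forall>c. \<forall>f\<in>S. (\<lambda>x. c * f x) \<in> S) \<and> (\<forall>f\<in>S. \<forall>g. (\<forall>x\<in>X. f x = g x) \<longrightarrow> g \<in> S)"

text \<open>The matrix of the orthogonal projection of the functions on \<open>X\<close> onto
  \<open>S\<close>, for the inner product given by summation over \<open>X\<close>.\<close>

definition projection_kernel :: "'a set \<Rightarrow> ('a \<Rightarrow> complex) set \<Rightarrow> ('a \<Rightarrow> 'a \<Rightarrow> complex) \<Rightarrow> bool" where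
  "projection_kernel X S P \<longleftrightarrow> (\<forall>x\<in>X. \<forall>y\<in>X. P x y = cnj (P y x)) \<and>
     (\<forall>y\<in>X. (\<lambda>x. P x y) \<in> S) \<and> (\<forall>f\<in>S. \<forall>x\<in>X. (\<Sum>y\<in>X. P x y * f y) = f x)"

lemma
  assumes "projection_kernel X S P"
  shows projection_kernel_cnj: "x \<in> X \<Longrightarrow> y \<in> X \<Longrightarrow> cnj (P y x) = P x y"
    and projection_kernel_in: "y \<in> X \<Longrightarrow> (\<lambda>x. P x y) \<in> S"
    and projection_kernel_apply: "f \<in> S \<Longrightarrow> x \<in> X \<Longrightarrow> (\<Sum>y\<in>X. P x y * f y) = f x"
proof -
  show "cnj (P y x) = P x y" if "x \<in> X" "y \<in> X" using assms that unfolding projection_kernel_def by metis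
  show "(\<lambda>x. P x y) \<in> S" if "y \<in> X" using assms that unfolding projection_kernel_def by blast
  show "(\<Sum>y\<in>X. P x y * f y) = f x" if "f \<in> S" "x \<in> X" using assms that unfolding projection_kernel_def by blast
qed

lemma
  assumes "function_space X S"
  shows function_space_zero: "(\<lambda>_. 0) \<in> S"
    and function_space_add: "f \<in> S \<Longrightarrow> g \<in> S \<Longrightarrow> (\<lambda>x. f x + g x) \<in> S"
    and function_space_scale: "f \<in> S \<Longrightarrow> (\<lambda>x. c * f x) \<in> S"
    and function_space_cong: "f \<in> S \<Longrightarrow> (\<And>x. x \<in> X \<Longrightarrow> f x = h x) \<Longrightarrow> h \<in> S"
  using assms unfolding function_space_def by blast+

lemma function_space_sum:
  assumes "function_space X S" "\<And>i. i \<in> I \<Longrightarrow> f i \<in> S"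
  shows "(\<lambda>x. \<Sum>i\<in>I. f i x) \<in> S"
proof (cases "finite I")
  case True
  then show ?thesis using assms(2)
  proof (induction I)
    case (insert i I)
    then have "(\<lambda>x. f i x + (\<Sum>i\<in>I. f i x)) \<in> S" by (intro function_space_add[OF assms(1)]) auto
    then show ?case using insert by simp
  qed (simp add: function_space_zero[OF assms(1)])
qed (simp add: function_space_zero[OF assms(1)])

text \<open>Gram-Schmidt along the points of \<open>X\<close>: the functions in \<open>S\<close>
  vanishing at the new point \<open>x\<close> form a space over the smaller set, and
  \<open>S\<close> exceeds it by at most one dimension, which contributes a rank one term.\<close>

lemma projection_kernel_exists:
  assumes "finite X" "function_space X S"
  shows "\<exists>P. projection_kernel X S P"
  using assms
proof (induction X arbitrary: S rule: finite_induct)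
  case empty
  then show ?case by (auto simp: projection_kernel_def)
next
  case (insert x X S)
  define S0 where "S0 = {f. \<exists>g\<in>S. g x = 0 \<and> (\<forall>y\<in>X. f y = g y)}"
  have "function_space X S0"
    unfolding function_space_def
  proof (intro conjI ballI allI impI)
    show "(\<lambda>_. 0) \<in> S0" using insert.prems by (auto simp: S0_def function_space_def)
    fix f g assume f: "f \<in> S0" 
    then obtain f' where f': "f' \<in> S" "f' x = 0" "\<forall>y\<in>X. f y = f' y" by (auto simp: S0_def)
    { fix c
      have "(\<lambda>x. c * f' x) \<in> S" by (rule function_space_scale[OF insert.prems f'(1)])
      then show "(\<lambda>x. c * f x) \<in> S0" unfolding S0_def using f' by (intro CollectI bexI[rotated]) auto }
    { assume "\<forall>x\<in>X. f x = g x" then show "g \<in> S0" using f' by (auto simp: S0_def) }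
    { assume "g \<in> S0"
      then obtain g' where g': "g' \<in> S" "g' x = 0" "\<forall>y\<in>X. g y = g' y" by (auto simp: S0_def)
      have "(\<lambda>x. f' x + g' x) \<in> S" by (rule function_space_add[OF insert.prems f'(1) g'(1)])
      then show "(\<lambda>x. f x + g x) \<in> S0" unfolding S0_def using f' g' by (intro CollectI bexI[rotated]) auto }
  qed
  then obtain P0 where P0: "projection_kernel X S0 P0" using insert.IH by blast
  define P1 where "P1 y z = (if y = x \<or> z = x then 0 else P0 y z)" for y z
  have in_S: "(\<lambda>y. if y = x then 0 else f y) \<in> S" if f: "f \<in> S0" for f
  proof -
    obtain g where g: "g \<in> S" "g x = 0" "\<forall>y\<in>X. f y = g y" using f by (auto simp: S0_def)
    show ?thesis using g by (intro function_space_cong[OF insert.prems g(1)]) auto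
  qed
  have P1: "(\<lambda>y. P1 y z) \<in> S" if "z \<in> insert x X" for z
  proof (cases "z = x")
    case True
    then have "P1 y z = 0" for y by (simp add: P1_def)
    then show ?thesis using insert.prems by (simp add: function_space_def)
  next
    case False
    then have "(\<lambda>y. P0 y z) \<in> S0" using P0 that by (auto simp: projection_kernel_def)
    from in_S[OF this] show ?thesis using False by (simp add: P1_def)
  qed
  have P1_cnj: "P1 y z = cnj (P1 z y)" if "y \<in> insert x X" "z \<in> insert x X" for y z
    using that P0 by (auto simp: P1_def projection_kernel_def)
  have P1_sum: "(\<Sum>z\<in>insert x X. P1 y z * f z) = (if y = x then 0 else \<Sum>z\<in>X. P0 y z * f z)" for y f
    using insert.hyps by (auto simp: P1_def intro!: sum.cong sum.neutral)
  have P1_rep: "(\<Sum>z\<in>insert x X. P1 y z * f z) = f y" if "f \<in> S" "f x = 0" "y \<in> insert x X" for f y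
  proof -
    have "f \<in> S0" using that by (auto simp: S0_def)
    then show ?thesis
      using projection_kernel_apply[OF P0, of f y] that unfolding P1_sum by (cases "y = x") simp_all
  qed
  show ?case
  proof (cases "\<forall>f\<in>S. f x = 0")
    case True
    then have "projection_kernel (insert x X) S P1"
      unfolding projection_kernel_def using P1 P1_cnj P1_rep by blast
    then show ?thesis by blast
  next
    case False
    then obtain g0 where g0: "g0 \<in> S" "g0 x \<noteq> 0" by auto
    \<comment> \<open>The component of \<open>g0\<close> orthogonal to the functions vanishing at
      \<open>x\<close>. Subtracting \<open>P1\<close> does not change the value at \<open>x\<close>,
      so \<open>g\<close> is not zero.\<close>
    define g where "g y = g0 y + (- 1) * (\<Sum>z\<in>insert x X. g0 z * P1 y z)" for y
    have "(\<lambda>y. \<Sum>z\<in>insert x X. g0 z * P1 y z) \<in> S"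
      by (rule function_space_sum[OF insert.prems]) (rule function_space_scale[OF insert.prems P1])
    then have "(\<lambda>y. (- 1) * (\<Sum>z\<in>insert x X. g0 z * P1 y z)) \<in> S" 
      by (rule function_space_scale[OF insert.prems])
    then have gS: "g \<in> S" unfolding g_def by (rule function_space_add[OF insert.prems g0(1)])
    have gx: "g x = g0 x" using insert.hyps by (simp add: g_def P1_def)
    define N where "N = (\<Sum>y\<in>insert x X. g y * cnj (g y))"
    have N_eq: "N = complex_of_real (\<Sum>y\<in>insert x X. (cmod (g y))\<^sup>2)"
      unfolding N_def of_real_sum by (intro sum.cong refl) (rule complex_norm_square[symmetric])
    have "(\<Sum>y\<in>insert x X. (cmod (g y))\<^sup>2) > 0"
      using insert.hyps g0(2) gx by (intro sum_pos2[of _ x]) auto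
    then have N0: "N \<noteq> 0" unfolding N_eq of_real_eq_0_iff by simp
    have N_cnj: "cnj N = N" by (simp add: N_eq)
    have P1g: "(\<Sum>z\<in>insert x X. cnj (g z) * f z) = 0" if f: "f \<in> S" "f x = 0" for f
    proof -
      have "(\<Sum>z\<in>insert x X. cnj (\<Sum>y\<in>insert x X. g0 y * P1 z y) * f z) =
          (\<Sum>z\<in>insert x X. \<Sum>y\<in>insert x X. cnj (g0 y) * (P1 y z * f z))"
        unfolding cnj_sum sum_distrib_right
        by (intro sum.cong refl) (simp add: P1_cnj[symmetric] mult_ac)
      also have "\<dots> = (\<Sum>y\<in>insert x X. \<Sum>z\<in>insert x X. cnj (g0 y) * (P1 y z * f z))"
        by (rule sum.swap)
      also have "\<dots> = (\<Sum>y\<in>insert x X. cnj (g0 y) * f y)"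
        unfolding sum_distrib_left[symmetric] by (intro sum.cong refl) (simp only: P1_rep[OF f])
      finally show ?thesis
        unfolding g_def by (simp only: complex_cnj_add complex_cnj_mult complex_cnj_minus complex_cnj_one
          distrib_right mult.assoc sum.distrib sum_distrib_left[symmetric]) simp
    qed
    have gg: "(\<Sum>z\<in>insert x X. cnj (g z) * g z) = N" by (simp add: N_def mult.commute)
    have P1gg: "(\<Sum>z\<in>insert x X. P1 y z * g z) = 0" if y: "y \<in> insert x X" for y
    proof -
      have "P1 x y = 0" by (simp add: P1_def)
      then have "(\<Sum>z\<in>insert x X. cnj (g z) * P1 z y) = 0" by (intro P1g P1 y)
      then have "cnj (\<Sum>z\<in>insert x X. cnj (g z) * P1 z y) = 0" by simp
      moreover have "cnj (\<Sum>z\<in>insert x X. cnj (g z) * P1 z y) = (\<Sum>z\<in>insert x X. P1 y z * g z)"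
        unfolding cnj_sum by (intro sum.cong refl) (simp add: P1_cnj[OF y] mult.commute)
      ultimately show ?thesis by simp
    qed
    define P where "P y z = P1 y z + g y * cnj (g z) / N" for y z
    have "projection_kernel (insert x X) S P"
      unfolding projection_kernel_def
    proof (intro conjI ballI)
      fix y z assume yz: "y \<in> insert x X" "z \<in> insert x X"
      show "P y z = cnj (P z y)" using P1_cnj[OF yz] by (simp add: P_def N_cnj mult.commute)
    next
      fix z assume z: "z \<in> insert x X"
      have "(\<lambda>y. (cnj (g z) / N) * g y) \<in> S" by (rule function_space_scale[OF insert.prems gS])
      with P1[OF z] have "(\<lambda>y. P1 y z + (cnj (g z) / N) * g y) \<in> S"
        by (rule function_space_add[OF insert.prems])
      then show "(\<lambda>y. P y z) \<in> S" by (simp add: P_def mult.commute)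
    next
      fix f y assume f: "f \<in> S" and y: "y \<in> insert x X"
      define c where "c = f x / g x"
      define f0 where "f0 y = f y + (- c) * g y" for y
      have "(\<lambda>y. (- c) * g y) \<in> S" by (rule function_space_scale[OF insert.prems gS])
      then have f0: "f0 \<in> S" unfolding f0_def by (rule function_space_add[OF insert.prems f])
      have f0x: "f0 x = 0" using g0(2) gx by (simp add: f0_def c_def)
      have f_eq: "f z = f0 z + c * g z" for z by (simp add: f0_def)
      have "(\<Sum>z\<in>insert x X. P y z * f z) =
        (\<Sum>z\<in>insert x X. P1 y z * f0 z) + c * (\<Sum>z\<in>insert x X. P1 y z * g z)
         + g y / N * (\<Sum>z\<in>insert x X. cnj (g z) * f0 z) + c * (g y / N * (\<Sum>z\<in>insert x X. cnj (g z) * g z))"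
        unfolding f_eq P_def sum_distrib_left sum.distrib[symmetric]
        by (intro sum.cong refl) (simp add: algebra_simps add_divide_distrib)
      also have "\<dots> = f y"
        unfolding P1_rep[OF f0 f0x y] P1gg[OF y] P1g[OF f0 f0x] gg using N0 by (simp add: f_eq)
      finally show "(\<Sum>z\<in>insert x X. P y z * f z) = f y" .
    qed
    then show ?thesis by blast
  qed
qed

text \<open>Each projection fixes the columns of the other, so \<open>P Q = Q\<close> and
  \<open>Q P = P\<close>; taking the adjoint of one identity gives equality.\<close>

lemma projection_kernel_unique:
  assumes P: "projection_kernel X S P" and Q: "projection_kernel X S Q"
    and x: "x \<in> X" and y: "y \<in> X"
  shows "P x y = Q x y"
proof -
  have 1: "(\<Sum>z\<in>X. P a z * Q z b) = Q a b" if "a \<in> X" "b \<in> X" for a b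
    using projection_kernel_apply[OF P projection_kernel_in[OF Q]] that by blast
  have 2: "(\<Sum>z\<in>X. Q a z * P z b) = P a b" if "a \<in> X" "b \<in> X" for a b
    using projection_kernel_apply[OF Q projection_kernel_in[OF P]] that by blast
  have "Q x y = (\<Sum>z\<in>X. P x z * Q z y)" using 1 x y by simp
  also have "\<dots> = (\<Sum>z\<in>X. cnj (P z x) * cnj (Q y z))"
    using x y by (intro sum.cong refl) (simp add: projection_kernel_cnj[OF P] projection_kernel_cnj[OF Q])
  also have "\<dots> = cnj (\<Sum>z\<in>X. Q y z * P z x)"
    by (simp add: mult.commute)
  also have "\<dots> = cnj (P y x)" using 2 x y by simp
  also have "\<dots> = P x y" by (rule projection_kernel_cnj[OF P x y])
  finally show ?thesis by simp
qed

lemma nonneg_Reals_sum: "(\<And>i. i \<in> I \<Longrightarrow> f i \<in> \<real>\<^sub>\<ge>\<^sub>0) \<Longrightarrow> (\<Sum>i\<in>I. f i :: complex) \<in> \<real>\<^sub>\<ge>\<^sub>0"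
  by (induction I rule: infinite_finite_induct) auto

lemma sum_nested_swap:
  "(\<Sum>a\<in>A. \<Sum>b\<in>B. \<Sum>c\<in>C. h a b c) = (\<Sum>c\<in>C. \<Sum>a\<in>A. \<Sum>b\<in>B. h a b c)"
proof -
  have "(\<Sum>a\<in>A. \<Sum>b\<in>B. \<Sum>c\<in>C. h a b c) = (\<Sum>a\<in>A. \<Sum>c\<in>C. \<Sum>b\<in>B. h a b c)"
    by (rule sum.cong[OF refl], rule sum.swap)
  also have "\<dots> = (\<Sum>c\<in>C. \<Sum>a\<in>A. \<Sum>b\<in>B. h a b c)" by (rule sum.swap)
  finally show ?thesis .
qed

text \<open>A projection is the product of its adjoint with itself, so the form is a sum of squared
  absolute values.\<close>

lemma projection_kernel_psd:
  assumes P: "projection_kernel X S P" and p: "\<And>i. i \<in> I \<Longrightarrow> p i \<in> X"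
  shows "(\<Sum>i\<in>I. \<Sum>j\<in>I. cnj (f i) * f j * P (p i) (p j)) \<in> \<real>\<^sub>\<ge>\<^sub>0"
proof -
  have PP: "P x y = (\<Sum>z\<in>X. cnj (P z x) * P z y)" if "x \<in> X" "y \<in> X" for x y
  proof -
    have "P x y = (\<Sum>z\<in>X. P x z * P z y)"
      using projection_kernel_apply[OF P projection_kernel_in[OF P]] that by simp
    also have "\<dots> = (\<Sum>z\<in>X. cnj (P z x) * P z y)"
      using that by (intro sum.cong refl) (simp add: projection_kernel_cnj[OF P])
    finally show ?thesis .
  qed
  have "(\<Sum>i\<in>I. \<Sum>j\<in>I. cnj (f i) * f j * P (p i) (p j)) =
    (\<Sum>i\<in>I. \<Sum>j\<in>I. \<Sum>z\<in>X. cnj (f i * P z (p i)) * (f j * P z (p j)))"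
  proof (intro sum.cong refl)
    fix i j assume "i \<in> I" "j \<in> I"
    from PP[OF p p, OF this]
    show "cnj (f i) * f j * P (p i) (p j) = (\<Sum>z\<in>X. cnj (f i * P z (p i)) * (f j * P z (p j)))"
      by (simp add: sum_distrib_left mult_ac)
  qed
  also have "\<dots> = (\<Sum>z\<in>X. \<Sum>i\<in>I. \<Sum>j\<in>I. cnj (f i * P z (p i)) * (f j * P z (p j)))"
    by (rule sum_nested_swap)
  also have "\<dots> = (\<Sum>z\<in>X. cnj (\<Sum>i\<in>I. f i * P z (p i)) * (\<Sum>j\<in>I. f j * P z (p j)))"
    unfolding cnj_sum sum_product ..
  also have "\<dots> = complex_of_real (\<Sum>z\<in>X. (cmod (\<Sum>i\<in>I. f i * P z (p i)))\<^sup>2)"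
    unfolding of_real_sum by (intro sum.cong refl) (simp add: complex_norm_square mult.commute del: of_real_power)
  also have "\<dots> \<in> \<real>\<^sub>\<ge>\<^sub>0"
    by (simp only: nonneg_Reals_of_real_iff) (intro sum_nonneg zero_le_power2)
  finally show ?thesis .
qed

text \<open>For a *-algebra \<open>D\<close> of matrices and an orthonormal basis \<open>T\<^sub>a\<close> of it, the map
  \<open>\<Phi> c = \<Sum> T\<^sub>a c T\<^sub>a\<^sup>*\<close> is positive for the Hilbert-Schmidt inner product: it is self-adjoint with range
  in the commutant of \<open>D\<close>, so \<open>c\<close> may be replaced by its projection \<open>c1\<close> to the commutant, where
  \<open>\<langle>c1, \<Phi> c1\<rangle> = \<Sum> \<parallel>T\<^sub>a\<^sup>* c1\<parallel>\<^sup>2\<close>. Here \<open>\<Sum> T\<^sub>a \<otimes> T\<^sub>a\<^sup>*\<close> is encoded by the projection kernel of \<open>D\<close>.\<close>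

lemma star_algebra_kernel_positive:
  fixes X :: "'a set" and D :: "('a \<times> 'a \<Rightarrow> complex) set"
  assumes fin: "finite X" and D: "function_space (X \<times> X) D"
    and mult: "\<And>s t. s \<in> D \<Longrightarrow> t \<in> D \<Longrightarrow> (\<lambda>(a, c). \<Sum>b\<in>X. s (a, b) * t (b, c)) \<in> D"
    and adj: "\<And>t. t \<in> D \<Longrightarrow> (\<lambda>(a, b). cnj (t (b, a))) \<in> D"
    and P: "projection_kernel (X \<times> X) D P"
  shows "(\<Sum>a\<in>X. \<Sum>c\<in>X. \<Sum>b\<in>X. \<Sum>d\<in>X. cnj (f (a, c)) * f (b, d) * P (a, b) (c, d)) \<in> \<real>\<^sub>\<ge>\<^sub>0"
proof -
  define C where "C = {c. \<forall>t\<in>D. \<forall>a\<in>X. \<forall>b\<in>X. (\<Sum>e\<in>X. t (a, e) * c (e, b)) = (\<Sum>e\<in>X. c (a, e) * t (e, b))}"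
  define \<Phi> where "\<Phi> c = (\<lambda>(a, c'). \<Sum>b\<in>X. \<Sum>d\<in>X. c (b, d) * P (a, b) (c', d))" for c
  define B where "B x y = (\<Sum>a\<in>X. \<Sum>c\<in>X. cnj (x (a, c)) * \<Phi> y (a, c))" for x y
  have C_comm: "(\<Sum>e\<in>X. t (a, e) * c (e, b)) = (\<Sum>e\<in>X. c (a, e) * t (e, b))"
    if "c \<in> C" "t \<in> D" "a \<in> X" "b \<in> X" for c t a b
    using that unfolding C_def by blast
  have C_space: "function_space (X \<times> X) C"
    unfolding function_space_def
  proof (intro conjI ballI allI impI)
    show "(\<lambda>_. 0) \<in> C" by (simp add: C_def)
    fix x assume x: "x \<in> C"
    show "(\<lambda>z. x z + y z) \<in> C" if "y \<in> C" for y
      using x that by (simp add: C_def algebra_simps sum.distrib)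
    show "(\<lambda>z. k * x z) \<in> C" for k
      using x by (simp add: C_def mult.left_commute mult.assoc flip: sum_distrib_left)
    show "y \<in> C" if eq: "\<forall>z\<in>X \<times> X. x z = y z" for y
      unfolding C_def
    proof (intro CollectI ballI)
      fix t a b assume t: "t \<in> D" and ab: "a \<in> X" "b \<in> X"
      have "(\<Sum>e\<in>X. t (a, e) * y (e, b)) = (\<Sum>e\<in>X. t (a, e) * x (e, b))"
        using eq ab by (intro sum.cong refl) auto
      also have "\<dots> = (\<Sum>e\<in>X. x (a, e) * t (e, b))" using x t ab by (simp add: C_def)
      also have "\<dots> = (\<Sum>e\<in>X. y (a, e) * t (e, b))"
        using eq ab by (intro sum.cong refl) auto
      finally show "(\<Sum>e\<in>X. t (a, e) * y (e, b)) = (\<Sum>e\<in>X. y (a, e) * t (e, b))" .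
    qed
  qed
  \<comment> \<open>Left multiplication by \<open>s\<close> and by its adjoint both preserve
    \<open>D\<close>, hence it commutes with the projection onto \<open>D\<close>.\<close>
  have comm: "(\<Sum>e\<in>X. s (a, e) * P (e, b) (c, d)) = (\<Sum>e\<in>X. P (a, b) (e, d) * s (e, c))"
    if s: "s \<in> D" and abcd: "a \<in> X" "b \<in> X" "c \<in> X" "d \<in> X" for s a b c d
  proof -
    have left: "(\<Sum>z\<in>X \<times> X. P x z * (\<Sum>e\<in>X. s (fst z, e) * P (e, snd z) y)) = (\<Sum>e\<in>X. s (fst x, e) * P (e, snd x) y)"
      if "s \<in> D" "x \<in> X \<times> X" "y \<in> X \<times> X" for s x y
    proof -
      have "(\<lambda>(a, c). \<Sum>b\<in>X. s (a, b) * P (b, c) y) \<in> D"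
        by (rule mult[OF that(1) projection_kernel_in[OF P that(3)], unfolded])
      from projection_kernel_apply[OF P this that(2)] show ?thesis by (simp add: case_prod_beta)
    qed
    define s' where "s' = (\<lambda>(a, b). cnj (s (b, a)))"
    have s': "s' \<in> D" unfolding s'_def by (rule adj[OF s])
    have "(\<Sum>e\<in>X. s (a, e) * P (e, b) (c, d)) =
        (\<Sum>z\<in>X \<times> X. P (a, b) z * (\<Sum>e\<in>X. s (fst z, e) * P (e, snd z) (c, d)))"
      using left[OF s, of "(a, b)" "(c, d)"] abcd by simp
    also have "\<dots> = (\<Sum>u\<in>X. \<Sum>v\<in>X. \<Sum>e\<in>X. P (a, b) (u, v) * s (u, e) * P (e, v) (c, d))"
      by (simp add: sum.cartesian_product' sum_distrib_left mult.assoc)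
    also have "\<dots> = (\<Sum>v\<in>X. \<Sum>e\<in>X. \<Sum>u\<in>X. P (a, b) (u, v) * s (u, e) * P (e, v) (c, d))"
      by (rule sum_nested_swap[symmetric])
    also have "\<dots> = (\<Sum>e\<in>X. \<Sum>v\<in>X. \<Sum>u\<in>X. P (a, b) (u, v) * s (u, e) * P (e, v) (c, d))"
      by (rule sum.swap)
    also have "\<dots> = (\<Sum>e\<in>X. \<Sum>v\<in>X. (\<Sum>u\<in>X. P (a, b) (u, v) * s (u, e)) * P (e, v) (c, d))"
      by (simp add: sum_distrib_right)
    also have "\<dots> = cnj (\<Sum>e\<in>X. \<Sum>v\<in>X. P (c, d) (e, v) * (\<Sum>u\<in>X. s' (e, u) * P (u, v) (a, b)))"
      unfolding cnj_sum complex_cnj_mult s'_def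
      using abcd by (intro sum.cong refl) (simp add: projection_kernel_cnj[OF P] mult.commute)
    also have "(\<Sum>e\<in>X. \<Sum>v\<in>X. P (c, d) (e, v) * (\<Sum>u\<in>X. s' (e, u) * P (u, v) (a, b))) =
        (\<Sum>e\<in>X. s' (c, e) * P (e, d) (a, b))"
      using left[OF s', of "(c, d)" "(a, b)"] abcd by (simp add: sum.cartesian_product')
    also have "cnj \<dots> = (\<Sum>e\<in>X. P (a, b) (e, d) * s (e, c))"
      unfolding cnj_sum complex_cnj_mult s'_def
      using abcd by (intro sum.cong refl) (simp add: projection_kernel_cnj[OF P] mult.commute)
    finally show ?thesis .
  qed
  have Phi_C: "\<Phi> c \<in> C" for c
    unfolding C_def
  proof (intro CollectI ballI)
    fix t a b assume t: "t \<in> D" and ab: "a \<in> X" "b \<in> X"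
    have "(\<Sum>e\<in>X. t (a, e) * \<Phi> c (e, b)) = (\<Sum>e\<in>X. \<Sum>u\<in>X. \<Sum>v\<in>X. c (u, v) * (t (a, e) * P (e, u) (b, v)))"
      by (simp add: \<Phi>_def sum_distrib_left mult_ac)
    also have "\<dots> = (\<Sum>u\<in>X. \<Sum>v\<in>X. c (u, v) * (\<Sum>e\<in>X. t (a, e) * P (e, u) (b, v)))"
      unfolding sum_distrib_left by (rule sum_nested_swap[symmetric])
    also have "\<dots> = (\<Sum>u\<in>X. \<Sum>v\<in>X. c (u, v) * (\<Sum>e\<in>X. P (a, u) (e, v) * t (e, b)))"
      using ab t by (intro sum.cong refl) (simp add: comm)
    also have "\<dots> = (\<Sum>u\<in>X. \<Sum>v\<in>X. \<Sum>e\<in>X. c (u, v) * P (a, u) (e, v) * t (e, b))"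
      by (simp add: sum_distrib_left mult_ac)
    also have "\<dots> = (\<Sum>e\<in>X. \<Sum>u\<in>X. \<Sum>v\<in>X. c (u, v) * P (a, u) (e, v) * t (e, b))"
      by (rule sum_nested_swap)
    also have "\<dots> = (\<Sum>e\<in>X. \<Phi> c (a, e) * t (e, b))"
      by (simp add: \<Phi>_def sum_distrib_right)
    finally show "(\<Sum>e\<in>X. t (a, e) * \<Phi> c (e, b)) = (\<Sum>e\<in>X. \<Phi> c (a, e) * t (e, b))" .
  qed
  \<comment> \<open>The adjoint operation maps \<open>D\<close> to itself, so the conjugated kernel
    with both index pairs swapped is again the projection kernel of \<open>D\<close>; uniqueness
    applies.\<close>
  have flip: "P (c, d) (a, b) = P (b, a) (d, c)" if "a \<in> X" "b \<in> X" "c \<in> X" "d \<in> X" for a b c d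
  proof -
    define P' where "P' x y = cnj (P (snd x, fst x) (snd y, fst y))" for x y
    have "projection_kernel (X \<times> X) D P'"
      unfolding projection_kernel_def
    proof (intro conjI ballI)
      fix x y assume xy: "x \<in> X \<times> X" "y \<in> X \<times> X"
      then have "cnj (P (snd y, fst y) (snd x, fst x)) = P (snd x, fst x) (snd y, fst y)"
        by (intro projection_kernel_cnj[OF P]) auto
      then show "P' x y = cnj (P' y x)" by (simp add: P'_def)
    next
      fix y assume y: "y \<in> X \<times> X"
      then have "(\<lambda>x. P x (snd y, fst y)) \<in> D" by (intro projection_kernel_in[OF P]) auto
      from adj[OF this] show "(\<lambda>x. P' x y) \<in> D" by (simp add: P'_def case_prod_beta')
    next
      fix h x assume h: "h \<in> D" and x: "x \<in> X \<times> X"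
      have "(\<Sum>y\<in>X \<times> X. P' x y * h y) = cnj (\<Sum>u\<in>X. \<Sum>v\<in>X. P (snd x, fst x) (v, u) * cnj (h (u, v)))"
        by (simp add: P'_def sum.cartesian_product')
      also have "(\<Sum>u\<in>X. \<Sum>v\<in>X. P (snd x, fst x) (v, u) * cnj (h (u, v))) =
          (\<Sum>v\<in>X. \<Sum>u\<in>X. P (snd x, fst x) (v, u) * cnj (h (u, v)))" by (rule sum.swap)
      also have "\<dots> = cnj (h x)"
        using projection_kernel_apply[OF P adj[OF h], of "(snd x, fst x)"] x
        by (simp add: sum.cartesian_product' case_prod_beta mem_Times_iff)
      finally show "(\<Sum>y\<in>X \<times> X. P' x y * h y) = h x" by simp
    qed
    from projection_kernel_unique[OF P this, of "(b, a)" "(d, c)"] that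
    have "P (b, a) (d, c) = cnj (P (a, b) (c, d))" by (simp add: P'_def)
    also have "\<dots> = P (c, d) (a, b)" using that by (intro projection_kernel_cnj[OF P]) auto
    finally show ?thesis by simp
  qed
  have B_expand: "B x y = (\<Sum>a\<in>X. \<Sum>c\<in>X. \<Sum>b\<in>X. \<Sum>d\<in>X. cnj (x (a, c)) * y (b, d) * P (a, b) (c, d))" for x y
    by (simp add: B_def \<Phi>_def sum_distrib_left mult.assoc)
  have B_cnj: "B x y = cnj (B y x)" for x y
  proof -
    have "cnj (B y x) = (\<Sum>a\<in>X. \<Sum>c\<in>X. \<Sum>b\<in>X. \<Sum>d\<in>X. y (a, c) * cnj (x (b, d)) * P (b, a) (d, c))"
      unfolding B_expand cnj_sum complex_cnj_mult complex_cnj_cnj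
      by (intro sum.cong refl) (simp add: projection_kernel_cnj[OF P] flip)
    also have "\<dots> = (\<Sum>z\<in>X \<times> X. \<Sum>w\<in>X \<times> X. y z * cnj (x w) * P (fst w, fst z) (snd w, snd z))"
      by (simp add: sum.cartesian_product')
    also have "\<dots> = (\<Sum>w\<in>X \<times> X. \<Sum>z\<in>X \<times> X. y z * cnj (x w) * P (fst w, fst z) (snd w, snd z))"
      by (rule sum.swap)
    also have "\<dots> = B x y" unfolding B_expand by (simp add: sum.cartesian_product' mult_ac)
    finally show ?thesis by simp
  qed
  obtain Q where Q: "projection_kernel (X \<times> X) C Q"
    using projection_kernel_exists[OF _ C_space] fin by blast
  define c1 where "c1 x = (\<Sum>y\<in>X \<times> X. f y * Q x y)" for x
  define c2 where "c2 x = f x - c1 x" for x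
  have c1: "c1 \<in> C" unfolding c1_def
    by (intro function_space_sum[OF C_space] function_space_scale[OF C_space] projection_kernel_in[OF Q])
  have c2: "(\<Sum>x\<in>X \<times> X. cnj (c2 x) * y x) = 0" if y: "y \<in> C" for y
  proof -
    have "(\<Sum>x\<in>X \<times> X. cnj (c1 x) * y x) = (\<Sum>x\<in>X \<times> X. \<Sum>z\<in>X \<times> X. cnj (f z) * (Q z x * y x))"
      unfolding c1_def cnj_sum sum_distrib_right complex_cnj_mult
      by (intro sum.cong refl) (simp add: projection_kernel_cnj[OF Q] mult.assoc)
    also have "\<dots> = (\<Sum>z\<in>X \<times> X. \<Sum>x\<in>X \<times> X. cnj (f z) * (Q z x * y x))" by (rule sum.swap)
    also have "\<dots> = (\<Sum>z\<in>X \<times> X. cnj (f z) * y z)"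
      unfolding sum_distrib_left[symmetric] by (intro sum.cong refl) (simp only: projection_kernel_apply[OF Q y])
    finally show ?thesis by (simp add: c2_def algebra_simps sum_subtractf)
  qed
  have Bc2: "B c2 y = 0" for y
    using c2[OF Phi_C[of y]] by (simp add: B_def sum.cartesian_product')
  have B_add: "B f f = B c1 c1 + B c1 c2 + B c2 f"
    unfolding B_expand sum.distrib[symmetric]
    by (intro sum.cong refl) (simp add: c2_def algebra_simps)
  then have "B f f = B c1 c1" using B_cnj[of c1 c2] Bc2 by simp
  also have "\<dots> = (\<Sum>a\<in>X. \<Sum>d\<in>X. \<Sum>c\<in>X. \<Sum>b\<in>X. cnj (c1 (a, c)) * c1 (a, b) * P (b, d) (c, d))"
  proof -
    \<comment> \<open>A column of \<open>P\<close> lies in \<open>D\<close> and hence commutes with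
      \<open>c1\<close>. After the exchange the sum is, for fixed \<open>a\<close> and
      \<open>d\<close>, a positive form of the projection.\<close>
    have move: "(\<Sum>b\<in>X. \<Sum>d\<in>X. cnj (c1 (a, c)) * c1 (b, d) * P (a, b) (c, d)) =
      (\<Sum>d\<in>X. \<Sum>b\<in>X. cnj (c1 (a, c)) * c1 (a, b) * P (b, d) (c, d))" if ac: "a \<in> X" "c \<in> X" for a c
    proof -
      have *: "(\<Sum>b\<in>X. P (a, b) (c, d) * c1 (b, d)) = (\<Sum>b\<in>X. c1 (a, b) * P (b, d) (c, d))" if d: "d \<in> X" for d
      proof -
        have "(\<lambda>x. P x (c, d)) \<in> D" using ac d by (intro projection_kernel_in[OF P]) auto
        from C_comm[OF c1 this ac(1) d] show ?thesis .
      qed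
      have "(\<Sum>b\<in>X. \<Sum>d\<in>X. cnj (c1 (a, c)) * c1 (b, d) * P (a, b) (c, d)) =
         (\<Sum>d\<in>X. cnj (c1 (a, c)) * (\<Sum>b\<in>X. P (a, b) (c, d) * c1 (b, d)))"
        by (subst sum.swap) (simp add: sum_distrib_left mult_ac)
      also have "\<dots> = (\<Sum>d\<in>X. cnj (c1 (a, c)) * (\<Sum>b\<in>X. c1 (a, b) * P (b, d) (c, d)))"
        by (intro sum.cong refl) (simp only: *)
      finally show ?thesis by (simp add: sum_distrib_left mult.assoc)
    qed
    have "B c1 c1 = (\<Sum>a\<in>X. \<Sum>c\<in>X. \<Sum>d\<in>X. \<Sum>b\<in>X. cnj (c1 (a, c)) * c1 (a, b) * P (b, d) (c, d))"
      unfolding B_expand by (rule sum.cong[OF refl], rule sum.cong[OF refl], rule move)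
    also have "\<dots> = (\<Sum>a\<in>X. \<Sum>d\<in>X. \<Sum>c\<in>X. \<Sum>b\<in>X. cnj (c1 (a, c)) * c1 (a, b) * P (b, d) (c, d))"
      by (rule sum.cong[OF refl], rule sum.swap)
    finally show ?thesis .
  qed
  also have "\<dots> \<in> \<real>\<^sub>\<ge>\<^sub>0"
  proof (rule nonneg_Reals_sum, rule nonneg_Reals_sum)
    fix a d assume ad: "a \<in> X" "d \<in> X"
    have "(\<Sum>c\<in>X. \<Sum>b\<in>X. cnj (cnj (c1 (a, c))) * cnj (c1 (a, b)) * P (c, d) (b, d)) \<in> \<real>\<^sub>\<ge>\<^sub>0"
      by (rule projection_kernel_psd[OF P, where p = "\<lambda>c. (c, d)"]) (use ad in auto)
    also have "(\<Sum>c\<in>X. \<Sum>b\<in>X. cnj (cnj (c1 (a, c))) * cnj (c1 (a, b)) * P (c, d) (b, d)) =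
        (\<Sum>c\<in>X. \<Sum>b\<in>X. cnj (c1 (a, c)) * c1 (a, b) * P (b, d) (c, d))"
      by (subst sum.swap) (simp add: mult_ac)
    finally show "(\<Sum>c\<in>X. \<Sum>b\<in>X. cnj (c1 (a, c)) * c1 (a, b) * P (b, d) (c, d)) \<in> \<real>\<^sub>\<ge>\<^sub>0" .
  qed
  finally show ?thesis unfolding B_expand .
qed

section \<open>Sums over lists of indices\<close>

lemma sum_listset_Cons:
  "(\<Sum>l\<in>listset (A # As). f l) = (\<Sum>a\<in>A. \<Sum>l\<in>listset As. f (a # l))"
proof -
  have "listset (A # As) = (\<lambda>(a, l). a # l) ` (A \<times> listset As)" by (auto simp: set_Cons_def)
  moreover have "inj_on (\<lambda>(a, l). a # l) (A \<times> listset As)" by (auto simp: inj_on_def)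
  ultimately show ?thesis by (simp add: sum.reindex sum.cartesian_product split_def)
qed

lemma length_listset: "l \<in> listset As \<Longrightarrow> length l = length As"
  by (induction As arbitrary: l) (auto simp: set_Cons_def)

lemma finite_listset: "(\<And>A. A \<in> set As \<Longrightarrow> finite A) \<Longrightarrow> finite (listset As)"
proof (induction As)
  case (Cons A As)
  have "listset (A # As) = (\<lambda>(a, l). a # l) ` (A \<times> listset As)" by (auto simp: set_Cons_def)
  then show ?case using Cons by simp
qed simp

lemma listset_append: "listset (As @ Bs) = (\<lambda>(k, l). k @ l) ` (listset As \<times> listset Bs)"
proof (induction As)
  case (Cons A As)
  show ?case
  proof (rule Set.set_eqI, rule iffI)
    fix z assume "z \<in> listset ((A # As) @ Bs)"
    then obtain a y where "z = a # y" "a \<in> A" "y \<in> listset (As @ Bs)" by (auto simp: set_Cons_def)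
    then obtain k l where "z = (a # k) @ l" "a # k \<in> listset (A # As)" "l \<in> listset Bs"
      using Cons.IH by (auto simp: set_Cons_def)
    then show "z \<in> (\<lambda>(k, l). k @ l) ` (listset (A # As) \<times> listset Bs)" by (intro image_eqI[of _ _ "(a # k, l)"]) auto
  next
    fix z assume "z \<in> (\<lambda>(k, l). k @ l) ` (listset (A # As) \<times> listset Bs)"
    then obtain a k l where "z = a # k @ l" "a \<in> A" "k \<in> listset As" "l \<in> listset Bs" by (auto simp: set_Cons_def)
    then show "z \<in> listset ((A # As) @ Bs)" using Cons.IH by (auto simp: set_Cons_def)
  qed
qed (auto intro!: image_eqI[of _ _ "([], _)"])

lemma sum_listset_append:
  "(\<Sum>m\<in>listset (As @ Bs). f m) = (\<Sum>k\<in>listset As. \<Sum>l\<in>listset Bs. f (k @ l))"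
proof -
  have "inj_on (\<lambda>(k, l). k @ l) (listset As \<times> listset Bs)"
    unfolding inj_on_def by clarsimp (metis append_eq_append_conv length_listset)
  then show ?thesis unfolding listset_append by (simp add: sum.reindex sum.cartesian_product split_def)
qed

lemma append_listset_iff:
  "length k = length As \<Longrightarrow> k @ l \<in> listset (As @ Bs) \<longleftrightarrow> k \<in> listset As \<and> l \<in> listset Bs"
proof
  assume k: "length k = length As" "k @ l \<in> listset (As @ Bs)"
  then obtain k' l' where *: "k @ l = k' @ l'" "k' \<in> listset As" "l' \<in> listset Bs"
    by (auto simp: listset_append)
  then have "length k' = length k" using k length_listset by metis
  then show "k \<in> listset As \<and> l \<in> listset Bs" using * by simp
qed (auto simp: listset_append)

lemma listset_appendE:
  assumes "m \<in> listset (As @ Bs)"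
  obtains k l where "m = k @ l" "k \<in> listset As" "l \<in> listset Bs" "length k = length As"
  using assms by (auto simp: listset_append dest: length_listset)

lemma rev_listset: "rev l \<in> listset (rev As) \<longleftrightarrow> l \<in> listset As"
proof (induction l arbitrary: As)
  case Nil
  show ?case by (cases As rule: rev_cases) (auto simp: set_Cons_def dest: length_listset)
next
  case (Cons a l)
  show ?case
  proof (cases As)
    case Nil
    then show ?thesis by auto
  next
    case (Cons A As')
    have "rev l @ [a] \<in> listset (rev As' @ [A]) \<longleftrightarrow> a # l \<in> listset (A # As')"
    proof (cases "length l = length As'")
      case True
      then show ?thesis using Cons.IH[of As'] by (subst append_listset_iff) (auto simp: set_Cons_def)
    next
      case False
      then show ?thesis using length_listset by fastforce
    qed
    then show ?thesis using Cons by simp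
  qed
qed

lemma sum_listset_rev: "(\<Sum>l\<in>listset (rev As). f l) = (\<Sum>l\<in>listset As. f (rev l))"
proof -
  have "listset (rev As) = rev ` listset As"
    using rev_listset[of _ As] rev_listset[of _ "rev As"] by (auto intro!: image_eqI[where x = "rev _"])
  then show ?thesis by (simp add: sum.reindex)
qed

section \<open>Fixed vectors of coloured words\<close>

abbreviation pairing_tensor :: "pairing \<Rightarrow> nat list \<Rightarrow> complex" where
  "pairing_tensor t i \<equiv> of_bool (fits (=) t i)"

text \<open>A colour stands for a finite-dimensional space with basis \<open>ix c\<close>, and
  \<open>bar c\<close> for the conjugate space with the same basis. A fixed point of
  \<open>bar\<close> is a self-adjoint colour.\<close>

locale colour_system =
  fixes bar :: "'c \<Rightarrow> 'c" and ix :: "'c \<Rightarrow> nat set"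
  assumes bar_bar [simp]: "bar (bar c) = c" and finite_ix [simp]: "finite (ix c)" and ix_bar [simp]: "ix (bar c) = ix c"
begin

abbreviation "idx w \<equiv> listset (map ix w)"
abbreviation "matches t w \<equiv> fits (\<lambda>a b. b = bar a) t w"
abbreviation "dual w \<equiv> rev (map bar w)"

lemma finite_idx [simp]: "finite (idx w)"
  by (intro finite_listset) auto

lemma length_idx: "i \<in> idx w \<Longrightarrow> length i = length w"
  using length_listset by fastforce

text \<open>\<open>V w\<close> is the space of fixed vectors of the tensor product with colours \<open>w\<close>: it is spanned by the
  vectors of the noncrossing pairings that match each colour with its dual.\<close>

inductive V :: "'c list \<Rightarrow> (nat list \<Rightarrow> complex) \<Rightarrow> bool" where
  pairing: "matches t w \<Longrightarrow> V w (pairing_tensor t)"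
| add: "V w f \<Longrightarrow> V w g \<Longrightarrow> V w (\<lambda>i. f i + g i)"
| scale: "V w f \<Longrightarrow> V w (\<lambda>i. a * f i)"
| zero: "V w (\<lambda>_. 0)"
| ext: "V w f \<Longrightarrow> (\<And>i. i \<in> idx w \<Longrightarrow> f i = g i) \<Longrightarrow> V w g"

lemma V_space: "function_space (idx w) {f. V w f}"
  unfolding function_space_def by (auto intro: V.add V.scale V.zero V.ext)

lemma V_sum: "(\<And>k. k \<in> K \<Longrightarrow> V w (f k)) \<Longrightarrow> V w (\<lambda>i. \<Sum>k\<in>K. f k i)"
  using function_space_sum[OF V_space, of K f w] by simp

lemma map_ix_dual: "map ix (dual w) = rev (map ix w)"
  by (simp add: rev_map comp_def)

lemma rev_idx: "rev i \<in> idx (dual w) \<longleftrightarrow> i \<in> idx w"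
  unfolding map_ix_dual by (rule rev_listset)

lemma idx_append_iff: "length i = length u \<Longrightarrow> i @ j \<in> idx (u @ v) \<longleftrightarrow> i \<in> idx u \<and> j \<in> idx v"
  by (simp add: append_listset_iff)

lemma idx_appendE:
  assumes "m \<in> idx (u @ v)"
  obtains i j where "m = i @ j" "i \<in> idx u" "j \<in> idx v" "length i = length u"
  using assms listset_appendE[of m "map ix u" "map ix v"] by auto

lemma V_star: "V w f \<Longrightarrow> V (dual w) (\<lambda>i. cnj (f (rev i)))"
proof (induction rule: V.induct)
  case (pairing t w)
  have "matches (mirror t) (dual w)"
  proof -
    have "(\<lambda>a b. bar a = bar (bar b)) = (\<lambda>a b. b = bar a)" by (auto simp: fun_eq_iff)
    then show ?thesis
      using pairing fits_mirror[of "\<lambda>a b. b = bar a" t "map bar w"] by (simp only: fits_map)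
  qed
  then have "V (dual w) (pairing_tensor (mirror t))" by (rule V.pairing)
  moreover have "pairing_tensor (mirror t) = (\<lambda>i. cnj (pairing_tensor t (rev i)))"
  proof
    fix i :: "nat list"
    have "(\<lambda>a b :: nat. b = a) = (=)" by (auto simp: fun_eq_iff)
    then show "pairing_tensor (mirror t) i = cnj (pairing_tensor t (rev i))"
      using fits_mirror[of "(=)" t "rev i"] by simp
  qed
  ultimately show ?case by simp
next
  case (ext w f g)
  have "V (dual w) (\<lambda>i. cnj (f (rev i)))" by (rule ext.IH)
  then show ?case
  proof (rule V.ext)
    fix i assume "i \<in> idx (dual w)"
    then have "rev i \<in> idx w" using rev_idx[of "rev i" w] by simp
    then show "cnj (f (rev i)) = cnj (g (rev i))" using ext by simp
  qed
qed (auto intro: V.intros)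

lemma matches_length: "matches t w \<Longrightarrow> length w = 2 * arcs t"
  by (rule fits_length)

text \<open>The invariant vector of a colour and its dual is placed in the middle of a word; on
  pairing vectors this inserts an arch.\<close>

lemma V_cup:
  assumes "V (u @ v) f"
  shows "V (u @ c # bar c # v) (\<lambda>i. if i ! length u = i ! Suc (length u) then f (take (length u) i @ drop (length u + 2) i) else 0)"
  using assms
proof (induction "u @ v" f rule: V.induct)
  case (pairing t)
  have len: "length u \<le> 2 * arcs t" using matches_length[OF pairing] by simp
  have "matches (insert_arch (length u) t) (u @ c # bar c # v)"
    using pairing len by (simp add: fits_insert_arch)
  then have "V (u @ c # bar c # v) (pairing_tensor (insert_arch (length u) t))" by (rule V.pairing)
  then show ?case
  proof (rule V.ext)
    fix i assume "i \<in> idx (u @ c # bar c # v)"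
    then obtain i1 i2 where i: "i = i1 @ i2" "length i1 = length u" "i2 \<in> idx (c # bar c # v)" by (rule idx_appendE)
    then obtain a b i3 where i2: "i2 = a # b # i3" by (auto simp: set_Cons_def)
    show "pairing_tensor (insert_arch (length u) t) i =
      (if i ! length u = i ! Suc (length u) then pairing_tensor t (take (length u) i @ drop (length u + 2) i) else 0)"
      using i(1,2) i2 len fits_insert_arch[of i1 "length u" t "(=)" a b i3] by (simp add: nth_append)
  qed
next
  case (add f g)
  from V.add[OF add(2,4)] show ?case by (rule V.ext) simp
next
  case (scale f a)
  from V.scale[OF scale(2), of a] show ?case by (rule V.ext) simp
next
  case zero
  show ?case by (rule V.ext[OF V.zero]) simp
next
  case (ext f g)
  from ext(2) show ?case
  proof (rule V.ext)
    fix i assume "i \<in> idx (u @ c # bar c # v)"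
    then obtain i1 i2 where i: "i = i1 @ i2" "i1 \<in> idx u" "length i1 = length u" "i2 \<in> idx (c # bar c # v)" by (rule idx_appendE)
    then obtain a b i3 where i2: "i2 = a # b # i3" "i3 \<in> idx v" by (auto simp: set_Cons_def)
    have "i1 @ i3 \<in> idx (u @ v)" using i i2 by (simp add: append_listset_iff)
    then show "(if i ! length u = i ! Suc (length u) then f (take (length u) i @ drop (length u + 2) i) else 0) =
      (if i ! length u = i ! Suc (length u) then g (take (length u) i @ drop (length u + 2) i) else 0)"
      using i i2 ext(3) by simp
  qed
qed

text \<open>Colour and index are merged into one label, so that \<open>contract_neighbours\<close>
  can follow both at once.\<close>

lemma matches_zip:
  fixes i :: "nat list"
  assumes "length w = length i" "matches t w"
  shows "fits (\<lambda>p q. q = (bar (fst p), snd p)) t (zip w i) \<longleftrightarrow> fits (=) t i"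
proof -
  have R: "(\<lambda>p q :: 'c \<times> nat. q = (bar (fst p), snd p)) = (\<lambda>p q. fst q = bar (fst p) \<and> snd p = snd q)"
    by (auto simp: fun_eq_iff prod_eq_iff)
  show ?thesis using arg_cong[OF R, of "\<lambda>R. fits R t (zip w i)"] fits_zip[OF assms(1), of "\<lambda>a b. b = bar a" "(=)" t] assms(2) by simp
qed

lemma zip_matches:
  fixes i :: "nat list"
  assumes "length w = length i" "fits (\<lambda>p q. q = (bar (fst p), snd p)) t (zip w i)"
  shows "matches t w"
proof -
  have R: "(\<lambda>p q :: 'c \<times> nat. q = (bar (fst p), snd p)) = (\<lambda>p q. fst q = bar (fst p) \<and> snd p = snd q)"
    by (auto simp: fun_eq_iff prod_eq_iff)
  show ?thesis using arg_cong[OF R, of "\<lambda>R. fits R t (zip w i)"]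
      fits_zip[OF assms(1), of "\<lambda>a b. b = bar a" "(=)" t] assms(2) by simp
qed

text \<open>The first case is a closed loop, whose contraction gives the factor
  \<open>card (ix c)\<close>; in the second the partners of the contracted points become joined, and
  the sum over \<open>a\<close> has exactly one nonzero candidate.\<close>

lemma pairing_cap:
  assumes t: "matches t (u @ c # bar c # v)"
  shows "(\<exists>t'. t = insert_arch (length u) t' \<and> matches t' (u @ v)) \<or>
    (\<exists>t'. matches t' (u @ v) \<and> (\<forall>i j. i \<in> idx u \<longrightarrow> j \<in> idx v \<longrightarrow>
      (\<Sum>a\<in>ix c. pairing_tensor t (i @ a # a # j)) = pairing_tensor t' (i @ j)))"
proof -
  have len: "length u + 2 \<le> 2 * arcs t" using matches_length[OF t] by simp
  define d where "d = (\<lambda>p :: 'c \<times> nat. (bar (fst p), snd p))"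
  have d: "\<forall>p. d (d p) = p" by (simp add: d_def)
  from contract_neighbours[OF len, where 'a = "'c \<times> nat"] show ?thesis
  proof
    assume "\<exists>t'. t = insert_arch (length u) t' \<and> length u \<le> 2 * arcs t'"
    then obtain t' where t': "t = insert_arch (length u) t'" "length u \<le> 2 * arcs t'" by blast
    then have "matches t' (u @ v)" using t by (simp add: fits_insert_arch)
    then show ?thesis using t' by blast
  next
    assume "\<exists>t' m s. Suc (arcs t') = arcs t \<and> m < 2 * arcs t' \<and>
      (\<forall>dual :: 'c \<times> nat \<Rightarrow> 'c \<times> nat. (\<forall>p. dual (dual p) = p) \<longrightarrow>
        (\<forall>xs ys p. length xs = length u \<longrightarrow>
          (fits (\<lambda>p q. q = dual p) t (xs @ p # dual p # ys) \<longleftrightarrow>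
             fits (\<lambda>p q. q = dual p) t' (xs @ ys) \<and> (xs @ ys) ! m = (if s then p else dual p))))"
    then obtain t' m s where t': "Suc (arcs t') = arcs t" "m < 2 * arcs t'" and
      f: "\<And>xs ys p. length xs = length u \<Longrightarrow> fits (\<lambda>p q. q = d p) t (xs @ p # d p # ys) \<longleftrightarrow>
             fits (\<lambda>p q. q = d p) t' (xs @ ys) \<and> (xs @ ys) ! m = (if s then p else d p)"
      using d by blast
    have m: "m < length (u @ v)" using t' matches_length[OF t] by simp
    have eq: "fits (=) t (i @ a # a # j) \<longleftrightarrow>
        fits (\<lambda>p q. q = d p) t' (zip (u @ v) (i @ j)) \<and> (u @ v) ! m = (if s then c else bar c) \<and> (i @ j) ! m = a"
      if "length i = length u" "length j = length v" for i j a
    proof -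
      have "fits (=) t (i @ a # a # j) \<longleftrightarrow> fits (\<lambda>p q. q = d p) t (zip (u @ c # bar c # v) (i @ a # a # j))"
        using matches_zip[OF _ t, of "i @ a # a # j"] that by (simp add: d_def)
      also have "zip (u @ c # bar c # v) (i @ a # a # j) = zip u i @ (c, a) # d (c, a) # zip v j"
        using that by (simp add: d_def)
      also have "fits (\<lambda>p q. q = d p) t \<dots> \<longleftrightarrow> fits (\<lambda>p q. q = d p) t' (zip (u @ v) (i @ j)) \<and>
         zip (u @ v) (i @ j) ! m = (if s then (c, a) else d (c, a))"
        using that f[of "zip u i" "(c, a)" "zip v j"] by simp
      also have "zip (u @ v) (i @ j) ! m = ((u @ v) ! m, (i @ j) ! m)"
        using m that by (intro nth_zip) auto
      finally show ?thesis by (auto simp: d_def)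
    qed
    \<comment> \<open>A constant index list fits every pairing, so it isolates what
      \<open>eq\<close> says about colours. Only lengths matter in \<open>eq\<close>, hence 0 may be
      taken whether or not it is an index.\<close>
    have "length (replicate (length u) 0 @ (0::nat) # 0 # replicate (length v) 0) = 2 * arcs t"
      using matches_length[OF t] by simp
    then have "fits (=) t (replicate (length u) 0 @ (0::nat) # 0 # replicate (length v) 0)"
      by (rule fits_replicate[where a = 0]) auto
    then have z: "fits (\<lambda>p q. q = d p) t' (zip (u @ v) (replicate (length u) 0 @ replicate (length v) 0))"
      and um: "(u @ v) ! m = (if s then c else bar c)"
      by (simp_all only: eq[of "replicate (length u) 0" "replicate (length v) 0" 0] length_replicate)
    have t'm: "matches t' (u @ v)" by (rule zip_matches[OF _ z[unfolded d_def]]) simp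
    have "(\<Sum>a\<in>ix c. pairing_tensor t (i @ a # a # j)) = pairing_tensor t' (i @ j)" if ij: "i \<in> idx u" "j \<in> idx v" for i j
    proof -
      have len: "length i = length u" "length j = length v" using ij by (auto dest: length_idx)
      have "i @ j \<in> idx (u @ v)" using ij len by (simp only: idx_append_iff)
      moreover have nth: "l \<in> listset As \<Longrightarrow> k < length As \<Longrightarrow> l ! k \<in> As ! k" for l and As :: "nat set list" and k
        by (induction As arbitrary: l k) (auto simp: set_Cons_def nth_Cons split: nat.split)
      ultimately have "(i @ j) ! m \<in> map ix (u @ v) ! m" using m by (metis length_map)
      then have im: "(i @ j) ! m \<in> ix c" using m um by (simp add: nth_map split: if_splits del: map_append)
      have "fits (=) t (i @ a # a # j) \<longleftrightarrow> fits (=) t' (i @ j) \<and> (i @ j) ! m = a" for a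
        using eq[OF len, of a] um matches_zip[OF _ t'm, of "i @ j"] len by (simp add: d_def)
      then have "(\<Sum>a\<in>ix c. pairing_tensor t (i @ a # a # j)) = (\<Sum>a\<in>ix c. if (i @ j) ! m = a then pairing_tensor t' (i @ j) else 0)"
        by (intro sum.cong refl) auto
      then show ?thesis using im by simp
    qed
    then show ?thesis using t'm by blast
  qed
qed

lemma V_cap:
  assumes "V (u @ c # bar c # v) f"
  shows "V (u @ v) (\<lambda>i. \<Sum>a\<in>ix c. f (take (length u) i @ a # a # drop (length u) i))"
  using assms
proof (induction "u @ c # bar c # v" f rule: V.induct)
  case (pairing t)
  from pairing_cap[OF pairing] show ?case
  proof
    assume "\<exists>t'. t = insert_arch (length u) t' \<and> matches t' (u @ v)"
    then obtain t' where t': "t = insert_arch (length u) t'" "matches t' (u @ v)" by blast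
    then have len: "length u \<le> 2 * arcs t'" using matches_length by fastforce
    from V.scale[OF V.pairing[OF t'(2)], of "of_nat (card (ix c))"] show ?thesis
      by (rule V.ext) (use len t' in \<open>auto elim!: idx_appendE simp: fits_insert_arch simp del: map_append\<close>)
  next
    assume "\<exists>t'. matches t' (u @ v) \<and> (\<forall>i j. i \<in> idx u \<longrightarrow> j \<in> idx v \<longrightarrow>
      (\<Sum>a\<in>ix c. pairing_tensor t (i @ a # a # j)) = pairing_tensor t' (i @ j))"
    then obtain t' where t': "matches t' (u @ v)" "\<And>i j. i \<in> idx u \<Longrightarrow> j \<in> idx v \<Longrightarrow>
      (\<Sum>a\<in>ix c. pairing_tensor t (i @ a # a # j)) = pairing_tensor t' (i @ j)" by blast
    from V.pairing[OF t'(1)] show ?thesis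
    proof (rule V.ext)
      fix i assume "i \<in> idx (u @ v)"
      then obtain i1 i2 where i: "i = i1 @ i2" "i1 \<in> idx u" "i2 \<in> idx v" "length i1 = length u" by (rule idx_appendE)
      then show "pairing_tensor t' i = (\<Sum>a\<in>ix c. pairing_tensor t (take (length u) i @ a # a # drop (length u) i))"
        using t'(2)[OF i(2,3)] by (simp del: sum_of_bool_eq)
    qed
  qed
next
  case (add f g)
  from V.add[OF add(2,4)] show ?case by (rule V.ext) (simp add: sum.distrib)
next
  case (scale f a)
  from V.scale[OF scale(2), of a] show ?case by (rule V.ext) (simp add: sum_distrib_left)
next
  case zero
  show ?case by (rule V.ext[OF V.zero]) simp
next
  case (ext f g)
  from ext(2) show ?case
  proof (rule V.ext)
    fix i assume "i \<in> idx (u @ v)"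
    then obtain i1 i2 where i: "i = i1 @ i2" "i1 \<in> idx u" "i2 \<in> idx v" "length i1 = length u" by (rule idx_appendE)
    have "i1 @ a # a # i2 \<in> idx (u @ c # bar c # v)" if "a \<in> ix c" for a
      using i that idx_append_iff[of i1 u "a # a # i2" "c # bar c # v"] by (simp add: set_Cons_def)
    then show "(\<Sum>a\<in>ix c. f (take (length u) i @ a # a # drop (length u) i)) = (\<Sum>a\<in>ix c. g (take (length u) i @ a # a # drop (length u) i))"
      using i ext(3) by (intro sum.cong) auto
  qed
qed

end

section \<open>Tensor operations on fixed vectors and the projections onto them\<close>

lemma cnj_of_bool: "cnj (of_bool b) = of_bool b"
  by simp

text \<open>If \<open>K\<close> maps \<open>S'\<close> into \<open>S\<close> and its adjoint maps
  \<open>S\<close> into \<open>S'\<close>, then \<open>P K\<close> and \<open>K Q\<close> both equal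
  \<open>P K Q\<close>.\<close>

lemma kernel_intertwine:
  assumes P: "projection_kernel X S P" and Q: "projection_kernel Y S' Q"
    and K1: "\<And>g. g \<in> S' \<Longrightarrow> (\<lambda>x. \<Sum>y\<in>Y. K x y * g y) \<in> S"
    and K2: "\<And>f. f \<in> S \<Longrightarrow> (\<lambda>y. \<Sum>x\<in>X. cnj (K x y) * f x) \<in> S'"
    and x: "x \<in> X" and y: "y \<in> Y"
  shows "(\<Sum>x'\<in>X. P x x' * K x' y) = (\<Sum>y'\<in>Y. K x y' * Q y' y)"
proof -
  have "(\<Sum>x'\<in>X. P x x' * K x' y) = cnj (\<Sum>x'\<in>X. cnj (K x' y) * P x' x)"
    unfolding cnj_sum using x by (intro sum.cong refl) (simp add: projection_kernel_cnj[OF P] mult.commute)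
  also have "(\<Sum>x'\<in>X. cnj (K x' y) * P x' x) = (\<Sum>y'\<in>Y. Q y y' * (\<Sum>x'\<in>X. cnj (K x' y') * P x' x))"
    using projection_kernel_apply[OF Q K2[OF projection_kernel_in[OF P x]] y] by simp
  also have "cnj \<dots> = (\<Sum>y'\<in>Y. \<Sum>x'\<in>X. P x x' * (K x' y' * Q y' y))"
    unfolding cnj_sum complex_cnj_mult sum_distrib_left
    using x y by (intro sum.cong refl) (simp add: projection_kernel_cnj[OF P] projection_kernel_cnj[OF Q] mult_ac)
  also have "\<dots> = (\<Sum>x'\<in>X. \<Sum>y'\<in>Y. P x x' * (K x' y' * Q y' y))" by (rule sum.swap)
  also have "\<dots> = (\<Sum>x'\<in>X. P x x' * (\<Sum>y'\<in>Y. K x' y' * Q y' y))" by (simp add: sum_distrib_left)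
  also have "\<dots> = (\<Sum>y'\<in>Y. K x y' * Q y' y)"
    by (rule projection_kernel_apply[OF P K1[OF projection_kernel_in[OF Q y]] x])
  finally show ?thesis .
qed

context colour_system
begin

lemma idx_append2E:
  assumes "m \<in> idx (u @ w @ v)"
  obtains i l j where "m = i @ l @ j" "i \<in> idx u" "l \<in> idx w" "j \<in> idx v" "length i = length u" "length l = length w"
proof -
  obtain i k where 1: "m = i @ k" "i \<in> idx u" "k \<in> idx (w @ v)" "length i = length u"
    using assms by (rule idx_appendE)
  from 1(3) obtain l j where "k = l @ j" "l \<in> idx w" "j \<in> idx v" "length l = length w" by (rule idx_appendE)
  with 1 that show thesis by blast
qed

lemma sum_idx_append: "(\<Sum>m\<in>idx (u @ v). f m) = (\<Sum>i\<in>idx u. \<Sum>j\<in>idx v. f (i @ j))"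
  by (simp add: sum_listset_append)

lemma sum_idx_Cons: "(\<Sum>m\<in>idx (c # v). f m) = (\<Sum>a\<in>ix c. \<Sum>j\<in>idx v. f (a # j))"
  by (simp only: list.map sum_listset_Cons)

lemma matches_insert_archE:
  assumes "matches (insert_arch k t) w" "k \<le> 2 * arcs t"
  obtains w1 c w2 where "w = w1 @ c # bar c # w2" "length w1 = k" "matches t (w1 @ w2)"
  using fits_insert_archE[OF assms] by metis

text \<open>For a pairing vector \<open>f\<close> the insertion is built up arch by arch with
  \<open>V_cup\<close>. The outer vector may have arches running over the inserted word.\<close>

lemma V_insert:
  assumes "V w f" "V (u @ v) g"
  shows "V (u @ w @ v) (\<lambda>i. f (take (length w) (drop (length u) i)) * g (take (length u) i @ drop (length u + length w) i))"
  using assms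
proof (induction arbitrary: u v g rule: V.induct)
  case (pairing t w)
  then show ?case
  proof (induction t arbitrary: u v w g rule: pairing_insert_induct)
    case Empty
    from Empty(2) show ?case using Empty(1) by simp
  next
    case (insert k t)
    obtain w1 c w2 where w: "w = w1 @ c # bar c # w2" "length w1 = k" "matches t (w1 @ w2)"
      by (rule matches_insert_archE[OF insert.prems(1) insert.hyps])
    define F where "F i = pairing_tensor t (take (length (w1 @ w2)) (drop (length u) i)) *
        g (take (length u) i @ drop (length u + length (w1 @ w2)) i)" for i
    have "V (u @ (w1 @ w2) @ v) F"
      unfolding F_def by (rule insert.IH[OF w(3) insert.prems(2)])
    then have "V ((u @ w1) @ (w2 @ v)) F" by simp
    from V_cup[OF this, of c] have G: "V (u @ w @ v) (\<lambda>i. if i ! length (u @ w1) = i ! Suc (length (u @ w1))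
        then F (take (length (u @ w1)) i @ drop (length (u @ w1) + 2) i) else 0)"
      unfolding w(1) by simp
    then show ?case
    proof (rule V.ext)
      fix i assume "i \<in> idx (u @ w @ v)"
      then obtain iu l iv where i: "i = iu @ l @ iv" "l \<in> idx w" "length iu = length u" "length l = length w" by (rule idx_append2E)
      from i(2) obtain l1 l2' where l: "l = l1 @ l2'" "length l1 = length w1" "l2' \<in> idx (c # bar c # w2)"
        unfolding w(1) by (rule idx_appendE)
      then obtain a b l2 where l2: "l2' = a # b # l2" "l2 \<in> idx w2" by (auto simp: set_Cons_def)
      have len2: "length l2 = length w2" using l2 by (auto dest: length_idx)
      have "fits (=) (insert_arch k t) (l1 @ a # b # l2) \<longleftrightarrow> a = b \<and> fits (=) t (l1 @ l2)"
        using l w insert.hyps by (intro fits_insert_arch) auto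
      then show "(if i ! length (u @ w1) = i ! Suc (length (u @ w1))
        then F (take (length (u @ w1)) i @ drop (length (u @ w1) + 2) i) else 0) =
        pairing_tensor (insert_arch k t) (take (length w) (drop (length u) i)) * g (take (length u) i @ drop (length u + length w) i)"
        using i l l2 len2 w(1) by (simp add: F_def nth_append)
    qed
  qed
next
  case (add w f f')
  from V.add[OF add.IH(1)[OF add.prems] add.IH(2)[OF add.prems]] show ?case by (rule V.ext) (simp add: distrib_right)
next
  case (scale w f a)
  from V.scale[OF scale.IH[OF scale.prems], of a] show ?case by (rule V.ext) (simp add: mult.assoc)
next
  case (zero w)
  show ?case by (rule V.ext[OF V.zero]) simp
next
  case (ext w f f')
  from ext.IH[OF ext.prems] show ?case
  proof (rule V.ext)
    fix i assume "i \<in> idx (u @ w @ v)"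
    then obtain iu l iv where "i = iu @ l @ iv" "l \<in> idx w" "length iu = length u" "length l = length w" by (rule idx_append2E)
    then show "f (take (length w) (drop (length u) i)) * g (take (length u) i @ drop (length u + length w) i) =
      f' (take (length w) (drop (length u) i)) * g (take (length u) i @ drop (length u + length w) i)"
      using ext.hyps by simp
  qed
qed

text \<open>The adjoint of the operation in \<open>V_insert\<close>; the arches of a pairing vector
  are contracted one at a time with \<open>V_cap\<close>.\<close>

lemma V_contract:
  assumes "V w f" "V (u @ w @ v) F"
  shows "V (u @ v) (\<lambda>i. \<Sum>l\<in>idx w. cnj (f l) * F (take (length u) i @ l @ drop (length u) i))"
  using assms
proof (induction arbitrary: u v F rule: V.induct)
  case (pairing t w)
  then show ?case
  proof (induction t arbitrary: u v w F rule: pairing_insert_induct)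
    case Empty
    from Empty(2) show ?case using Empty(1) by simp
  next
    case (insert k t)
    obtain w1 c w2 where w: "w = w1 @ c # bar c # w2" "length w1 = k" "matches t (w1 @ w2)"
      by (rule matches_insert_archE[OF insert.prems(1) insert.hyps])
    have "V ((u @ w1) @ c # bar c # (w2 @ v)) F" using insert.prems(2) w(1) by simp
    define F' where "F' i = (\<Sum>a\<in>ix c. F (take (length (u @ w1)) i @ a # a # drop (length (u @ w1)) i))" for i
    have "V ((u @ w1) @ (w2 @ v)) F'" unfolding F'_def by (rule V_cap) fact
    then have "V (u @ (w1 @ w2) @ v) F'" by simp
    from insert.IH[OF w(3) this] show ?case
    proof (rule V.ext)
      fix i assume "i \<in> idx (u @ v)"
      then obtain iu iv where i: "i = iu @ iv" "length iu = length u" by (rule idx_appendE)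
      have fits: "pairing_tensor (insert_arch k t) (l1 @ a # b # l2) = (if b = a then pairing_tensor t (l1 @ l2) else 0)"
        if "l1 \<in> idx w1" for l1 a b l2
        using that w insert.hyps fits_insert_arch[of l1 k t "(=)" a b l2] by (auto dest: length_idx)
      have "(\<Sum>l\<in>idx w. cnj (pairing_tensor (insert_arch k t) l) * F (take (length u) i @ l @ drop (length u) i)) =
        (\<Sum>l1\<in>idx w1. \<Sum>a\<in>ix c. \<Sum>b\<in>ix c. \<Sum>l2\<in>idx w2.
          pairing_tensor (insert_arch k t) (l1 @ a # b # l2) * F (iu @ l1 @ a # b # l2 @ iv))"
        unfolding w(1) sum_idx_append sum_idx_Cons using i
        by (simp add: cnj_of_bool del: sum_of_bool_mult_eq sum_mult_of_bool_eq)
      also have "\<dots> = (\<Sum>l1\<in>idx w1. \<Sum>a\<in>ix c. \<Sum>b\<in>ix c. if b = a then \<Sum>l2\<in>idx w2.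
          pairing_tensor t (l1 @ l2) * F (iu @ l1 @ a # a # l2 @ iv) else 0)"
        by (intro sum.cong refl) (simp add: fits del: sum_of_bool_mult_eq sum_mult_of_bool_eq)
      also have "\<dots> = (\<Sum>l1\<in>idx w1. \<Sum>a\<in>ix c. \<Sum>l2\<in>idx w2. pairing_tensor t (l1 @ l2) * F (iu @ l1 @ a # a # l2 @ iv))"
        by (intro sum.cong refl) (simp del: sum_of_bool_mult_eq sum_mult_of_bool_eq)
      also have "\<dots> = (\<Sum>l1\<in>idx w1. \<Sum>l2\<in>idx w2. \<Sum>a\<in>ix c. pairing_tensor t (l1 @ l2) * F (iu @ l1 @ a # a # l2 @ iv))"
        by (rule sum.cong[OF refl], rule sum.swap)
      also have "\<dots> = (\<Sum>l\<in>idx (w1 @ w2). cnj (pairing_tensor t l) * F' (take (length u) i @ l @ drop (length u) i))"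
        unfolding sum_idx_append F'_def using i
        by (intro sum.cong refl) (simp add: cnj_of_bool length_idx sum_distrib_left del: sum_of_bool_mult_eq sum_mult_of_bool_eq)
      finally show "(\<Sum>l\<in>idx (w1 @ w2). cnj (pairing_tensor t l) * F' (take (length u) i @ l @ drop (length u) i)) =
        (\<Sum>l\<in>idx w. cnj (pairing_tensor (insert_arch k t) l) * F (take (length u) i @ l @ drop (length u) i))" ..
    qed
  qed
next
  case (add w f f')
  from V.add[OF add.IH(1)[OF add.prems] add.IH(2)[OF add.prems]] show ?case
    by (rule V.ext) (simp add: distrib_right sum.distrib)
next
  case (scale w f a)
  from V.scale[OF scale.IH[OF scale.prems], of "cnj a"] show ?case by (rule V.ext) (simp add: mult.assoc sum_distrib_left)
next
  case (zero w)
  show ?case by (rule V.ext[OF V.zero]) simp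
next
  case (ext w f f')
  from ext.IH[OF ext.prems] show ?case
    by (rule V.ext) (use ext.hyps in \<open>auto intro!: sum.cong\<close>)
qed

lemma V_concat: "V w f \<Longrightarrow> V v g \<Longrightarrow> V (w @ v) (\<lambda>i. f (take (length w) i) * g (drop (length w) i))"
  using V_insert[of w f "[]" v g] by simp

lemma V_trace:
  "V (u @ w @ dual w @ v) F \<Longrightarrow> V (u @ v) (\<lambda>i. \<Sum>k\<in>idx w. F (take (length u) i @ k @ rev k @ drop (length u) i))"
proof (induction w arbitrary: v F rule: rev_induct)
  case Nil
  then show ?case by simp
next
  case (snoc c w)
  then have "V ((u @ w) @ c # bar c # (dual w @ v)) F" by simp
  from V_cap[OF this] have "V (u @ w @ dual w @ v)
    (\<lambda>i. \<Sum>a\<in>ix c. F (take (length (u @ w)) i @ a # a # drop (length (u @ w)) i))" by simp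
  from snoc.IH[OF this] show ?case
  proof (rule V.ext)
    fix i assume "i \<in> idx (u @ v)"
    then obtain iu iv where i: "i = iu @ iv" "length iu = length u" by (rule idx_appendE)
    show "(\<Sum>k\<in>idx w. \<Sum>a\<in>ix c. F (take (length (u @ w)) (take (length u) i @ k @ rev k @ drop (length u) i) @ a # a #
          drop (length (u @ w)) (take (length u) i @ k @ rev k @ drop (length u) i))) =
      (\<Sum>k\<in>idx (w @ [c]). F (take (length u) i @ k @ rev k @ drop (length u) i))"
      unfolding sum_idx_append sum_idx_Cons using i by (intro sum.cong refl) (simp add: length_idx)
  qed
qed

text \<open>When vectors of \<open>V (dual w @ v)\<close> are read as matrices, this is the matrix
  product: concatenation followed by the trace over \<open>w\<close>.\<close>

lemma V_compose:
  assumes "V (u @ w) f" "V (dual w @ v) g"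
  shows "V (u @ v) (\<lambda>i. \<Sum>k\<in>idx w. f (take (length u) i @ k) * g (rev k @ drop (length u) i))"
proof -
  have "V (u @ w @ dual w @ v) (\<lambda>i. f (take (length (u @ w)) i) * g (drop (length (u @ w)) i))"
    using V_concat[OF assms] by simp
  from V_trace[OF this] show ?thesis
  proof (rule V.ext)
    fix i assume "i \<in> idx (u @ v)"
    then obtain iu iv where i: "i = iu @ iv" "length iu = length u" by (rule idx_appendE)
    then show "(\<Sum>k\<in>idx w. f (take (length (u @ w)) (take (length u) i @ k @ rev k @ drop (length u) i)) *
         g (drop (length (u @ w)) (take (length u) i @ k @ rev k @ drop (length u) i))) =
      (\<Sum>k\<in>idx w. f (take (length u) i @ k) * g (rev k @ drop (length u) i))"
      by (intro sum.cong refl) (simp add: length_idx)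
  qed
qed

text \<open>The choice is harmless because projection kernels are unique on the index lists; the
  value 0 elsewhere lets arbitrary words have moments.\<close>

definition E :: "'c list \<Rightarrow> nat list \<Rightarrow> nat list \<Rightarrow> complex" where
  "E w i j = (if i \<in> idx w \<and> j \<in> idx w then (SOME P. projection_kernel (idx w) {f. V w f} P) i j else 0)"

lemma E_kernel: "projection_kernel (idx w) {f. V w f} (E w)"
proof -
  define P where "P = (SOME P. projection_kernel (idx w) {f. V w f} P)"
  have P: "projection_kernel (idx w) {f. V w f} P"
    unfolding P_def by (rule someI_ex[of "projection_kernel (idx w) {f. V w f}"]) (rule projection_kernel_exists[OF finite_idx V_space])
  have E: "E w i j = P i j" if "i \<in> idx w" "j \<in> idx w" for i j using that by (simp add: E_def P_def)
  show ?thesis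
    unfolding projection_kernel_def
  proof (intro conjI ballI)
    fix x y assume xy: "x \<in> idx w" "y \<in> idx w"
    show "E w x y = cnj (E w y x)" using xy by (simp add: E projection_kernel_cnj[OF P])
  next
    fix y assume y: "y \<in> idx w"
    then have "V w (\<lambda>x. P x y)" using projection_kernel_in[OF P y] by simp
    then show "(\<lambda>x. E w x y) \<in> {f. V w f}" using y by (auto intro: V.ext simp: E)
  next
    fix f x assume f: "f \<in> {f. V w f}" and x: "x \<in> idx w"
    have "(\<Sum>y\<in>idx w. E w x y * f y) = (\<Sum>y\<in>idx w. P x y * f y)"
      using x by (intro sum.cong refl) (simp add: E)
    then show "(\<Sum>y\<in>idx w. E w x y * f y) = f x" using projection_kernel_apply[OF P f x] by simp
  qed
qed

lemma E_outside: "i \<notin> idx w \<or> j \<notin> idx w \<Longrightarrow> E w i j = 0"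
  by (auto simp: E_def)

lemma E_cnj: "cnj (E w j i) = E w i j"
  using projection_kernel_cnj[OF E_kernel, of i w j] E_outside[of i w j] E_outside[of j w i] by fastforce

lemma E_column: "j \<in> idx w \<Longrightarrow> V w (\<lambda>i. E w i j)"
  using projection_kernel_in[OF E_kernel] by blast

lemma E_apply: "V w f \<Longrightarrow> i \<in> idx w \<Longrightarrow> (\<Sum>j\<in>idx w. E w i j * f j) = f i"
  using projection_kernel_apply[OF E_kernel] by blast

lemma E_unique:
  assumes "projection_kernel (idx w) {f. V w f} P" "i \<in> idx w" "j \<in> idx w"
  shows "E w i j = P i j"
  by (rule projection_kernel_unique[OF E_kernel assms])

lemma E_empty: "E [] [] [] = 1"
proof -
  have "V [] (pairing_tensor Empty)" by (rule V.pairing) simp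
  from E_apply[OF this, of "[]"] show ?thesis by simp
qed

text \<open>An instance of \<open>kernel_intertwine\<close>: \<open>K\<close> inserts
  \<open>f\<close> between \<open>u\<close> and \<open>v\<close>, and \<open>V_insert\<close> and
  \<open>V_contract\<close> say that \<open>K\<close> and its adjoint respect fixed vectors.\<close>

lemma E_insert:
  assumes f: "V w f" and i: "i1 \<in> idx u" "i \<in> idx w" "i2 \<in> idx v" and j: "j1 \<in> idx u" "j2 \<in> idx v"
  shows "(\<Sum>l\<in>idx w. E (u @ w @ v) (i1 @ i @ i2) (j1 @ l @ j2) * f l) = f i * E (u @ v) (i1 @ i2) (j1 @ j2)"
proof -
  define mid where "mid x = take (length w) (drop (length u) x)" for x :: "nat list"
  define out where "out x = take (length u) x @ drop (length u + length w) x" for x :: "nat list"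
  define K where "K x y = (if y = out x then f (mid x) else 0)" for x y
  have len: "length i1 = length u" "length i = length w" "length j1 = length u"
    using i j by (auto dest: length_idx)
  have mid_out: "mid (a @ l @ b) = l" "out (a @ l @ b) = a @ b" if "a \<in> idx u" "l \<in> idx w" for a l b
    using that by (auto simp: mid_def out_def length_idx)
  have out: "out x \<in> idx (u @ v)" if "x \<in> idx (u @ w @ v)" for x
    using that by (auto elim!: idx_append2E simp: mid_out idx_append_iff simp del: map_append)
  have Ksum: "(\<Sum>y\<in>idx (u @ v). K x y * g y) = f (mid x) * g (out x)" if "x \<in> idx (u @ w @ v)" for x g
    using out[OF that] by (simp add: K_def if_distrib[of "\<lambda>t. t * _"] del: map_append cong: if_cong)
  have Ksum': "(\<Sum>x\<in>idx (u @ w @ v). g x (K x (y1 @ y2))) = (\<Sum>l\<in>idx w. g (y1 @ l @ y2) (f l))"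
    if y: "y1 \<in> idx u" "y2 \<in> idx v" and g: "\<And>x. g x 0 = (0 :: complex)" for g y1 y2
  proof -
    have "(\<Sum>x\<in>idx (u @ w @ v). g x (K x (y1 @ y2))) =
      (\<Sum>a\<in>idx u. \<Sum>l\<in>idx w. \<Sum>b\<in>idx v. if a = y1 \<and> b = y2 then g (a @ l @ b) (f l) else 0)"
      unfolding sum_idx_append
      by (intro sum.cong refl) (use y in \<open>auto simp: K_def mid_out g length_idx\<close>)
    also have "\<dots> = (\<Sum>a\<in>idx u. \<Sum>l\<in>idx w. if a = y1 then g (a @ l @ y2) (f l) else 0)"
    proof (intro sum.cong refl)
      fix a l
      have "(\<Sum>b\<in>idx v. if a = y1 \<and> b = y2 then g (a @ l @ b) (f l) else 0) =
        (\<Sum>b\<in>idx v. if b = y2 then (if a = y1 then g (a @ l @ b) (f l) else 0) else 0)"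
        by (intro sum.cong refl) auto
      then show "(\<Sum>b\<in>idx v. if a = y1 \<and> b = y2 then g (a @ l @ b) (f l) else 0) = (if a = y1 then g (a @ l @ y2) (f l) else 0)"
        using y by simp
    qed
    also have "\<dots> = (\<Sum>l\<in>idx w. \<Sum>a\<in>idx u. if a = y1 then g (a @ l @ y2) (f l) else 0)" by (rule sum.swap)
    also have "\<dots> = (\<Sum>l\<in>idx w. g (y1 @ l @ y2) (f l))" using y by simp
    finally show ?thesis .
  qed
  have "(\<Sum>x'\<in>idx (u @ w @ v). E (u @ w @ v) (i1 @ i @ i2) x' * K x' (j1 @ j2)) =
      (\<Sum>y'\<in>idx (u @ v). K (i1 @ i @ i2) y' * E (u @ v) y' (j1 @ j2))"
  proof (rule kernel_intertwine[OF E_kernel E_kernel])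
    fix g assume "g \<in> {g. V (u @ v) g}"
    then have "V (u @ w @ v) (\<lambda>x. f (mid x) * g (out x))" using V_insert[OF f] by (simp add: mid_def out_def)
    then show "(\<lambda>x. \<Sum>y\<in>idx (u @ v). K x y * g y) \<in> {f. V (u @ w @ v) f}"
      by (auto intro: V.ext simp: Ksum simp del: map_append)
  next
    fix F assume "F \<in> {f. V (u @ w @ v) f}"
    then have "V (u @ v) (\<lambda>i. \<Sum>l\<in>idx w. cnj (f l) * F (take (length u) i @ l @ drop (length u) i))"
      using V_contract[OF f] by simp
    then have "V (u @ v) (\<lambda>y. \<Sum>x\<in>idx (u @ w @ v). cnj (K x y) * F x)"
    proof (rule V.ext)
      fix y assume "y \<in> idx (u @ v)"
      then obtain y1 y2 where y: "y = y1 @ y2" "y1 \<in> idx u" "y2 \<in> idx v" "length y1 = length u" by (rule idx_appendE)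
      then show "(\<Sum>l\<in>idx w. cnj (f l) * F (take (length u) y @ l @ drop (length u) y)) = (\<Sum>x\<in>idx (u @ w @ v). cnj (K x y) * F x)"
        using Ksum'[of y1 y2 "\<lambda>x k. cnj k * F x"] by (simp del: map_append)
    qed
    then show "(\<lambda>y. \<Sum>x\<in>idx (u @ w @ v). cnj (K x y) * F x) \<in> {g. V (u @ v) g}" by simp
  qed (use i j len in \<open>simp_all add: idx_append_iff del: map_append\<close>)
  then show ?thesis
    using Ksum[of "i1 @ i @ i2" "\<lambda>y. E (u @ v) y (j1 @ j2)"] i j len
      Ksum'[of j1 j2 "\<lambda>x k. E (u @ w @ v) (i1 @ i @ i2) x * k"]
    by (simp add: idx_append_iff mid_out del: map_append)
qed

text \<open>The case of a single arch. These are the unitarity relations of a matrix and of its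
  transpose, as seen by the functional with matrices \<open>E w\<close>.\<close>

lemma E_insert_pair:
  assumes i: "i1 \<in> idx u" "i2 \<in> idx v" "a \<in> ix c" "b \<in> ix c" and j: "j1 \<in> idx u" "j2 \<in> idx v"
  shows "(\<Sum>k\<in>ix c. E (u @ c # bar c # v) (i1 @ a # b # i2) (j1 @ k # k # j2)) = (if a = b then E (u @ v) (i1 @ i2) (j1 @ j2) else 0)"
    and "(\<Sum>k\<in>ix c. E (u @ c # bar c # v) (j1 @ k # k # j2) (i1 @ a # b # i2)) = (if a = b then E (u @ v) (j1 @ j2) (i1 @ i2) else 0)"
proof -
  have "fits R (Arch Empty Empty) [x, y] \<longleftrightarrow> R x y" for R and x y :: 'x by auto
  then have T: "pairing_tensor (Arch Empty Empty) [x, y] = (if x = y then 1 else 0)" for x y :: nat by simp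
  have "V [c, bar c] (pairing_tensor (Arch Empty Empty))" by (rule V.pairing) auto
  from E_insert[OF this i(1) _ i(2) j, of "[a, b]"] i
  have *: "(\<Sum>l\<in>idx [c, bar c]. E (u @ [c, bar c] @ v) (i1 @ [a, b] @ i2) (j1 @ l @ j2) * pairing_tensor (Arch Empty Empty) l) =
      pairing_tensor (Arch Empty Empty) [a, b] * E (u @ v) (i1 @ i2) (j1 @ j2)"
    by (simp add: set_Cons_def del: fits.simps)
  have pair: "(\<Sum>l\<in>idx [c, bar c]. g l) = (\<Sum>k\<in>ix c. \<Sum>k'\<in>ix c. g [k, k'])" for g :: "nat list \<Rightarrow> complex"
    by (simp only: list.map sum_listset_Cons ix_bar) simp
  have "(\<Sum>k\<in>ix c. \<Sum>k'\<in>ix c. E (u @ c # bar c # v) (i1 @ a # b # i2) (j1 @ k # k' # j2) * (if k = k' then 1 else 0)) =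
      (if a = b then 1 else 0) * E (u @ v) (i1 @ i2) (j1 @ j2)"
    using * unfolding pair T by simp
  then show *: "(\<Sum>k\<in>ix c. E (u @ c # bar c # v) (i1 @ a # b # i2) (j1 @ k # k # j2)) = (if a = b then E (u @ v) (i1 @ i2) (j1 @ j2) else 0)"
    by (simp add: if_distrib cong: if_cong)
  from arg_cong[OF *, of cnj]
  show "(\<Sum>k\<in>ix c. E (u @ c # bar c # v) (j1 @ k # k # j2) (i1 @ a # b # i2)) = (if a = b then E (u @ v) (j1 @ j2) (i1 @ i2) else 0)"
    by (simp add: E_cnj split: if_splits)
qed

end

section \<open>Positivity of the family of projections\<close>

context colour_system
begin

text \<open>The spaces \<open>V (dual w @ w')\<close> are the blocks of a *-algebra of matrices indexed by pairs of a word
  and an index list, so that \<open>star_algebra_kernel_positive\<close> applies.\<close>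

lemma E_positive_words:
  fixes f :: "('c list \<times> nat list) \<times> ('c list \<times> nat list) \<Rightarrow> complex"
  assumes W: "finite W"
  defines "X \<equiv> SIGMA w:W. idx w"
  shows "(\<Sum>a\<in>X. \<Sum>c\<in>X. \<Sum>b\<in>X. \<Sum>d\<in>X. cnj (f (a, c)) * f (b, d) *
      (if fst a = fst c \<and> fst b = fst d
       then E (dual (fst a) @ fst b) (rev (snd a) @ snd b) (rev (snd c) @ snd d) else 0)) \<in> \<real>\<^sub>\<ge>\<^sub>0"
proof -
  define P :: "(('c list \<times> nat list) \<times> ('c list \<times> nat list)) \<Rightarrow> (('c list \<times> nat list) \<times> ('c list \<times> nat list)) \<Rightarrow> complex"
    where "P = (\<lambda>(a, b) (c, d). if fst a = fst c \<and> fst b = fst d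
       then E (dual (fst a) @ fst b) (rev (snd a) @ snd b) (rev (snd c) @ snd d) else 0)"
  \<comment> \<open>The row index is reversed because \<open>dual\<close> reverses the letters of a
    word.\<close>
  define blk where "blk t w w' m = t ((w, rev (take (length w) m)), (w', drop (length w) m))"
    for t :: "(('c list \<times> nat list) \<times> ('c list \<times> nat list)) \<Rightarrow> complex" and w w' m
  define D where "D = {t. \<forall>w\<in>W. \<forall>w'\<in>W. V (dual w @ w') (blk t w w')}"
  have fin: "finite X" unfolding X_def using W by (intro finite_SigmaI) auto
  have sumX: "(\<Sum>b\<in>X. g b) = (\<Sum>w\<in>W. \<Sum>k\<in>idx w. g (w, k))" for g :: "_ \<Rightarrow> complex"
    unfolding X_def using W by (subst sum.Sigma) (auto simp: split_def)
  have m_split: "\<exists>i k. m = rev i @ k \<and> i \<in> idx w \<and> k \<in> idx w' \<and> length i = length w" if "m \<in> idx (dual w @ w')" for m w w'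
  proof -
    from that obtain r k where "m = r @ k" "r \<in> idx (dual w)" "k \<in> idx w'" "length r = length (dual w)" by (rule idx_appendE)
    then show ?thesis using rev_idx[of "rev r" w] by (intro exI[of _ "rev r"] exI[of _ k]) auto
  qed
  have blk_eq: "blk t w w' (rev i @ k) = t ((w, i), (w', k))" if "length i = length w" for t w w' i k
    using that by (simp add: blk_def)
  have m_in: "rev i @ k \<in> idx (dual w @ w')" if "i \<in> idx w" "k \<in> idx w'" for i k w w'
    using that rev_idx[of i w] idx_append_iff[of "rev i" "dual w" k w'] by (simp add: length_idx del: map_append rev_rev_ident)
  have D_space: "function_space (X \<times> X) D"
    unfolding function_space_def
  proof (intro conjI ballI allI impI)
    show "(\<lambda>_. 0) \<in> D" using V.zero by (simp add: D_def blk_def[abs_def])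
    fix s assume s: "s \<in> D"
    show "(\<lambda>x. s x + t x) \<in> D" if "t \<in> D" for t
      using s that V.add unfolding D_def blk_def by blast
    show "(\<lambda>x. c * s x) \<in> D" for c
      using s V.scale unfolding D_def blk_def by blast
    show "t \<in> D" if eq: "\<forall>x\<in>X \<times> X. s x = t x" for t
      unfolding D_def
    proof (intro CollectI ballI)
      fix w w' assume w: "w \<in> W" "w' \<in> W"
      have "V (dual w @ w') (blk s w w')" using s w by (auto simp: D_def)
      then show "V (dual w @ w') (blk t w w')"
      proof (rule V.ext)
        fix m assume "m \<in> idx (dual w @ w')"
        then obtain i k where "m = rev i @ k" "i \<in> idx w" "k \<in> idx w'" "length i = length w" using m_split by blast
        then show "blk s w w' m = blk t w w' m" using eq w by (simp add: blk_eq X_def)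
      qed
    qed
  qed
  have D_mult: "(\<lambda>(a, c). \<Sum>b\<in>X. s (a, b) * t (b, c)) \<in> D" if s: "s \<in> D" and t: "t \<in> D" for s t
    unfolding D_def
  proof (intro CollectI ballI)
    fix w w'' assume w: "w \<in> W" "w'' \<in> W"
    have "V (dual w @ w'') (\<lambda>m. \<Sum>w'\<in>W. \<Sum>k\<in>idx w'. blk s w w' (take (length (dual w)) m @ k) * blk t w' w'' (rev k @ drop (length (dual w)) m))"
      using s t w by (intro V_sum V_compose) (auto simp: D_def)
    then show "V (dual w @ w'') (blk (\<lambda>(a, c). \<Sum>b\<in>X. s (a, b) * t (b, c)) w w'')"
    proof (rule V.ext)
      fix m assume "m \<in> idx (dual w @ w'')"
      then obtain i l where m: "m = rev i @ l" "i \<in> idx w" "l \<in> idx w''" "length i = length w" using m_split by blast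
      have "blk (\<lambda>(a, c). \<Sum>b\<in>X. s (a, b) * t (b, c)) w w'' m = (\<Sum>w'\<in>W. \<Sum>k\<in>idx w'. s ((w, i), (w', k)) * t ((w', k), (w'', l)))"
        using m by (simp add: blk_eq sumX)
      also have "\<dots> = (\<Sum>w'\<in>W. \<Sum>k\<in>idx w'. blk s w w' (take (length (dual w)) m @ k) * blk t w' w'' (rev k @ drop (length (dual w)) m))"
        using m by (intro sum.cong refl) (simp add: blk_eq length_idx)
      finally show "(\<Sum>w'\<in>W. \<Sum>k\<in>idx w'. blk s w w' (take (length (dual w)) m @ k) * blk t w' w'' (rev k @ drop (length (dual w)) m)) =
        blk (\<lambda>(a, c). \<Sum>b\<in>X. s (a, b) * t (b, c)) w w'' m" ..
    qed
  qed
  have D_adj: "(\<lambda>(a, b). cnj (t (b, a))) \<in> D" if t: "t \<in> D" for t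
    unfolding D_def
  proof (intro CollectI ballI)
    fix w w' assume w: "w \<in> W" "w' \<in> W"
    have "V (dual (dual w' @ w)) (\<lambda>m. cnj (blk t w' w (rev m)))"
      using t w by (intro V_star) (auto simp: D_def)
    then have "V (dual w @ w') (\<lambda>m. cnj (blk t w' w (rev m)))"
      by (simp add: rev_map comp_def)
    then show "V (dual w @ w') (blk (\<lambda>(a, b). cnj (t (b, a))) w w')"
    proof (rule V.ext)
      fix m assume "m \<in> idx (dual w @ w')"
      then obtain i l where m: "m = rev i @ l" "i \<in> idx w" "l \<in> idx w'" "length i = length w" using m_split by blast
      then show "cnj (blk t w' w (rev m)) = blk (\<lambda>(a, b). cnj (t (b, a))) w w' m"
        by (simp add: blk_eq length_idx)
    qed
  qed
  have "projection_kernel (X \<times> X) D P"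
    unfolding projection_kernel_def
  proof (intro conjI ballI)
    fix x y assume "x \<in> X \<times> X" "y \<in> X \<times> X"
    show "P x y = cnj (P y x)"
      by (cases x; cases y) (auto simp: P_def E_cnj)
  next
    fix y assume y: "y \<in> X \<times> X"
    show "(\<lambda>x. P x y) \<in> D"
      unfolding D_def
    proof (intro CollectI ballI)
      fix w w' assume w: "w \<in> W" "w' \<in> W"
      obtain v j v' l where y_eq: "y = ((v, j), (v', l))" by (metis prod.exhaust)
      show "V (dual w @ w') (blk (\<lambda>x. P x y) w w')"
      proof (cases "w = v \<and> w' = v'")
        case True
        then have "V (dual w @ w') (\<lambda>m. E (dual w @ w') m (rev j @ l))"
          using y y_eq by (intro E_column m_in) (auto simp: X_def)
        then show ?thesis
        proof (rule V.ext)
          fix m assume "m \<in> idx (dual w @ w')"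
          then obtain i k where "m = rev i @ k" "i \<in> idx w" "k \<in> idx w'" "length i = length w" using m_split by blast
          then show "E (dual w @ w') m (rev j @ l) = blk (\<lambda>x. P x y) w w' m"
            using True y_eq by (simp add: blk_eq P_def)
        qed
      next
        case False
        then have "blk (\<lambda>x. P x y) w w' = (\<lambda>_. 0)" using y_eq by (auto simp: blk_def P_def)
        then show ?thesis using V.zero by simp
      qed
    qed
  next
    fix t x assume t: "t \<in> D" and x: "x \<in> X \<times> X"
    obtain w i w' k where x_eq: "x = ((w, i), (w', k))" by (metis prod.exhaust)
    have w: "w \<in> W" "w' \<in> W" "i \<in> idx w" "k \<in> idx w'" using x x_eq by (auto simp: X_def)
    have "(\<Sum>y\<in>X \<times> X. P x y * t y) = (\<Sum>v\<in>W. \<Sum>j\<in>idx v. \<Sum>v'\<in>W. \<Sum>l\<in>idx v'. P x ((v, j), (v', l)) * t ((v, j), (v', l)))"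
      by (simp only: sum.cartesian_product' sumX)
    also have "\<dots> = (\<Sum>v\<in>W. if v = w then \<Sum>j\<in>idx w. \<Sum>v'\<in>W. if v' = w' then \<Sum>l\<in>idx w'.
        E (dual w @ w') (rev i @ k) (rev j @ l) * t ((w, j), (w', l)) else 0 else 0)"
      by (intro sum.cong refl) (auto simp: x_eq P_def intro!: sum.cong sum.neutral)
    also have "\<dots> = (\<Sum>j\<in>idx w. \<Sum>l\<in>idx w'. E (dual w @ w') (rev i @ k) (rev j @ l) * t ((w, j), (w', l)))"
      using W w by simp
    also have "\<dots> = (\<Sum>m\<in>idx (dual w @ w'). E (dual w @ w') (rev i @ k) m * blk t w w' m)"
    proof -
      have "(\<Sum>m\<in>idx (dual w @ w'). E (dual w @ w') (rev i @ k) m * blk t w w' m) =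
        (\<Sum>j\<in>idx w. \<Sum>l\<in>idx w'. E (dual w @ w') (rev i @ k) (rev j @ l) * blk t w w' (rev j @ l))"
        unfolding sum_idx_append map_ix_dual sum_listset_rev ..
      also have "\<dots> = (\<Sum>j\<in>idx w. \<Sum>l\<in>idx w'. E (dual w @ w') (rev i @ k) (rev j @ l) * t ((w, j), (w', l)))"
        by (intro sum.cong refl) (simp add: blk_eq length_idx)
      finally show ?thesis ..
    qed
    also have "\<dots> = blk t w w' (rev i @ k)"
      using t w by (intro E_apply m_in) (auto simp: D_def)
    also have "\<dots> = t x" using w by (simp add: blk_eq length_idx x_eq)
    finally show "(\<Sum>y\<in>X \<times> X. P x y * t y) = t x" .
  qed
  from star_algebra_kernel_positive[OF fin D_space D_mult D_adj this, of f]
  show ?thesis unfolding P_def split_conv .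
qed

text \<open>The coefficients are collected into one function of a row label and a column label, to
  which \<open>E_positive_words\<close> applies. Members with index lists out of range, removed in
  \<open>K'\<close>, contribute 0.\<close>

lemma E_positive:
  assumes K: "finite K" and len: "\<And>m. m \<in> K \<Longrightarrow> length (i m) = length (w m) \<and> length (j m) = length (w m)"
  shows "(\<Sum>m\<in>K. \<Sum>m'\<in>K. cnj (x m) * x m' * E (dual (w m) @ w m') (rev (i m) @ i m') (rev (j m) @ j m')) \<in> \<real>\<^sub>\<ge>\<^sub>0"
proof -
  define K' where "K' = {m\<in>K. i m \<in> idx (w m) \<and> j m \<in> idx (w m)}"
  define X where "X = (SIGMA u:w ` K'. idx u)"
  have K': "finite K'" using K by (simp add: K'_def)
  have fin: "finite X" unfolding X_def using K' by (intro finite_SigmaI) auto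
  have in_X: "(w m, i m) \<in> X" "(w m, j m) \<in> X" if "m \<in> K'" for m
    using that by (auto simp: X_def K'_def)
  define P where "P a b c d = (if fst a = fst c \<and> fst b = fst d
       then E (dual (fst a) @ fst b) (rev (snd a) @ snd b) (rev (snd c) @ snd d) else 0)"
    for a b c d :: "'c list \<times> nat list"
  define f where "f = (\<lambda>(a, c). \<Sum>m\<in>K'. if a = (w m, i m) then if c = (w m, j m) then x m else 0 else 0)"
  have "(\<Sum>a\<in>X. \<Sum>c\<in>X. \<Sum>b\<in>X. \<Sum>d\<in>X. cnj (f (a, c)) * f (b, d) * P a b c d) \<in> \<real>\<^sub>\<ge>\<^sub>0"
    unfolding X_def P_def by (rule E_positive_words) (use K' in simp)
  also have "(\<Sum>a\<in>X. \<Sum>c\<in>X. \<Sum>b\<in>X. \<Sum>d\<in>X. cnj (f (a, c)) * f (b, d) * P a b c d) =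
      (\<Sum>m\<in>K'. \<Sum>m'\<in>K'. cnj (x m) * x m' * P (w m, i m) (w m', i m') (w m, j m) (w m', j m'))"
  proof -
    have pick: "(\<Sum>b\<in>X. \<Sum>d\<in>X. f (b, d) * g b d) = (\<Sum>m\<in>K'. x m * g (w m, i m) (w m, j m))" for g
    proof -
      have "(\<Sum>b\<in>X. \<Sum>d\<in>X. f (b, d) * g b d) =
          (\<Sum>b\<in>X. \<Sum>d\<in>X. \<Sum>m\<in>K'. if b = (w m, i m) then if d = (w m, j m) then x m * g b d else 0 else 0)"
        unfolding f_def split_conv sum_distrib_right by (intro sum.cong refl) auto
      also have "\<dots> = (\<Sum>m\<in>K'. \<Sum>b\<in>X. \<Sum>d\<in>X. if b = (w m, i m) then if d = (w m, j m) then x m * g b d else 0 else 0)"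
        by (rule sum_nested_swap)
      also have "\<dots> = (\<Sum>m\<in>K'. x m * g (w m, i m) (w m, j m))"
      proof (rule sum.cong[OF refl])
        fix m assume m: "m \<in> K'"
        have "(\<Sum>b\<in>X. \<Sum>d\<in>X. if b = (w m, i m) then if d = (w m, j m) then x m * g b d else 0 else 0) =
          (\<Sum>b\<in>X. if b = (w m, i m) then (\<Sum>d\<in>X. if d = (w m, j m) then x m * g b d else 0) else 0)"
          by (intro sum.cong refl) simp
        then show "(\<Sum>b\<in>X. \<Sum>d\<in>X. if b = (w m, i m) then if d = (w m, j m) then x m * g b d else 0 else 0) = x m * g (w m, i m) (w m, j m)"
          using fin in_X[OF m] by simp
      qed
      finally show ?thesis .
    qed
    have pick_cnj: "(\<Sum>a\<in>X. \<Sum>c\<in>X. cnj (f (a, c)) * g a c) = (\<Sum>m\<in>K'. cnj (x m) * g (w m, i m) (w m, j m))" for g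
    proof -
      have "(\<Sum>a\<in>X. \<Sum>c\<in>X. cnj (f (a, c)) * g a c) = cnj (\<Sum>a\<in>X. \<Sum>c\<in>X. f (a, c) * cnj (g a c))" by simp
      then show ?thesis unfolding pick by simp
    qed
    have "(\<Sum>a\<in>X. \<Sum>c\<in>X. \<Sum>b\<in>X. \<Sum>d\<in>X. cnj (f (a, c)) * f (b, d) * P a b c d) =
      (\<Sum>a\<in>X. \<Sum>c\<in>X. cnj (f (a, c)) * (\<Sum>b\<in>X. \<Sum>d\<in>X. f (b, d) * P a b c d))"
      by (simp only: sum_distrib_left mult.assoc)
    also have "\<dots> = (\<Sum>m\<in>K'. cnj (x m) * (\<Sum>m'\<in>K'. x m' * P (w m, i m) (w m', i m') (w m, j m) (w m', j m')))"
      unfolding pick by (rule pick_cnj)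
    finally show ?thesis by (simp only: sum_distrib_left mult.assoc)
  qed
  also have "\<dots> = (\<Sum>m\<in>K'. \<Sum>m'\<in>K'. cnj (x m) * x m' * E (dual (w m) @ w m') (rev (i m) @ i m') (rev (j m) @ j m'))"
    by (simp add: P_def)
  also have "\<dots> = (\<Sum>m\<in>K. \<Sum>m'\<in>K. cnj (x m) * x m' * E (dual (w m) @ w m') (rev (i m) @ i m') (rev (j m) @ j m'))"
  proof -
    have zero: "E (dual (w m) @ w m') (rev (i m) @ i m') (rev (j m) @ j m') = 0"
      if "m \<in> K" "m' \<in> K" "m \<notin> K' \<or> m' \<notin> K'" for m m'
    proof (rule E_outside)
      have "rev k @ k' \<in> idx (dual (w m) @ w m') \<longleftrightarrow> k \<in> idx (w m) \<and> k' \<in> idx (w m')" if "length k = length (w m)" for k k'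
        using that rev_idx[of k "w m"] by (simp add: append_listset_iff)
      then show "rev (i m) @ i m' \<notin> idx (dual (w m) @ w m') \<or> rev (j m) @ j m' \<notin> idx (dual (w m) @ w m')"
        using that len by (auto simp: K'_def)
    qed
    have "(\<Sum>m'\<in>K'. cnj (x m) * x m' * E (dual (w m) @ w m') (rev (i m) @ i m') (rev (j m) @ j m')) =
      (\<Sum>m'\<in>K. cnj (x m) * x m' * E (dual (w m) @ w m') (rev (i m) @ i m') (rev (j m) @ j m'))" if "m \<in> K" for m
      using K zero that by (intro sum.mono_neutral_left) (auto simp: K'_def)
    moreover have "(\<Sum>m\<in>K'. g m) = (\<Sum>m\<in>K. g m)" if "\<And>m. m \<in> K - K' \<Longrightarrow> g m = 0" for g :: "_ \<Rightarrow> complex"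
      using K that by (intro sum.mono_neutral_left) (auto simp: K'_def)
    ultimately show ?thesis using zero by (auto simp: K'_def intro!: sum.cong)
  qed
  finally show ?thesis .
qed

end

section \<open>C*-seminorms on monoid algebras\<close>

abbreviation mon :: "'m \<Rightarrow> 'm \<Rightarrow>\<^sub>0 complex" where
  "mon m \<equiv> Poly_Mapping.single m 1"

lemma invol_zero [simp]: "invol (0 :: 'm::involutive_monoid) = 0"
  by (metis add.left_neutral add.right_neutral invol_add invol_invol)

lemma poly_mapping_expand: "x = (\<Sum>m\<in>Poly_Mapping.keys x. Poly_Mapping.single m (Poly_Mapping.lookup x m))"
  by (rule poly_mapping_eqI)
    (auto simp: lookup_sum lookup_single when_def in_keys_iff sum.delta)

text \<open>Stands in for multilinearity: an identity additive in each argument is checked on single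
  terms, one argument at a time.\<close>

lemma poly_mapping_additive_eqI:
  fixes F G :: "('m \<Rightarrow>\<^sub>0 complex) \<Rightarrow> 'b::comm_monoid_add"
  assumes "\<And>x y. F (x + y) = F x + F y" "\<And>x y. G (x + y) = G x + G y" "F 0 = 0" "G 0 = 0"
    and "\<And>m c. m \<in> Poly_Mapping.keys x \<Longrightarrow> F (Poly_Mapping.single m c) = G (Poly_Mapping.single m c)"
  shows "F x = G x"
proof -
  have sum: "H (\<Sum>m\<in>K. f m) = (\<Sum>m\<in>K. H (f m))"
    if "\<And>x y. H (x + y) = H x + H y" "H 0 = 0"
    for H :: "('m \<Rightarrow>\<^sub>0 complex) \<Rightarrow> 'b" and f and K :: "'m set"
    using that by (induction K rule: infinite_finite_induct) auto
  have "F x = (\<Sum>m\<in>Poly_Mapping.keys x. F (Poly_Mapping.single m (Poly_Mapping.lookup x m)))"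
    by (subst poly_mapping_expand) (rule sum[OF assms(1,3)])
  also have "\<dots> = (\<Sum>m\<in>Poly_Mapping.keys x. G (Poly_Mapping.single m (Poly_Mapping.lookup x m)))"
    by (intro sum.cong refl assms(5))
  also have "\<dots> = G x"
    by (subst (3) poly_mapping_expand) (rule sum[OF assms(2,4), symmetric])
  finally show ?thesis .
qed

lemma lookup_pstar: "Poly_Mapping.lookup (pstar x) m = cnj (Poly_Mapping.lookup x (invol m))"
proof -
  have "Poly_Mapping.lookup (pstar x) m =
      (\<Sum>k\<in>Poly_Mapping.keys x. if k = invol m then cnj (Poly_Mapping.lookup x k) else 0)"
    unfolding pstar_def lookup_sum
    by (intro sum.cong refl) (auto simp: lookup_single when_def invol_invol)
  then show ?thesis by (simp add: in_keys_iff)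
qed

lemma pstar_add: "pstar (x + y) = pstar x + pstar y"
  and pstar_zero [simp]: "pstar 0 = 0"
  and pstar_minus: "pstar (x - y) = pstar x - pstar y"
  and pstar_uminus: "pstar (- x) = - pstar x"
  and pstar_pstar [simp]: "pstar (pstar x) = x"
  by (auto intro!: poly_mapping_eqI simp: lookup_pstar lookup_add lookup_minus invol_invol)

lemma pstar_single: "pstar (Poly_Mapping.single m c) = Poly_Mapping.single (invol m) (cnj c)"
  by (rule poly_mapping_eqI) (auto simp: lookup_pstar lookup_single when_def invol_invol)

lemma pstar_mult: "pstar (x * y) = pstar y * pstar x"
proof (rule poly_mapping_additive_eqI[where x = x])
  fix m c
  show "pstar (Poly_Mapping.single m c * y) = pstar y * pstar (Poly_Mapping.single m c)"
    by (rule poly_mapping_additive_eqI[where x = y])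
      (auto simp: pstar_add algebra_simps mult_single pstar_single invol_add)
qed (auto simp: pstar_add algebra_simps)

lemma pstar_one [simp]: "pstar 1 = 1"
  using pstar_single[of 0 1] by simp

lemma pstar_sum: "pstar (\<Sum>i\<in>I. f i) = (\<Sum>i\<in>I. pstar (f i))"
  by (induction I rule: infinite_finite_induct) (auto simp: pstar_add)

lemma scalar_0 [simp]: "scalar 0 = 0" and scalar_1 [simp]: "scalar 1 = 1"
  by (auto simp: scalar_def)

lemma scalar_add: "scalar (a + b) = scalar a + scalar b"
  and scalar_diff: "scalar (a - b) = scalar a - scalar b"
  and scalar_uminus: "scalar (- a) = - scalar a"
  and scalar_mult: "scalar (a * b) = scalar a * scalar b"
  by (auto simp: scalar_def single_add single_diff single_uminus mult_single)

lemma scalar_sum: "scalar (\<Sum>i\<in>I. f i) = (\<Sum>i\<in>I. scalar (f i))"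
  by (induction I rule: infinite_finite_induct) (auto simp: scalar_add)

lemma scalar_numeral: "scalar (numeral k) = numeral k"
  by (simp add: scalar_def)

lemma scalar_single: "scalar c * Poly_Mapping.single m d = Poly_Mapping.single m (c * d)"
  by (simp add: scalar_def mult_single)

lemma pstar_scalar [simp]: "pstar (scalar c) = scalar (cnj c)"
  by (simp add: scalar_def pstar_single)

lemma scalar_commute: "x * scalar c = scalar c * x"
  by (rule poly_mapping_additive_eqI[where x = x])
    (auto simp: algebra_simps mult_single scalar_def)

lemma scalar_left_commute: "x * (scalar c * y) = scalar c * (x * y)"
  by (metis mult.assoc scalar_commute)

lemma scalar_scalar: "scalar a * (scalar b * x) = scalar (a * b) * x"
  by (simp add: scalar_mult mult.assoc)

definition lin :: "('m \<Rightarrow> complex) \<Rightarrow> ('m \<Rightarrow>\<^sub>0 complex) \<Rightarrow> complex" where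
  "lin f x = (\<Sum>m\<in>Poly_Mapping.keys x. Poly_Mapping.lookup x m * f m)"

lemma lin_eq: "finite K \<Longrightarrow> Poly_Mapping.keys x \<subseteq> K \<Longrightarrow> lin f x = (\<Sum>m\<in>K. Poly_Mapping.lookup x m * f m)"
  unfolding lin_def by (rule sum.mono_neutral_left) (auto simp: in_keys_iff)

lemma lin_zero [simp]: "lin f 0 = 0"
  by (simp add: lin_def)

lemma lin_add: "lin f (x + y) = lin f x + lin f y"
proof -
  let ?K = "Poly_Mapping.keys x \<union> Poly_Mapping.keys y"
  have "lin f (x + y) = (\<Sum>m\<in>?K. Poly_Mapping.lookup (x + y) m * f m)"
    by (intro lin_eq keys_add) simp
  then show ?thesis
    by (simp add: lin_eq[of ?K] lookup_add distrib_right sum.distrib)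
qed

lemma lin_single [simp]: "lin f (Poly_Mapping.single m c) = c * f m"
  by (cases "c = 0") (auto simp: lin_def)

lemma lin_scalar:
  fixes f :: "'m::monoid_add \<Rightarrow> complex"
  shows "lin f (scalar c * x) = c * lin f x"
  by (rule poly_mapping_additive_eqI[where x = x]) (auto simp: algebra_simps scalar_single lin_add)

lemma lin_scalar_const: "lin f (scalar c) = c * f 0"
  by (simp add: scalar_def)

lemma lin_uminus:
  fixes f :: "'m::monoid_add \<Rightarrow> complex"
  shows "lin f (- x) = - lin f x"
  using lin_scalar[of f "-1" x] by (simp add: scalar_uminus)

lemma lin_diff:
  fixes f :: "'m::monoid_add \<Rightarrow> complex"
  shows "lin f (x - y) = lin f x - lin f y"
  using lin_add[of f x "- y"] by (simp add: lin_uminus)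

lemma lin_sum: "lin f (\<Sum>i\<in>I. g i) = (\<Sum>i\<in>I. lin f (g i))"
  by (induction I rule: infinite_finite_induct) (auto simp: lin_add)

lemma mult_expand: "x * y = (\<Sum>m\<in>Poly_Mapping.keys x. \<Sum>k\<in>Poly_Mapping.keys y.
    Poly_Mapping.single (m + k) (Poly_Mapping.lookup x m * Poly_Mapping.lookup y k))"
  by (subst poly_mapping_expand[of x], subst poly_mapping_expand[of y])
    (simp add: sum_product mult_single)

definition star_submonoid :: "'m::involutive_monoid set \<Rightarrow> bool" where
  "star_submonoid M \<longleftrightarrow> 0 \<in> M \<and> (\<forall>x\<in>M. \<forall>y\<in>M. x + y \<in> M) \<and> (\<forall>x\<in>M. invol x \<in> M)"

lemma monoid_algebra_single: "m \<in> M \<Longrightarrow> Poly_Mapping.single m c \<in> monoid_algebra M"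
  by (auto simp: monoid_algebra_def)

lemma monoid_algebra_zero [simp]: "0 \<in> monoid_algebra M"
  by (auto simp: monoid_algebra_def)

lemma monoid_algebra_add: "x \<in> monoid_algebra M \<Longrightarrow> y \<in> monoid_algebra M \<Longrightarrow> x + y \<in> monoid_algebra M"
  using keys_add[of x y] by (auto simp: monoid_algebra_def)

lemma monoid_algebra_uminus: "x \<in> monoid_algebra M \<Longrightarrow> - x \<in> monoid_algebra M"
  by (auto simp: monoid_algebra_def in_keys_iff)

lemma monoid_algebra_diff: "x \<in> monoid_algebra M \<Longrightarrow> y \<in> monoid_algebra M \<Longrightarrow> x - y \<in> monoid_algebra M"
  using monoid_algebra_add[of x M "- y"] monoid_algebra_uminus[of y M] by simp

lemma monoid_algebra_sum: "(\<And>i. i \<in> I \<Longrightarrow> f i \<in> monoid_algebra M) \<Longrightarrow> (\<Sum>i\<in>I. f i) \<in> monoid_algebra M"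
  by (induction I rule: infinite_finite_induct) (auto simp: monoid_algebra_add)

lemma
  assumes "star_submonoid M"
  shows monoid_algebra_scalar: "scalar c \<in> monoid_algebra M"
    and monoid_algebra_one: "1 \<in> monoid_algebra M"
    and monoid_algebra_mult: "x \<in> monoid_algebra M \<Longrightarrow> y \<in> monoid_algebra M \<Longrightarrow> x * y \<in> monoid_algebra M"
    and monoid_algebra_pstar: "x \<in> monoid_algebra M \<Longrightarrow> pstar x \<in> monoid_algebra M"
proof -
  show *: "scalar c \<in> monoid_algebra M" for c
    using assms by (auto simp: scalar_def star_submonoid_def intro!: monoid_algebra_single)
  show "1 \<in> monoid_algebra M" using *[of 1] by simp
  show "x * y \<in> monoid_algebra M" if "x \<in> monoid_algebra M" "y \<in> monoid_algebra M"
    using that assms unfolding mult_expand[of x y]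
    by (intro monoid_algebra_sum monoid_algebra_single)
      (auto simp: monoid_algebra_def star_submonoid_def)
  show "pstar x \<in> monoid_algebra M" if "x \<in> monoid_algebra M"
    using that assms unfolding pstar_def
    by (intro monoid_algebra_sum monoid_algebra_single)
      (auto simp: monoid_algebra_def star_submonoid_def)
qed

lemma keys_monoid_algebra: "x \<in> monoid_algebra M \<Longrightarrow> m \<in> Poly_Mapping.keys x \<Longrightarrow> m \<in> M"
  by (auto simp: monoid_algebra_def)

lemma star_submonoid_Times:
  "star_submonoid M \<Longrightarrow> star_submonoid N \<Longrightarrow> star_submonoid (M \<times> N)"
  by (auto simp: star_submonoid_def zero_prod_def plus_prod_def invol_prod_def)

locale cstar_seminormed =
  fixes M :: "'m::involutive_monoid set" and p :: "('m \<Rightarrow>\<^sub>0 complex) \<Rightarrow> real"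
  assumes M: "star_submonoid M" and p: "cstar_seminorm M p"
begin

abbreviation "A \<equiv> monoid_algebra M"

lemmas closed [simp, intro] = monoid_algebra_scalar[OF M] monoid_algebra_one[OF M]
  monoid_algebra_mult[OF M] monoid_algebra_pstar[OF M] monoid_algebra_add monoid_algebra_diff
  monoid_algebra_uminus monoid_algebra_sum

lemma nonneg: "x \<in> A \<Longrightarrow> 0 \<le> p x"
  and scale: "x \<in> A \<Longrightarrow> p (scalar c * x) = cmod c * p x"
  and triangle: "x \<in> A \<Longrightarrow> y \<in> A \<Longrightarrow> p (x + y) \<le> p x + p y"
  and submult: "x \<in> A \<Longrightarrow> y \<in> A \<Longrightarrow> p (x * y) \<le> p x * p y"
  and cstar: "x \<in> A \<Longrightarrow> p (pstar x * x) = (p x)\<^sup>2"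
  using p unfolding cstar_seminorm_def by blast+

lemma zero [simp]: "p 0 = 0"
  using scale[of 0 0] by simp

lemma uminus: "x \<in> A \<Longrightarrow> p (- x) = p x"
  using scale[of x "-1"] by (simp add: scalar_uminus)

lemma diff: "x \<in> A \<Longrightarrow> y \<in> A \<Longrightarrow> p (x - y) \<le> p x + p y"
  using triangle[of x "- y"] uminus[of y] by auto

lemma diff_commute: "x \<in> A \<Longrightarrow> y \<in> A \<Longrightarrow> p (x - y) = p (y - x)"
  using uminus[of "x - y"] by auto

lemma null_add: "x \<in> A \<Longrightarrow> y \<in> A \<Longrightarrow> p x = 0 \<Longrightarrow> p y = 0 \<Longrightarrow> p (x + y) = 0"
  using triangle[of x y] nonneg[of "x + y"] by auto

lemma null_mult_left: "x \<in> A \<Longrightarrow> y \<in> A \<Longrightarrow> p x = 0 \<Longrightarrow> p (y * x) = 0"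
  using submult[of y x] nonneg[of "y * x"] by auto

lemma null_mult_right: "x \<in> A \<Longrightarrow> y \<in> A \<Longrightarrow> p x = 0 \<Longrightarrow> p (x * y) = 0"
  using submult[of x y] nonneg[of "x * y"] by auto

lemma null_sum: "(\<And>i. i \<in> I \<Longrightarrow> f i \<in> A \<and> p (f i) = 0) \<Longrightarrow> p (\<Sum>i\<in>I. f i) = 0"
  by (induction I rule: infinite_finite_induct) (auto intro!: null_add)

lemma sum_le: "(\<And>i. i \<in> I \<Longrightarrow> f i \<in> A) \<Longrightarrow> p (\<Sum>i\<in>I. f i) \<le> (\<Sum>i\<in>I. p (f i))"
proof (induction I rule: infinite_finite_induct)
  case (insert i I)
  then have "p (f i + (\<Sum>i\<in>I. f i)) \<le> p (f i) + p (\<Sum>i\<in>I. f i)" by (intro triangle) auto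
  then show ?case using insert by fastforce
qed auto

lemma pstar: assumes x: "x \<in> A" shows "p (pstar x) = p x"
proof -
  have *: "p x \<le> p (pstar x)" if "x \<in> A" for x
  proof (cases "p x = 0")
    case False
    have "p x * p x \<le> p (pstar x) * p x"
      using cstar[OF that] submult[of "pstar x" x] that by (auto simp: power2_eq_square)
    then show ?thesis using False nonneg[OF that] by (simp add: mult_le_cancel_right)
  qed (use that nonneg[of "pstar x"] in auto)
  show ?thesis using *[OF x] *[of "pstar x"] x by auto
qed

lemma one_le: "p 1 \<le> 1"
proof -
  have "p 1 = (p 1)\<^sup>2" using cstar[of 1] by auto
  then have "p 1 = 0 \<or> p 1 = 1" by (auto simp: power2_eq_square)
  then show ?thesis by auto
qed

lemma selfadjoint_square: "x \<in> A \<Longrightarrow> pstar x = x \<Longrightarrow> p (x * x) = (p x)\<^sup>2"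
  using cstar[of x] by simp

text \<open>With \<open>s\<close> approximating the square root of \<open>1 - a\<^sup>2\<close>, the element \<open>u = a + i s\<close> is almost unitary and
  \<open>2a\<^sup>2 - 1\<close> is close to the real part of \<open>u\<^sup>2\<close>. The iteration below is the binomial series for
  \<open>1 - s\<close> in disguise.\<close>

lemma selfadjoint_chebyshev:
  assumes a: "a \<in> A" "pstar a = a" "p a \<le> 1"
  shows "p (a * a + a * a - 1) \<le> 1"
proof -
  define h where "h = a * a"
  have h: "h \<in> A" "pstar h = h" "p h \<le> 1"
    using a selfadjoint_square[OF a(1,2)] nonneg[OF a(1)]
    by (auto simp: h_def pstar_mult abs_square_le_1)
  \<comment> \<open>The fixed point of \<open>y = (h + y * y) / 2\<close> is one minus the square
    root of \<open>1 - h\<close>; \<open>r\<close> is the same iteration with the number 1 in place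
    of \<open>h\<close>.\<close>
  define q where "q = rec_nat 0 (\<lambda>_ y. scalar (1/2) * (h + y * y))"
  define r where "r = rec_nat 0 (\<lambda>_ y. (1 + y * y) / 2 :: real)"
  have q_simps: "q 0 = 0" "q (Suc k) = scalar (1/2) * (h + q k * q k)" for k by (auto simp: q_def)
  have r_simps: "r 0 = 0" "r (Suc k) = (1 + r k * r k) / 2" for k by (auto simp: r_def)
  have q: "q k \<in> A" "pstar (q k) = q k" for k
    by (induction k) (use h in \<open>auto simp: q_simps pstar_mult pstar_add scalar_commute\<close>)
  have q_comm: "h * y = y * h \<Longrightarrow> q k * y = y * q k" for y k
  proof (induction k)
    case (Suc k)
    then have "q k * (q k * y) = y * (q k * q k)" by (metis mult.assoc)
    then show ?case using Suc by (simp add: q_simps scalar_left_commute algebra_simps)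
  qed (simp add: q_simps)
  have hq: "h * q k = q k * h" for k using q_comm[of h k] by simp
  have qq: "q j * q k = q k * q j" for j k using q_comm[OF hq] .
  have aq: "a * q k = q k * a" for k using q_comm[of a k] by (simp add: h_def mult.assoc)
  have r_bounds: "0 \<le> r k \<and> r k \<le> 1" for k
  proof (induction k)
    case (Suc k)
    then have "r k * r k \<le> 1" by (simp add: mult_le_one)
    with Suc show ?case by (simp add: r_simps)
  qed (simp add: r_simps)
  have q_le: "p (q k) \<le> r k" for k
  proof (induction k)
    case (Suc k)
    have "p (q (Suc k)) = 1/2 * p (h + q k * q k)" using h q by (simp add: q_simps scale closed)
    also have "p (h + q k * q k) \<le> p h + p (q k) * p (q k)"
      using triangle[OF h(1), of "q k * q k"] submult[of "q k" "q k"] q by fastforce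
    also have "\<dots> \<le> 1 + r k * r k"
      using h Suc nonneg[OF q(1)] r_bounds by (intro add_mono mult_mono) auto
    finally show ?case by (simp add: r_simps)
  qed (simp add: q_simps r_simps)
  \<comment> \<open>The increments of \<open>q\<close> are dominated by those of the bounded
    increasing sequence \<open>r\<close>. This replaces convergence of \<open>q\<close>, whose limit
    need not exist in an algebra that is not complete.\<close>
  have step: "p (q (Suc k) - q k) \<le> r (Suc k) - r k" for k
  proof (induction k)
    case 0
    show ?case using h q_le[of 1] by (simp add: q_simps r_simps)
  next
    case (Suc k)
    have "q (Suc (Suc k)) - q (Suc k) = scalar (1/2) * (q (Suc k) * q (Suc k) - q k * q k)"
      using q_simps(2)[of "Suc k"] q_simps(2)[of k] by (simp add: algebra_simps)
    also have "q (Suc k) * q (Suc k) - q k * q k = (q (Suc k) - q k) * (q (Suc k) + q k)"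
      by (simp add: algebra_simps qq[of "Suc k" k])
    finally have "p (q (Suc (Suc k)) - q (Suc k)) = 1/2 * p ((q (Suc k) - q k) * (q (Suc k) + q k))"
      using q by (simp add: scale closed)
    also have "p ((q (Suc k) - q k) * (q (Suc k) + q k)) \<le> p (q (Suc k) - q k) * p (q (Suc k) + q k)"
      using q by (intro submult) auto
    also have "\<dots> \<le> (r (Suc k) - r k) * (r (Suc k) + r k)"
    proof (rule mult_mono[OF Suc])
      show "p (q (Suc k) + q k) \<le> r (Suc k) + r k"
        using triangle[OF q(1) q(1), of "Suc k" k] q_le[of k] q_le[of "Suc k"] by linarith
      show "0 \<le> r (Suc k) - r k" using Suc nonneg[of "q (Suc k) - q k"] q by fastforce
      show "0 \<le> p (q (Suc k) + q k)" using q by (intro nonneg) auto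
    qed
    also have "(r (Suc k) - r k) * (r (Suc k) + r k) = r (Suc k) * r (Suc k) - r k * r k"
      by (simp add: algebra_simps)
    also have "1/2 * (r (Suc k) * r (Suc k) - r k * r k) = r (Suc (Suc k)) - r (Suc k)"
    proof -
      have "1/2 * (x * x - y * y) = z - x" if "z = (1 + x * x) / 2" "x = (1 + y * y) / 2" for x y z :: real
        unfolding that(1) using that(2) by (simp add: field_simps)
      then show ?thesis using r_simps(2) by blast
    qed
    finally show ?case by simp
  qed
  have bound: "p (h + h - 1) \<le> 1 + 4 * (r (Suc k) - r k)" for k
  proof -
    define s where "s = 1 - q k"
    define d where "d = q (Suc k) - q k"
    define i :: "'m \<Rightarrow>\<^sub>0 complex" where "i = scalar \<i>"
    define u where "u = a + i * s"
    define v where "v = a - i * s"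
    have ii: "i * (i * x) = - x" "a * (i * x) = i * (a * x)" "s * (i * x) = i * (s * x)" for x
      by (simp_all add: i_def scalar_scalar scalar_uminus scalar_left_commute[of a] scalar_left_commute[of s])
    have in_A: "s \<in> A" "d \<in> A" "u \<in> A" "v \<in> A" "i \<in> A"
      using q a by (auto simp: s_def d_def u_def v_def i_def)
    have as: "a * s = s * a" using aq by (simp add: s_def algebra_simps)
    note expand = distrib_left distrib_right left_diff_distrib right_diff_distrib mult.assoc ii as h_def
    have star_s: "pstar s = s" using q by (simp add: s_def pstar_minus)
    have star_u: "pstar u = v"
      by (simp add: u_def v_def pstar_add pstar_mult a star_s i_def scalar_uminus scalar_commute)
    have "q (Suc k) + q (Suc k) = h + q k * q k"
      unfolding q_simps distrib_right[symmetric] scalar_add[symmetric] by simp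
    \<comment> \<open>By the recursion, \<open>s * s\<close> misses \<open>1 - h\<close> by exactly
      twice the increment \<open>d\<close>.\<close>
    then have hs: "h + s * s = 1 + d + d"
      by (simp add: s_def d_def algebra_simps)
    have vu: "v * u = 1 + d + d"
      using hs by (simp add: u_def v_def expand)
    have "(p u)\<^sup>2 = p (1 + d + d)" using cstar[of u] in_A star_u vu by simp
    also have "\<dots> \<le> 1 + 2 * (r (Suc k) - r k)"
      using triangle[of "1 + d" d] triangle[of 1 d] one_le step[of k] in_A by (auto simp: d_def)
    finally have pu: "(p u)\<^sup>2 \<le> 1 + 2 * (r (Suc k) - r k)" .
    have "h + h - 1 = scalar (1/2) * (u * u + v * v) + (d + d)"
    proof -
      have "u * u + v * v = (h - s * s) + (h - s * s)"
        by (simp add: u_def v_def expand)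
      then have "scalar (1/2) * (u * u + v * v) = scalar (1/2) * (h - s * s) + scalar (1/2) * (h - s * s)"
        by (simp add: distrib_left)
      also have "\<dots> = h - s * s" unfolding distrib_right[symmetric] scalar_add[symmetric] by simp
      finally have X: "scalar (1/2) * (u * u + v * v) = h - s * s" .
      have "d + d = h + s * s - 1" using hs by (simp add: algebra_simps)
      then show ?thesis unfolding X by simp
    qed
    also have "p \<dots> \<le> p (scalar (1/2) * (u * u + v * v)) + p (d + d)"
      using in_A by (intro triangle) auto
    also have "p (scalar (1/2) * (u * u + v * v)) = 1/2 * p (u * u + v * v)"
      using in_A by (simp add: scale closed)
    finally have "p (h + h - 1) \<le> 1/2 * p (u * u + v * v) + p (d + d)" .
    moreover have "p (u * u + v * v) \<le> (p u)\<^sup>2 + (p u)\<^sup>2"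
      using triangle[of "u * u" "v * v"] submult[of u u] submult[of v v] pstar[of u] in_A star_u
      by (auto simp: power2_eq_square)
    moreover have "p (d + d) \<le> 2 * (r (Suc k) - r k)"
      using triangle[of d d] step[of k] in_A by (auto simp: d_def)
    ultimately show ?thesis using pu by linarith
  qed
  have "incseq r"
    using step nonneg q by (intro incseq_SucI) (meson closed diff_ge_0_iff_ge order_trans)
  then obtain l where l: "r \<longlonglongrightarrow> l"
    using incseq_convergent[of r 1] r_bounds by blast
  have "(\<lambda>k. 1 + 4 * (r (Suc k) - r k)) \<longlonglongrightarrow> 1 + 4 * (l - l)"
    by (intro tendsto_intros l LIMSEQ_Suc[OF l])
  then have "p (h + h - 1) \<le> 1 + 4 * (l - l)"
    by (rule LIMSEQ_le_const) (use bound in auto)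
  then show ?thesis by (simp add: h_def)
qed

text \<open>In spectral terms: \<open>a * a\<close> has spectrum between 0 and
  \<open>(p a)\<^sup>2\<close>, so its distance from the midpoint is at most half the length of that
  interval.\<close>

lemma square_centre:
  assumes a: "a \<in> A" "pstar a = a"
  shows "p (a * a - scalar (of_real ((p a)\<^sup>2 / 2))) \<le> (p a)\<^sup>2 / 2"
proof (cases "p a = 0")
  case True
  then show ?thesis using selfadjoint_square[OF a] by simp
next
  case False
  define c where "c = p a"
  have c: "c > 0" using nonneg[OF a(1)] False by (simp add: c_def)
  define b where "b = scalar (of_real (1 / c)) * a"
  have b: "b \<in> A" "pstar b = b" "p b \<le> 1"
    using a c by (auto simp: b_def pstar_mult scale scalar_commute c_def norm_divide)
  have bb: "b * b = scalar (of_real (1 / c\<^sup>2)) * (a * a)"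
    unfolding b_def mult.assoc scalar_left_commute[of a] scalar_scalar by (simp add: power2_eq_square)
  have "scalar (of_real (c\<^sup>2 / 2)) * (b * b + b * b - 1) =
      scalar (of_real (c\<^sup>2 / 2)) * (b * b) + scalar (of_real (c\<^sup>2 / 2)) * (b * b) - scalar (of_real (c\<^sup>2 / 2))"
    by (simp add: algebra_simps)
  also have "scalar (of_real (c\<^sup>2 / 2)) * (b * b) = scalar (1/2) * (a * a)"
    unfolding bb using c by (simp add: scalar_scalar)
  also have "scalar (1/2) * (a * a) + scalar (1/2) * (a * a) = a * a"
    unfolding distrib_right[symmetric] scalar_add[symmetric] by simp
  finally have eq: "scalar (of_real (c\<^sup>2 / 2)) * (b * b + b * b - 1) = a * a - scalar (of_real (c\<^sup>2 / 2))" .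
  have "p (a * a - scalar (of_real (c\<^sup>2 / 2))) = c\<^sup>2 / 2 * p (b * b + b * b - 1)"
  proof -
    have "cmod (of_real (c\<^sup>2 / 2)) = c\<^sup>2 / 2" by (subst norm_of_real) simp
    moreover have "b * b + b * b - 1 \<in> A" using b by auto
    ultimately show ?thesis unfolding eq[symmetric] by (simp only: scale)
  qed
  also have "\<dots> \<le> c\<^sup>2 / 2 * 1"
    using selfadjoint_chebyshev[OF b] by (intro mult_left_mono) auto
  finally show ?thesis by (simp add: c_def)
qed

text \<open>The function \<open>t \<mapsto> \<parallel>h + t\<parallel>\<close> is convex, takes the value \<open>r = \<parallel>h\<parallel>\<close> at \<open>0\<close> and is at most \<open>r/2\<close>
  at \<open>-r/2\<close> for a square \<open>h\<close>; hence it is at least \<open>r + t\<close> for positive \<open>t\<close>. This replaces the spectral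
  argument for the monotonicity of the norm.\<close>

lemma sum_squares_bound:
  assumes K: "finite K" "j \<in> K" and g: "\<And>k. k \<in> K \<Longrightarrow> g k \<in> A" "\<And>k. k \<in> K \<Longrightarrow> pstar (g k) = g k"
    and null: "p ((\<Sum>k\<in>K. g k * g k) - 1) = 0"
  shows "p (g j) \<le> 1"
proof (rule ccontr)
  assume "\<not> p (g j) \<le> 1"
  define h where "h = g j * g j"
  define r where "r = (p (g j))\<^sup>2"
  have r: "r > 1" using \<open>\<not> p (g j) \<le> 1\<close> by (simp add: r_def one_less_power)
  have h: "h \<in> A" "p h = r" using g K selfadjoint_square[of "g j"] by (auto simp: h_def r_def)
  have centre: "p (h - scalar (of_real (r / 2))) \<le> r / 2"
    using square_centre[of "g j"] g K by (simp add: h_def r_def)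
  \<comment> \<open>Each of the other squares is \<open>R k\<close> plus an element of norm at most
    \<open>R k\<close>; summed up, they give the shift \<open>c\<close> and the error
    \<open>w\<close>.\<close>
  define R where "R k = (p (g k))\<^sup>2 / 2" for k
  define c where "c = (\<Sum>k\<in>K - {j}. R k)"
  have c: "c \<ge> 0" by (auto simp: c_def R_def intro!: sum_nonneg)
  define w where "w = (\<Sum>k\<in>K - {j}. g k * g k - scalar (of_real (R k)))"
  have w: "w \<in> A" using g by (auto simp: w_def)
  have pw: "p w \<le> c"
  proof -
    have "p w \<le> (\<Sum>k\<in>K - {j}. p (g k * g k - scalar (of_real (R k))))"
      unfolding w_def using g by (intro sum_le) auto
    also have "\<dots> \<le> c" unfolding c_def R_def using g by (intro sum_mono square_centre) auto
    finally show ?thesis .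
  qed
  have sum: "(\<Sum>k\<in>K. g k * g k) = h + w + scalar (of_real c)"
    using K by (simp add: w_def c_def h_def sum.remove[of K j] sum_subtractf scalar_sum)
  have "p (h + scalar (of_real c)) \<le> c + 1"
  proof -
    have "p (h + scalar (of_real c)) = p (((\<Sum>k\<in>K. g k * g k) - 1) + (1 - w))"
      by (simp add: sum algebra_simps)
    also have "\<dots> \<le> p ((\<Sum>k\<in>K. g k * g k) - 1) + p (1 - w)"
      using g w by (intro triangle) auto
    also have "\<dots> \<le> c + 1" using null diff[of 1 w] w one_le pw by auto
    finally show ?thesis .
  qed
  \<comment> \<open>Convexity along \<open>h + t\<close>: the point \<open>t = 0\<close> is a
    combination of \<open>t = - r / 2\<close> and \<open>t = c\<close> with weights proportional to
    \<open>c\<close> and \<open>r / 2\<close>.\<close>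
  moreover have "(c + r / 2) * r \<le> c * (r / 2) + r / 2 * p (h + scalar (of_real c))"
  proof -
    have "scalar (of_real (c + r / 2)) * h =
        scalar (of_real c) * (h - scalar (of_real (r / 2))) + scalar (of_real (r / 2)) * (h + scalar (of_real c))"
      by (simp add: algebra_simps scalar_add scalar_mult[symmetric])
    then have "p (scalar (of_real (c + r / 2)) * h) \<le>
       p (scalar (of_real c) * (h - scalar (of_real (r / 2)))) + p (scalar (of_real (r / 2)) * (h + scalar (of_real c)))"
      using triangle h by auto
    also have "\<dots> = c * p (h - scalar (of_real (r / 2))) + r / 2 * p (h + scalar (of_real c))"
      using h c r by (subst (1 2) scale) auto
    also have "\<dots> \<le> c * (r / 2) + r / 2 * p (h + scalar (of_real c))"
      using centre c r by (intro add_mono mult_left_mono) auto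
    finally show ?thesis using h c r by (simp add: scale norm_of_real del: of_real_add)
  qed
  ultimately have "(c + r / 2) * r \<le> c * (r / 2) + r / 2 * (c + 1)"
    using r by (smt (verit) mult_left_mono divide_nonneg_nonneg)
  moreover have "(c + r / 2) * r = c * r + r * r / 2" "c * (r / 2) + r / 2 * (c + 1) = c * r + r / 2"
    by (simp_all add: field_simps)
  ultimately have "r * r \<le> r" by linarith
  then show False using r by simp
qed

end

section \<open>Universal C*-seminorms\<close>

text \<open>A pointwise supremum of C*-seminorms is again one as soon as it is finite, and a common
  bound on the monoid elements makes it finite. The zero seminorm ensures that the family is not
  empty.\<close>

lemma
  fixes M :: "'m::involutive_monoid set" and B :: "'m \<Rightarrow> real"
  assumes M: "star_submonoid M"
    and B: "\<And>p m. cstar_seminorm M p \<Longrightarrow> (\<forall>r\<in>R. p r = 0) \<Longrightarrow> m \<in> M \<Longrightarrow> p (mon m) \<le> B m"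
  shows universal_seminorm_cstar: "cstar_seminorm M (universal_seminorm M R)"
    and universal_seminorm_relator: "r \<in> R \<Longrightarrow> universal_seminorm M R r = 0"
    and universal_seminorm_greatest: "cstar_seminorm M p \<Longrightarrow> (\<forall>r\<in>R. p r = 0) \<Longrightarrow>
      x \<in> monoid_algebra M \<Longrightarrow> p x \<le> universal_seminorm M R x"
proof -
  define Q where "Q = {p. cstar_seminorm M p \<and> (\<forall>r\<in>R. p r = 0)}"
  let ?U = "universal_seminorm M R"
  have U: "?U x = (SUP p\<in>Q. p x)" for x
    unfolding universal_seminorm_def Q_def by (rule arg_cong[where f = Sup]) auto
  have Q0: "(\<lambda>_. 0) \<in> Q" by (auto simp: Q_def cstar_seminorm_def)
  then have ne: "Q \<noteq> {}" by auto
  have Q: "cstar_seminormed M p" if "p \<in> Q" for p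
    using that M by (auto simp: Q_def cstar_seminormed_def)
  note facts = cstar_seminormed.nonneg[OF Q] cstar_seminormed.scale[OF Q] cstar_seminormed.triangle[OF Q]
    cstar_seminormed.submult[OF Q] cstar_seminormed.cstar[OF Q]
  have le: "p x \<le> (\<Sum>m\<in>Poly_Mapping.keys x. cmod (Poly_Mapping.lookup x m) * B m)"
    if pQ: "p \<in> Q" and x: "x \<in> monoid_algebra M" for p x
  proof -
    interpret cstar_seminormed M p by (rule Q[OF pQ])
    have keys: "m \<in> M" if "m \<in> Poly_Mapping.keys x" for m using x that by (rule keys_monoid_algebra)
    have "p x = p (\<Sum>m\<in>Poly_Mapping.keys x. scalar (Poly_Mapping.lookup x m) * mon m)"
      by (subst (1) poly_mapping_expand[of x]) (simp add: scalar_single)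
    also have "\<dots> \<le> (\<Sum>m\<in>Poly_Mapping.keys x. p (scalar (Poly_Mapping.lookup x m) * mon m))"
      using keys by (intro sum_le closed monoid_algebra_single) auto
    also have "\<dots> \<le> (\<Sum>m\<in>Poly_Mapping.keys x. cmod (Poly_Mapping.lookup x m) * B m)"
    proof (rule sum_mono)
      fix m assume m: "m \<in> Poly_Mapping.keys x"
      have "p (mon m) \<le> B m" using pQ m keys by (intro B) (auto simp: Q_def)
      then show "p (scalar (Poly_Mapping.lookup x m) * mon m) \<le> cmod (Poly_Mapping.lookup x m) * B m"
        using keys[OF m] by (subst scale) (auto intro!: mult_left_mono monoid_algebra_single)
    qed
    finally show ?thesis .
  qed
  have upper: "p x \<le> ?U x" if "p \<in> Q" "x \<in> monoid_algebra M" for p x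
    unfolding U using that le by (intro cSUP_upper bdd_aboveI2) auto
  have least: "?U x \<le> c" if "\<And>p. p \<in> Q \<Longrightarrow> p x \<le> c" for x c
    unfolding U using that ne by (intro cSUP_least) auto
  show "?U r = 0" if "r \<in> R"
  proof -
    have "(\<lambda>p. p r) ` Q = {0}" using that ne by (auto simp: Q_def)
    then show ?thesis by (simp add: U)
  qed
  show "p x \<le> ?U x" if "cstar_seminorm M p" "\<forall>r\<in>R. p r = 0" "x \<in> monoid_algebra M"
    using that by (intro upper) (auto simp: Q_def)
  have U_nonneg: "0 \<le> ?U x" if "x \<in> monoid_algebra M" for x
    using upper[OF Q0 that] by simp
  have U_scale_le: "?U (scalar c * x) \<le> cmod c * ?U x" if "x \<in> monoid_algebra M" for c x
    using that by (intro least) (simp add: facts(2) upper mult_left_mono)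
  show "cstar_seminorm M ?U"
    unfolding cstar_seminorm_def
  proof (intro conjI ballI allI)
    fix x assume x: "x \<in> monoid_algebra M"
    show "0 \<le> ?U x" using x by (rule U_nonneg)
    show "?U (scalar c * x) = cmod c * ?U x" for c
    proof (cases "c = 0")
      case True
      then show ?thesis using U_scale_le[OF x, of 0] U_nonneg[of 0] by simp
    next
      case False
      have "?U x = ?U (scalar (inverse c) * (scalar c * x))" using False by (simp add: scalar_scalar)
      also have "\<dots> \<le> cmod (inverse c) * ?U (scalar c * x)"
        using x by (intro U_scale_le monoid_algebra_mult[OF M] monoid_algebra_scalar[OF M])
      finally have "cmod c * ?U x \<le> cmod c * (cmod (inverse c) * ?U (scalar c * x))"
        by (rule mult_left_mono) simp
      also have "\<dots> = ?U (scalar c * x)" using False by (simp add: norm_inverse)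
      finally have "cmod c * ?U x \<le> ?U (scalar c * x)" .
      then show ?thesis using U_scale_le[OF x, of c] by simp
    qed
    show "?U (pstar x * x) = (?U x)\<^sup>2"
    proof (rule antisym)
      show "?U (pstar x * x) \<le> (?U x)\<^sup>2"
        using x by (intro least) (simp add: facts(5) facts(1) upper power_mono)
      have "pstar x * x \<in> monoid_algebra M"
        using x by (intro monoid_algebra_mult[OF M] monoid_algebra_pstar[OF M])
      from upper[OF _ this] have "p x \<le> sqrt (?U (pstar x * x))" if "p \<in> Q" for p
        using that facts(5)[OF that x] by (metis real_le_rsqrt)
      then have "?U x \<le> sqrt (?U (pstar x * x))" by (rule least)
      then have "(?U x)\<^sup>2 \<le> (sqrt (?U (pstar x * x)))\<^sup>2" using U_nonneg[OF x] by (rule power_mono)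
      then show "(?U x)\<^sup>2 \<le> ?U (pstar x * x)"
        using U_nonneg[OF \<open>pstar x * x \<in> monoid_algebra M\<close>] by simp
    qed
    fix y assume y: "y \<in> monoid_algebra M"
    show "?U (x + y) \<le> ?U x + ?U y"
    proof (rule least)
      fix p assume p: "p \<in> Q"
      show "p (x + y) \<le> ?U x + ?U y"
        using facts(3)[OF p x y] upper[OF p x] upper[OF p y] by linarith
    qed
    show "?U (x * y) \<le> ?U x * ?U y"
    proof (rule least)
      fix p assume p: "p \<in> Q"
      have "p x * p y \<le> ?U x * ?U y"
        using upper[OF p x] upper[OF p y] facts(1)[OF p y] U_nonneg[OF x] by (intro mult_mono)
      then show "p (x * y) \<le> ?U x * ?U y" using facts(4)[OF p x y] by linarith
    qed
  qed
qed

section \<open>Uniform bounds for the generators\<close>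

definition letter :: "nat \<Rightarrow> nat \<Rightarrow> bool \<Rightarrow> free_alg" where
  "letter i j e = mon (Word [((i, j), e)])"

lemma pstar_letter: "pstar (letter i j e) = letter i j (\<not> e)"
  by (simp add: letter_def pstar_single invol_word_def)

lemma gen_letter: "gen i j = letter i j False"
  by (simp add: gen_def letter_def)

lemma star_submonoid_words: "star_submonoid (words n)"
  by (auto simp: star_submonoid_def words_def zero_word_def plus_word_def invol_word_def image_image)

lemma letter_in: "i \<in> {1..n} \<Longrightarrow> j \<in> {1..n} \<Longrightarrow> letter i j e \<in> monoid_algebra (words n)"
  unfolding letter_def by (intro monoid_algebra_single) (auto simp: words_def)

lemma delta_in: "delta i j \<in> monoid_algebra (words n)"
  using monoid_algebra_one[OF star_submonoid_words] by (auto simp: delta_def)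

text \<open>\<open>al\<close> records the pairs of star tags that yield a relation: opposite tags
  for the generators of the unitary algebra, all pairs for the self-adjoint ones.\<close>

definition unitary_relations :: "nat \<Rightarrow> (bool \<Rightarrow> bool \<Rightarrow> bool) \<Rightarrow> (free_alg \<Rightarrow> real) \<Rightarrow> bool" where
  "unitary_relations n al p \<longleftrightarrow> (\<forall>e e' i j. al e e' \<longrightarrow> i \<in> {1..n} \<longrightarrow> j \<in> {1..n} \<longrightarrow>
     p ((\<Sum>k=1..n. letter i k e * letter j k e') - delta i j) = 0 \<and>
     p ((\<Sum>k=1..n. letter k i e * letter k j e') - delta i j) = 0)"

lemma unitary_relations_u:
  assumes "\<forall>r\<in>relators_u n. p r = 0"
  shows "unitary_relations n (\<lambda>e e'. e' = (\<not> e)) p"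
  unfolding unitary_relations_def
proof (intro allI impI)
  fix e e' i j assume e: "e' = (\<not> e)" and ij: "i \<in> {1..n}" "j \<in> {1..n}"
  have sets: "{(\<Sum>k=1..n. letter i k False * letter j k True) - delta i j | i j. i \<in> {1..n} \<and> j \<in> {1..n}} \<union>
      {(\<Sum>k=1..n. letter k i True * letter k j False) - delta i j | i j. i \<in> {1..n} \<and> j \<in> {1..n}} \<union>
      ({(\<Sum>k=1..n. letter k i False * letter k j True) - delta i j | i j. i \<in> {1..n} \<and> j \<in> {1..n}} \<union>
      {(\<Sum>k=1..n. letter i k True * letter j k False) - delta i j | i j. i \<in> {1..n} \<and> j \<in> {1..n}}) = relators_u n"
    by (simp add: relators_u_def unitary_relators_def gen_letter pstar_letter)
  have "(\<Sum>k=1..n. letter i k False * letter j k True) - delta i j \<in> relators_u n"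
    unfolding sets[symmetric] by (rule UnI1, rule UnI1, rule CollectI, rule exI[of _ i], rule exI[of _ j]) (use ij in simp)
  moreover have "(\<Sum>k=1..n. letter k i True * letter k j False) - delta i j \<in> relators_u n"
    unfolding sets[symmetric] by (rule UnI1, rule UnI2, rule CollectI, rule exI[of _ i], rule exI[of _ j]) (use ij in simp)
  moreover have "(\<Sum>k=1..n. letter k i False * letter k j True) - delta i j \<in> relators_u n"
    unfolding sets[symmetric] by (rule UnI2, rule UnI1, rule CollectI, rule exI[of _ i], rule exI[of _ j]) (use ij in simp)
  moreover have "(\<Sum>k=1..n. letter i k True * letter j k False) - delta i j \<in> relators_u n"
    unfolding sets[symmetric] by (rule UnI2, rule UnI2, rule CollectI, rule exI[of _ i], rule exI[of _ j]) (use ij in simp)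
  ultimately have "(\<Sum>k=1..n. letter i k e * letter j k e') - delta i j \<in> relators_u n"
    "(\<Sum>k=1..n. letter k i e * letter k j e') - delta i j \<in> relators_u n"
    using e by (cases e; simp)+
  with assms show "p ((\<Sum>k=1..n. letter i k e * letter j k e') - delta i j) = 0 \<and>
     p ((\<Sum>k=1..n. letter k i e * letter k j e') - delta i j) = 0" by blast
qed

lemma unitary_relations_o:
  assumes p: "cstar_seminorm (words n) p" and null: "\<forall>r\<in>relators_o n. p r = 0"
  shows "unitary_relations n (\<lambda>e e'. True) p"
  unfolding unitary_relations_def
proof (intro allI impI)
  interpret cstar_seminormed "words n" p
    using p star_submonoid_words by (simp add: cstar_seminormed_def)
  fix e e' i j assume ij: "i \<in> {1..n}" "j \<in> {1..n}"
  have lf: "p (letter i j e - letter i j False) = 0" if "i \<in> {1..n}" "j \<in> {1..n}" for i j e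
  proof (cases e)
    case True
    have "letter i j False - letter i j True \<in> relators_o n"
      unfolding relators_o_def gen_letter pstar_letter by (rule UnI1, rule UnI1, rule CollectI, rule exI[of _ i], rule exI[of _ j]) (use that in simp)
    with null have "p (letter i j False - letter i j True) = 0" by blast
    then show ?thesis using True diff_commute[of "letter i j False" "letter i j True"] letter_in[OF that] by simp
  qed simp
  have prod: "p (letter a b e * letter c d e' - letter a b False * letter c d False) = 0"
    if "a \<in> {1..n}" "b \<in> {1..n}" "c \<in> {1..n}" "d \<in> {1..n}" for a b c d
  proof -
    have eq: "letter a b e * letter c d e' - letter a b False * letter c d False =
      (letter a b e - letter a b False) * letter c d e' + letter a b False * (letter c d e' - letter c d False)"
      by (simp add: algebra_simps)
    show ?thesis unfolding eq using that lf
      by (intro null_add null_mult_left null_mult_right) (auto intro!: letter_in closed)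
  qed
  have *: "p (X - d) = 0" if "X = (\<Sum>k=1..n. f k)" "Y = (\<Sum>k=1..n. g k)" "p (Y - d) = 0" "d \<in> A"
      "\<And>k. k \<in> {1..n} \<Longrightarrow> f k \<in> A \<and> g k \<in> A \<and> p (f k - g k) = 0" for X Y d and f g :: "nat \<Rightarrow> free_alg"
  proof -
    have eq: "X - d = (\<Sum>k=1..n. f k - g k) + (Y - d)" by (simp add: that sum_subtractf)
    have "p (\<Sum>k=1..n. f k - g k) = 0" using that by (intro null_sum) auto
    moreover have "Y \<in> A" "(\<Sum>k=1..n. f k - g k) \<in> A"
      unfolding that(2) by (intro closed; use that(5) in blast)+
    ultimately show ?thesis unfolding eq using that(3,4) by (intro null_add) auto
  qed
  have "(\<Sum>k=1..n. letter i k False * letter j k False) - delta i j \<in> relators_o n"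
    unfolding relators_o_def gen_letter by (rule UnI1, rule UnI2, rule CollectI, rule exI[of _ i], rule exI[of _ j]) (use ij in simp)
  with null have 1: "p ((\<Sum>k=1..n. letter i k False * letter j k False) - delta i j) = 0" by blast
  have "(\<Sum>k=1..n. letter k i False * letter k j False) - delta i j \<in> relators_o n"
    unfolding relators_o_def gen_letter by (rule UnI2, rule CollectI, rule exI[of _ i], rule exI[of _ j]) (use ij in simp)
  with null have 2: "p ((\<Sum>k=1..n. letter k i False * letter k j False) - delta i j) = 0" by blast
  show "p ((\<Sum>k=1..n. letter i k e * letter j k e') - delta i j) = 0 \<and>
     p ((\<Sum>k=1..n. letter k i e * letter k j e') - delta i j) = 0"
  proof
    show "p ((\<Sum>k=1..n. letter i k e * letter j k e') - delta i j) = 0"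
      using ij prod by (intro *[OF refl refl 1 delta_in]) (auto intro!: letter_in closed)
    show "p ((\<Sum>k=1..n. letter k i e * letter k j e') - delta i j) = 0"
      using ij prod by (intro *[OF refl refl 2 delta_in]) (auto intro!: letter_in closed)
  qed
qed

text \<open>The squares of the real and imaginary parts of all letters in row \<open>i\<close> add
  up to half of two relations, hence to 1 modulo null elements. Each part has norm at most 1 by
  \<open>sum_squares_bound\<close>, and a letter is a combination of two of them; any uniform bound
  serves the purpose.\<close>

lemma letter_bound:
  assumes p: "cstar_seminorm (words n) p" and rel: "unitary_relations n al p"
    and al: "\<And>e. al e (\<not> e)" and ij: "i \<in> {1..n}" "j \<in> {1..n}"
  shows "p (letter i j e) \<le> 2"
proof -
  interpret cstar_seminormed "words n" p
    using p star_submonoid_words by (simp add: cstar_seminormed_def)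
  define x where "x k = scalar (1/2) * (letter i k False + letter i k True)" for k
  define y where "y k = scalar (- \<i>/2) * (letter i k False - letter i k True)" for k
  define g where "g = (\<lambda>(k, b). if b then x k else y k)"
  have in_A: "letter i k e \<in> A" if "k \<in> {1..n}" for k e using letter_in ij that by auto
  have g: "g z \<in> A" "pstar (g z) = g z" if "z \<in> {1..n} \<times> UNIV" for z
  proof -
    show "g z \<in> A" using that in_A by (auto simp: g_def x_def y_def)
    have "pstar (x k) = x k" for k
      by (simp add: x_def pstar_mult pstar_add pstar_letter scalar_commute add.commute)
    moreover have "pstar (y k) = y k" for k
      by (simp add: y_def pstar_mult pstar_minus pstar_letter scalar_commute scalar_uminus algebra_simps)
    ultimately show "pstar (g z) = g z" by (cases z) (auto simp: g_def)
  qed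
  have sq: "x k * x k + y k * y k =
      scalar (1/2) * (letter i k False * letter i k True + letter i k True * letter i k False)" for k
  proof -
    let ?v = "letter i k False" and ?w = "letter i k True"
    have sc: "scalar c * a * (scalar c * b) = scalar (c * c) * (a * b)" for c and a b :: free_alg
      by (simp only: mult.assoc scalar_left_commute[of a] scalar_scalar)
    have "x k * x k + y k * y k = scalar (1/4) * ((?v + ?w) * (?v + ?w) - (?v - ?w) * (?v - ?w))"
    proof -
      have "x k * x k = scalar (1/4) * ((?v + ?w) * (?v + ?w))" unfolding x_def sc by simp
      moreover have "y k * y k = scalar (- (1/4)) * ((?v - ?w) * (?v - ?w))" unfolding y_def sc by simp
      ultimately show ?thesis by (simp add: scalar_uminus right_diff_distrib)
    qed
    also have "(?v + ?w) * (?v + ?w) - (?v - ?w) * (?v - ?w) = scalar 2 * (?v * ?w + ?w * ?v)"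
      by (simp add: scalar_numeral algebra_simps mult_2)
    finally show ?thesis by (simp add: scalar_scalar)
  qed
  have "(\<Sum>z\<in>{1..n} \<times> UNIV. g z * g z) = (\<Sum>k=1..n. x k * x k + y k * y k)"
    by (simp add: sum.cartesian_product' g_def UNIV_bool add.commute)
  also have "\<dots> = scalar (1/2) * ((\<Sum>k=1..n. letter i k False * letter i k True) + (\<Sum>k=1..n. letter i k True * letter i k False))"
    unfolding sq sum_distrib_left[symmetric] sum.distrib ..
  finally have sum: "(\<Sum>z\<in>{1..n} \<times> UNIV. g z * g z) - 1 =
      scalar (1/2) * (((\<Sum>k=1..n. letter i k False * letter i k True) - delta i i) +
        ((\<Sum>k=1..n. letter i k True * letter i k False) - delta i i))"
  proof -
    have "(1 :: free_alg) = scalar (1/2) * (1 + 1)"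
      by (simp only: distrib_left distrib_right[symmetric] mult_1_right scalar_add[symmetric]) simp
    moreover assume "(\<Sum>z\<in>{1..n} \<times> UNIV. g z * g z) = scalar (1/2) * ((\<Sum>k=1..n. letter i k False * letter i k True) + (\<Sum>k=1..n. letter i k True * letter i k False))"
    ultimately show ?thesis by (simp add: delta_def algebra_simps)
  qed
  have "p ((\<Sum>k=1..n. letter i k False * letter i k True) - delta i i) = 0"
    "p ((\<Sum>k=1..n. letter i k True * letter i k False) - delta i i) = 0"
    using rel ij al[of False] al[of True] unfolding unitary_relations_def by auto
  then have null: "p ((\<Sum>z\<in>{1..n} \<times> UNIV. g z * g z) - 1) = 0"
    unfolding sum by (intro null_mult_left null_add closed delta_in in_A)
  have "p (x j) \<le> 1" "p (y j) \<le> 1"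
    using sum_squares_bound[of "{1..n} \<times> UNIV" "(j, True)" g] sum_squares_bound[of "{1..n} \<times> UNIV" "(j, False)" g]
      null g ij by (auto simp: g_def)
  moreover have "letter i j e = x j + scalar (if e then - \<i> else \<i>) * y j"
  proof -
    have "scalar (1/2) * a + scalar (1/2) * a = a" for a :: free_alg
      unfolding distrib_right[symmetric] scalar_add[symmetric] by simp
    then show ?thesis
      by (cases e) (simp_all add: x_def y_def scalar_scalar scalar_uminus algebra_simps)
  qed
  moreover have "x j \<in> A" "y j \<in> A" using g(1)[of "(j, True)"] g(1)[of "(j, False)"] ij by (auto simp: g_def)
  ultimately show ?thesis
    using triangle[of "x j" "scalar (if e then - \<i> else \<i>) * y j"] scale[of "y j" "if e then - \<i> else \<i>"]
    by (auto split: if_splits)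
qed

lemma word_bound:
  assumes p: "cstar_seminorm (words n) p" and rel: "unitary_relations n al p"
    and al: "\<And>e. al e (\<not> e)" and m: "m \<in> words n"
  shows "p (mon m) \<le> 2 ^ length (letters m)"
proof -
  interpret cstar_seminormed "words n" p
    using p star_submonoid_words by (simp add: cstar_seminormed_def)
  have "p (mon (Word l)) \<le> 2 ^ length l" if "Word l \<in> words n" for l
    using that
  proof (induction l)
    case Nil
    then show ?case using one_le by (simp flip: zero_word_def)
  next
    case (Cons a l)
    obtain i j e where a: "a = ((i, j), e)" by (metis prod.exhaust)
    have ij: "i \<in> {1..n}" "j \<in> {1..n}" and l: "Word l \<in> words n" using Cons.prems by (auto simp: words_def a)
    have "mon (Word (a # l)) = letter i j e * mon (Word l)"
      by (simp add: letter_def a mult_single plus_word_def)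
    also have "p \<dots> \<le> p (letter i j e) * p (mon (Word l))"
      using ij l by (intro submult letter_in monoid_algebra_single)
    also have "\<dots> \<le> 2 * 2 ^ length l"
      using Cons.IH[OF l] letter_bound[OF p rel al ij] l
      by (intro mult_mono nonneg monoid_algebra_single) auto
    finally show ?case by simp
  qed
  then show ?thesis using m by (cases m) simp
qed

lemma word_bound_u:
  "cstar_seminorm (words n) p \<Longrightarrow> \<forall>r\<in>relators_u n. p r = 0 \<Longrightarrow> m \<in> words n \<Longrightarrow> p (mon m) \<le> 2 ^ length (letters m)"
  by (rule word_bound[OF _ unitary_relations_u]) auto

lemma word_bound_o:
  "cstar_seminorm (words n) p \<Longrightarrow> \<forall>r\<in>relators_o n. p r = 0 \<Longrightarrow> m \<in> words n \<Longrightarrow> p (mon m) \<le> 2 ^ length (letters m)"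
  by (rule word_bound[OF _ unitary_relations_o]) auto

lemma norm_u_cstar: "cstar_seminorm (words n) (norm_u n)"
  unfolding norm_u_def by (rule universal_seminorm_cstar[OF star_submonoid_words]) (rule word_bound_u)

lemma norm_u_relator: "r \<in> relators_u n \<Longrightarrow> norm_u n r = 0"
  unfolding norm_u_def by (rule universal_seminorm_relator[OF star_submonoid_words]) (rule word_bound_u)

lemma norm_u_greatest:
  "cstar_seminorm (words n) p \<Longrightarrow> \<forall>r\<in>relators_u n. p r = 0 \<Longrightarrow> x \<in> monoid_algebra (words n) \<Longrightarrow> p x \<le> norm_u n x"
  unfolding norm_u_def by (rule universal_seminorm_greatest[OF star_submonoid_words]) (rule word_bound_u)

lemma norm_o_cstar: "cstar_seminorm (words n) (norm_o n)"
  unfolding norm_o_def by (rule universal_seminorm_cstar[OF star_submonoid_words]) (rule word_bound_o)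

lemma norm_o_relator: "r \<in> relators_o n \<Longrightarrow> norm_o n r = 0"
  unfolding norm_o_def by (rule universal_seminorm_relator[OF star_submonoid_words]) (rule word_bound_o)

lemma norm_o_greatest:
  "cstar_seminorm (words n) p \<Longrightarrow> \<forall>r\<in>relators_o n. p r = 0 \<Longrightarrow> x \<in> monoid_algebra (words n) \<Longrightarrow> p x \<le> norm_o n x"
  unfolding norm_o_def by (rule universal_seminorm_greatest[OF star_submonoid_words]) (rule word_bound_o)

section \<open>Separated completions\<close>

context cstar_seminormed
begin

abbreviation "cls \<equiv> limit_class M p"
abbreviation "cauchy \<equiv> cauchy_seq M p"

lemma cauchy_in: "cauchy x \<Longrightarrow> x k \<in> A"
  by (auto simp: cauchy_seq_def)

lemma cauchy_const: "x \<in> A \<Longrightarrow> cauchy (\<lambda>_. x)"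
  by (auto simp: cauchy_seq_def)

lemma cauchyI:
  assumes "\<And>k. x k \<in> A" "\<And>e. e > 0 \<Longrightarrow> \<exists>N. \<forall>k\<ge>N. \<forall>l\<ge>N. p (x k - x l) < e"
  shows "cauchy x"
  using assms by (auto simp: cauchy_seq_def)

lemma cauchyD: "cauchy x \<Longrightarrow> e > 0 \<Longrightarrow> \<exists>N. \<forall>k\<ge>N. \<forall>l\<ge>N. p (x k - x l) < e"
  by (auto simp: cauchy_seq_def)

lemma cauchy_bounded:
  assumes "cauchy x"
  obtains C where "C > 0" "\<And>k. p (x k) \<le> C"
proof -
  obtain N where N: "\<And>k. k \<ge> N \<Longrightarrow> p (x k - x N) < 1"
    using cauchyD[OF assms, of 1] by auto
  define C where "C = Max ((\<lambda>k. p (x k)) ` {..N}) + 1"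
  have le: "p (x k) \<le> C - 1" if "k \<le> N" for k
    unfolding C_def using that by simp
  have "p (x k) \<le> C" for k
  proof (cases "k \<le> N")
    case False
    then have "p (x k) \<le> p (x k - x N) + p (x N)"
      using triangle[of "x k - x N" "x N"] cauchy_in[OF assms] by simp
    then show ?thesis using N[of k] le[of N] False by simp
  qed (use le in force)
  moreover have "C > 0" using le[of 0] nonneg[OF cauchy_in[OF assms, of 0]] by simp
  ultimately show thesis using that by blast
qed

definition null_seq :: "(nat \<Rightarrow> 'm \<Rightarrow>\<^sub>0 complex) \<Rightarrow> bool" where
  "null_seq x \<longleftrightarrow> (\<forall>k. x k \<in> A) \<and> (\<lambda>k. p (x k)) \<longlonglongrightarrow> 0"

lemma null_seq_squeeze:
  assumes "\<And>k. x k \<in> A" "\<And>k. p (x k) \<le> f k" "f \<longlonglongrightarrow> 0"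
  shows "null_seq x"
  unfolding null_seq_def
proof (intro conjI allI)
  show "(\<lambda>k. p (x k)) \<longlonglongrightarrow> 0"
    by (rule tendsto_sandwich[OF _ _ tendsto_const assms(3)])
      (use assms nonneg in \<open>simp_all add: always_eventually\<close>)
qed (rule assms)

lemma null_seq_zero: "null_seq (\<lambda>_. 0)"
  by (simp add: null_seq_def)

lemma null_seq_add:
  assumes "null_seq x" "null_seq y"
  shows "null_seq (\<lambda>k. x k + y k)"
proof (rule null_seq_squeeze)
  show "(\<lambda>k. p (x k) + p (y k)) \<longlonglongrightarrow> 0"
    using tendsto_add[of "\<lambda>k. p (x k)" 0 sequentially "\<lambda>k. p (y k)" 0] assms by (simp add: null_seq_def)
qed (use assms triangle in \<open>auto simp: null_seq_def\<close>)

lemma null_seq_scalar: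
  assumes "null_seq x"
  shows "null_seq (\<lambda>k. scalar c * x k)"
proof (rule null_seq_squeeze)
  show "(\<lambda>k. cmod c * p (x k)) \<longlonglongrightarrow> 0"
    using tendsto_mult_left[of "\<lambda>k. p (x k)" 0 sequentially "cmod c"] assms by (simp add: null_seq_def)
qed (use assms in \<open>auto simp: null_seq_def scale\<close>)

lemma null_seq_uminus: "null_seq x \<Longrightarrow> null_seq (\<lambda>k. - x k)"
  using null_seq_scalar[of x "-1"] by (simp add: scalar_uminus)

lemma null_seq_pstar: "null_seq x \<Longrightarrow> null_seq (\<lambda>k. pstar (x k))"
  by (auto simp: null_seq_def pstar)

lemma null_seq_mult_left:
  assumes x: "null_seq x" and y: "cauchy y"
  shows "null_seq (\<lambda>k. y k * x k)"
proof -
  obtain C where C: "C > 0" "\<And>k. p (y k) \<le> C" by (rule cauchy_bounded[OF y]) blast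
  show ?thesis
  proof (rule null_seq_squeeze)
    fix k
    have xA: "x k \<in> A" using x by (simp add: null_seq_def)
    show "y k * x k \<in> A" using xA cauchy_in[OF y] by auto
    show "p (y k * x k) \<le> C * p (x k)"
      using submult[OF cauchy_in[OF y, of k] xA] mult_right_mono[OF C(2)[of k] nonneg[OF xA]] by linarith
    show "(\<lambda>k. C * p (x k)) \<longlonglongrightarrow> 0"
      using tendsto_mult_left[of "\<lambda>k. p (x k)" 0 sequentially C] x by (simp add: null_seq_def)
  qed
qed

lemma null_seq_mult_right:
  assumes x: "null_seq x" and y: "cauchy y"
  shows "null_seq (\<lambda>k. x k * y k)"
proof -
  obtain C where C: "C > 0" "\<And>k. p (y k) \<le> C" by (rule cauchy_bounded[OF y]) blast
  show ?thesis
  proof (rule null_seq_squeeze)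
    fix k
    have xA: "x k \<in> A" using x by (simp add: null_seq_def)
    show "x k * y k \<in> A" using xA cauchy_in[OF y] by auto
    show "p (x k * y k) \<le> p (x k) * C"
      using submult[OF xA cauchy_in[OF y, of k]] mult_left_mono[OF C(2)[of k] nonneg[OF xA]] by linarith
    show "(\<lambda>k. p (x k) * C) \<longlonglongrightarrow> 0"
      using tendsto_mult_right[of "\<lambda>k. p (x k)" 0 sequentially C] x by (simp add: null_seq_def)
  qed
qed

lemma cauchy_add:
  assumes x: "cauchy x" and y: "cauchy y"
  shows "cauchy (\<lambda>k. x k + y k)"
proof (rule cauchyI)
  fix e :: real assume e: "e > 0"
  obtain N1 where N1: "\<And>k l. k \<ge> N1 \<Longrightarrow> l \<ge> N1 \<Longrightarrow> p (x k - x l) < e / 2"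
    using cauchyD[OF x, of "e/2"] e by auto
  obtain N2 where N2: "\<And>k l. k \<ge> N2 \<Longrightarrow> l \<ge> N2 \<Longrightarrow> p (y k - y l) < e / 2"
    using cauchyD[OF y, of "e/2"] e by auto
  have "p (x k + y k - (x l + y l)) < e" if "k \<ge> max N1 N2" "l \<ge> max N1 N2" for k l
  proof -
    have "p ((x k - x l) + (y k - y l)) \<le> p (x k - x l) + p (y k - y l)"
      using cauchy_in[OF x] cauchy_in[OF y] by (intro triangle closed)
    then show ?thesis using N1[of k l] N2[of k l] that by (simp add: algebra_simps)
  qed
  then show "\<exists>N. \<forall>k\<ge>N. \<forall>l\<ge>N. p (x k + y k - (x l + y l)) < e" by blast
qed (use assms cauchy_in in auto)

lemma cauchy_mult:
  assumes x: "cauchy x" and y: "cauchy y"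
  shows "cauchy (\<lambda>k. x k * y k)"
proof (rule cauchyI)
  fix e :: real assume e: "e > 0"
  obtain C where C: "C > 0" "\<And>k. p (x k) \<le> C" by (rule cauchy_bounded[OF x]) blast
  obtain D where D: "D > 0" "\<And>k. p (y k) \<le> D" by (rule cauchy_bounded[OF y]) blast
  obtain N1 where N1: "\<And>k l. k \<ge> N1 \<Longrightarrow> l \<ge> N1 \<Longrightarrow> p (x k - x l) < e / (2 * D)"
    using cauchyD[OF x, of "e/(2*D)"] e D by auto
  obtain N2 where N2: "\<And>k l. k \<ge> N2 \<Longrightarrow> l \<ge> N2 \<Longrightarrow> p (y k - y l) < e / (2 * C)"
    using cauchyD[OF y, of "e/(2*C)"] e C by auto
  have "p (x k * y k - x l * y l) < e" if kl: "k \<ge> max N1 N2" "l \<ge> max N1 N2" for k l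
  proof -
    have in_A: "x k - x l \<in> A" "y k - y l \<in> A" "x l \<in> A" "y k \<in> A"
      using cauchy_in[OF x] cauchy_in[OF y] by (auto intro: closed)
    have "x k * y k - x l * y l = (x k - x l) * y k + x l * (y k - y l)" by (simp add: algebra_simps)
    then have "p (x k * y k - x l * y l) \<le> p ((x k - x l) * y k) + p (x l * (y k - y l))"
      using in_A triangle[of "(x k - x l) * y k" "x l * (y k - y l)"] by auto
    moreover have "p ((x k - x l) * y k) \<le> p (x k - x l) * D"
      using submult[OF in_A(1,4)] mult_left_mono[OF D(2)[of k] nonneg[OF in_A(1)]] by linarith
    moreover have "p (x l * (y k - y l)) \<le> C * p (y k - y l)"
      using submult[OF in_A(3,2)] mult_right_mono[OF C(2)[of l] nonneg[OF in_A(2)]] by linarith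
    moreover have "p (x k - x l) * D < e / 2"
      using N1[of k l] kl D by (simp add: field_simps)
    moreover have "C * p (y k - y l) < e / 2"
      using N2[of k l] kl C by (simp add: field_simps)
    ultimately show ?thesis by linarith
  qed
  then show "\<exists>N. \<forall>k\<ge>N. \<forall>l\<ge>N. p (x k * y k - x l * y l) < e" by blast
qed (use assms cauchy_in in auto)

lemma cauchy_pstar: "cauchy x \<Longrightarrow> cauchy (\<lambda>k. pstar (x k))"
  by (rule cauchyI) (simp_all add: cauchy_in pstar pstar_minus[symmetric] cauchyD)

lemma cauchy_scalar: "cauchy x \<Longrightarrow> cauchy (\<lambda>k. scalar c * x k)"
  using cauchy_mult[OF cauchy_const[OF monoid_algebra_scalar[OF M]]] .

lemma cauchy_of_null:
  assumes x: "null_seq (\<lambda>k. x k - a)" and a: "a \<in> A"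
  shows "cauchy x"
proof (rule cauchyI)
  have in_A: "x k - a \<in> A" for k using x by (simp add: null_seq_def)
  show "x k \<in> A" for k using monoid_algebra_add[OF in_A[of k] a] by simp
  fix e :: real assume "e > 0"
  then have "eventually (\<lambda>k. p (x k - a) < e / 2) sequentially"
    using x order_tendstoD(2)[of "\<lambda>k. p (x k - a)" 0 sequentially "e / 2"] by (simp add: null_seq_def)
  then obtain N where N: "\<And>k. k \<ge> N \<Longrightarrow> p (x k - a) < e / 2" by (auto simp: eventually_sequentially)
  have "p (x k - x l) < e" if "k \<ge> N" "l \<ge> N" for k l
    using diff[OF in_A[of k] in_A[of l]] N[OF that(1)] N[OF that(2)] by simp
  then show "\<exists>N. \<forall>k\<ge>N. \<forall>l\<ge>N. p (x k - x l) < e" by blast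
qed

lemma mem_cls: "y \<in> cls x \<longleftrightarrow> cauchy y \<and> null_seq (\<lambda>k. y k - x k)" if "cauchy x"
  using that cauchy_in[OF that] by (auto simp: limit_class_def null_seq_def cauchy_in)

lemma null_seq_minus_commute: "null_seq (\<lambda>k. x k - y k) \<Longrightarrow> null_seq (\<lambda>k. y k - x k)"
  using null_seq_uminus[of "\<lambda>k. x k - y k"] by simp

lemma null_seq_minus_trans:
  "null_seq (\<lambda>k. x k - y k) \<Longrightarrow> null_seq (\<lambda>k. y k - z k) \<Longrightarrow> null_seq (\<lambda>k. x k - z k)"
  using null_seq_add[of "\<lambda>k. x k - y k" "\<lambda>k. y k - z k"] by simp

lemma cls_eq_iff:
  assumes x: "cauchy x" and y: "cauchy y"
  shows "cls x = cls y \<longleftrightarrow> null_seq (\<lambda>k. x k - y k)"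
proof
  assume "cls x = cls y"
  moreover have "x \<in> cls x" using x null_seq_zero by (simp add: mem_cls)
  ultimately show "null_seq (\<lambda>k. x k - y k)" using mem_cls[OF y] by blast
next
  assume "null_seq (\<lambda>k. x k - y k)"
  note * = this null_seq_minus_commute[OF this]
  show "cls x = cls y"
    using *[THEN null_seq_minus_trans[rotated]] by (auto simp: mem_cls x y)
qed

text \<open>The operations of the completion go through chosen representatives; these differ from a
  given Cauchy sequence by a null sequence, which makes every operation computable on any
  representative.\<close>

lemma representative_cls:
  assumes "cauchy x"
  shows "cauchy (representative (cls x))" "null_seq (\<lambda>k. representative (cls x) k - x k)"
proof -
  have "x \<in> cls x" using assms null_seq_zero by (simp add: mem_cls)
  then have "representative (cls x) \<in> cls x" unfolding representative_def
    by (rule someI[where P = "\<lambda>z. z \<in> cls x"])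
  then show "cauchy (representative (cls x))" "null_seq (\<lambda>k. representative (cls x) k - x k)"
    using mem_cls[OF assms] by auto
qed

abbreviation "C \<equiv> completion M p"

lemma completion_carrierE:
  assumes "X \<in> carrier C"
  obtains x where "cauchy x" "X = cls x"
  using assms by (auto simp: completion_def)

lemma completion_carrierI: "cauchy x \<Longrightarrow> cls x \<in> carrier C"
  by (auto simp: completion_def)

lemma completion_zero: "\<zero>\<^bsub>C\<^esub> = cls (\<lambda>_. 0)"
  and completion_one: "\<one>\<^bsub>C\<^esub> = cls (\<lambda>_. 1)"
  by (simp_all add: completion_def)

lemma completion_add: "cauchy x \<Longrightarrow> cauchy y \<Longrightarrow> cls x \<oplus>\<^bsub>C\<^esub> cls y = cls (\<lambda>k. x k + y k)"
proof -
  assume x: "cauchy x" and y: "cauchy y"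
  let ?x = "representative (cls x)" and ?y = "representative (cls y)"
  note x' = representative_cls[OF x] and y' = representative_cls[OF y]
  have "null_seq (\<lambda>k. (?x k - x k) + (?y k - y k))" by (rule null_seq_add[OF x'(2) y'(2)])
  then have "cls (\<lambda>k. ?x k + ?y k) = cls (\<lambda>k. x k + y k)"
    by (subst cls_eq_iff[OF cauchy_add[OF x'(1) y'(1)] cauchy_add[OF x y]]) (simp add: algebra_simps)
  then show ?thesis by (simp add: completion_def)
qed

lemma completion_mult: "cauchy x \<Longrightarrow> cauchy y \<Longrightarrow> cls x \<otimes>\<^bsub>C\<^esub> cls y = cls (\<lambda>k. x k * y k)"
proof -
  assume x: "cauchy x" and y: "cauchy y"
  let ?x = "representative (cls x)" and ?y = "representative (cls y)"
  note x' = representative_cls[OF x] and y' = representative_cls[OF y]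
  have "null_seq (\<lambda>k. (?x k - x k) * ?y k + x k * (?y k - y k))"
    by (intro null_seq_add null_seq_mult_left null_seq_mult_right x' y' x)
  then have "cls (\<lambda>k. ?x k * ?y k) = cls (\<lambda>k. x k * y k)"
    by (subst cls_eq_iff[OF cauchy_mult[OF x'(1) y'(1)] cauchy_mult[OF x y]]) (simp add: algebra_simps)
  then show ?thesis by (simp add: completion_def)
qed

lemma completion_smult: "cauchy x \<Longrightarrow> c \<odot>\<^bsub>C\<^esub> cls x = cls (\<lambda>k. scalar c * x k)"
proof -
  assume x: "cauchy x"
  let ?x = "representative (cls x)"
  note x' = representative_cls[OF x]
  have "null_seq (\<lambda>k. scalar c * (?x k - x k))" by (rule null_seq_scalar[OF x'(2)])
  then have "cls (\<lambda>k. scalar c * ?x k) = cls (\<lambda>k. scalar c * x k)"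
    by (subst cls_eq_iff[OF cauchy_scalar[OF x'(1)] cauchy_scalar[OF x]]) (simp add: algebra_simps)
  then show ?thesis by (simp add: completion_def)
qed

lemma completion_star: "cauchy x \<Longrightarrow> star C (cls x) = cls (\<lambda>k. pstar (x k))"
proof -
  assume x: "cauchy x"
  let ?x = "representative (cls x)"
  note x' = representative_cls[OF x]
  have "null_seq (\<lambda>k. pstar (?x k - x k))" by (rule null_seq_pstar[OF x'(2)])
  then have "cls (\<lambda>k. pstar (?x k)) = cls (\<lambda>k. pstar (x k))"
    by (subst cls_eq_iff[OF cauchy_pstar[OF x'(1)] cauchy_pstar[OF x]]) (simp add: pstar_minus)
  then show ?thesis by (simp add: completion_def)
qed

lemma completion_abelian_monoid: "abelian_monoid C"
proof (rule abelian_monoidI)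
  fix X Y Z assume X: "X \<in> carrier C"
  obtain x where x: "cauchy x" "X = cls x" by (rule completion_carrierE[OF X])
  note z0 = cauchy_const[OF monoid_algebra_zero]
  show "\<zero>\<^bsub>C\<^esub> \<oplus>\<^bsub>C\<^esub> X = X" using x z0 by (simp add: completion_zero completion_add)
  assume Y: "Y \<in> carrier C"
  obtain y where y: "cauchy y" "Y = cls y" by (rule completion_carrierE[OF Y])
  show "X \<oplus>\<^bsub>C\<^esub> Y \<in> carrier C" using x y by (simp add: completion_add completion_carrierI cauchy_add)
  show "X \<oplus>\<^bsub>C\<^esub> Y = Y \<oplus>\<^bsub>C\<^esub> X" using x y by (simp add: completion_add add.commute)
  assume Z: "Z \<in> carrier C"
  obtain z where z: "cauchy z" "Z = cls z" by (rule completion_carrierE[OF Z])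
  show "X \<oplus>\<^bsub>C\<^esub> Y \<oplus>\<^bsub>C\<^esub> Z = X \<oplus>\<^bsub>C\<^esub> (Y \<oplus>\<^bsub>C\<^esub> Z)"
    using x y z by (simp add: completion_add cauchy_add add.assoc)
next
  show "\<zero>\<^bsub>C\<^esub> \<in> carrier C"
    using cauchy_const[OF monoid_algebra_zero] by (simp add: completion_zero completion_carrierI)
qed

abbreviation "emb \<equiv> embed M p"

lemma emb_eq_iff: "x \<in> A \<Longrightarrow> y \<in> A \<Longrightarrow> emb x = emb y \<longleftrightarrow> p (x - y) = 0"
  unfolding embed_def using LIMSEQ_unique[of "\<lambda>_. p (x - y)" "p (x - y)" 0]
  by (subst cls_eq_iff) (auto simp: cauchy_const null_seq_def)

lemma emb_in: "x \<in> A \<Longrightarrow> emb x \<in> carrier C"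
  and emb_add: "x \<in> A \<Longrightarrow> y \<in> A \<Longrightarrow> emb x \<oplus>\<^bsub>C\<^esub> emb y = emb (x + y)"
  and emb_mult: "x \<in> A \<Longrightarrow> y \<in> A \<Longrightarrow> emb x \<otimes>\<^bsub>C\<^esub> emb y = emb (x * y)"
  and emb_smult: "x \<in> A \<Longrightarrow> c \<odot>\<^bsub>C\<^esub> emb x = emb (scalar c * x)"
  and emb_star: "x \<in> A \<Longrightarrow> star C (emb x) = emb (pstar x)"
  and emb_zero: "\<zero>\<^bsub>C\<^esub> = emb 0"
  and emb_one: "\<one>\<^bsub>C\<^esub> = emb 1"
  by (simp_all add: embed_def completion_carrierI cauchy_const completion_add completion_mult
      completion_smult completion_star completion_zero completion_one)

lemma emb_finsum:
  assumes "finite I" "\<And>i. i \<in> I \<Longrightarrow> f i \<in> A"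
  shows "finsum C (\<lambda>i. emb (f i)) I = emb (\<Sum>i\<in>I. f i)"
proof -
  interpret C: abelian_monoid C by (rule completion_abelian_monoid)
  show ?thesis using assms
  proof (induction I)
    case (insert i I)
    then have "finsum C (\<lambda>i. emb (f i)) (insert i I) = emb (f i) \<oplus>\<^bsub>C\<^esub> finsum C (\<lambda>i. emb (f i)) I"
      by (intro C.finsum_insert) (auto simp: emb_in)
    then show ?case using insert by (simp add: emb_add closed)
  qed (simp add: emb_zero)
qed

lemma representative_emb:
  assumes "x \<in> A"
  shows "cauchy (representative (emb x))" "null_seq (\<lambda>k. representative (emb x) k - x)"
  using representative_cls[OF cauchy_const[OF assms]] by (simp_all add: embed_def)

end

section \<open>Positive functionals and GNS seminorms\<close>

lemma cnj_mult_nonneg: "cnj c * c \<in> \<real>\<^sub>\<ge>\<^sub>0"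
  by (simp add: complex_nonneg_Reals_iff)

lemma hermitian_of_real_forms:
  assumes "\<And>c. Im (c * g + cnj c * h) = 0"
  shows "h = cnj g"
  using assms[of 1] assms[of \<i>] by (simp add: complex_eq_iff)

text \<open>Test values \<open>c = - l * cnj g\<close>: for positive \<open>b\<close> the optimum is
  \<open>l = 1 / b\<close>, for \<open>b = 0\<close> a large \<open>l\<close> forces
  \<open>g = 0\<close>.\<close>

lemma quadratic_cauchy_schwarz:
  assumes b: "b \<ge> 0" and nonneg: "\<And>c. a + 2 * Re (c * g) + (cmod c)\<^sup>2 * b \<ge> 0"
  shows "(cmod g)\<^sup>2 \<le> a * b"
proof -
  have key: "a - 2 * l * (cmod g)\<^sup>2 + l\<^sup>2 * (cmod g)\<^sup>2 * b \<ge> 0" for l :: real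
  proof -
    have e1: "Re (of_real (- l) * cnj g * g) = - l * (cmod g)\<^sup>2"
      by (simp only: cmod_power2) (simp add: power2_eq_square algebra_simps)
    have e2: "(cmod (of_real (- l) * cnj g))\<^sup>2 = l\<^sup>2 * (cmod g)\<^sup>2"
      by (simp add: norm_mult power_mult_distrib)
    show ?thesis using nonneg[of "of_real (- l) * cnj g"] unfolding e1 e2 by (simp add: mult.assoc)
  qed
  show ?thesis
  proof (cases "b = 0")
    case True
    have "(cmod g)\<^sup>2 \<le> 0"
    proof (rule ccontr)
      assume *: "\<not> (cmod g)\<^sup>2 \<le> 0"
      then show False using key[of "(a + 1) / (2 * (cmod g)\<^sup>2)"] True by simp
    qed
    then show ?thesis using True by simp
  next
    case False
    then have "(cmod g)\<^sup>2 / b \<le> a" using key[of "1 / b"] by (simp add: power2_eq_square)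
    then show ?thesis using False b by (simp add: field_simps)
  qed
qed

definition psd_on :: "'a set \<Rightarrow> ('a \<Rightarrow> 'a \<Rightarrow> complex) \<Rightarrow> bool" where
  "psd_on U G \<longleftrightarrow> (\<forall>f. (\<Sum>u\<in>U. \<Sum>v\<in>U. cnj (f u) * f v * G u v) \<in> \<real>\<^sub>\<ge>\<^sub>0)"

text \<open>Cholesky factorization by induction: with a nonzero diagonal entry at \<open>x\<close>
  the Schur complement \<open>G'\<close> is again positive; with a zero entry the whole row and
  column at \<open>x\<close> vanish.\<close>

lemma psd_on_factorization:
  assumes "finite U" "psd_on U G"
  shows "\<exists>g :: nat \<Rightarrow> 'a \<Rightarrow> complex. \<forall>u\<in>U. \<forall>v\<in>U. G u v = (\<Sum>k<card U. cnj (g k u) * g k v)"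
  using assms
proof (induction U arbitrary: G rule: finite_induct)
  case (insert x U)
  let ?\<alpha> = "G x x"
  have expand: "(\<Sum>u\<in>insert x U. \<Sum>v\<in>insert x U. cnj (f u) * f v * G u v) =
      (\<Sum>u\<in>U. \<Sum>v\<in>U. cnj (f u) * f v * G u v) + cnj (f x) * (\<Sum>v\<in>U. f v * G x v)
      + f x * (\<Sum>u\<in>U. cnj (f u) * G u x) + cnj (f x) * f x * ?\<alpha>" for f
    using insert.hyps by (simp add: sum.distrib sum_distrib_left algebra_simps)
  have psd: "(\<Sum>u\<in>U. \<Sum>v\<in>U. cnj (f u) * f v * G u v) + cnj c * (\<Sum>v\<in>U. f v * G x v)
      + c * (\<Sum>u\<in>U. cnj (f u) * G u x) + cnj c * c * ?\<alpha> \<in> \<real>\<^sub>\<ge>\<^sub>0" for f c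
  proof -
    define f' where "f' = f(x := c)"
    have U: "f' u = f u" if "u \<in> U" for u using insert.hyps that by (auto simp: f'_def)
    have e1: "(\<Sum>u\<in>U. \<Sum>v\<in>U. cnj (f' u) * f' v * G u v) = (\<Sum>u\<in>U. \<Sum>v\<in>U. cnj (f u) * f v * G u v)"
      by (intro sum.cong refl) (simp only: U)
    have e2: "(\<Sum>v\<in>U. f' v * G x v) = (\<Sum>v\<in>U. f v * G x v)"
      by (intro sum.cong refl) (simp only: U)
    have e3: "(\<Sum>u\<in>U. cnj (f' u) * G u x) = (\<Sum>u\<in>U. cnj (f u) * G u x)"
      by (intro sum.cong refl) (simp only: U)
    have e4: "f' x = c" by (simp add: f'_def)
    have "(\<Sum>u\<in>insert x U. \<Sum>v\<in>insert x U. cnj (f' u) * f' v * G u v) \<in> \<real>\<^sub>\<ge>\<^sub>0"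
      using insert.prems unfolding psd_on_def by (rule spec)
    then show ?thesis unfolding expand e1 e2 e3 e4 .
  qed
  have psdU: "psd_on U G" unfolding psd_on_def using psd[of _ 0] by simp
  have \<alpha>: "?\<alpha> \<in> \<real>\<^sub>\<ge>\<^sub>0" using psd[of "\<lambda>_. 0" 1] by simp
  have pair: "G u u + cnj c * G x u + c * G u x + cnj c * c * ?\<alpha> \<in> \<real>\<^sub>\<ge>\<^sub>0" if "u \<in> U" for u c
  proof -
    define f :: "'a \<Rightarrow> complex" where "f v = (if v = u then 1 else 0)" for v
    have "f v * h v = (if v = u then h v else 0)" "cnj (f v) * h v = (if v = u then h v else 0)"
      for v and h :: "'a \<Rightarrow> complex" by (simp_all add: f_def)
    then have d: "(\<Sum>v\<in>U. f v * h v) = h u" "(\<Sum>v\<in>U. cnj (f v) * h v) = h u" for h :: "'a \<Rightarrow> complex"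
      using that insert.hyps(1) by simp_all
    show ?thesis using psd[of f c] unfolding mult.assoc sum_distrib_left[symmetric] d .
  qed
  have herm: "G x u = cnj (G u x)" if "u \<in> U" for u
  proof (rule hermitian_of_real_forms)
    fix c
    have "G u u \<in> \<real>\<^sub>\<ge>\<^sub>0" using pair[OF that, of 0] by simp
    moreover have "cnj c * c * ?\<alpha> \<in> \<real>\<^sub>\<ge>\<^sub>0"
      by (rule nonneg_Reals_mult_I[OF cnj_mult_nonneg \<alpha>])
    ultimately show "Im (c * G u x + cnj c * G x u) = 0"
      using pair[OF that, of c] by (simp only: complex_nonneg_Reals_iff plus_complex.simps) linarith
  qed
  show ?case
  proof (cases "?\<alpha> = 0")
    case True
    have zero: "G u x = 0" if "u \<in> U" for u
    proof -
      have "(cmod (G u x))\<^sup>2 \<le> Re (G u u) * 0"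
      proof (rule quadratic_cauchy_schwarz)
        fix c
        have "Re (cnj c * G x u) = Re (c * G u x)" by (simp add: herm[OF that])
        then show "0 \<le> Re (G u u) + 2 * Re (c * G u x) + (cmod c)\<^sup>2 * 0"
          using pair[OF that, of c] True by (simp only: complex_nonneg_Reals_iff plus_complex.simps) simp
      qed simp
      then show ?thesis by simp
    qed
    obtain g :: "nat \<Rightarrow> 'a \<Rightarrow> complex" where g: "\<forall>u\<in>U. \<forall>v\<in>U. G u v = (\<Sum>k<card U. cnj (g k u) * g k v)"
      using insert.IH[OF psdU] by blast
    show ?thesis
      using g zero herm True insert.hyps
      by (intro exI[of _ "\<lambda>k u. if u = x \<or> k = card U then 0 else g k u"]) (auto intro!: sum.cong)
  next
    case False
    define G' where "G' u v = G u v - G u x * G x v / ?\<alpha>" for u v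
    have \<alpha>': "cnj ?\<alpha> = ?\<alpha>" using \<alpha> by (auto simp: complex_nonneg_Reals_iff complex_eq_iff)
    have "psd_on U G'"
      unfolding psd_on_def
    proof
      fix f
      define s where "s = (\<Sum>v\<in>U. f v * G x v)"
      have cs: "(\<Sum>u\<in>U. cnj (f u) * G u x) = cnj s"
        unfolding s_def cnj_sum by (intro sum.cong refl) (simp add: herm)
      have "(\<Sum>u\<in>U. \<Sum>v\<in>U. cnj (f u) * f v * G' u v) =
          (\<Sum>u\<in>U. \<Sum>v\<in>U. cnj (f u) * f v * G u v) - (\<Sum>u\<in>U. cnj (f u) * G u x) * (\<Sum>v\<in>U. f v * G x v) / ?\<alpha>"
        unfolding sum_product sum_divide_distrib sum_subtractf[symmetric]
        by (intro sum.cong refl) (simp add: G'_def algebra_simps)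
      also have "\<dots> = (\<Sum>u\<in>U. \<Sum>v\<in>U. cnj (f u) * f v * G u v) + cnj (- s / ?\<alpha>) * (\<Sum>v\<in>U. f v * G x v)
        + (- s / ?\<alpha>) * (\<Sum>u\<in>U. cnj (f u) * G u x) + cnj (- s / ?\<alpha>) * (- s / ?\<alpha>) * ?\<alpha>"
        unfolding cs s_def[symmetric] using False by (simp add: \<alpha>' field_simps)
      also have "\<dots> \<in> \<real>\<^sub>\<ge>\<^sub>0" by (rule psd)
      finally show "(\<Sum>u\<in>U. \<Sum>v\<in>U. cnj (f u) * f v * G' u v) \<in> \<real>\<^sub>\<ge>\<^sub>0" .
    qed
    then obtain g :: "nat \<Rightarrow> 'a \<Rightarrow> complex" where
      g: "\<forall>u\<in>U. \<forall>v\<in>U. G' u v = (\<Sum>k<card U. cnj (g k u) * g k v)"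
      using insert.IH by blast
    define r where "r = complex_of_real (sqrt (Re ?\<alpha>))"
    have rr: "r * r = ?\<alpha>" "cnj r = r"
      using \<alpha> by (auto simp: r_def complex_nonneg_Reals_iff complex_eq_iff simp flip: of_real_mult)
    then have r0: "r \<noteq> 0" using False by auto
    define g' where "g' k u = (if k = card U then (if u = x then r else G x u / r) else if u = x then 0 else g k u)" for k u
    have herm': "cnj (G x u) = G u x" if "u \<in> insert x U" for u using herm that \<alpha>' by (cases "u = x") auto
    have "G u v = (\<Sum>k<card (insert x U). cnj (g' k u) * g' k v)" if uv: "u \<in> insert x U" "v \<in> insert x U" for u v
    proof -
      have top: "cnj (g' (card U) u) * g' (card U) v = G u x * G x v / ?\<alpha>"
        using uv r0 herm'[of u] rr by (auto simp: g'_def)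
      have "(\<Sum>k<card U. cnj (g' k u) * g' k v) = G u v - G u x * G x v / ?\<alpha>"
      proof (cases "u = x \<or> v = x")
        case True
        then have "(\<Sum>k<card U. cnj (g' k u) * g' k v) = 0" by (intro sum.neutral) (auto simp: g'_def)
        then show ?thesis using True False by auto
      next
        case neq: False
        then have "(\<Sum>k<card U. cnj (g' k u) * g' k v) = (\<Sum>k<card U. cnj (g k u) * g k v)"
          by (intro sum.cong) (auto simp: g'_def)
        also have "\<dots> = G' u v" using g uv neq by auto
        finally show ?thesis by (simp add: G'_def)
      qed
      then show ?thesis using insert.hyps by (simp add: top)
    qed
    then show ?thesis by blast
  qed
qed simp

text \<open>The Schur product theorem: a factorization of \<open>G\<close> writes the form as a sum
  of forms of \<open>H\<close> alone.\<close>

lemma psd_on_Schur: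
  assumes fin: "finite U" "finite V" and G: "psd_on U G" and H: "psd_on V H"
  shows "psd_on (U \<times> V) (\<lambda>x y. G (fst x) (fst y) * H (snd x) (snd y))"
  unfolding psd_on_def
proof
  fix f
  obtain g :: "nat \<Rightarrow> 'a \<Rightarrow> complex" where g: "\<forall>u\<in>U. \<forall>v\<in>U. G u v = (\<Sum>k<card U. cnj (g k u) * g k v)"
    using psd_on_factorization[OF fin(1) G] by blast
  have "(\<Sum>x\<in>U \<times> V. \<Sum>y\<in>U \<times> V. cnj (f x) * f y * (G (fst x) (fst y) * H (snd x) (snd y))) =
      (\<Sum>x\<in>U \<times> V. \<Sum>y\<in>U \<times> V. \<Sum>k<card U. cnj (f x * g k (fst x)) * (f y * g k (fst y)) * H (snd x) (snd y))"
    using g by (intro sum.cong refl) (auto simp: sum_distrib_left sum_distrib_right mult_ac)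
  also have "\<dots> = (\<Sum>k<card U. \<Sum>x\<in>U \<times> V. \<Sum>y\<in>U \<times> V. cnj (f x * g k (fst x)) * (f y * g k (fst y)) * H (snd x) (snd y))"
    by (rule sum_nested_swap)
  also have "\<dots> \<in> \<real>\<^sub>\<ge>\<^sub>0"
  proof (rule nonneg_Reals_sum)
    fix k
    define h where "h v = (\<Sum>u\<in>U. f (u, v) * g k u)" for v
    have "(\<Sum>x\<in>U \<times> V. \<Sum>y\<in>U \<times> V. cnj (f x * g k (fst x)) * (f y * g k (fst y)) * H (snd x) (snd y)) =
      (\<Sum>u\<in>U. \<Sum>v\<in>V. \<Sum>u'\<in>U. \<Sum>v'\<in>V. cnj (f (u, v) * g k u) * (f (u', v') * g k u') * H v v')"
      by (simp add: sum.cartesian_product')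
    also have "\<dots> = (\<Sum>v\<in>V. \<Sum>u\<in>U. \<Sum>u'\<in>U. \<Sum>v'\<in>V. cnj (f (u, v) * g k u) * (f (u', v') * g k u') * H v v')"
      by (rule sum.swap)
    also have "\<dots> = (\<Sum>v\<in>V. \<Sum>v'\<in>V. \<Sum>u\<in>U. \<Sum>u'\<in>U. cnj (f (u, v) * g k u) * (f (u', v') * g k u') * H v v')"
      by (rule sum.cong[OF refl], rule sum_nested_swap)
    also have "\<dots> = (\<Sum>v\<in>V. \<Sum>v'\<in>V. cnj (h v) * h v' * H v v')"
      unfolding h_def cnj_sum sum_product by (simp only: sum_distrib_right)
    finally show "(\<Sum>x\<in>U \<times> V. \<Sum>y\<in>U \<times> V. cnj (f x * g k (fst x)) * (f y * g k (fst y)) * H (snd x) (snd y)) \<in> \<real>\<^sub>\<ge>\<^sub>0"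
      using H by (simp add: psd_on_def)
  qed
  finally show "(\<Sum>x\<in>U \<times> V. \<Sum>y\<in>U \<times> V. cnj (f x) * f y * (G (fst x) (fst y) * H (snd x) (snd y))) \<in> \<real>\<^sub>\<ge>\<^sub>0" .
qed

definition positive_functional :: "'m::involutive_monoid set \<Rightarrow> ('m \<Rightarrow> complex) \<Rightarrow> bool" where
  "positive_functional M \<mu> \<longleftrightarrow> (\<forall>x\<in>monoid_algebra M. lin \<mu> (pstar x * x) \<in> \<real>\<^sub>\<ge>\<^sub>0)"

text \<open>The length of the vector that \<open>x\<close> defines in the GNS space of
  \<open>\<mu>\<close>.\<close>

definition vnorm :: "('m::involutive_monoid \<Rightarrow> complex) \<Rightarrow> ('m \<Rightarrow>\<^sub>0 complex) \<Rightarrow> real" where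
  "vnorm \<mu> x = sqrt (Re (lin \<mu> (pstar x * x)))"

lemma
  assumes M: "star_submonoid M" and pos: "positive_functional M \<mu>"
    and x: "x \<in> monoid_algebra M" and y: "y \<in> monoid_algebra M"
  shows positive_functional_hermitian: "lin \<mu> (pstar y * x) = cnj (lin \<mu> (pstar x * y))"
    and vnorm_cauchy_schwarz: "cmod (lin \<mu> (pstar x * y)) \<le> vnorm \<mu> x * vnorm \<mu> y"
    and vnorm_triangle: "vnorm \<mu> (x + y) \<le> vnorm \<mu> x + vnorm \<mu> y"
proof -
  let ?F = "\<lambda>x y. lin \<mu> (pstar x * y)"
  have expand: "?F (x + scalar c * y) (x + scalar c * y) =
      ?F x x + c * ?F x y + cnj c * ?F y x + cnj c * c * ?F y y" for c
  proof -
    have "pstar (x + scalar c * y) * (x + scalar c * y) =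
      pstar x * x + scalar c * (pstar x * y) + scalar (cnj c) * (pstar y * x) + scalar (cnj c * c) * (pstar y * y)"
      by (simp add: pstar_add pstar_mult scalar_commute[of _ "cnj c"] algebra_simps scalar_mult
          scalar_left_commute[of "pstar x"] scalar_left_commute[of "pstar y"])
    then show ?thesis by (simp add: lin_add lin_scalar)
  qed
  have F: "?F (x + scalar c * y) (x + scalar c * y) \<in> \<real>\<^sub>\<ge>\<^sub>0" for c
    using pos x y monoid_algebra_mult[OF M monoid_algebra_scalar[OF M] y] unfolding positive_functional_def
    by (blast intro: monoid_algebra_add)
  have xx: "?F x x \<in> \<real>\<^sub>\<ge>\<^sub>0" and yy: "?F y y \<in> \<real>\<^sub>\<ge>\<^sub>0"
    using pos x y unfolding positive_functional_def by auto
  show herm: "?F y x = cnj (?F x y)"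
  proof (rule hermitian_of_real_forms)
    fix c
    have "cnj c * c * ?F y y \<in> \<real>\<^sub>\<ge>\<^sub>0"
      by (rule nonneg_Reals_mult_I[OF cnj_mult_nonneg yy])
    then show "Im (c * ?F x y + cnj c * ?F y x) = 0"
      using F[of c] xx unfolding expand by (simp only: complex_nonneg_Reals_iff plus_complex.simps) linarith
  qed
  have vsq: "(vnorm \<mu> x)\<^sup>2 = Re (?F x x)" "(vnorm \<mu> y)\<^sup>2 = Re (?F y y)"
    using xx yy by (auto simp: vnorm_def complex_nonneg_Reals_iff)
  have vn: "vnorm \<mu> x \<ge> 0" "vnorm \<mu> y \<ge> 0"
    using xx yy by (auto simp: vnorm_def complex_nonneg_Reals_iff)
  have "(cmod (?F x y))\<^sup>2 \<le> Re (?F x x) * Re (?F y y)"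
  proof (rule quadratic_cauchy_schwarz)
    show "0 \<le> Re (?F y y)" using yy by (simp add: complex_nonneg_Reals_iff)
    fix c
    have "Re (cnj c * ?F y x) = Re (c * ?F x y)" by (simp add: herm)
    moreover have "Re (cnj c * c * ?F y y) = (cmod c)\<^sup>2 * Re (?F y y)"
      by (simp only: cmod_power2) (simp add: power2_eq_square algebra_simps)
    ultimately show "0 \<le> Re (?F x x) + 2 * Re (c * ?F x y) + (cmod c)\<^sup>2 * Re (?F y y)"
      using F[of c] unfolding expand by (simp only: complex_nonneg_Reals_iff plus_complex.simps) linarith
  qed
  then have "(cmod (?F x y))\<^sup>2 \<le> (vnorm \<mu> x * vnorm \<mu> y)\<^sup>2" by (simp add: power_mult_distrib vsq)
  then show cs: "cmod (?F x y) \<le> vnorm \<mu> x * vnorm \<mu> y"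
    using vn by (rule_tac power2_le_imp_le) auto
  have "Re (?F (x + y) (x + y)) = Re (?F x x) + 2 * Re (?F x y) + Re (?F y y)"
    using expand[of 1] by (simp add: herm)
  also have "\<dots> \<le> (vnorm \<mu> x + vnorm \<mu> y)\<^sup>2"
    using cs complex_Re_le_cmod[of "?F x y"] by (simp add: power2_sum vsq)
  finally show "vnorm \<mu> (x + y) \<le> vnorm \<mu> x + vnorm \<mu> y"
    unfolding vnorm_def[of \<mu> "x + y"] using vn by (intro real_le_lsqrt) auto
qed

lemma vnorm_scalar: "vnorm \<mu> (scalar c * x) = cmod c * vnorm \<mu> x"
proof -
  have "pstar (scalar c * x) * (scalar c * x) = scalar (cnj c * c) * (pstar x * x)"
    by (simp add: pstar_mult scalar_commute[of _ "cnj c"] mult.assoc scalar_left_commute[of "pstar x"] scalar_scalar)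
  then have "lin \<mu> (pstar (scalar c * x) * (scalar c * x)) = of_real ((cmod c)\<^sup>2) * lin \<mu> (pstar x * x)"
    by (simp add: lin_scalar complex_norm_square mult.commute del: of_real_power)
  then show ?thesis by (simp add: vnorm_def real_sqrt_mult)
qed

text \<open>The norm of \<open>t\<close> in the direct sum of the GNS representations of
  \<open>\<Phi>\<close>, taken over unit vectors of their dense subspaces.\<close>

definition gns_seminorm :: "'m::involutive_monoid set \<Rightarrow> ('m \<Rightarrow> complex) set \<Rightarrow> ('m \<Rightarrow>\<^sub>0 complex) \<Rightarrow> real" where
  "gns_seminorm M \<Phi> t = Sup {vnorm \<mu> (t * y) | \<mu> y. \<mu> \<in> \<Phi> \<and> y \<in> monoid_algebra M \<and> lin \<mu> (pstar y * y) = 1}"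

text \<open>Since monoid elements act contractively, \<open>t\<close> is bounded by the sum of its
  absolute coefficients, so the supremum is finite. The C*-identity comes from applying
  Cauchy-Schwarz to \<open>y\<close> and \<open>pstar t * t * y\<close>.\<close>

lemma
  assumes M: "star_submonoid M" and ne: "\<Phi> \<noteq> {}"
    and pos: "\<And>\<mu>. \<mu> \<in> \<Phi> \<Longrightarrow> positive_functional M \<mu>" and unit: "\<And>\<mu>. \<mu> \<in> \<Phi> \<Longrightarrow> \<mu> 0 = 1"
    and contr: "\<And>\<mu> m y. \<mu> \<in> \<Phi> \<Longrightarrow> m \<in> M \<Longrightarrow> y \<in> monoid_algebra M \<Longrightarrow> vnorm \<mu> (mon m * y) \<le> vnorm \<mu> y"
  shows gns_seminorm_cstar: "cstar_seminorm M (gns_seminorm M \<Phi>)"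
    and gns_seminorm_bound: "\<mu> \<in> \<Phi> \<Longrightarrow> t \<in> monoid_algebra M \<Longrightarrow> y \<in> monoid_algebra M \<Longrightarrow>
      vnorm \<mu> (t * y) \<le> gns_seminorm M \<Phi> t * vnorm \<mu> y"
    and gns_seminorm_least: "t \<in> monoid_algebra M \<Longrightarrow>
      (\<And>\<mu> y. \<mu> \<in> \<Phi> \<Longrightarrow> y \<in> monoid_algebra M \<Longrightarrow> vnorm \<mu> (t * y) \<le> c * vnorm \<mu> y) \<Longrightarrow> gns_seminorm M \<Phi> t \<le> c"
proof -
  let ?N = "gns_seminorm M \<Phi>" and ?A = "monoid_algebra M"
  note [simp] = monoid_algebra_mult[OF M] monoid_algebra_one[OF M] monoid_algebra_scalar[OF M]
    monoid_algebra_pstar[OF M] monoid_algebra_add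
  have vn: "vnorm \<mu> x \<ge> 0" if "\<mu> \<in> \<Phi>" "x \<in> ?A" for \<mu> x
    using pos[OF that(1)] that(2) by (auto simp: vnorm_def positive_functional_def complex_nonneg_Reals_iff)
  have vnorm1: "vnorm \<mu> y = 1" if "lin \<mu> (pstar y * y) = 1" for \<mu> :: "'a \<Rightarrow> complex" and y using that by (simp add: vnorm_def)
  have bounded: "vnorm \<mu> (t * y) \<le> (\<Sum>m\<in>Poly_Mapping.keys t. cmod (Poly_Mapping.lookup t m)) * vnorm \<mu> y"
    if \<mu>: "\<mu> \<in> \<Phi>" and t: "t \<in> ?A" and y: "y \<in> ?A" for \<mu> t y
  proof -
    have in_A: "mon m \<in> ?A" if "m \<in> Poly_Mapping.keys t" for m
      using keys_monoid_algebra[OF t that] by (rule monoid_algebra_single)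
    have "vnorm \<mu> (\<Sum>m\<in>K. scalar (c m) * (mon m * y)) \<le> (\<Sum>m\<in>K. cmod (c m)) * vnorm \<mu> y"
      if "K \<subseteq> Poly_Mapping.keys t" for K c
      using finite_subset[OF that finite_keys] that
    proof (induction K rule: finite_induct)
      case (insert m K)
      have K: "(\<Sum>m\<in>K. scalar (c m) * (mon m * y)) \<in> ?A"
        using insert in_A y by (intro monoid_algebra_sum) auto
      have m: "mon m \<in> ?A" "m \<in> M" using insert in_A keys_monoid_algebra[OF t] by auto
      have "vnorm \<mu> (scalar (c m) * (mon m * y) + (\<Sum>m\<in>K. scalar (c m) * (mon m * y))) \<le>
        vnorm \<mu> (scalar (c m) * (mon m * y)) + vnorm \<mu> (\<Sum>m\<in>K. scalar (c m) * (mon m * y))"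
        using K m y by (intro vnorm_triangle[OF M pos[OF \<mu>]]) auto
      also have "\<dots> \<le> cmod (c m) * vnorm \<mu> y + (\<Sum>m\<in>K. cmod (c m)) * vnorm \<mu> y"
        using insert contr[OF \<mu> m(2) y] by (intro add_mono) (auto simp: vnorm_scalar mult_left_mono)
      finally show ?case using insert.hyps by (simp add: distrib_right)
    qed (simp add: vnorm_def)
    from this[OF subset_refl, of "Poly_Mapping.lookup t"]
    have "vnorm \<mu> ((\<Sum>m\<in>Poly_Mapping.keys t. scalar (Poly_Mapping.lookup t m) * mon m) * y) \<le>
      (\<Sum>m\<in>Poly_Mapping.keys t. cmod (Poly_Mapping.lookup t m)) * vnorm \<mu> y"
      by (simp add: sum_distrib_right mult.assoc)
    then show ?thesis by (simp add: scalar_single flip: poly_mapping_expand)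
  qed
  have one: "lin \<mu> (pstar 1 * 1) = 1" if "\<mu> \<in> \<Phi>" for \<mu>
    using unit[OF that] lin_single[of \<mu> 0 1] by simp
  have upper: "vnorm \<mu> (t * y) \<le> ?N t" if "\<mu> \<in> \<Phi>" "t \<in> ?A" "y \<in> ?A" "lin \<mu> (pstar y * y) = 1" for \<mu> t y
    unfolding gns_seminorm_def
  proof (rule cSup_upper)
    show "bdd_above {vnorm \<mu> (t * y) |\<mu> y. \<mu> \<in> \<Phi> \<and> y \<in> ?A \<and> lin \<mu> (pstar y * y) = 1}"
    proof (rule bdd_aboveI)
      fix z assume "z \<in> {vnorm \<mu> (t * y) |\<mu> y. \<mu> \<in> \<Phi> \<and> y \<in> ?A \<and> lin \<mu> (pstar y * y) = 1}"
      then obtain \<mu> y where "z = vnorm \<mu> (t * y)" "\<mu> \<in> \<Phi>" "y \<in> ?A" "lin \<mu> (pstar y * y) = 1" by blast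
      then show "z \<le> (\<Sum>m\<in>Poly_Mapping.keys t. cmod (Poly_Mapping.lookup t m)) * 1"
        using bounded[of \<mu> t y] that(2) vnorm1[of \<mu> y] by simp
    qed
  qed (use that in blast)
  have least: "?N t \<le> c" if "\<And>\<mu> y. \<mu> \<in> \<Phi> \<Longrightarrow> y \<in> ?A \<Longrightarrow> vnorm \<mu> (t * y) \<le> c * vnorm \<mu> y" for t c
    unfolding gns_seminorm_def
  proof (rule cSup_least)
    obtain \<mu> where "\<mu> \<in> \<Phi>" using ne by blast
    then show "{vnorm \<mu> (t * y) |\<mu> y. \<mu> \<in> \<Phi> \<and> y \<in> ?A \<and> lin \<mu> (pstar y * y) = 1} \<noteq> {}"
      using one by (auto intro!: exI[of _ \<mu>] exI[of _ 1] simp del: pstar_one)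
    fix z assume "z \<in> {vnorm \<mu> (t * y) |\<mu> y. \<mu> \<in> \<Phi> \<and> y \<in> ?A \<and> lin \<mu> (pstar y * y) = 1}"
    then obtain \<mu> y where "z = vnorm \<mu> (t * y)" "\<mu> \<in> \<Phi>" "y \<in> ?A" "lin \<mu> (pstar y * y) = 1" by blast
    then show "z \<le> c" using that[of \<mu> y] vnorm1[of \<mu> y] by simp
  qed
  then show "?N t \<le> c" if "t \<in> ?A" "\<And>\<mu> y. \<mu> \<in> \<Phi> \<Longrightarrow> y \<in> ?A \<Longrightarrow> vnorm \<mu> (t * y) \<le> c * vnorm \<mu> y"
    using that by blast
  have bound: "vnorm \<mu> (t * y) \<le> ?N t * vnorm \<mu> y" if "\<mu> \<in> \<Phi>" "t \<in> ?A" "y \<in> ?A" for \<mu> t y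
  proof (cases "vnorm \<mu> y = 0")
    case True
    then show ?thesis using bounded[OF that] by simp
  next
    case False
    define r where "r = vnorm \<mu> y"
    have r: "r > 0" using False vn[OF that(1,3)] by (simp add: r_def)
    define y' where "y' = scalar (of_real (1 / r)) * y"
    have y': "y' \<in> ?A" "vnorm \<mu> y' = 1" using that r by (auto simp: y'_def vnorm_scalar r_def norm_divide)
    have "lin \<mu> (pstar y' * y') \<in> \<real>\<^sub>\<ge>\<^sub>0"
      using pos[OF that(1)] y'(1) by (simp add: positive_functional_def)
    then have "lin \<mu> (pstar y' * y') = 1"
      using y'(2) by (auto simp: vnorm_def complex_nonneg_Reals_iff complex_eq_iff)
    from upper[OF that(1,2) y'(1) this] have "vnorm \<mu> (scalar (of_real (1 / r)) * (t * y)) \<le> ?N t"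
      by (simp only: y'_def scalar_left_commute)
    then have "vnorm \<mu> (t * y) / r \<le> ?N t" using r by (simp add: vnorm_scalar norm_divide)
    then show ?thesis using r by (simp add: field_simps flip: r_def)
  qed
  then show "\<mu> \<in> \<Phi> \<Longrightarrow> t \<in> ?A \<Longrightarrow> y \<in> ?A \<Longrightarrow> vnorm \<mu> (t * y) \<le> ?N t * vnorm \<mu> y" for \<mu> t y .
  have N0: "?N t \<ge> 0" if "t \<in> ?A" for t
  proof -
    obtain \<mu> where \<mu>: "\<mu> \<in> \<Phi>" using ne by blast
    have "vnorm \<mu> (t * 1) \<le> ?N t" using that one[OF \<mu>] by (intro upper \<mu>) simp_all
    then show ?thesis using vn[OF \<mu> that] by simp
  qed
  have scale_le: "?N (scalar c * t) \<le> cmod c * ?N t" if "t \<in> ?A" for c t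
    using bound that by (intro least) (auto simp: mult.assoc vnorm_scalar intro!: mult_left_mono)
  have mult: "?N (s * t) \<le> ?N s * ?N t" if "s \<in> ?A" "t \<in> ?A" for s t
  proof (rule least)
    fix \<mu> y assume \<mu>: "\<mu> \<in> \<Phi>" and y: "y \<in> ?A"
    have "vnorm \<mu> (s * t * y) \<le> ?N s * vnorm \<mu> (t * y)" using bound[OF \<mu> that(1), of "t * y"] that y by (simp add: mult.assoc)
    also have "\<dots> \<le> ?N s * (?N t * vnorm \<mu> y)" using bound[OF \<mu> that(2) y] N0[OF that(1)] by (rule mult_left_mono)
    finally show "vnorm \<mu> (s * t * y) \<le> ?N s * ?N t * vnorm \<mu> y" by (simp add: mult.assoc)
  qed
  have sq: "(?N t)\<^sup>2 \<le> ?N (pstar t * t)" if t: "t \<in> ?A" for t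
  proof -
    have "?N t \<le> sqrt (?N (pstar t * t))"
    proof (rule least)
      fix \<mu> y assume \<mu>: "\<mu> \<in> \<Phi>" and y: "y \<in> ?A"
      have tt: "pstar t * t \<in> ?A" using t by simp
      have "Re (lin \<mu> (pstar (t * y) * (t * y))) = Re (lin \<mu> (pstar y * (pstar t * t * y)))"
        by (simp add: pstar_mult mult.assoc)
      also have "\<dots> \<le> vnorm \<mu> y * vnorm \<mu> (pstar t * t * y)"
        using vnorm_cauchy_schwarz[OF M pos[OF \<mu>] y, of "pstar t * t * y"] t y
          complex_Re_le_cmod[of "lin \<mu> (pstar y * (pstar t * t * y))"] by simp
      also have "\<dots> \<le> vnorm \<mu> y * (?N (pstar t * t) * vnorm \<mu> y)"
        using bound[OF \<mu> tt y] vn[OF \<mu> y] by (rule mult_left_mono)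
      also have "\<dots> = (sqrt (?N (pstar t * t)) * vnorm \<mu> y)\<^sup>2"
        using N0[OF tt] by (simp add: power2_eq_square mult_ac)
      finally show "vnorm \<mu> (t * y) \<le> sqrt (?N (pstar t * t)) * vnorm \<mu> y"
        unfolding vnorm_def[of \<mu> "t * y"] using vn[OF \<mu> y] N0[OF tt] by (intro real_le_lsqrt) auto
    qed
    then have "(?N t)\<^sup>2 \<le> (sqrt (?N (pstar t * t)))\<^sup>2" using N0[OF t] by (rule power_mono)
    then show ?thesis using N0 t by simp
  qed
  have star_le: "?N t \<le> ?N (pstar t)" if t: "t \<in> ?A" for t
  proof (cases "?N t = 0")
    case True
    then show ?thesis using N0 t by simp
  next
    case False
    have "?N t * ?N t \<le> ?N (pstar t) * ?N t"
      using sq[OF t] mult[of "pstar t" t] t by (simp add: power2_eq_square)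
    then show ?thesis using False N0[OF t] by (simp add: mult_le_cancel_right)
  qed
  show "cstar_seminorm M ?N"
    unfolding cstar_seminorm_def
  proof (intro conjI ballI allI)
    fix t assume t: "t \<in> ?A"
    show "0 \<le> ?N t" using t by (rule N0)
    show "?N (scalar c * t) = cmod c * ?N t" for c
    proof (cases "c = 0")
      case True
      then show ?thesis using scale_le[OF t, of 0] N0[of 0] by simp
    next
      case False
      have "?N t = ?N (scalar (inverse c) * (scalar c * t))" using False by (simp add: scalar_scalar)
      also have "\<dots> \<le> cmod (inverse c) * ?N (scalar c * t)" using t by (intro scale_le) simp
      finally have "cmod c * ?N t \<le> cmod c * (cmod (inverse c) * ?N (scalar c * t))"
        by (rule mult_left_mono) simp
      also have "\<dots> = ?N (scalar c * t)" using False by (simp add: norm_inverse)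
      finally show ?thesis using scale_le[OF t, of c] by simp
    qed
    show "?N (pstar t * t) = (?N t)\<^sup>2"
    proof (rule antisym)
      have "?N (pstar t * t) \<le> ?N (pstar t) * ?N t" using t by (intro mult) simp_all
      also have "\<dots> \<le> ?N t * ?N t"
        using star_le[of "pstar t"] t N0[OF t] by (intro mult_right_mono) auto
      finally show "?N (pstar t * t) \<le> (?N t)\<^sup>2" by (simp add: power2_eq_square)
    qed (rule sq[OF t])
    fix s assume s: "s \<in> ?A"
    show "?N (t * s) \<le> ?N t * ?N s" using t s by (rule mult)
    show "?N (t + s) \<le> ?N t + ?N s"
    proof (rule least)
      fix \<mu> y assume \<mu>: "\<mu> \<in> \<Phi>" and y: "y \<in> ?A"
      have "vnorm \<mu> (t * y + s * y) \<le> vnorm \<mu> (t * y) + vnorm \<mu> (s * y)"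
        using t s y by (intro vnorm_triangle[OF M pos[OF \<mu>]]) simp_all
      then show "vnorm \<mu> ((t + s) * y) \<le> (?N t + ?N s) * vnorm \<mu> y"
        using bound[OF \<mu> t y] bound[OF \<mu> s y] by (simp add: distrib_right)
    qed
  qed
qed

section \<open>Slices of the comultiplication\<close>

lemma alg_tensor_eq:
  assumes "finite K" "finite L" "Poly_Mapping.keys x \<subseteq> K" "Poly_Mapping.keys y \<subseteq> L"
  shows "alg_tensor x y = (\<Sum>u\<in>K. \<Sum>v\<in>L.
     Poly_Mapping.single (u, v) (Poly_Mapping.lookup x u * Poly_Mapping.lookup y v))"
proof -
  have "alg_tensor x y = (\<Sum>u\<in>Poly_Mapping.keys x. \<Sum>v\<in>L.
     Poly_Mapping.single (u, v) (Poly_Mapping.lookup x u * Poly_Mapping.lookup y v))"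
    unfolding alg_tensor_def using assms
    by (intro sum.cong refl sum.mono_neutral_left) (auto simp: in_keys_iff)
  also have "\<dots> = (\<Sum>u\<in>K. \<Sum>v\<in>L.
     Poly_Mapping.single (u, v) (Poly_Mapping.lookup x u * Poly_Mapping.lookup y v))"
    using assms by (intro sum.mono_neutral_left) (auto simp: in_keys_iff)
  finally show ?thesis .
qed

lemma alg_tensor_single:
  "alg_tensor (Poly_Mapping.single u c) (Poly_Mapping.single v d) = Poly_Mapping.single (u, v) (c * d)"
  by (subst alg_tensor_eq[of "{u}" "{v}"]) (auto simp: keys_single)

lemma alg_tensor_zero [simp]: "alg_tensor 0 y = 0" "alg_tensor x 0 = 0"
  by (simp_all add: alg_tensor_def)

lemma alg_tensor_add_left: "alg_tensor (x + x') y = alg_tensor x y + alg_tensor x' y"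
  using keys_add[of x x']
  by (simp add: alg_tensor_eq[of "Poly_Mapping.keys x \<union> Poly_Mapping.keys x'" "Poly_Mapping.keys y"]
      lookup_add distrib_right single_add sum.distrib)

lemma alg_tensor_add_right: "alg_tensor x (y + y') = alg_tensor x y + alg_tensor x y'"
  using keys_add[of y y']
  by (simp add: alg_tensor_eq[of "Poly_Mapping.keys x" "Poly_Mapping.keys y \<union> Poly_Mapping.keys y'"]
      lookup_add distrib_left single_add sum.distrib)

lemma alg_tensor_mult: "alg_tensor x y * alg_tensor x' y' = alg_tensor (x * x') (y * y')"
proof (rule poly_mapping_additive_eqI[where x = x])
  fix u c
  show "alg_tensor (Poly_Mapping.single u c) y * alg_tensor x' y' = alg_tensor (Poly_Mapping.single u c * x') (y * y')"
  proof (rule poly_mapping_additive_eqI[where x = y])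
    fix v d
    show "alg_tensor (Poly_Mapping.single u c) (Poly_Mapping.single v d) * alg_tensor x' y' =
      alg_tensor (Poly_Mapping.single u c * x') (Poly_Mapping.single v d * y')"
    proof (rule poly_mapping_additive_eqI[where x = x'])
      fix u' c'
      show "alg_tensor (Poly_Mapping.single u c) (Poly_Mapping.single v d) * alg_tensor (Poly_Mapping.single u' c') y' =
        alg_tensor (Poly_Mapping.single u c * Poly_Mapping.single u' c') (Poly_Mapping.single v d * y')"
        by (rule poly_mapping_additive_eqI[where x = y'])
          (simp_all add: alg_tensor_add_right distrib_left alg_tensor_single mult_single plus_prod_def mult_ac)
    qed (simp_all add: alg_tensor_add_left distrib_left)
  qed (simp_all add: alg_tensor_add_right distrib_left distrib_right)
qed (simp_all add: alg_tensor_add_left distrib_left distrib_right)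

lemma pstar_alg_tensor: "pstar (alg_tensor x y) = alg_tensor (pstar x) (pstar y)"
proof (rule poly_mapping_additive_eqI[where x = x])
  fix u c
  show "pstar (alg_tensor (Poly_Mapping.single u c) y) = alg_tensor (pstar (Poly_Mapping.single u c)) (pstar y)"
    by (rule poly_mapping_additive_eqI[where x = y])
      (simp_all add: alg_tensor_add_right alg_tensor_single pstar_add pstar_single invol_prod_def)
qed (simp_all add: alg_tensor_add_left pstar_add)

lemma alg_tensor_one [simp]: "alg_tensor 1 1 = 1"
  using alg_tensor_single[of 0 1 0 1] by (simp flip: zero_prod_def)

lemma alg_tensor_diff:
  "alg_tensor (x - x') y = alg_tensor x y - alg_tensor x' y" "alg_tensor x (y - y') = alg_tensor x y - alg_tensor x y'"
  using alg_tensor_add_left[of "x - x'" x' y] alg_tensor_add_right[of x "y - y'" y'] by (simp_all add: eq_diff_eq)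

lemma alg_tensor_in: "x \<in> monoid_algebra M \<Longrightarrow> y \<in> monoid_algebra N \<Longrightarrow> alg_tensor x y \<in> monoid_algebra (M \<times> N)"
  unfolding alg_tensor_def by (intro monoid_algebra_sum monoid_algebra_single) (auto simp: monoid_algebra_def)

definition tensor_functional :: "('m \<Rightarrow> complex) \<Rightarrow> ('m \<Rightarrow> complex) \<Rightarrow> 'm \<times> 'm \<Rightarrow> complex" where
  "tensor_functional \<mu> \<nu> = (\<lambda>(u, v). \<mu> u * \<nu> v)"

lemma lin_tensor: "lin (tensor_functional \<mu> \<nu>) (alg_tensor x y) = lin \<mu> x * lin \<nu> y"
proof (rule poly_mapping_additive_eqI[where x = x])
  fix u c
  show "lin (tensor_functional \<mu> \<nu>) (alg_tensor (Poly_Mapping.single u c) y) = lin \<mu> (Poly_Mapping.single u c) * lin \<nu> y"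
    by (rule poly_mapping_additive_eqI[where x = y])
      (simp_all add: alg_tensor_add_right alg_tensor_single lin_add distrib_left tensor_functional_def)
qed (simp_all add: alg_tensor_add_left lin_add distrib_right)

lemma lin_pstar_mult:
  fixes x :: "'m::involutive_monoid \<Rightarrow>\<^sub>0 complex"
  assumes K: "finite K" "Poly_Mapping.keys x \<subseteq> K"
  shows "lin \<mu> (pstar x * x) =
    (\<Sum>u\<in>K. \<Sum>v\<in>K. cnj (Poly_Mapping.lookup x u) * Poly_Mapping.lookup x v * \<mu> (invol u + v))"
proof -
  have x: "x = (\<Sum>u\<in>K. Poly_Mapping.single u (Poly_Mapping.lookup x u))"
    by (subst poly_mapping_expand) (use K in \<open>auto intro!: sum.mono_neutral_left simp: in_keys_iff\<close>)
  have "lin \<mu> (pstar x * x) = lin \<mu> (pstar (\<Sum>u\<in>K. Poly_Mapping.single u (Poly_Mapping.lookup x u)) *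
      (\<Sum>u\<in>K. Poly_Mapping.single u (Poly_Mapping.lookup x u)))" using x by simp
  then show ?thesis by (simp add: pstar_sum pstar_single sum_product mult_single lin_sum)
qed

lemma positive_functional_psd:
  fixes M :: "'m::involutive_monoid set"
  assumes "positive_functional M \<mu>" "finite U" "U \<subseteq> M"
  shows "psd_on U (\<lambda>u v. \<mu> (invol u + v))"
  unfolding psd_on_def
proof
  fix f :: "'m \<Rightarrow> complex"
  define x where "x = (\<Sum>u\<in>U. Poly_Mapping.single u (f u))"
  have l: "Poly_Mapping.lookup x u = (if u \<in> U then f u else 0)" for u
    using assms(2) by (simp add: x_def lookup_sum lookup_single when_def)
  then have keys: "Poly_Mapping.keys x \<subseteq> U" by (auto simp: in_keys_iff split: if_splits)
  have "lin \<mu> (pstar x * x) \<in> \<real>\<^sub>\<ge>\<^sub>0"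
    using assms keys by (auto simp: positive_functional_def monoid_algebra_def)
  then show "(\<Sum>u\<in>U. \<Sum>v\<in>U. cnj (f u) * f v * \<mu> (invol u + v)) \<in> \<real>\<^sub>\<ge>\<^sub>0"
    unfolding lin_pstar_mult[OF assms(2) keys] by (simp add: l cong: sum.cong)
qed

text \<open>The Gram matrix of a product functional is the Schur product of the two Gram
  matrices.\<close>

lemma positive_functional_tensor:
  assumes "positive_functional M \<mu>" "positive_functional N \<nu>"
  shows "positive_functional (M \<times> N) (tensor_functional \<mu> \<nu>)"
  unfolding positive_functional_def
proof
  fix t assume t: "t \<in> monoid_algebra (M \<times> N)"
  let ?U = "fst ` Poly_Mapping.keys t" and ?V = "snd ` Poly_Mapping.keys t"
  have keys: "Poly_Mapping.keys t \<subseteq> ?U \<times> ?V" by force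
  have "?U \<subseteq> M" "?V \<subseteq> N" using t by (auto simp: monoid_algebra_def)
  then have "psd_on (?U \<times> ?V) (\<lambda>x y. \<mu> (invol (fst x) + fst y) * \<nu> (invol (snd x) + snd y))"
    using assms by (intro psd_on_Schur positive_functional_psd) auto
  then show "lin (tensor_functional \<mu> \<nu>) (pstar t * t) \<in> \<real>\<^sub>\<ge>\<^sub>0"
    unfolding lin_pstar_mult[OF _ keys, simplified] psd_on_def
    by (simp add: tensor_functional_def plus_prod_def invol_prod_def split_def)
qed

text \<open>In a GNS space on which the generating matrices act as unitaries, their columns are isometries,
  so that every word acts as a contraction.\<close>

lemma column_contraction:
  fixes T :: "free_alg \<Rightarrow> ('m::involutive_monoid \<Rightarrow>\<^sub>0 complex)"
  assumes N: "star_submonoid N" and pos: "positive_functional N \<nu>"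
    and T_add: "\<And>x y. T (x + y) = T x + T y" and T_mult: "\<And>x y. T (x * y) = T x * T y"
    and T_star: "\<And>x. T (pstar x) = pstar (T x)" and T_one: "T 1 = 1" and T_zero: "T 0 = 0"
    and T_in: "\<And>x. x \<in> monoid_algebra (words n) \<Longrightarrow> T x \<in> monoid_algebra N"
    and null: "\<And>j e y. j \<in> {1..n} \<Longrightarrow> y \<in> monoid_algebra N \<Longrightarrow>
      lin \<nu> (pstar y * T ((\<Sum>k=1..n. letter k j (\<not> e) * letter k j e) - 1) * y) = 0"
    and m: "m \<in> words n" and y: "y \<in> monoid_algebra N"
  shows "vnorm \<nu> (T (mon m) * y) \<le> vnorm \<nu> y"
proof -
  have T_sum: "T (\<Sum>i\<in>I. f i) = (\<Sum>i\<in>I. T (f i))" for I and f :: "nat \<Rightarrow> free_alg"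
    by (induction I rule: infinite_finite_induct) (auto simp: T_add T_zero)
  have T_diff: "T (x - y) = T x - T y" for x y using T_add[of "x - y" y] by simp
  have letter: "vnorm \<nu> (T (letter i j e) * y) \<le> vnorm \<nu> y" if ij: "i \<in> {1..n}" "j \<in> {1..n}" and y: "y \<in> monoid_algebra N" for i j e y
  proof -
    let ?L = "\<lambda>k. letter k j e"
    have in_A: "?L k \<in> monoid_algebra (words n)" if "k \<in> {1..n}" for k using letter_in that ij by auto
    define r where "r = (\<Sum>k=1..n. pstar (?L k) * ?L k) - 1"
    have nn: "lin \<nu> (pstar (T (?L k) * y) * (T (?L k) * y)) \<in> \<real>\<^sub>\<ge>\<^sub>0" if "k \<in> {1..n}" for k
      using pos monoid_algebra_mult[OF N T_in[OF in_A[OF that]] y] unfolding positive_functional_def by blast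
    have "(\<Sum>k=1..n. lin \<nu> (pstar (T (?L k) * y) * (T (?L k) * y))) = lin \<nu> (pstar y * T (\<Sum>k=1..n. pstar (?L k) * ?L k) * y)"
      by (simp add: T_sum T_mult T_star pstar_mult sum_distrib_left sum_distrib_right lin_sum mult.assoc)
    also have "pstar y * T (\<Sum>k=1..n. pstar (?L k) * ?L k) * y = pstar y * y + pstar y * T r * y"
      by (simp add: r_def T_diff T_one algebra_simps)
    also have "lin \<nu> \<dots> = lin \<nu> (pstar y * y)"
      using null[OF ij(2) y, of e] by (simp add: lin_add r_def pstar_letter)
    finally have sum: "(\<Sum>k=1..n. Re (lin \<nu> (pstar (T (?L k) * y) * (T (?L k) * y)))) = Re (lin \<nu> (pstar y * y))"
      by (metis Re_sum)
    have "Re (lin \<nu> (pstar (T (?L i) * y) * (T (?L i) * y))) \<le> (\<Sum>k=1..n. Re (lin \<nu> (pstar (T (?L k) * y) * (T (?L k) * y))))"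
      using ij nn by (intro member_le_sum) (auto simp: complex_nonneg_Reals_iff)
    then show ?thesis unfolding sum vnorm_def by (rule real_sqrt_le_mono)
  qed
  have "vnorm \<nu> (T (mon (Word l)) * y) \<le> vnorm \<nu> y" if "Word l \<in> words n" for l
    using that
  proof (induction l)
    case Nil
    then show ?case by (simp add: T_one flip: zero_word_def)
  next
    case (Cons a l)
    obtain i j e where a: "a = ((i, j), e)" by (metis prod.exhaust)
    have ij: "i \<in> {1..n}" "j \<in> {1..n}" and l: "Word l \<in> words n" using Cons.prems by (auto simp: words_def a)
    have "mon (Word (a # l)) = letter i j e * mon (Word l)"
      by (simp add: letter_def a mult_single plus_word_def)
    then have "vnorm \<nu> (T (mon (Word (a # l))) * y) = vnorm \<nu> (T (letter i j e) * (T (mon (Word l)) * y))"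
      by (simp add: T_mult mult.assoc)
    also have "\<dots> \<le> vnorm \<nu> (T (mon (Word l)) * y)"
      using l y by (intro letter[OF ij] monoid_algebra_mult[OF N] T_in monoid_algebra_single)
    also have "\<dots> \<le> vnorm \<nu> y" by (rule Cons.IH[OF l])
    finally show ?case .
  qed
  then show ?thesis using m by (cases m) simp
qed

text \<open>Treats both quantum groups at once: \<open>p\<close> is the largest C*-seminorm that
  kills the relators \<open>R\<close>, and \<open>al\<close> lists the star tags of the unitarity
  relations.\<close>

locale unitary_algebra =
  fixes n :: nat and p :: "free_alg \<Rightarrow> real" and R :: "free_alg set" and al :: "bool \<Rightarrow> bool \<Rightarrow> bool"
  assumes p_cstar: "cstar_seminorm (words n) p"
    and rel: "unitary_relations n al p" and al: "\<And>e. al e (\<not> e)"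
    and R_null: "\<And>r. r \<in> R \<Longrightarrow> p r = 0"
    and R_in: "R \<subseteq> monoid_algebra (words n)"
    and greatest: "\<And>q x. cstar_seminorm (words n) q \<Longrightarrow> \<forall>r\<in>R. q r = 0 \<Longrightarrow> x \<in> monoid_algebra (words n) \<Longrightarrow> q x \<le> p x"
begin

sublocale cstar_seminormed "words n" p
  using p_cstar star_submonoid_words by unfold_locales

abbreviation "T1 x \<equiv> alg_tensor x (1 :: free_alg)"
abbreviation "T2 x \<equiv> alg_tensor (1 :: free_alg) x"
abbreviation "MM \<equiv> words n \<times> words n"
abbreviation "AA \<equiv> monoid_algebra MM"

lemma MM: "star_submonoid MM"
  by (intro star_submonoid_Times M)

definition restrict_state :: "(elem \<Rightarrow> complex) \<Rightarrow> (nat \<times> nat) word \<Rightarrow> complex" where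
  "restrict_state \<phi> m = \<phi> (emb (mon m))"

lemma lin_restrict_state:
  assumes \<phi>: "state C \<phi>" and x: "x \<in> A"
  shows "lin (restrict_state \<phi>) x = \<phi> (emb x)"
proof -
  have add: "\<phi> (emb (a + b)) = \<phi> (emb a) + \<phi> (emb b)" if "a \<in> A" "b \<in> A" for a b
    using \<phi> that emb_in emb_add[OF that] unfolding state_def by metis
  have sc: "\<phi> (emb (scalar c * a)) = c * \<phi> (emb a)" if "a \<in> A" for a c
    using \<phi> that emb_in emb_smult[OF that, of c] unfolding state_def by metis
  have zero: "\<phi> (emb 0) = 0" using sc[of 0 0] by simp
  have "\<phi> (emb (\<Sum>m\<in>K. scalar (c m) * mon m)) = (\<Sum>m\<in>K. c m * restrict_state \<phi> m)"
    if "finite K" "K \<subseteq> words n" for K c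
    using that
  proof (induction K)
    case (insert m K)
    have "mon m \<in> A" "(\<Sum>m\<in>K. scalar (c m) * mon m) \<in> A"
      using insert by (auto intro!: monoid_algebra_single closed)
    then show ?case using insert by (simp add: add sc restrict_state_def)
  qed (simp add: zero)
  from this[of "Poly_Mapping.keys x" "Poly_Mapping.lookup x"]
  have "\<phi> (emb (\<Sum>m\<in>Poly_Mapping.keys x. scalar (Poly_Mapping.lookup x m) * mon m)) = lin (restrict_state \<phi>) x"
    using x by (simp add: lin_def monoid_algebra_def)
  then show ?thesis by (simp add: scalar_single flip: poly_mapping_expand)
qed

lemma restrict_state_positive: "state C \<phi> \<Longrightarrow> positive_functional (words n) (restrict_state \<phi>)"
  unfolding positive_functional_def
proof
  fix x assume \<phi>: "state C \<phi>" and x: "x \<in> A"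
  have "\<phi> (star C (emb x) \<otimes>\<^bsub>C\<^esub> emb x) \<in> \<real>\<^sub>\<ge>\<^sub>0" using \<phi> emb_in[OF x] unfolding state_def by blast
  then show "lin (restrict_state \<phi>) (pstar x * x) \<in> \<real>\<^sub>\<ge>\<^sub>0"
    using x by (simp add: lin_restrict_state[OF \<phi>] emb_star emb_mult closed)
qed

lemma restrict_state_unit: "state C \<phi> \<Longrightarrow> restrict_state \<phi> 0 = 1"
  by (simp add: restrict_state_def state_def emb_one flip: single_one)

lemma restrict_state_null: "state C \<phi> \<Longrightarrow> x \<in> A \<Longrightarrow> p x = 0 \<Longrightarrow> lin (restrict_state \<phi>) x = 0"
  using lin_restrict_state[of \<phi> x] lin_restrict_state[of \<phi> 0] emb_eq_iff[of x 0] by simp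

definition product_states :: "((nat \<times> nat) word \<times> (nat \<times> nat) word \<Rightarrow> complex) set" where
  "product_states = {tensor_functional (restrict_state \<phi>) (restrict_state \<psi>) | \<phi> \<psi>. state C \<phi> \<and> state C \<psi>}"

text \<open>On words a product functional factors, and one factor is a state of the completion
  evaluated on a multiple of the null element \<open>r\<close>.\<close>

lemma product_states_null:
  assumes \<nu>: "\<nu> \<in> product_states" and r: "r \<in> A" "p r = 0" and y: "y \<in> AA" and z: "z \<in> AA"
  shows "lin \<nu> (z * T1 r * y) = 0" "lin \<nu> (z * T2 r * y) = 0"
proof -
  obtain \<phi> \<psi> where \<phi>: "state C \<phi>" "state C \<psi>" and \<nu>: "\<nu> = tensor_functional (restrict_state \<phi>) (restrict_state \<psi>)"
    using \<nu> by (auto simp: product_states_def)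
  have *: "lin \<nu> (z * alg_tensor a b * y) = 0"
    if ab: "\<And>u v u' v'. u \<in> words n \<Longrightarrow> v \<in> words n \<Longrightarrow> u' \<in> words n \<Longrightarrow> v' \<in> words n \<Longrightarrow>
      lin (restrict_state \<phi>) (mon u * a * mon u') * lin (restrict_state \<psi>) (mon v * b * mon v') = 0" for a b
  proof (rule poly_mapping_additive_eqI[where x = z and G = "\<lambda>_. 0"])
    fix m c assume "m \<in> Poly_Mapping.keys z"
    then have m: "fst m \<in> words n" "snd m \<in> words n" using keys_monoid_algebra[OF z] by (auto simp: mem_Times_iff)
    show "lin \<nu> (Poly_Mapping.single m c * alg_tensor a b * y) = 0"
    proof (rule poly_mapping_additive_eqI[where x = y and G = "\<lambda>_. 0"])
      fix m' c' assume "m' \<in> Poly_Mapping.keys y"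
      then have m': "fst m' \<in> words n" "snd m' \<in> words n" using keys_monoid_algebra[OF y] by (auto simp: mem_Times_iff)
      have s: "Poly_Mapping.single m c = scalar c * alg_tensor (mon (fst m)) (mon (snd m))" for m :: "(nat \<times> nat) word \<times> (nat \<times> nat) word" and c
        by (simp add: alg_tensor_single scalar_single)
      have "Poly_Mapping.single m c * alg_tensor a b * Poly_Mapping.single m' c' =
        scalar c * (scalar c' * alg_tensor (mon (fst m) * a * mon (fst m')) (mon (snd m) * b * mon (snd m')))"
        unfolding s[of m] s[of m'] by (simp only: mult.assoc scalar_left_commute[of "alg_tensor _ _"] alg_tensor_mult)
      then show "lin \<nu> (Poly_Mapping.single m c * alg_tensor a b * Poly_Mapping.single m' c') = 0"
        by (simp only: lin_scalar \<nu> lin_tensor ab[OF m m'] mult_zero_right)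
    qed (simp_all add: lin_add distrib_left)
  qed (simp_all add: lin_add distrib_right)
  have null: "lin (restrict_state \<phi>') (mon u * r * mon u') = 0" if "state C \<phi>'" "u \<in> words n" "u' \<in> words n" for \<phi>' u u'
  proof (rule restrict_state_null[OF that(1)])
    have u: "mon u \<in> A" "mon u' \<in> A" using that by (auto intro: monoid_algebra_single)
    show "mon u * r * mon u' \<in> A" using u r by auto
    show "p (mon u * r * mon u') = 0" using u r by (intro null_mult_right null_mult_left) auto
  qed
  show "lin \<nu> (z * T1 r * y) = 0" by (rule *) (simp add: null[OF \<phi>(1)])
  show "lin \<nu> (z * T2 r * y) = 0" by (rule *) (simp add: null[OF \<phi>(2)])
qed

lemma product_states_positive: "\<nu> \<in> product_states \<Longrightarrow> positive_functional MM \<nu>"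
  by (auto simp: product_states_def intro!: positive_functional_tensor restrict_state_positive)

lemma product_states_unit: "\<nu> \<in> product_states \<Longrightarrow> \<nu> 0 = 1"
  by (auto simp: product_states_def tensor_functional_def zero_prod_def restrict_state_unit)

lemma T1_star: "T1 (pstar x) = pstar (T1 x)" and T2_star: "T2 (pstar x) = pstar (T2 x)"
  and T1_mult: "T1 (x * y) = T1 x * T1 y" and T2_mult: "T2 (x * y) = T2 x * T2 y"
  by (simp_all add: pstar_alg_tensor alg_tensor_mult)

lemma T1_in: "x \<in> A \<Longrightarrow> T1 x \<in> AA" and T2_in: "x \<in> A \<Longrightarrow> T2 x \<in> AA"
  by (simp_all add: alg_tensor_in)

lemma column_null:
  assumes "j \<in> {1..n}"
  shows "(\<Sum>k=1..n. letter k j (\<not> e) * letter k j e) - 1 \<in> A"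
    and "p ((\<Sum>k=1..n. letter k j (\<not> e) * letter k j e) - 1) = 0"
proof -
  show "(\<Sum>k=1..n. letter k j (\<not> e) * letter k j e) - 1 \<in> A"
    using assms by (intro closed letter_in)
  show "p ((\<Sum>k=1..n. letter k j (\<not> e) * letter k j e) - 1) = 0"
  proof -
    have "al (\<not> e) e" using al[of "\<not> e"] by simp
    with rel assms have "p ((\<Sum>k=1..n. letter k j (\<not> e) * letter k j e) - delta j j) = 0"
      unfolding unitary_relations_def by blast
    then show ?thesis by (simp add: delta_def)
  qed
qed

text \<open>A pair of words is the product of a word in the first leg and one in the second;
  \<open>column_contraction\<close> handles each leg.\<close>

lemma product_states_contraction:
  assumes \<nu>: "\<nu> \<in> product_states" and m: "m \<in> MM" and y: "y \<in> AA"
  shows "vnorm \<nu> (mon m * y) \<le> vnorm \<nu> y"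
proof -
  have m': "fst m \<in> words n" "snd m \<in> words n" using m by auto
  have "mon m = T1 (mon (fst m)) * T2 (mon (snd m))"
    using alg_tensor_single[of "fst m" 1 "snd m" 1] by (simp add: alg_tensor_mult)
  then have "vnorm \<nu> (mon m * y) = vnorm \<nu> (T1 (mon (fst m)) * (T2 (mon (snd m)) * y))" by (simp add: mult.assoc)
  also have "\<dots> \<le> vnorm \<nu> (T2 (mon (snd m)) * y)"
    using m' y by (intro column_contraction[OF MM product_states_positive[OF \<nu>], where T = T1 and n = n]
        product_states_null[OF \<nu>] column_null T1_in T2_in
      monoid_algebra_mult[OF MM] monoid_algebra_pstar[OF MM] monoid_algebra_single)
      (simp_all add: alg_tensor_add_left T1_star T1_mult)
  also have "\<dots> \<le> vnorm \<nu> y"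
    using m' y by (intro column_contraction[OF MM product_states_positive[OF \<nu>], where T = T2 and n = n]
        product_states_null[OF \<nu>] column_null T2_in monoid_algebra_pstar[OF MM])
      (simp_all add: alg_tensor_add_right T2_star T2_mult)
  finally show ?thesis .
qed

lemma product_functional_eq:
  "product_functional (words n) p \<phi> \<psi> t = lin (tensor_functional (restrict_state \<phi>) (restrict_state \<psi>)) t"
  unfolding product_functional_def lin_def tensor_functional_def restrict_state_def
  by (intro sum.cong refl) (auto simp: mult.assoc)

abbreviation "q \<equiv> spatial_seminorm (words n) p"

text \<open>Recognizes the spatial seminorm as an operator norm over all product states, so that the
  general facts on GNS seminorms apply.\<close>

lemma spatial_seminorm_gns: "q = gns_seminorm MM product_states"
proof
  fix t
  show "q t = gns_seminorm MM product_states t"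
    unfolding spatial_seminorm_def gns_seminorm_def product_functional_eq vnorm_def product_states_def
    by (rule arg_cong[where f = Sup]) blast
qed

context
  fixes h :: "elem \<Rightarrow> complex"
  assumes h: "state C h"
begin

text \<open>The supremum defining \<open>q\<close> must range over a nonempty set; the given state
  \<open>h\<close> provides a member.\<close>

lemma product_states_nonempty: "product_states \<noteq> {}"
  using h by (auto simp: product_states_def)

lemma spatial_cstar: "cstar_seminorm MM q"
  unfolding spatial_seminorm_gns by (rule gns_seminorm_cstar[OF MM product_states_nonempty])
    (rule product_states_positive product_states_unit product_states_contraction; assumption)+

lemma spatial_null:
  assumes "t \<in> AA" "\<And>\<nu> y z. \<nu> \<in> product_states \<Longrightarrow> y \<in> AA \<Longrightarrow> z \<in> AA \<Longrightarrow> lin \<nu> (z * (t * y)) = 0"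
  shows "q t = 0"
proof (rule antisym)
  show "q t \<le> 0"
    unfolding spatial_seminorm_gns
  proof (rule gns_seminorm_least[OF MM product_states_nonempty])
    fix \<nu> y assume \<nu>: "\<nu> \<in> product_states" and y: "y \<in> AA"
    have "lin \<nu> (pstar (t * y) * (t * y)) = 0"
      using assms y by (intro assms(2) \<nu> monoid_algebra_pstar[OF MM] monoid_algebra_mult[OF MM])
    then show "vnorm \<nu> (t * y) \<le> 0 * vnorm \<nu> y" by (simp add: vnorm_def)
  qed (use assms in \<open>auto intro: product_states_positive product_states_unit product_states_contraction\<close>)
  show "0 \<le> q t" using spatial_cstar assms(1) by (auto simp: cstar_seminorm_def)
qed

text \<open>Pulled back along either leg, \<open>q\<close> is a C*-seminorm that kills the relators,
  so universality of \<open>p\<close> bounds it.\<close>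

lemma spatial_leg:
  assumes T_add: "\<And>x y. T (x + y) = T x + T y" and T_mult: "\<And>x y. T (x * y) = T x * T y"
    and T_star: "\<And>x. T (pstar x) = pstar (T x)" and T_scalar: "\<And>c. T (scalar c) = scalar c"
    and T_in: "\<And>x. x \<in> A \<Longrightarrow> T x \<in> AA"
    and null: "\<And>\<nu> r y z. \<nu> \<in> product_states \<Longrightarrow> r \<in> A \<Longrightarrow> p r = 0 \<Longrightarrow> y \<in> AA \<Longrightarrow> z \<in> AA \<Longrightarrow> lin \<nu> (z * T r * y) = 0"
    and x: "x \<in> A"
  shows "q (T x) \<le> p x"
proof (rule greatest[OF _ _ x])
  show "cstar_seminorm (words n) (\<lambda>x. q (T x))"
    using spatial_cstar T_in unfolding cstar_seminorm_def
    by (simp add: T_add T_mult T_star T_scalar)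
  show "\<forall>r\<in>R. q (T r) = 0"
  proof
    fix r assume "r \<in> R"
    then have "r \<in> A" "p r = 0" using R_in R_null by auto
    then show "q (T r) = 0" using null T_in by (intro spatial_null) (auto simp: mult.assoc)
  qed
qed

lemma scalar_tensor: "T1 (scalar c) = scalar c" "T2 (scalar c) = scalar c"
  using alg_tensor_single[of 0 c 0 1] alg_tensor_single[of 0 1 0 c] by (simp_all add: scalar_def flip: zero_prod_def)

lemma spatial_cross: 
  assumes "x \<in> A" "y \<in> A"
  shows "q (alg_tensor x y) \<le> p x * p y"
proof -
  interpret q: cstar_seminormed MM q using spatial_cstar MM by unfold_locales
  have "alg_tensor x y = T1 x * T2 y" by (simp add: alg_tensor_mult)
  then have "q (alg_tensor x y) \<le> q (T1 x) * q (T2 y)" using q.submult[of "T1 x" "T2 y"] T1_in T2_in assms by simp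
  also have "\<dots> \<le> p x * p y"
  proof (rule mult_mono)
    show "q (T1 x) \<le> p x"
      using assms by (intro spatial_leg product_states_null T1_in)
        (simp_all add: alg_tensor_add_left T1_star T1_mult scalar_tensor)
    show "q (T2 y) \<le> p y"
      using assms by (intro spatial_leg product_states_null T2_in)
        (simp_all add: alg_tensor_add_right T2_star T2_mult scalar_tensor)
  qed (use assms nonneg q.nonneg T2_in in auto)
  finally show ?thesis .
qed

interpretation q: cstar_seminormed MM q
  using spatial_cstar MM by unfold_locales

text \<open>\<open>tensor\<close> is defined through chosen representatives, not constant sequences;
  the cross-norm estimate shows that the difference is a null sequence.\<close>

lemma tensor_emb:
  assumes x: "x \<in> A" and y: "y \<in> A"
  shows "tensor (words n) p (emb x) (emb y) = embed MM q (alg_tensor x y)"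
proof -
  let ?x = "representative (emb x)" and ?y = "representative (emb y)"
  note x' = representative_emb[OF x] and y' = representative_emb[OF y]
  obtain D where D: "D > 0" "\<And>k. p (?y k) \<le> D" by (rule cauchy_bounded[OF y'(1)]) blast
  have null: "q.null_seq (\<lambda>k. alg_tensor (?x k) (?y k) - alg_tensor x y)"
  proof (rule q.null_seq_squeeze)
    fix k
    have in_A: "?x k \<in> A" "?y k \<in> A" "?x k - x \<in> A" "?y k - y \<in> A" using cauchy_in x' y' x y by (auto intro: closed)
    show "alg_tensor (?x k) (?y k) - alg_tensor x y \<in> AA"
      using in_A x y by (intro q.closed alg_tensor_in)
    have "alg_tensor (?x k) (?y k) - alg_tensor x y = alg_tensor (?x k - x) (?y k) + alg_tensor x (?y k - y)"
      by (simp add: alg_tensor_diff)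
    then have "q (alg_tensor (?x k) (?y k) - alg_tensor x y) \<le> q (alg_tensor (?x k - x) (?y k)) + q (alg_tensor x (?y k - y))"
      using in_A x by (simp add: q.triangle alg_tensor_in)
    also have "\<dots> \<le> p (?x k - x) * p (?y k) + p x * p (?y k - y)"
      using in_A x by (intro add_mono spatial_cross)
    also have "\<dots> \<le> p (?x k - x) * D + p x * p (?y k - y)"
      using mult_left_mono[OF D(2)[of k] nonneg[OF in_A(3)]] by simp
    finally show "q (alg_tensor (?x k) (?y k) - alg_tensor x y) \<le> p (?x k - x) * D + p x * p (?y k - y)" .
    have "(\<lambda>k. p (?x k - x) * D + p x * p (?y k - y)) \<longlonglongrightarrow> 0 * D + p x * 0"
      using x'(2) y'(2) unfolding null_seq_def by (intro tendsto_intros) auto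
    then show "(\<lambda>k. p (?x k - x) * D + p x * p (?y k - y)) \<longlonglongrightarrow> 0" by simp
  qed
  have cauchy: "q.cauchy (\<lambda>k. alg_tensor (?x k) (?y k))"
    by (rule q.cauchy_of_null[OF null]) (use x y in \<open>simp add: alg_tensor_in\<close>)
  have "q.cls (\<lambda>k. alg_tensor (?x k) (?y k)) = q.cls (\<lambda>k. alg_tensor x y)"
    using null by (subst q.cls_eq_iff[OF cauchy q.cauchy_const]) (simp_all add: x y alg_tensor_in)
  then show ?thesis by (simp only: tensor_def embed_def[of MM])
qed

end

end

text \<open>An entry, at row \<open>is\<close> and column \<open>js\<close>, of the tensor product
  of copies of the generating matrix, with conjugated copies where \<open>es\<close> is
  \<open>True\<close>.\<close>

definition entry :: "bool list \<Rightarrow> nat list \<Rightarrow> nat list \<Rightarrow> free_alg" where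
  "entry es is js = mon (Word (zip (zip is js) es))"

lemma entry_Nil [simp]: "entry [] is js = 1"
  by (simp add: entry_def flip: zero_word_def)

lemma entry_Cons: "entry (e # es) (i # is) (j # js) = letter i j e * entry es is js"
  by (simp add: entry_def letter_def mult_single plus_word_def)

lemma entry_in:
  "is \<in> listset (replicate k {1..n}) \<Longrightarrow> js \<in> listset (replicate k {1..n}) \<Longrightarrow> length es = k \<Longrightarrow>
    entry es is js \<in> monoid_algebra (words n)"
proof (induction k arbitrary: es "is" js)
  case 0
  then show ?case by (simp add: monoid_algebra_one[OF star_submonoid_words])
next
  case (Suc k)
  then obtain e es' i is' j js' where *: "es = e # es'" "is = i # is'" "js = j # js'"
    by (cases es; cases "is"; cases js) (auto simp: set_Cons_def)
  then show ?case
    using Suc by (auto simp: entry_Cons set_Cons_def intro!: monoid_algebra_mult[OF star_submonoid_words] letter_in)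
qed

section \<open>Invariance on matrix entries\<close>

context unitary_algebra
begin

abbreviation "ixs k \<equiv> listset (replicate k {1..n})"

lemma finite_ixs: "finite (ixs k)"
  by (intro finite_listset) auto

context
  fixes h :: "elem \<Rightarrow> complex" and \<Delta>
  assumes h: "state C h" and \<Delta>: "comultiplication n p \<Delta>"
begin

interpretation q: cstar_seminormed MM q
  using spatial_cstar[OF h] MM by unfold_locales

lemma comultiplication_letter:
  assumes ij: "i \<in> {1..n}" "j \<in> {1..n}"
  shows "\<Delta> (emb (letter i j e)) = embed MM q (\<Sum>k=1..n. alg_tensor (letter i k e) (letter k j e))"
proof -
  have False': "\<Delta> (emb (letter i j False)) = embed MM q (\<Sum>k=1..n. alg_tensor (letter i k False) (letter k j False))"
  proof -
    interpret abelian_monoid q.C by (rule q.completion_abelian_monoid)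
    have "\<Delta> (emb (letter i j False)) = finsum q.C (\<lambda>k. tensor (words n) p (emb (letter i k False)) (emb (letter k j False))) {1..n}"
      using \<Delta> ij by (simp add: comultiplication_def tensor_square_def gen_letter)
    also have "\<dots> = finsum q.C (\<lambda>k. embed MM q (alg_tensor (letter i k False) (letter k j False))) {1..n}"
      using ij by (intro finsum_cong') (auto simp: tensor_emb[OF h] letter_in q.emb_in alg_tensor_in)
    also have "\<dots> = embed MM q (\<Sum>k=1..n. alg_tensor (letter i k False) (letter k j False))"
      using ij by (intro q.emb_finsum) (auto simp: letter_in alg_tensor_in)
    finally show ?thesis .
  qed
  show ?thesis
  proof (cases e)
    case True
    have in_A: "letter i j False \<in> A" using ij by (rule letter_in)
    have "\<Delta> (emb (letter i j True)) = \<Delta> (star C (emb (letter i j False)))"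
      using in_A by (simp add: emb_star pstar_letter)
    also have "\<dots> = star q.C (\<Delta> (emb (letter i j False)))"
      using \<Delta> emb_in[OF in_A] by (simp add: comultiplication_def unital_star_hom_def tensor_square_def)
    also have "\<dots> = embed MM q (pstar (\<Sum>k=1..n. alg_tensor (letter i k False) (letter k j False)))"
      unfolding False' using ij by (intro q.emb_star) (auto simp: letter_in alg_tensor_in intro!: monoid_algebra_sum)
    finally show ?thesis using True by (simp add: pstar_sum pstar_alg_tensor pstar_letter)
  qed (use False' in simp)
qed

lemma comultiplication_entry:
  assumes "is \<in> ixs k" "js \<in> ixs k" "length es = k"
  shows "\<Delta> (emb (entry es is js)) = embed MM q (\<Sum>ls\<in>ixs k. alg_tensor (entry es is ls) (entry es ls js))"
  using assms
proof (induction k arbitrary: es "is" js)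
  case 0
  have "\<Delta> \<one>\<^bsub>C\<^esub> = \<one>\<^bsub>q.C\<^esub>"
    using \<Delta> by (simp add: comultiplication_def unital_star_hom_def tensor_square_def)
  then show ?case using 0 by (simp add: emb_one q.emb_one)
next
  case (Suc k)
  then obtain e es' i is' j js' where *: "es = e # es'" "is = i # is'" "js = j # js'"
    by (cases es; cases "is"; cases js) (auto simp: set_Cons_def)
  have ij: "i \<in> {1..n}" "j \<in> {1..n}" and ixs: "is' \<in> ixs k" "js' \<in> ixs k" and len: "length es' = k"
    using Suc.prems * by (auto simp: set_Cons_def)
  have in_A: "letter i j e \<in> A" "entry es' is' js' \<in> A" using ij ixs len by (auto intro: letter_in entry_in)
  have in_AA: "(\<Sum>k=1..n. alg_tensor (letter i k e) (letter k j e)) \<in> AA"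
    "(\<Sum>ls\<in>ixs k. alg_tensor (entry es' is' ls) (entry es' ls js')) \<in> AA"
    using ij ixs len by (intro monoid_algebra_sum alg_tensor_in letter_in entry_in; simp)+
  have "\<Delta> (emb (entry es is js)) = \<Delta> (emb (letter i j e) \<otimes>\<^bsub>C\<^esub> emb (entry es' is' js'))"
    using in_A by (simp add: * entry_Cons emb_mult)
  also have "\<dots> = \<Delta> (emb (letter i j e)) \<otimes>\<^bsub>q.C\<^esub> \<Delta> (emb (entry es' is' js'))"
    using \<Delta> emb_in in_A by (simp add: comultiplication_def unital_star_hom_def tensor_square_def)
  also have "\<dots> = embed MM q ((\<Sum>k=1..n. alg_tensor (letter i k e) (letter k j e)) *
      (\<Sum>ls\<in>ixs k. alg_tensor (entry es' is' ls) (entry es' ls js')))"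
    unfolding Suc.IH[OF ixs len] comultiplication_letter[OF ij] using in_AA by (rule q.emb_mult)
  also have "(\<Sum>k=1..n. alg_tensor (letter i k e) (letter k j e)) *
      (\<Sum>ls\<in>ixs k. alg_tensor (entry es' is' ls) (entry es' ls js')) =
      (\<Sum>ls\<in>ixs (Suc k). alg_tensor (entry es is ls) (entry es ls js))"
    unfolding replicate_Suc sum_listset_Cons * entry_Cons sum_product alg_tensor_mult ..
  finally show ?case .
qed

lemma left_slice_sum:
  assumes T: "left_slice (words n) p h T" and "finite I"
    and "\<And>i. i \<in> I \<Longrightarrow> a i \<in> A" "\<And>i. i \<in> I \<Longrightarrow> b i \<in> A"
  shows "T (embed MM q (\<Sum>i\<in>I. alg_tensor (a i) (b i))) = emb (\<Sum>i\<in>I. scalar (h (emb (a i))) * b i)"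
  using assms(2-4)
proof (induction I)
  case empty
  have "T (0 \<odot>\<^bsub>q.C\<^esub> embed MM q 0) = 0 \<odot>\<^bsub>C\<^esub> T (embed MM q 0)"
    using T q.emb_in[of 0] by (simp add: left_slice_def bounded_linear_map_def linear_map_def tensor_square_def)
  moreover have "T (embed MM q 0) \<in> carrier C"
    using T q.emb_in[of 0] by (auto simp: left_slice_def bounded_linear_map_def linear_map_def tensor_square_def)
  then obtain x where "cauchy x" "T (embed MM q 0) = cls x" by (rule completion_carrierE)
  ultimately have "T (embed MM q 0) = emb 0"
    by (simp add: q.emb_smult completion_smult) (simp add: embed_def)
  then show ?case by simp
next
  case (insert i I)
  have in_A: "a i \<in> A" "b i \<in> A" using insert by auto
  have t: "alg_tensor (a i) (b i) \<in> AA" "(\<Sum>i\<in>I. alg_tensor (a i) (b i)) \<in> AA"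
    using insert by (auto intro!: monoid_algebra_sum alg_tensor_in)
  have "T (embed MM q (\<Sum>i\<in>insert i I. alg_tensor (a i) (b i))) =
      T (embed MM q (alg_tensor (a i) (b i)) \<oplus>\<^bsub>q.C\<^esub> embed MM q (\<Sum>i\<in>I. alg_tensor (a i) (b i)))"
    using insert t by (simp add: q.emb_add)
  also have "\<dots> = T (embed MM q (alg_tensor (a i) (b i))) \<oplus>\<^bsub>C\<^esub> T (embed MM q (\<Sum>i\<in>I. alg_tensor (a i) (b i)))"
    using T q.emb_in[OF t(1)] q.emb_in[OF t(2)]
    by (simp add: left_slice_def bounded_linear_map_def linear_map_def tensor_square_def)
  also have "T (embed MM q (alg_tensor (a i) (b i))) = h (emb (a i)) \<odot>\<^bsub>C\<^esub> emb (b i)"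
    using T emb_in in_A unfolding tensor_emb[OF h in_A, symmetric] by (simp add: left_slice_def)
  finally show ?case
    using insert in_A by (simp add: emb_smult emb_add closed)
qed

end

text \<open>Left invariance in matrix form: since the comultiplication of an entry is a matrix
  product, slicing with \<open>h\<close> in the first leg gives \<open>H U = H\<close> up to norm
  zero, with \<open>H\<close> the matrix of Haar values.\<close>

lemma haar_functional_entry:
  assumes haar: "haar_functional n p h" and ixs: "is \<in> ixs k" "js \<in> ixs k" and len: "length es = k"
  shows "p ((\<Sum>ls\<in>ixs k. scalar (h (emb (entry es is ls))) * entry es ls js) - scalar (h (emb (entry es is js)))) = 0"
proof -
  from haar obtain \<Delta> T where h: "state C h" and \<Delta>: "comultiplication n p \<Delta>" and T: "left_slice (words n) p h T"
    and inv: "\<And>a. a \<in> carrier C \<Longrightarrow> T (\<Delta> a) = h a \<odot>\<^bsub>C\<^esub> \<one>\<^bsub>C\<^esub>"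
    unfolding haar_functional_def by blast
  have e: "entry es is js \<in> A" using ixs len by (rule entry_in)
  have in_A: "entry es is ls \<in> A" "entry es ls js \<in> A" if "ls \<in> ixs k" for ls
    using ixs len that by (auto intro: entry_in)
  have "emb (\<Sum>ls\<in>ixs k. scalar (h (emb (entry es is ls))) * entry es ls js) = T (\<Delta> (emb (entry es is js)))"
    unfolding comultiplication_entry[OF h \<Delta> ixs len]
    using in_A finite_ixs by (intro left_slice_sum[OF h \<Delta> T, symmetric]) auto
  also have "\<dots> = emb (scalar (h (emb (entry es is js))))"
    using inv[OF emb_in[OF e]] emb_smult[of 1] by (simp add: emb_one closed)
  finally show ?thesis
    using in_A by (subst (asm) emb_eq_iff) (auto intro!: closed)
qed

end

section \<open>Moments of the Haar functional\<close>

text \<open>The colour of a letter is read off its row index and star tag, so several systems of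
  generators can share one free algebra.\<close>

locale moment_system = colour_system bar ix for bar :: "'c \<Rightarrow> 'c" and ix +
  fixes col :: "nat \<Rightarrow> bool \<Rightarrow> 'c"
  assumes col_not: "col i (\<not> e) = bar (col i e)"
begin

definition colours :: "(nat \<times> nat) word \<Rightarrow> 'c list" where
  "colours m = map (\<lambda>((i, j), e). col i e) (letters m)"

definition rows :: "(nat \<times> nat) word \<Rightarrow> nat list" where
  "rows m = map (\<lambda>((i, j), e). i) (letters m)"

definition columns :: "(nat \<times> nat) word \<Rightarrow> nat list" where
  "columns m = map (\<lambda>((i, j), e). j) (letters m)"

definition mom :: "(nat \<times> nat) word \<Rightarrow> complex" where
  "mom m = E (colours m) (rows m) (columns m)"

lemma word_add [simp]:
  "colours (m + m') = colours m @ colours m'" "rows (m + m') = rows m @ rows m'" "columns (m + m') = columns m @ columns m'"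
  by (simp_all add: colours_def rows_def columns_def plus_word_def)

lemma word_invol [simp]:
  "colours (invol m) = dual (colours m)" "rows (invol m) = rev (rows m)" "columns (invol m) = rev (columns m)"
  by (simp_all add: colours_def rows_def columns_def invol_word_def rev_map split_def col_not)

lemma length_rows [simp]: "length (rows m) = length (colours m)" "length (columns m) = length (colours m)"
  by (simp_all add: colours_def rows_def columns_def)

lemma word_zero [simp]: "colours 0 = []" "rows 0 = []" "columns 0 = []"
  by (simp_all add: colours_def rows_def columns_def zero_word_def)

lemma mom_zero [simp]: "mom 0 = 1"
  by (simp add: mom_def E_empty)

lemma mom_positive: "positive_functional M mom"
  unfolding positive_functional_def
proof
  fix x :: free_alg
  have "lin mom (pstar x * x) = (\<Sum>m\<in>Poly_Mapping.keys x. \<Sum>m'\<in>Poly_Mapping.keys x.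
      cnj (Poly_Mapping.lookup x m) * Poly_Mapping.lookup x m' *
      E (dual (colours m) @ colours m') (rev (rows m) @ rows m') (rev (columns m) @ columns m'))"
    by (subst lin_pstar_mult[OF finite_keys subset_refl]) (simp add: mom_def)
  also have "\<dots> \<in> \<real>\<^sub>\<ge>\<^sub>0" by (rule E_positive) simp_all
  finally show "lin mom (pstar x * x) \<in> \<real>\<^sub>\<ge>\<^sub>0" .
qed

text \<open>The largest two-sided ideal contained in the kernel of the functional.\<close>

definition null :: "free_alg \<Rightarrow> bool" where
  "null x \<longleftrightarrow> (\<forall>a b. lin mom (a * x * b) = 0)"

lemma nullI:
  assumes "\<And>m m'. lin mom (mon m * x * mon m') = 0"
  shows "null x"
  unfolding null_def
proof (intro allI)
  fix a b
  show "lin mom (a * x * b) = 0"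
  proof (rule poly_mapping_additive_eqI[where x = a and G = "\<lambda>_. 0"])
    fix m c
    show "lin mom (Poly_Mapping.single m c * x * b) = 0"
    proof (rule poly_mapping_additive_eqI[where x = b and G = "\<lambda>_. 0"])
      fix m' c'
      have "Poly_Mapping.single m c * x * Poly_Mapping.single m' c' = (scalar c * mon m) * x * (scalar c' * mon m')"
        by (simp add: scalar_single)
      also have "\<dots> = scalar (c * c') * (mon m * x * mon m')"
        by (simp only: mult.assoc scalar_left_commute[of x] scalar_left_commute[of "mon m"] scalar_scalar)
      finally show "lin mom (Poly_Mapping.single m c * x * Poly_Mapping.single m' c') = 0"
        by (simp add: lin_scalar assms)
    qed (simp_all add: lin_add distrib_left)
  qed (simp_all add: lin_add distrib_right)
qed

lemma null_add: "null x \<Longrightarrow> null y \<Longrightarrow> null (x + y)"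
  by (simp add: null_def distrib_left distrib_right lin_add)

lemma null_mult: "null x \<Longrightarrow> null (a * x * b)"
  unfolding null_def by (metis mult.assoc)

lemma null_zero: "null 0"
  by (simp add: null_def)

lemma null_sum: "(\<And>i. i \<in> I \<Longrightarrow> null (f i)) \<Longrightarrow> null (\<Sum>i\<in>I. f i)"
  by (induction I rule: infinite_finite_induct) (auto simp: null_zero null_add)

lemma null_scalar: "null x \<Longrightarrow> null (scalar c * x)"
  using null_mult[of x "scalar c" 1] by simp

lemma E_append3_outside:
  assumes "length i1 = length u" "length i2 = length w" "length j1 = length u" "length j2 = length w"
    and "i1 \<notin> idx u \<or> i3 \<notin> idx v \<or> j1 \<notin> idx u \<or> j3 \<notin> idx v"
  shows "E (u @ w @ v) (i1 @ i2 @ i3) (j1 @ j2 @ j3) = 0"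
  using assms by (intro E_outside) (auto simp: append_listset_iff)

text \<open>\<open>null\<close> multiplies by arbitrary words, whose indices may be out of range;
  then both sides are 0.\<close>

lemma E_insert':
  assumes f: "V w f" and i: "i \<in> idx w" and len: "length i1 = length u" "length j1 = length u"
  shows "(\<Sum>l\<in>idx w. E (u @ w @ v) (i1 @ i @ i2) (j1 @ l @ j2) * f l) = f i * E (u @ v) (i1 @ i2) (j1 @ j2)"
proof (cases "i1 \<in> idx u \<and> i2 \<in> idx v \<and> j1 \<in> idx u \<and> j2 \<in> idx v")
  case True
  then show ?thesis using f i by (intro E_insert) auto
next
  case False
  have "E (u @ w @ v) (i1 @ i @ i2) (j1 @ l @ j2) = 0" if "l \<in> idx w" for l
    using False len i that by (intro E_append3_outside) (auto dest: length_idx)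
  moreover have "E (u @ v) (i1 @ i2) (j1 @ j2) = 0"
    using False len by (intro E_outside) (auto simp: append_listset_iff)
  ultimately show ?thesis by simp
qed

lemma E_insert_pair':
  assumes "a \<in> ix c" "b \<in> ix c" and len: "length i1 = length u" "length j1 = length u"
  shows "(\<Sum>k\<in>ix c. E (u @ c # bar c # v) (i1 @ a # b # i2) (j1 @ k # k # j2)) = (if a = b then E (u @ v) (i1 @ i2) (j1 @ j2) else 0)"
    and "(\<Sum>k\<in>ix c. E (u @ c # bar c # v) (i1 @ k # k # i2) (j1 @ a # b # j2)) = (if a = b then E (u @ v) (i1 @ i2) (j1 @ j2) else 0)"
proof -
  have out: "E (u @ c # bar c # v) (i1 @ k # k' # i2) (j1 @ l # l' # j2) = 0"
    if "\<not> (i1 \<in> idx u \<and> i2 \<in> idx v \<and> j1 \<in> idx u \<and> j2 \<in> idx v)" for k l k' l'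
    using that len E_append3_outside[of i1 u "[k, k']" "[c, bar c]" j1 "[l, l']" i2 v j2] by auto
  have out': "E (u @ v) (i1 @ i2) (j1 @ j2) = 0"
    if "\<not> (i1 \<in> idx u \<and> i2 \<in> idx v \<and> j1 \<in> idx u \<and> j2 \<in> idx v)"
    using that len by (intro E_outside) (auto simp: append_listset_iff)
  show "(\<Sum>k\<in>ix c. E (u @ c # bar c # v) (i1 @ a # b # i2) (j1 @ k # k # j2)) = (if a = b then E (u @ v) (i1 @ i2) (j1 @ j2) else 0)"
    using E_insert_pair(1)[of i1 u i2 v a c b j1 j2] assms out out'
    by (cases "i1 \<in> idx u \<and> i2 \<in> idx v \<and> j1 \<in> idx u \<and> j2 \<in> idx v") auto
  show "(\<Sum>k\<in>ix c. E (u @ c # bar c # v) (i1 @ k # k # i2) (j1 @ a # b # j2)) = (if a = b then E (u @ v) (i1 @ i2) (j1 @ j2) else 0)"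
    using E_insert_pair(2)[of j1 u j2 v a c b i1 i2] assms out out'
    by (cases "i1 \<in> idx u \<and> i2 \<in> idx v \<and> j1 \<in> idx u \<and> j2 \<in> idx v") auto
qed

lemma letter_mult: "letter i j e * letter i' j' e' = mon (Word [((i, j), e), ((i', j'), e')])"
  by (simp add: letter_def mult_single plus_word_def)

lemma null_pair:
  assumes c: "col i e = c" "col j e' = bar c" and ij: "i \<in> ix c" "j \<in> ix c"
  shows "null ((\<Sum>k\<in>ix c. letter i k e * letter j k e') - delta i j)"
proof (rule nullI)
  fix m m'
  have "lin mom (mon m * ((\<Sum>k\<in>ix c. letter i k e * letter j k e') - delta i j) * mon m') =
    (\<Sum>k\<in>ix c. mom (m + Word [((i, k), e), ((j, k), e')] + m')) - (if i = j then mom (m + m') else 0)"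
    by (simp add: letter_mult left_diff_distrib right_diff_distrib sum_distrib_left sum_distrib_right
        mult_single lin_diff lin_sum delta_def)
  also have "(\<Sum>k\<in>ix c. mom (m + Word [((i, k), e), ((j, k), e')] + m')) =
    (\<Sum>k\<in>ix c. E (colours m @ c # bar c # colours m') (rows m @ i # j # rows m') (columns m @ k # k # columns m'))"
    by (simp add: mom_def) (simp add: colours_def rows_def columns_def c)
  also have "\<dots> = (if i = j then mom (m + m') else 0)"
    using ij by (subst E_insert_pair'(1)) (auto simp: mom_def)
  finally show "lin mom (mon m * ((\<Sum>k\<in>ix c. letter i k e * letter j k e') - delta i j) * mon m') = 0" by simp
qed

text \<open>Here the sum runs over row indices, which determine colours; hence all rows in
  \<open>ix c\<close> must carry the same colour.\<close>

lemma null_pair_transposed: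
  assumes c: "\<And>k. k \<in> ix c \<Longrightarrow> col k e = c" "\<And>k. k \<in> ix c \<Longrightarrow> col k e' = bar c" and ij: "i \<in> ix c" "j \<in> ix c"
  shows "null ((\<Sum>k\<in>ix c. letter k i e * letter k j e') - delta i j)"
proof (rule nullI)
  fix m m'
  have "lin mom (mon m * ((\<Sum>k\<in>ix c. letter k i e * letter k j e') - delta i j) * mon m') =
    (\<Sum>k\<in>ix c. mom (m + Word [((k, i), e), ((k, j), e')] + m')) - (if i = j then mom (m + m') else 0)"
    by (simp add: letter_mult left_diff_distrib right_diff_distrib sum_distrib_left sum_distrib_right
        mult_single lin_diff lin_sum delta_def)
  also have "(\<Sum>k\<in>ix c. mom (m + Word [((k, i), e), ((k, j), e')] + m')) =
    (\<Sum>k\<in>ix c. E (colours m @ c # bar c # colours m') (rows m @ k # k # rows m') (columns m @ i # j # columns m'))"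
    by (intro sum.cong refl, simp add: mom_def) (simp add: colours_def rows_def columns_def c)
  also have "\<dots> = (if i = j then mom (m + m') else 0)"
    using ij by (subst E_insert_pair'(2)) (auto simp: mom_def)
  finally show "lin mom (mon m * ((\<Sum>k\<in>ix c. letter k i e * letter k j e') - delta i j) * mon m') = 0" by simp
qed

lemma mom_entry:
  assumes "length is = length es" "length js = length es"
  shows "lin mom (entry es is js) = E (map2 col is es) is js"
proof -
  have "colours (Word (zip (zip is js) es)) = map2 col is es \<and> rows (Word (zip (zip is js) es)) = is \<and>
      columns (Word (zip (zip is js) es)) = js"
    using assms by (induction es arbitrary: "is" js)
      (auto simp: colours_def rows_def columns_def length_Suc_conv)
  then show ?thesis by (simp add: entry_def mom_def)
qed

text \<open>\<open>E_insert'\<close> with the fixed vector in the middle of a longer word: modulo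
  null elements the matrix of entries leaves \<open>f\<close> unchanged.\<close>

lemma null_fixed_vector:
  assumes f: "V w f" and w: "w = map2 col is es" and i: "is \<in> idx w" and len: "length is = length es"
  shows "null ((\<Sum>l\<in>idx w. scalar (f l) * entry es is l) - scalar (f is))"
proof (rule nullI)
  fix m m'
  have lw: "length w = length es" using w len by simp
  have word: "colours (Word (zip (zip is l) es)) = w \<and> rows (Word (zip (zip is l) es)) = is \<and>
      columns (Word (zip (zip is l) es)) = l" if "length l = length es" for l
    using len that unfolding w by (induction es arbitrary: "is" l)
      (auto simp: colours_def rows_def columns_def length_Suc_conv)
  have "mon m * ((\<Sum>l\<in>idx w. scalar (f l) * entry es is l) - scalar (f is)) * mon m' =
    (\<Sum>l\<in>idx w. scalar (f l) * mon (m + Word (zip (zip is l) es) + m')) - scalar (f is) * mon (m + m')"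
    by (simp add: left_diff_distrib right_diff_distrib sum_distrib_left sum_distrib_right entry_def
        scalar_left_commute[of "mon m"] mult.assoc scalar_commute[of "mon m"] mult_single add.assoc)
  then have "lin mom (mon m * ((\<Sum>l\<in>idx w. scalar (f l) * entry es is l) - scalar (f is)) * mon m') =
    (\<Sum>l\<in>idx w. f l * mom (m + Word (zip (zip is l) es) + m')) - f is * mom (m + m')"
    by (simp add: lin_diff lin_sum lin_scalar)
  also have "(\<Sum>l\<in>idx w. f l * mom (m + Word (zip (zip is l) es) + m')) =
    (\<Sum>l\<in>idx w. E (colours m @ w @ colours m') (rows m @ is @ rows m') (columns m @ l @ columns m') * f l)"
    by (intro sum.cong refl) (simp add: mom_def word length_idx lw mult.commute)
  also have "\<dots> = f is * mom (m + m')"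
    using i by (subst E_insert'[OF f]) (simp_all add: mom_def)
  finally show "lin mom (mon m * ((\<Sum>l\<in>idx w. scalar (f l) * entry es is l) - scalar (f is)) * mon m') = 0" by simp
qed

end

lemma entry_append:
  assumes "length is = length es" "length js = length es"
  shows "entry (es @ es') (is @ is') (js @ js') = entry es is js * entry es' is' js'"
  using assms by (simp add: entry_def mult_single plus_word_def)

context unitary_algebra
begin

text \<open>The analogue for the norm: an arch between neighbours is contracted by one unitarity
  relation, and the rest is the induction hypothesis.\<close>

lemma pairing_fixed:
  assumes "fits al t es" "is \<in> ixs (length es)"
  shows "p ((\<Sum>l\<in>ixs (length es). scalar (pairing_tensor t l) * entry es is l) - scalar (pairing_tensor t is)) = 0"
  using assms
proof (induction t arbitrary: es "is" rule: pairing_insert_induct)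
  case Empty
  then show ?case by simp
next
  case (insert k t)
  obtain e1 e e' e2 where es: "es = e1 @ e # e' # e2" "length e1 = k" "al e e'" "fits al t (e1 @ e2)"
    using fits_insert_archE[OF insert.prems(1) insert.hyps] by metis
  define N1 N2 where "N1 = length e1" and "N2 = length e2"
  have len: "length es = N1 + Suc (Suc N2)" "length (e1 @ e2) = N1 + N2" by (simp_all add: es(1) N1_def N2_def)
  have rep: "replicate (length es) {1..n} = replicate N1 {1..n} @ {1..n} # {1..n} # replicate N2 {1..n}"
    "replicate (length (e1 @ e2)) {1..n} = replicate N1 {1..n} @ replicate N2 {1..n}"
    unfolding len by (simp_all only: replicate_add replicate_Suc)
  obtain i1 r where 1: "is = i1 @ r" "i1 \<in> ixs N1" "r \<in> listset ({1..n} # {1..n} # replicate N2 {1..n})" "length i1 = N1"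
    using insert.prems(2) unfolding rep by (auto elim: listset_appendE)
  then obtain x y i2 where r: "r = x # y # i2" "x \<in> {1..n}" "y \<in> {1..n}" "i2 \<in> ixs N2" by (auto simp: set_Cons_def)
  have is12: "i1 @ i2 \<in> ixs (length (e1 @ e2))" unfolding rep using 1 r by (simp add: append_listset_iff)
  have T: "pairing_tensor (insert_arch k t) (l1 @ a # b # l2) = (if b = a then pairing_tensor t (l1 @ l2) else 0)"
    if "length l1 = N1" for l1 a b l2
  proof -
    have "length l1 = k" using that es(2) by (simp add: N1_def)
    from fits_insert_arch[OF this insert.hyps, of "(=)" a b l2] show ?thesis by auto
  qed
  define S where "S = (\<Sum>a=1..n. letter x a e * letter y a e')"
  have S: "S - delta x y \<in> A" "p (S - delta x y) = 0"
    using rel es(3) r unfolding S_def unitary_relations_def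
    by (blast intro: closed letter_in delta_in)+
  have ent: "entry es is (l1 @ a # b # l2) = entry e1 i1 l1 * (letter x a e * letter y b e') * entry e2 i2 l2"
    if "length l1 = N1" for l1 a b l2
    using that 1 unfolding es(1) 1(1) r(1)
    by (subst entry_append) (simp_all add: N1_def entry_Cons mult.assoc)
  have in_A: "entry e1 i1 l1 \<in> A" "entry e2 i2 l2 \<in> A" if "l1 \<in> ixs N1" "l2 \<in> ixs N2" for l1 l2
    using that 1 r by (auto intro!: entry_in simp: N1_def N2_def)
  have "(\<Sum>l\<in>ixs (length es). scalar (pairing_tensor (insert_arch k t) l) * entry es is l) =
    (\<Sum>l1\<in>ixs N1. \<Sum>a=1..n. \<Sum>b=1..n. \<Sum>l2\<in>ixs N2. if b = a then
       scalar (pairing_tensor t (l1 @ l2)) * (entry e1 i1 l1 * (letter x a e * letter y b e') * entry e2 i2 l2) else 0)"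
    unfolding rep sum_listset_append sum_listset_Cons
  proof (intro sum.cong refl)
    fix l1 a b l2 assume "l1 \<in> ixs N1"
    then have l1: "length l1 = N1" using length_listset[of l1] by simp
    show "scalar (pairing_tensor (insert_arch k t) (l1 @ a # b # l2)) * entry es is (l1 @ a # b # l2) = (if b = a then
       scalar (pairing_tensor t (l1 @ l2)) * (entry e1 i1 l1 * (letter x a e * letter y b e') * entry e2 i2 l2) else 0)"
      unfolding T[OF l1] ent[OF l1] by simp
  qed
  also have "\<dots> = (\<Sum>l1\<in>ixs N1. \<Sum>a=1..n. \<Sum>l2\<in>ixs N2. \<Sum>b=1..n. if b = a then
       scalar (pairing_tensor t (l1 @ l2)) * (entry e1 i1 l1 * (letter x a e * letter y b e') * entry e2 i2 l2) else 0)"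
    by (rule sum.cong[OF refl], rule sum.cong[OF refl], rule sum.swap)
  also have "\<dots> = (\<Sum>l1\<in>ixs N1. \<Sum>a=1..n. \<Sum>l2\<in>ixs N2.
       scalar (pairing_tensor t (l1 @ l2)) * (entry e1 i1 l1 * (letter x a e * letter y a e') * entry e2 i2 l2))"
    by (intro sum.cong refl) simp
  also have "\<dots> = (\<Sum>l1\<in>ixs N1. \<Sum>l2\<in>ixs N2. \<Sum>a=1..n.
       scalar (pairing_tensor t (l1 @ l2)) * (entry e1 i1 l1 * (letter x a e * letter y a e') * entry e2 i2 l2))"
    by (rule sum.cong[OF refl], rule sum.swap)
  also have "\<dots> = (\<Sum>l1\<in>ixs N1. \<Sum>l2\<in>ixs N2. scalar (pairing_tensor t (l1 @ l2)) * (entry e1 i1 l1 * S * entry e2 i2 l2))"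
    by (simp add: S_def sum_distrib_left sum_distrib_right)
  finally have sum1: "(\<Sum>l\<in>ixs (length es). scalar (pairing_tensor (insert_arch k t) l) * entry es is l) = \<dots>" .
  have sum2: "(\<Sum>l\<in>ixs (length (e1 @ e2)). scalar (pairing_tensor t l) * entry (e1 @ e2) (i1 @ i2) l) =
     (\<Sum>l1\<in>ixs N1. \<Sum>l2\<in>ixs N2. scalar (pairing_tensor t (l1 @ l2)) * (entry e1 i1 l1 * entry e2 i2 l2))"
    unfolding rep sum_listset_append
  proof (intro sum.cong refl)
    fix l1 l2 assume "l1 \<in> ixs N1"
    then have "length l1 = length e1" using length_listset by (fastforce simp: N1_def)
    then show "scalar (pairing_tensor t (l1 @ l2)) * entry (e1 @ e2) (i1 @ i2) (l1 @ l2) =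
      scalar (pairing_tensor t (l1 @ l2)) * (entry e1 i1 l1 * entry e2 i2 l2)"
      using 1 by (simp add: entry_append N1_def)
  qed
  \<comment> \<open>\<open>Q\<close> is the error made by replacing the contracted pair
    \<open>S\<close> by \<open>delta x y\<close>; \<open>Z\<close> is the defect of the smaller
    pairing, null by induction.\<close>
  define Q where "Q = (\<Sum>l1\<in>ixs N1. \<Sum>l2\<in>ixs N2. scalar (pairing_tensor t (l1 @ l2)) * (entry e1 i1 l1 * (S - delta x y) * entry e2 i2 l2))"
  define Z where "Z = (\<Sum>l\<in>ixs (length (e1 @ e2)). scalar (pairing_tensor t l) * entry (e1 @ e2) (i1 @ i2) l) - scalar (pairing_tensor t (i1 @ i2))"
  have "scalar c * (entry e1 i1 l1 * (S - delta x y) * entry e2 i2 l2) \<in> A \<and>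
      p (scalar c * (entry e1 i1 l1 * (S - delta x y) * entry e2 i2 l2)) = 0"
    if "l1 \<in> ixs N1" "l2 \<in> ixs N2" for c l1 l2
  proof -
    have "scalar c * (u * d * v) \<in> A \<and> p (scalar c * (u * d * v)) = 0"
      if "u \<in> A" "d \<in> A" "v \<in> A" "p d = 0" for u d v
      using that null_mult_left[OF _ _ null_mult_right[OF _ _ null_mult_left[OF that(2,1,4)]]] by auto
    then show ?thesis using S in_A[OF that] by blast
  qed
  then have inner: "(\<Sum>l2\<in>ixs N2. scalar (c l2) * (entry e1 i1 l1 * (S - delta x y) * entry e2 i2 l2)) \<in> A \<and>
      p (\<Sum>l2\<in>ixs N2. scalar (c l2) * (entry e1 i1 l1 * (S - delta x y) * entry e2 i2 l2)) = 0"
    if "l1 \<in> ixs N1" for c l1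
    using that by (intro conjI monoid_algebra_sum null_sum) auto
  have Q: "Q \<in> A" "p Q = 0"
    unfolding Q_def by (rule monoid_algebra_sum, erule inner[THEN conjunct1]) (rule null_sum, erule inner)
  have Z: "Z \<in> A" "p Z = 0"
  proof -
    show "p Z = 0" unfolding Z_def by (rule insert.IH[OF es(4) is12])
    show "Z \<in> A" unfolding Z_def using is12 by (auto intro!: closed entry_in)
  qed
  have "(\<Sum>l\<in>ixs (length es). scalar (pairing_tensor (insert_arch k t) l) * entry es is l) - scalar (pairing_tensor (insert_arch k t) is) =
    Q + delta x y * Z"
  proof -
    have d: "delta x y * u = u * delta x y" for u by (simp add: delta_def)
    have "(\<Sum>l\<in>ixs (length es). scalar (pairing_tensor (insert_arch k t) l) * entry es is l) =
      Q + delta x y * (\<Sum>l\<in>ixs (length (e1 @ e2)). scalar (pairing_tensor t l) * entry (e1 @ e2) (i1 @ i2) l)"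
      unfolding sum1 sum2 Q_def sum_distrib_left sum.distrib[symmetric]
      by (intro sum.cong refl) (simp add: delta_def algebra_simps)
    moreover have "scalar (pairing_tensor (insert_arch k t) is) = delta x y * scalar (pairing_tensor t (i1 @ i2))"
      using T[OF 1(4), of x y i2] 1 r by (simp add: delta_def)
    ultimately show ?thesis by (simp add: Z_def right_diff_distrib)
  qed
  also have "p (Q + delta x y * Z) = 0"
    using Q Z delta_in by (intro null_add null_mult_left closed) auto
  finally show ?case .
qed

end

text \<open>Colours depend on the star tag only and share the full index range.
  \<open>al_bar\<close> turns matching arches into relations, \<open>R_mom\<close> makes the
  universal property available for the pairing functional.\<close>

locale haar_system = unitary_algebra n p R al + moment_system bar "\<lambda>_. {1..n}" "\<lambda>_. cl"
  for n :: nat and p R al and bar :: "'c \<Rightarrow> 'c" and cl +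
  assumes al_bar: "\<And>e e'. cl e' = bar (cl e) \<Longrightarrow> al e e'"
    and R_mom: "\<And>r. r \<in> R \<Longrightarrow> null r"
begin

lemma mom_contraction:
  assumes m: "m \<in> words n" and y: "y \<in> A"
  shows "vnorm mom (mon m * y) \<le> vnorm mom y"
proof (rule column_contraction[OF M mom_positive, where T = "\<lambda>x. x" and n = n])
  fix j e and y :: free_alg assume j: "j \<in> {1..n}"
  have "null ((\<Sum>k\<in>{1..n}. letter k j (\<not> e) * letter k j e) - delta j j)"
    by (rule null_pair_transposed[where c = "cl (\<not> e)"]) (use j col_not[of "\<not> e"] in auto)
  then show "lin mom (pstar y * ((\<Sum>k=1..n. letter k j (\<not> e) * letter k j e) - 1) * y) = 0"
    unfolding null_def by (simp add: delta_def)
qed (use m y in auto)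

text \<open>The GNS seminorm of \<open>mom\<close> kills the relators and so lies below
  \<open>p\<close>; evaluation at the cyclic vector gives the estimate.\<close>

lemma mom_bound:
  assumes x: "x \<in> A"
  shows "cmod (lin mom x) \<le> p x"
proof -
  have pos: "\<mu> \<in> {mom} \<Longrightarrow> positive_functional (words n) \<mu>" for \<mu> using mom_positive by auto
  have unit: "\<mu> \<in> {mom} \<Longrightarrow> \<mu> 0 = 1" for \<mu> using mom_zero by blast
  have contr: "\<mu> \<in> {mom} \<Longrightarrow> m \<in> words n \<Longrightarrow> y \<in> A \<Longrightarrow> vnorm \<mu> (mon m * y) \<le> vnorm \<mu> y" for \<mu> m y
    using mom_contraction by auto
  have cstar: "cstar_seminorm (words n) (gns_seminorm (words n) {mom})"
    by (rule gns_seminorm_cstar[OF M insert_not_empty], erule pos, erule unit, erule (2) contr)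
  have R: "gns_seminorm (words n) {mom} r = 0" if "r \<in> R" for r
  proof (rule antisym)
    have r: "r \<in> A" using that R_in by auto
    show "gns_seminorm (words n) {mom} r \<le> 0"
    proof (rule gns_seminorm_least[OF M insert_not_empty], erule pos, erule unit, erule (2) contr, rule r)
      fix \<mu> and y :: free_alg assume "\<mu> \<in> {mom}"
      have "lin mom (pstar (r * y) * r * y) = 0" using R_mom[OF that] by (simp only: null_def)
      then show "vnorm \<mu> (r * y) \<le> 0 * vnorm \<mu> y" using \<open>\<mu> \<in> {mom}\<close> by (simp add: vnorm_def mult.assoc)
    qed
    show "0 \<le> gns_seminorm (words n) {mom} r" using cstar r by (auto simp: cstar_seminorm_def)
  qed
  have v1: "vnorm mom 1 = 1" using lin_single[of mom 0 1] mom_zero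
    unfolding vnorm_def by (simp only: pstar_one mult_1_left mult_1_right single_one one_complex.simps real_sqrt_one)
  have "cmod (lin mom (pstar 1 * x)) \<le> vnorm mom 1 * vnorm mom x"
    by (rule vnorm_cauchy_schwarz[OF M mom_positive]) (use x in auto)
  also have "\<dots> = vnorm mom (x * 1)" by (simp only: v1 mult_1_left mult_1_right)
  also have "\<dots> \<le> gns_seminorm (words n) {mom} x * vnorm mom 1"
    by (rule gns_seminorm_bound[OF M insert_not_empty], erule pos, erule unit, erule (2) contr) (use x in auto)
  also have "\<dots> \<le> p x" using greatest[OF cstar _ x] R by (simp only: v1 mult_1_right) blast
  finally show ?thesis by simp
qed

text \<open>Linear extension of \<open>pairing_fixed\<close>: arches joining dual colours satisfy
  \<open>al\<close>.\<close>

lemma fixed_vector: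
  assumes "V (map cl es) f" "is \<in> ixs (length es)"
  shows "p ((\<Sum>l\<in>ixs (length es). scalar (f l) * entry es is l) - scalar (f is)) = 0"
  using assms
proof (induction "map cl es" f rule: V.induct)
  case (pairing t)
  then have "fits (\<lambda>e e'. cl e' = bar (cl e)) t es" by (simp add: fits_map)
  then have "fits al t es"
    by (induction t arbitrary: es) (use al_bar in \<open>auto, blast\<close>)
  then show ?case using pairing.prems by (rule pairing_fixed)
next
  case (add f g)
  have in_A: "(\<Sum>l\<in>ixs (length es). scalar (h l) * entry es is l) - scalar (h is) \<in> A" for h
    using add.prems by (auto intro!: closed entry_in)
  have "(\<Sum>l\<in>ixs (length es). scalar (f l + g l) * entry es is l) - scalar (f is + g is) =
    ((\<Sum>l\<in>ixs (length es). scalar (f l) * entry es is l) - scalar (f is)) +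
    ((\<Sum>l\<in>ixs (length es). scalar (g l) * entry es is l) - scalar (g is))"
    by (simp add: scalar_add distrib_right sum.distrib)
  then show ?case using add in_A by (simp add: cstar_seminormed.null_add[OF cstar_seminormed_axioms])
next
  case (scale f a)
  have in_A: "(\<Sum>l\<in>ixs (length es). scalar (f l) * entry es is l) - scalar (f is) \<in> A"
    using scale.prems by (auto intro!: closed entry_in)
  have "(\<Sum>l\<in>ixs (length es). scalar (a * f l) * entry es is l) - scalar (a * f is) =
    scalar a * ((\<Sum>l\<in>ixs (length es). scalar (f l) * entry es is l) - scalar (f is))"
    by (simp add: scalar_mult right_diff_distrib sum_distrib_left mult.assoc)
  then show ?case using scale in_A by (simp add: cstar_seminormed.scale[OF cstar_seminormed_axioms])
next
  case zero
  then show ?case by simp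
next
  case (ext f g)
  have "(\<Sum>l\<in>ixs (length es). scalar (f l) * entry es is l) - scalar (f is) =
    (\<Sum>l\<in>ixs (length es). scalar (g l) * entry es is l) - scalar (g is)"
    using ext.hyps(3) ext.prems by (simp add: map_replicate_const)
  then show ?case using ext by simp
qed

text \<open>Let \<open>H\<close> be the matrix of Haar values. Applying \<open>mom\<close> to left
  invariance gives \<open>H E = H\<close>; applying \<open>h\<close> to the fact that the entries
  fix the columns of \<open>E\<close> gives \<open>H E = E\<close>.\<close>

theorem haar_moment:
  assumes haar: "haar_functional n p h" and ixs: "is \<in> ixs (length es)" "js \<in> ixs (length es)"
  shows "h (emb (entry es is js)) = E (map cl es) is js"
proof -
  let ?w = "map cl es" and ?k = "length es"
  have idx: "idx ?w = ixs ?k" by (simp add: map_replicate_const)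
  have h: "state C h" using haar by (simp add: haar_functional_def)
  have len: "length l = ?k" if "l \<in> ixs ?k" for l using length_listset[OF that] by simp
  have map2: "map2 (\<lambda>_. cl) l es = ?w" if "l \<in> ixs ?k" for l
    using len[OF that] by (induction es arbitrary: l) (auto simp: length_Suc_conv)
  have in_A: "entry es k l \<in> A" if "k \<in> ixs ?k" "l \<in> ixs ?k" for k l using that by (intro entry_in) auto
  have mom: "lin mom (entry es k l) = E ?w k l" if "k \<in> ixs ?k" "l \<in> ixs ?k" for k l
    using mom_entry[of k es l] that by (simp only: len map2)
  define x where "x = (\<Sum>l\<in>ixs ?k. scalar (h (emb (entry es is l))) * entry es l js) - scalar (h (emb (entry es is js)))"
  have "x \<in> A" unfolding x_def using ixs by (intro closed in_A)
  then have "cmod (lin mom x) \<le> 0"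
    using mom_bound[of x] haar_functional_entry[OF haar ixs refl] by (simp only: x_def)
  then have "lin mom x = 0" by simp
  moreover have "lin mom x = (\<Sum>l\<in>ixs ?k. h (emb (entry es is l)) * E ?w l js) - h (emb (entry es is js))"
    unfolding x_def lin_diff lin_sum lin_scalar lin_scalar_const mom_zero
    by (simp only: mom[OF _ ixs(2)] mult_1_right cong: sum.cong)
  ultimately have 1: "(\<Sum>l\<in>ixs ?k. h (emb (entry es is l)) * E ?w l js) = h (emb (entry es is js))"
    by simp
  have "V ?w (\<lambda>i. E ?w i js)" using ixs idx by (intro E_column) simp
  from fixed_vector[OF this ixs(1)]
  have "lin (restrict_state h) ((\<Sum>l\<in>ixs ?k. scalar (E ?w l js) * entry es is l) - scalar (E ?w is js)) = 0"
    using in_A ixs by (intro restrict_state_null[OF h]) (auto intro!: closed)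
  then have 2: "(\<Sum>l\<in>ixs ?k. h (emb (entry es is l)) * E ?w l js) = E ?w is js"
    unfolding lin_diff lin_sum lin_scalar lin_scalar_const restrict_state_unit[OF h]
    by (simp only: lin_restrict_state[OF h] in_A[OF ixs(1)] mult_1_right mult.commute[of "E _ _ _"] right_minus_eq cong: sum.cong)
  show ?thesis using 1 2 by simp
qed

end

section \<open>Coded *-probability spaces\<close>

definition word_product :: "('m::involutive_monoid \<Rightarrow>\<^sub>0 complex) \<Rightarrow> bool list \<Rightarrow> ('m \<Rightarrow>\<^sub>0 complex)" where
  "word_product x w = foldr (\<lambda>e y. (if e then pstar x else x) * y) w 1"

lemma (in cstar_seminormed) star_moment_emb:
  assumes x: "x \<in> A"
  shows "star_moment C h (emb x) w = h (emb (word_product x w)) \<and> word_product x w \<in> A"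
proof -
  have "foldr (\<lambda>e y. (if e then star C (emb x) else emb x) \<otimes>\<^bsub>C\<^esub> y) w \<one>\<^bsub>C\<^esub> = emb (word_product x w) \<and> word_product x w \<in> A"
  proof (induction w)
    case Nil
    show ?case by (simp add: word_product_def emb_one)
  next
    case (Cons e w)
    then have "word_product x w \<in> A" by simp
    moreover have "word_product x (e # w) = (if e then pstar x else x) * word_product x w" by (simp add: word_product_def)
    ultimately show ?case using Cons x by (simp add: emb_star emb_mult)
  qed
  then show ?thesis by (simp add: star_moment_def)
qed

lemma word_product_diagonal:
  fixes w :: "bool list"
  assumes "x = scalar (of_real c) * (\<Sum>i\<in>S. letter i i False)"
  shows "word_product x w = scalar (of_real c ^ length w) * (\<Sum>i\<in>listset (replicate (length w) S). entry w i i)"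
proof (induction w)
  case Nil
  show ?case by (simp add: word_product_def)
next
  case (Cons e w)
  have star: "(if e then pstar x else x) = scalar (of_real c) * (\<Sum>i\<in>S. letter i i e)"
    by (cases e) (simp_all add: assms pstar_mult pstar_sum pstar_letter scalar_commute)
  have "word_product x (e # w) = (if e then pstar x else x) * word_product x w" by (simp add: word_product_def)
  also have "\<dots> = scalar (of_real c) * (\<Sum>i\<in>S. letter i i e) * (scalar (of_real c ^ length w) * (\<Sum>i\<in>listset (replicate (length w) S). entry w i i))"
    unfolding star Cons ..
  also have "\<dots> = scalar (of_real c ^ length (e # w)) * ((\<Sum>i\<in>S. letter i i e) * (\<Sum>i\<in>listset (replicate (length w) S). entry w i i))"
    by (simp only: mult.assoc scalar_left_commute[of "\<Sum>i\<in>S. letter i i e"] scalar_scalar length_Cons power_Suc)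
  also have "(\<Sum>i\<in>S. letter i i e) * (\<Sum>i\<in>listset (replicate (length w) S). entry w i i) =
      (\<Sum>i\<in>listset (replicate (length (e # w)) S). entry (e # w) i i)"
    unfolding sum_product list.size add_Suc_right add_0_right replicate_Suc sum_listset_Cons entry_Cons ..
  finally show ?case .
qed

lemma complex_ring_cring: "cring complex_ring"
proof (rule cringI)
  show "abelian_group complex_ring"
  proof (rule abelian_groupI)
    fix x :: complex
    show "\<exists>y\<in>carrier complex_ring. y \<oplus>\<^bsub>complex_ring\<^esub> x = \<zero>\<^bsub>complex_ring\<^esub>"
      by (rule bexI[of _ "- x"]) (auto simp: complex_ring_def)
  qed (auto simp: complex_ring_def)
  show "Group.comm_monoid complex_ring"
    by (rule comm_monoidI) (auto simp: complex_ring_def)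
qed (auto simp: complex_ring_def algebra_simps)

context moment_system
begin

text \<open>A class modulo null elements is determined by the values of the functional on all its
  two-sided multiples by words. Words are countable, so these values form one complex sequence, as
  the type \<open>space\<close> demands.\<close>

definition code :: "free_alg \<Rightarrow> nat \<Rightarrow> complex" where
  "code a = (\<lambda>k. lin mom (mon (Word (from_nat (fst (prod_decode k)))) * a * mon (Word (from_nat (snd (prod_decode k))))))"

lemma code_eq_iff: "code a = code b \<longleftrightarrow> null (a - b)"
proof
  assume *: "code a = code b"
  show "null (a - b)"
  proof (rule nullI)
    fix m m' :: "(nat \<times> nat) word"
    from fun_cong[OF *, of "prod_encode (to_nat (letters m), to_nat (letters m'))"]
    show "lin mom (mon m * (a - b) * mon m') = 0"
      by (simp add: code_def algebra_simps lin_diff)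
  qed
next
  assume "null (a - b)"
  then have "lin mom (x * a * y) = lin mom (x * b * y)" for x y
    unfolding null_def by (simp add: algebra_simps lin_diff)
  then show "code a = code b" by (simp add: code_def)
qed

definition decode :: "(nat \<Rightarrow> complex) \<Rightarrow> free_alg" where
  "decode X = (SOME a. code a = X)"

lemma code_decode: "code (decode (code a)) = code a"
  unfolding decode_def by (rule someI[of "\<lambda>b. code b = code a"]) simp

lemma null_decode: "null (decode (code a) - a)"
  using code_decode code_eq_iff by blast

definition B :: space where
  "B = \<lparr>carrier = range code, mult = (\<lambda>X Y. code (decode X * decode Y)), one = code 1, zero = code 0,
     add = (\<lambda>X Y. code (decode X + decode Y)), smult = (\<lambda>c X. code (scalar c * decode X)),
     star = (\<lambda>X. code (pstar (decode X)))\<rparr>"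

definition \<psi> :: "(nat \<Rightarrow> complex) \<Rightarrow> complex" where
  "\<psi> X = lin mom (decode X)"

lemma lin_mom_pstar: "lin mom (pstar x) = cnj (lin mom x)"
  using positive_functional_hermitian[of UNIV mom 1 x] mom_positive
  by (simp add: star_submonoid_def monoid_algebra_def)

lemma null_pstar: "null x \<Longrightarrow> null (pstar x)"
  unfolding null_def
proof (intro allI)
  fix a b assume x: "\<forall>a b. lin mom (a * x * b) = 0"
  have "lin mom (a * pstar x * b) = cnj (lin mom (pstar b * x * pstar a))"
    unfolding lin_mom_pstar[symmetric] by (simp add: pstar_mult mult.assoc)
  then show "lin mom (a * pstar x * b) = 0" using x by simp
qed

lemma B_add: "code a \<oplus>\<^bsub>B\<^esub> code b = code (a + b)"
proof -
  have "null ((decode (code a) - a) + (decode (code b) - b))" by (intro null_add null_decode)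
  then show ?thesis by (simp add: B_def code_eq_iff algebra_simps)
qed

lemma B_mult: "code a \<otimes>\<^bsub>B\<^esub> code b = code (a * b)"
proof -
  have "null (1 * (decode (code a) - a) * decode (code b) + a * (decode (code b) - b) * 1)"
    by (intro null_add null_mult null_decode)
  then show ?thesis by (simp add: B_def code_eq_iff algebra_simps)
qed

lemma B_smult: "c \<odot>\<^bsub>B\<^esub> code a = code (scalar c * a)"
proof -
  have "null (scalar c * (decode (code a) - a))" by (intro null_scalar null_decode)
  then show ?thesis by (simp add: B_def code_eq_iff algebra_simps)
qed

lemma B_star: "star B (code a) = code (pstar a)"
  using null_pstar[OF null_decode, of a] by (simp add: B_def code_eq_iff pstar_minus)

lemma B_one: "\<one>\<^bsub>B\<^esub> = code 1" and B_zero: "\<zero>\<^bsub>B\<^esub> = code 0" and B_carrier: "carrier B = range code"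
  by (simp_all add: B_def)

lemma \<psi>_code: "\<psi> (code a) = lin mom a"
proof -
  have "lin mom (1 * (decode (code a) - a) * 1) = 0" using null_decode unfolding null_def by blast
  then show ?thesis by (simp add: \<psi>_def lin_diff)
qed

lemmas B_simps = B_add B_mult B_smult B_star B_one B_zero \<psi>_code

lemma B_star_algebra: "star_algebra B"
proof -
  have grp: "abelian_group B"
  proof (rule abelian_groupI)
    fix X assume "X \<in> carrier B"
    then obtain a where "X = code a" by (auto simp: B_carrier)
    then show "\<exists>Y\<in>carrier B. Y \<oplus>\<^bsub>B\<^esub> X = \<zero>\<^bsub>B\<^esub>"
      by (intro bexI[of _ "code (- a)"]) (auto simp: B_carrier B_simps)
  qed (auto simp: B_carrier B_simps ac_simps)
  have mon: "Group.monoid B"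
    by (rule Group.monoidI) (auto simp: B_carrier B_simps mult.assoc)
  have ring: "Ring.ring B"
    by (rule ringI[OF grp mon]) (auto simp: B_carrier B_simps algebra_simps)
  have module: "Module.module complex_ring B"
    by (rule moduleI[OF complex_ring_cring grp])
      (auto simp: B_carrier B_simps complex_ring_def scalar_add scalar_scalar algebra_simps)
  show ?thesis
    by (intro star_algebra.intro star_algebra_axioms.intro ring module)
      (auto simp: B_carrier B_simps mult.assoc scalar_left_commute pstar_add pstar_mult scalar_commute[of _ "cnj _"])
qed

lemma B_state: "state B \<psi>"
  using mom_positive[of UNIV] lin_single[of mom 0 1]
  by (auto simp: state_def B_carrier B_simps lin_add lin_scalar positive_functional_def monoid_algebra_def)

lemma B_space: "star_prob_space B \<psi>"
  using B_star_algebra B_state by (simp add: star_prob_space_def)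

lemma star_moment_B: "star_moment B \<psi> (code x) w = lin mom (word_product x w)"
proof -
  have "foldr (\<lambda>e y. (if e then star B (code x) else code x) \<otimes>\<^bsub>B\<^esub> y) w \<one>\<^bsub>B\<^esub> = code (word_product x w)"
    by (induction w) (simp_all add: word_product_def B_simps)
  then show ?thesis by (simp add: star_moment_def B_simps)
qed

end

section \<open>Freeness\<close>

context colour_system
begin

text \<open>The pairing is bilinear; since \<open>V w\<close> is closed under conjugation, this
  amounts to orthogonality for the inner product.\<close>

definition orthogonal :: "'c list \<Rightarrow> (nat list \<Rightarrow> complex) \<Rightarrow> bool" where
  "orthogonal w \<eta> \<longleftrightarrow> (\<forall>f. V w f \<longrightarrow> (\<Sum>l\<in>idx w. \<eta> l * f l) = 0)"

abbreviation block_word :: "('c list \<times> (nat list \<Rightarrow> complex)) list \<Rightarrow> 'c list" where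
  "block_word bs \<equiv> concat (map fst bs)"

fun block_product :: "('c list \<times> (nat list \<Rightarrow> complex)) list \<Rightarrow> nat list \<Rightarrow> complex" where
  "block_product [] J = 1"
| "block_product ((w, \<eta>) # bs) J = \<eta> (take (length w) J) * block_product bs (drop (length w) J)"

lemma block_product_append:
  "length J = length (block_word bs) \<Longrightarrow> block_product (bs @ bs') (J @ J') = block_product bs J * block_product bs' J'"
proof (induction bs arbitrary: J)
  case (Cons a bs)
  obtain w \<eta> where a: "a = (w, \<eta>)" by (cases a)
  have "length (drop (length w) J) = length (block_word bs)" "length J \<ge> length w" using Cons.prems a by auto
  then show ?case using Cons.IH[of "drop (length w) J"] a by (simp add: mult.assoc)
qed simp

text \<open>Pairing with an additional arch means contracting \<open>F\<close> at the feet of that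
  arch first; this drives the inductions for freeness, sign weights and the Gram matrix.\<close>

lemma sum_insert_arch:
  assumes k: "length u = k" "k \<le> 2 * arcs t"
  shows "(\<Sum>J\<in>idx (u @ c # bar c # v). F J * pairing_tensor (insert_arch k t) J) =
    (\<Sum>i\<in>idx u. \<Sum>j\<in>idx v. (\<Sum>a\<in>ix c. F (i @ a # a # j)) * pairing_tensor t (i @ j))"
proof -
  have fits: "pairing_tensor (insert_arch k t) (i @ a # b # j) = (if b = a then pairing_tensor t (i @ j) else 0)"
    if "i \<in> idx u" for i a b j
    using length_idx[OF that] k fits_insert_arch[of i k t "(=)" a b j] by auto
  have "(\<Sum>J\<in>idx (u @ c # bar c # v). F J * pairing_tensor (insert_arch k t) J) =
    (\<Sum>i\<in>idx u. \<Sum>a\<in>ix c. \<Sum>b\<in>ix c. \<Sum>j\<in>idx v. F (i @ a # b # j) * pairing_tensor (insert_arch k t) (i @ a # b # j))"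
    unfolding sum_idx_append sum_idx_Cons ix_bar ..
  also have "\<dots> = (\<Sum>i\<in>idx u. \<Sum>a\<in>ix c. \<Sum>b\<in>ix c. if b = a then \<Sum>j\<in>idx v. F (i @ a # a # j) * pairing_tensor t (i @ j) else 0)"
    by (intro sum.cong refl) (simp add: fits del: sum_of_bool_mult_eq sum_mult_of_bool_eq)
  also have "\<dots> = (\<Sum>i\<in>idx u. \<Sum>a\<in>ix c. \<Sum>j\<in>idx v. F (i @ a # a # j) * pairing_tensor t (i @ j))"
    by (intro sum.cong refl) (simp del: sum_of_bool_mult_eq sum_mult_of_bool_eq)
  also have "\<dots> = (\<Sum>i\<in>idx u. \<Sum>j\<in>idx v. \<Sum>a\<in>ix c. F (i @ a # a # j) * pairing_tensor t (i @ j))"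
    by (rule sum.cong[OF refl], rule sum.swap)
  finally show ?thesis by (simp only: sum_distrib_right)
qed

lemma V_cnj: "V w f \<Longrightarrow> V w (\<lambda>i. cnj (f i))"
proof (induction rule: V.induct)
  case (pairing t w)
  from V.pairing[OF this] show ?case by (rule V.ext) simp
next
  case (ext w f g)
  from ext.IH show ?case by (rule V.ext) (simp add: ext.hyps)
qed (auto intro: V.intros)

context
  fixes \<kappa> :: "'c \<Rightarrow> bool"
  assumes \<kappa>: "\<kappa> (bar c) = \<kappa> c"
begin

definition alternating :: "bool list \<Rightarrow> ('c list \<times> (nat list \<Rightarrow> complex)) list \<Rightarrow> bool" where
  "alternating ls bs \<longleftrightarrow> distinct_adj ls \<and>
     list_all2 (\<lambda>b (w, \<eta>). w \<noteq> [] \<and> (\<forall>c\<in>set w. \<kappa> c = b) \<and> orthogonal w \<eta>) ls bs"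

text \<open>Dual colours have the same class while adjacent blocks, which are not empty, have
  different classes; so two neighbouring dual letters lie in one block.\<close>

lemma alternating_split:
  assumes "alternating ls bs" "block_word bs = u @ c # bar c # v"
  shows "\<exists>bs1 w1 w2 \<eta> bs2. bs = bs1 @ (w1 @ c # bar c # w2, \<eta>) # bs2 \<and> u = block_word bs1 @ w1 \<and> v = w2 @ block_word bs2"
  using assms
proof (induction bs arbitrary: ls u)
  case (Cons a bs)
  obtain w \<eta> where a: "a = (w, \<eta>)" by (cases a)
  from Cons.prems(1) obtain b ls' where ls: "ls = b # ls'" by (cases ls) (auto simp: alternating_def)
  have alt: "alternating ls' bs" using Cons.prems(1) ls by (cases ls') (auto simp: alternating_def)
  have eq: "w @ block_word bs = u @ c # bar c # v" using Cons.prems(2) a by simp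
  show ?case
  proof (cases "length u < length w")
    case False
    then have "take (length w) u = w" using arg_cong[OF eq, of "take (length w)"] by simp
    then obtain u' where u: "u = w @ u'" by (metis append_take_drop_id)
    then have "block_word bs = u' @ c # bar c # v" using eq by simp
    from Cons.IH[OF alt this] obtain bs1 w1 w2 \<eta>' bs2 where
      "bs = bs1 @ (w1 @ c # bar c # w2, \<eta>') # bs2" "u' = block_word bs1 @ w1" "v = w2 @ block_word bs2" by blast
    then show ?thesis using u a
      by (intro exI[of _ "a # bs1"] exI[of _ w1] exI[of _ w2] exI[of _ \<eta>'] exI[of _ bs2]) simp
  next
    case True
    then obtain r where r: "w = u @ r" "r @ block_word bs = c # bar c # v"
      using eq by (auto simp: append_eq_append_conv2)
    with True obtain w' where w: "w = u @ c # w'" by (cases r) auto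
    then have rest: "w' @ block_word bs = bar c # v" using eq by simp
    have \<kappa>c: "\<kappa> c = b" using Cons.prems(1) ls a w by (auto simp: alternating_def)
    show ?thesis
    proof (cases w')
      case Nil
      then have bw: "block_word bs = bar c # v" using rest by simp
      then obtain a' bs' where bs: "bs = a' # bs'" by (cases bs) auto
      obtain w'' \<eta>'' where a': "a' = (w'', \<eta>'')" by (cases a')
      obtain b' ls'' where ls': "ls' = b' # ls''" using alt bs by (cases ls') (auto simp: alternating_def)
      have w'': "w'' \<noteq> []" "\<forall>c\<in>set w''. \<kappa> c = b'" using alt bs a' ls' by (auto simp: alternating_def)
      then have "hd w'' = bar c" using bw bs a' by (cases w'') auto
      then have "\<kappa> (bar c) = b'" using w'' by (metis list.set_sel(1))
      moreover have "b \<noteq> b'" using Cons.prems(1) ls ls' by (auto simp: alternating_def)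
      ultimately show ?thesis using \<kappa> \<kappa>c by simp
    next
      case (Cons d w2)
      then show ?thesis using rest w a
        by (intro exI[of _ "[]"] exI[of _ u] exI[of _ w2] exI[of _ \<eta>] exI[of _ bs]) simp
    qed
  qed
qed simp

text \<open>An innermost arch cannot join two different blocks, so contracting it stays inside one block
  and preserves orthogonality there.\<close>

lemma alternating_orthogonal_pairing:
  assumes "alternating ls bs" "bs \<noteq> []" "matches t (block_word bs)"
  shows "(\<Sum>J\<in>idx (block_word bs). block_product bs J * pairing_tensor t J) = 0"
  using assms
proof (induction t arbitrary: bs rule: pairing_insert_induct)
  case Empty
  then show ?case by (cases bs; cases ls) (auto simp: alternating_def)
next
  case (insert k t)
  obtain u c v where uv: "block_word bs = u @ c # bar c # v" "length u = k" "matches t (u @ v)"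
    by (rule matches_insert_archE[OF insert.prems(3) insert.hyps])
  from alternating_split[OF insert.prems(1) uv(1)] obtain bs1 w1 w2 \<eta> bs2 where
    bs: "bs = bs1 @ (w1 @ c # bar c # w2, \<eta>) # bs2" "u = block_word bs1 @ w1" "v = w2 @ block_word bs2" by blast
  define \<eta>' where "\<eta>' l = (\<Sum>a\<in>ix c. \<eta> (take (length w1) l @ a # a # drop (length w1) l))" for l
  define bs' where "bs' = bs1 @ (w1 @ w2, \<eta>') # bs2"
  have orth: "orthogonal (w1 @ c # bar c # w2) \<eta>"
    using insert.prems(1) bs(1) by (auto simp: alternating_def list_all2_append2 list_all2_Cons2)
  have \<eta>': "(\<Sum>l\<in>idx (w1 @ w2). \<eta>' l * f l) = 0" if f: "V (w1 @ w2) f" for f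
  proof -
    let ?g = "\<lambda>i. if i ! length w1 = i ! Suc (length w1) then f (take (length w1) i @ drop (length w1 + 2) i) else 0"
    have "(\<Sum>l\<in>idx (w1 @ c # bar c # w2). \<eta> l * ?g l) = 0"
      using orth V_cup[OF f, of c] unfolding orthogonal_def by blast
    moreover have "(\<Sum>l\<in>idx (w1 @ c # bar c # w2). \<eta> l * ?g l) =
      (\<Sum>l1\<in>idx w1. \<Sum>a\<in>ix c. \<Sum>b\<in>ix c. \<Sum>l2\<in>idx w2. if b = a then \<eta> (l1 @ a # a # l2) * f (l1 @ l2) else 0)"
      unfolding sum_idx_append sum_idx_Cons ix_bar
      by (intro sum.cong refl) (auto simp: length_idx nth_append)
    also have "\<dots> = (\<Sum>l1\<in>idx w1. \<Sum>a\<in>ix c. \<Sum>l2\<in>idx w2. \<Sum>b\<in>ix c. if b = a then \<eta> (l1 @ a # a # l2) * f (l1 @ l2) else 0)"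
      by (rule sum.cong[OF refl], rule sum.cong[OF refl], rule sum.swap)
    also have "\<dots> = (\<Sum>l1\<in>idx w1. \<Sum>a\<in>ix c. \<Sum>l2\<in>idx w2. \<eta> (l1 @ a # a # l2) * f (l1 @ l2))"
      by (intro sum.cong refl) simp
    also have "\<dots> = (\<Sum>l1\<in>idx w1. \<Sum>l2\<in>idx w2. \<Sum>a\<in>ix c. \<eta> (l1 @ a # a # l2) * f (l1 @ l2))"
      by (rule sum.cong[OF refl], rule sum.swap)
    also have "\<dots> = (\<Sum>l\<in>idx (w1 @ w2). \<eta>' l * f l)"
      unfolding sum_idx_append by (intro sum.cong refl) (simp add: \<eta>'_def length_idx sum_distrib_right)
    finally show ?thesis by simp
  qed
  have "(\<Sum>J\<in>idx (block_word bs). block_product bs J * pairing_tensor (insert_arch k t) J) =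
    (\<Sum>i\<in>idx u. \<Sum>j\<in>idx v. (\<Sum>a\<in>ix c. block_product bs (i @ a # a # j)) * pairing_tensor t (i @ j))"
    unfolding uv(1) by (rule sum_insert_arch[OF uv(2) insert.hyps])
  also have "\<dots> = (\<Sum>i\<in>idx u. \<Sum>j\<in>idx v. block_product bs' (i @ j) * pairing_tensor t (i @ j))"
  proof (intro sum.cong refl)
    fix i j assume ij: "i \<in> idx u" "j \<in> idx v"
    from ij(1) obtain i1 i2 where i: "i = i1 @ i2" "length i1 = length (block_word bs1)" "i2 \<in> idx w1"
      unfolding bs(2) by (rule idx_appendE) blast
    from ij(2) obtain j1 j2 where j: "j = j1 @ j2" "j1 \<in> idx w2" "length j1 = length w2"
      unfolding bs(3) by (rule idx_appendE) blast
    have "block_product bs (i @ a # a # j) = block_product bs1 i1 * (\<eta> (i2 @ a # a # j1) * block_product bs2 j2)" for a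
      unfolding bs(1) i(1) append_assoc using i j by (subst block_product_append) (simp_all add: length_idx)
    moreover have "block_product bs' (i @ j) = block_product bs1 i1 * (\<eta>' (i2 @ j1) * block_product bs2 j2)"
      unfolding bs'_def i(1) append_assoc using i j by (subst block_product_append) (simp_all add: length_idx)
    ultimately have "(\<Sum>a\<in>ix c. block_product bs (i @ a # a # j)) = block_product bs' (i @ j)"
      using i by (simp add: \<eta>'_def length_idx sum_distrib_left sum_distrib_right)
    then show "(\<Sum>a\<in>ix c. block_product bs (i @ a # a # j)) * pairing_tensor t (i @ j) = block_product bs' (i @ j) * pairing_tensor t (i @ j)" by simp
  qed
  also have "\<dots> = (\<Sum>J\<in>idx (block_word bs'). block_product bs' J * pairing_tensor t J)"
  proof -
    have "block_word bs' = u @ v" by (simp add: bs'_def bs)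
    then show ?thesis by (simp only: sum_idx_append)
  qed
  also have "\<dots> = 0"
  \<comment> \<open>If the contracted block disappears, its neighbours may have equal class and
    alternation is lost. But then its remaining coefficient is 0, by orthogonality to the empty
    pairing, and so is the whole product.\<close>
  proof (cases "w1 @ w2 = []")
    case True
    have "V [] (pairing_tensor Empty)" by (rule V.pairing) simp
    from \<eta>'[unfolded True, OF this] have "\<eta>' [] = 0" by simp
    moreover have "block_product bs' J = 0" if J: "J \<in> idx (block_word bs')" for J
    proof -
      from J have "J \<in> idx (block_word bs1 @ block_word bs2)" using True by (simp add: bs'_def)
      then obtain J1 J2 where "J = J1 @ J2" "length J1 = length (block_word bs1)" by (rule idx_appendE)
      then show ?thesis unfolding bs'_def using True \<open>\<eta>' [] = 0\<close> by (simp add: block_product_append)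
    qed
    ultimately show ?thesis by simp
  next
    case False
    have "alternating ls bs'"
      using insert.prems(1) False \<eta>' unfolding alternating_def bs(1) bs'_def
      by (auto simp: list_all2_append2 list_all2_Cons2 orthogonal_def)
    moreover have "matches t (block_word bs')" using uv(3) by (simp add: bs'_def bs)
    ultimately show ?thesis by (intro insert.IH) (simp_all add: bs'_def)
  qed
  finally show ?case .
qed

lemma alternating_orthogonal:
  assumes "alternating ls bs" "bs \<noteq> []" "V (block_word bs) f"
  shows "(\<Sum>J\<in>idx (block_word bs). block_product bs J * f J) = 0"
  using assms(3)
proof (induction "block_word bs" f rule: V.induct)
  case (pairing t)
  then show ?case by (rule alternating_orthogonal_pairing[OF assms(1,2)])
next
  case (scale f a)
  then show ?case by (simp add: mult.left_commute[of _ a] sum_distrib_left[symmetric])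
next
  case (ext f g)
  have "(\<Sum>J\<in>idx (block_word bs). block_product bs J * g J) = (\<Sum>J\<in>idx (block_word bs). block_product bs J * f J)"
    by (intro sum.cong refl) (simp add: ext.hyps)
  then show ?case using ext by simp
qed (simp_all add: distrib_left sum.distrib)

end

end

section \<open>Freeness of the algebras of two colour classes\<close>

context moment_system
begin

context
  fixes \<kappa> :: "'c \<Rightarrow> bool"
  assumes \<kappa>: "\<kappa> (bar c) = \<kappa> c"
begin

definition class_algebra :: "bool \<Rightarrow> free_alg set" where
  "class_algebra b = monoid_algebra {m. \<forall>c\<in>set (colours m). \<kappa> c = b}"

lemma class_star_submonoid: "star_submonoid {m. \<forall>c\<in>set (colours m). \<kappa> c = b}"
  by (auto simp: star_submonoid_def \<kappa>)

text \<open>A row of entries contracted over the column index with a vector orthogonal to the fixed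
  ones; products of such elements produce exactly the blocks of \<open>alternating\<close>.\<close>

definition reduced :: "bool \<Rightarrow> free_alg \<Rightarrow> bool" where
  "reduced b g \<longleftrightarrow> (\<exists>es is w \<eta>. w = map2 col is es \<and> length is = length es \<and> w \<noteq> [] \<and> is \<in> idx w \<and>
     (\<forall>c\<in>set w. \<kappa> c = b) \<and> orthogonal w \<eta> \<and> g = (\<Sum>l\<in>idx w. scalar (\<eta> l) * entry es is l))"

inductive reduced_span :: "bool \<Rightarrow> free_alg \<Rightarrow> bool" for b where
  "reduced b g \<Longrightarrow> reduced_span b g"
| "reduced_span b x \<Longrightarrow> reduced_span b y \<Longrightarrow> reduced_span b (x + y)"
| "reduced_span b x \<Longrightarrow> reduced_span b (scalar c * x)"
| "reduced_span b 0"

lemma reduced_span_sum: "(\<And>i. i \<in> I \<Longrightarrow> reduced_span b (f i)) \<Longrightarrow> reduced_span b (\<Sum>i\<in>I. f i)"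
  by (induction I rule: infinite_finite_induct) (auto intro: reduced_span.intros)

lemma word_eq_entry: "mon m = entry (map snd (letters m)) (rows m) (columns m)"
proof -
  have "zip (zip (map (\<lambda>((i, j), e). i) l) (map (\<lambda>((i, j), e). j) l)) (map snd l) = l" for l :: "((nat \<times> nat) \<times> bool) list"
    by (induction l) auto
  then show ?thesis by (cases m) (simp add: entry_def rows_def columns_def)
qed

lemma colours_map2: "colours m = map2 col (rows m) (map snd (letters m))"
proof -
  have "map (\<lambda>((i, j), e). col i e) l = map2 col (map (\<lambda>((i, j), e). i) l) (map snd l)" for l :: "((nat \<times> nat) \<times> bool) list"
    by (induction l) auto
  then show ?thesis by (simp add: colours_def rows_def)
qed

lemma null_outside:
  assumes "rows m \<notin> idx (colours m) \<or> columns m \<notin> idx (colours m)"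
  shows "null (mon m)"
proof (rule nullI)
  fix a b
  have "mom (a + m + b) = 0"
    unfolding mom_def using assms by (intro E_outside) (auto simp: append_listset_iff)
  then show "lin mom (mon a * mon m * mon b) = 0" by (simp add: mult_single)
qed

text \<open>Modulo null elements the constant \<open>mom m\<close> is the image of the word \<open>m\<close> under the projection
  onto fixed vectors, so a centred element is a combination of entries contracted with vectors
  orthogonal to the fixed ones.\<close>

lemma centred_word:
  assumes m: "\<forall>c\<in>set (colours m). \<kappa> c = b"
  shows "\<exists>y. reduced_span b y \<and> null (mon m - scalar (mom m) - y)"
proof (cases "m = 0 \<or> rows m \<notin> idx (colours m) \<or> columns m \<notin> idx (colours m)")
  case True
  have "null (mon m - scalar (mom m) - 0)"
  proof (cases "m = 0")
    case False
    then have out: "rows m \<notin> idx (colours m) \<or> columns m \<notin> idx (colours m)" using True by blast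
    then have "mom m = 0" unfolding mom_def by (intro E_outside) auto
    then show ?thesis using null_outside[OF out] by simp
  qed (simp add: null_zero)
  then show ?thesis using reduced_span.intros(4) by blast
next
  case False
  let ?w = "colours m" and ?es = "map snd (letters m)"
  \<comment> \<open>The basis vector at \<open>columns m\<close> minus its projection onto the fixed
    vectors.\<close>
  define \<eta> where "\<eta> l = (if l = columns m then 1 else 0) - E ?w l (columns m)" for l
  define y where "y = (\<Sum>l\<in>idx ?w. scalar (\<eta> l) * entry ?es (rows m) l)"
  have j: "columns m \<in> idx ?w" using False by blast
  have orth: "orthogonal ?w \<eta>"
    unfolding orthogonal_def
  proof (intro allI impI)
    fix f assume f: "V ?w f"
    have "(\<Sum>l\<in>idx ?w. E ?w l (columns m) * f l) = cnj (\<Sum>l\<in>idx ?w. E ?w (columns m) l * cnj (f l))"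
      by (simp add: E_cnj)
    also have "\<dots> = f (columns m)" using E_apply[OF V_cnj[OF f] j] by simp
    finally have "(\<Sum>l\<in>idx ?w. E ?w l (columns m) * f l) = f (columns m)" .
    moreover have "(\<Sum>l\<in>idx ?w. (if l = columns m then 1 else 0) * f l) = f (columns m)"
      using j by (simp add: if_distrib[of "\<lambda>t. t * _"] cong: if_cong)
    ultimately show "(\<Sum>l\<in>idx ?w. \<eta> l * f l) = 0"
      by (simp add: \<eta>_def left_diff_distrib sum_subtractf)
  qed
  have "reduced b y"
    unfolding reduced_def
  proof (intro exI conjI)
    show "?w = map2 col (rows m) ?es" by (rule colours_map2)
    show "length (rows m) = length ?es" by (simp add: rows_def)
    show "?w \<noteq> []" using False by (cases m) (auto simp: colours_def zero_word_def)
    show "y = (\<Sum>l\<in>idx ?w. scalar (\<eta> l) * entry ?es (rows m) l)" by (rule y_def)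
  qed (use False m orth in auto)
  moreover have "null (mon m - scalar (mom m) - y)"
  proof -
    have "y = mon m - (\<Sum>l\<in>idx ?w. scalar (E ?w l (columns m)) * entry ?es (rows m) l)"
    proof -
      have "(\<Sum>l\<in>idx ?w. scalar (if l = columns m then 1 else 0) * entry ?es (rows m) l) =
        (\<Sum>l\<in>idx ?w. if l = columns m then entry ?es (rows m) l else 0)"
        by (intro sum.cong refl) simp
      also have "\<dots> = mon m" using j by (simp add: word_eq_entry)
      finally show ?thesis
        by (simp add: y_def \<eta>_def scalar_diff left_diff_distrib sum_subtractf)
    qed
    then have "mon m - scalar (mom m) - y =
      (\<Sum>l\<in>idx ?w. scalar (E ?w l (columns m)) * entry ?es (rows m) l) - scalar (E ?w (rows m) (columns m))"
      by (simp add: mom_def)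
    moreover have "null \<dots>"
      using False by (intro null_fixed_vector[OF E_column[OF j] colours_map2]) (auto simp: rows_def)
    ultimately show ?thesis by simp
  qed
  ultimately show ?thesis using reduced_span.intros(1) by blast
qed

lemma centred_class_algebra:
  assumes x: "x \<in> class_algebra b" "lin mom x = 0"
  shows "\<exists>y. reduced_span b y \<and> null (x - y)"
proof -
  have "\<forall>m\<in>Poly_Mapping.keys x. \<exists>y. reduced_span b y \<and> null (mon m - scalar (mom m) - y)"
    using x(1) by (auto simp: class_algebra_def monoid_algebra_def intro!: centred_word)
  then obtain y where y: "\<And>m. m \<in> Poly_Mapping.keys x \<Longrightarrow> reduced_span b (y m) \<and> null (mon m - scalar (mom m) - y m)"
    by metis
  define z where "z = (\<Sum>m\<in>Poly_Mapping.keys x. scalar (Poly_Mapping.lookup x m) * y m)"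
  have "reduced_span b z"
    unfolding z_def by (intro reduced_span_sum reduced_span.intros(3)) (use y in blast)
  moreover have "x - z = (\<Sum>m\<in>Poly_Mapping.keys x. scalar (Poly_Mapping.lookup x m) * (mon m - scalar (mom m) - y m))"
  proof -
    have "(\<Sum>m\<in>Poly_Mapping.keys x. scalar (Poly_Mapping.lookup x m) * scalar (mom m)) = scalar (lin mom x)"
      by (simp add: lin_def scalar_sum scalar_mult)
    moreover have "(\<Sum>m\<in>Poly_Mapping.keys x. scalar (Poly_Mapping.lookup x m) * mon m) = x"
      by (simp add: scalar_single flip: poly_mapping_expand)
    ultimately show ?thesis by (simp add: z_def right_diff_distrib sum_subtractf x(2))
  qed
  moreover have "null \<dots>" by (intro null_sum null_scalar) (use y in blast)
  ultimately show ?thesis by metis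
qed

abbreviation "prod_of xs \<equiv> foldr (*) xs (1 :: free_alg)"

lemma reduced_product:
  assumes "list_all2 reduced ls xs"
  shows "\<exists>bs es is. list_all2 (\<lambda>b (w, \<eta>). w \<noteq> [] \<and> (\<forall>c\<in>set w. \<kappa> c = b) \<and> orthogonal w \<eta>) ls bs \<and>
    block_word bs = map2 col is es \<and> length is = length es \<and> is \<in> idx (block_word bs) \<and>
    prod_of xs = (\<Sum>J\<in>idx (block_word bs). scalar (block_product bs J) * entry es is J)"
  using assms
proof (induction ls xs rule: list_all2_induct)
  case Nil
  show ?case by (intro exI[of _ "[]"]) simp
next
  case (Cons b ls x xs)
  from Cons.hyps(1) obtain es1 is1 w \<eta> where
    x: "w = map2 col is1 es1" "length is1 = length es1" "w \<noteq> []" "is1 \<in> idx w"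
     "\<forall>c\<in>set w. \<kappa> c = b" "orthogonal w \<eta>" "x = (\<Sum>l\<in>idx w. scalar (\<eta> l) * entry es1 is1 l)"
    unfolding reduced_def by blast
  from Cons.IH obtain bs es2 is2 where
    IH: "list_all2 (\<lambda>b (w, \<eta>). w \<noteq> [] \<and> (\<forall>c\<in>set w. \<kappa> c = b) \<and> orthogonal w \<eta>) ls bs"
    "block_word bs = map2 col is2 es2" "length is2 = length es2" "is2 \<in> idx (block_word bs)"
    "prod_of xs = (\<Sum>J\<in>idx (block_word bs). scalar (block_product bs J) * entry es2 is2 J)" by blast
  have len: "length w = length es1" using x by simp
  have "prod_of (x # xs) = (\<Sum>l\<in>idx w. \<Sum>J\<in>idx (block_word bs). scalar (\<eta> l) * entry es1 is1 l * (scalar (block_product bs J) * entry es2 is2 J))"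
    by (simp only: foldr.simps comp_apply IH(5) x(7) sum_product)
  also have "\<dots> = (\<Sum>l\<in>idx w. \<Sum>J\<in>idx (block_word bs). scalar (block_product ((w, \<eta>) # bs) (l @ J)) * entry (es1 @ es2) (is1 @ is2) (l @ J))"
  proof (intro sum.cong refl)
    fix l J assume l: "l \<in> idx w"
    then have "length l = length w" by (rule length_idx)
    moreover have "scalar (\<eta> l) * entry es1 is1 l * (scalar (block_product bs J) * entry es2 is2 J) =
      scalar (\<eta> l * block_product bs J) * (entry es1 is1 l * entry es2 is2 J)"
      by (simp only: mult.assoc scalar_left_commute[of "entry es1 is1 l"] scalar_scalar)
    ultimately show "scalar (\<eta> l) * entry es1 is1 l * (scalar (block_product bs J) * entry es2 is2 J) =
      scalar (block_product ((w, \<eta>) # bs) (l @ J)) * entry (es1 @ es2) (is1 @ is2) (l @ J)"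
      using x(2) len by (simp add: entry_append)
  qed
  also have "\<dots> = (\<Sum>J\<in>idx (block_word ((w, \<eta>) # bs)). scalar (block_product ((w, \<eta>) # bs) J) * entry (es1 @ es2) (is1 @ is2) J)"
    by (simp only: list.map concat.simps fst_conv sum_idx_append)
  finally show ?case
    using x IH by (intro exI[of _ "(w, \<eta>) # bs"] exI[of _ "es1 @ es2"] exI[of _ "is1 @ is2"])
      (auto simp: append_listset_iff simp del: block_product.simps)
qed

text \<open>The functional replaces entries by \<open>E\<close>, whose rows are conjugates of fixed
  vectors, so the coefficients are annihilated by \<open>alternating_orthogonal\<close>.\<close>

lemma reduced_product_zero:
  assumes "list_all2 reduced ls xs" "distinct_adj ls" "ls \<noteq> []"
  shows "lin mom (prod_of xs) = 0"
proof -
  obtain bs es "is" where bs: "list_all2 (\<lambda>b (w, \<eta>). w \<noteq> [] \<and> (\<forall>c\<in>set w. \<kappa> c = b) \<and> orthogonal w \<eta>) ls bs"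
    "block_word bs = map2 col is es" "length is = length es" "is \<in> idx (block_word bs)"
    "prod_of xs = (\<Sum>J\<in>idx (block_word bs). scalar (block_product bs J) * entry es is J)"
    using reduced_product[OF assms(1)] by blast
  have alt: "alternating \<kappa> ls bs" using bs assms(2) by (simp add: alternating_def[of \<kappa>, OF \<kappa>])
  have ne: "bs \<noteq> []" using bs(1) assms(3) by auto
  have len: "length J = length es" if "J \<in> idx (block_word bs)" for J
    using length_idx[OF that] bs(2,3) by simp
  have "lin mom (prod_of xs) = (\<Sum>J\<in>idx (block_word bs). block_product bs J * E (block_word bs) is J)"
    unfolding bs(5) lin_sum lin_scalar using bs(3) len
    by (intro sum.cong refl) (simp add: mom_entry bs(2))
  also have "\<dots> = (\<Sum>J\<in>idx (block_word bs). block_product bs J * cnj (E (block_word bs) J is))"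
    by (simp add: E_cnj)
  also have "\<dots> = 0"
    by (rule alternating_orthogonal[of \<kappa>, OF \<kappa> alt ne V_cnj[OF E_column[OF bs(4)]]])
  finally show ?thesis .
qed

text \<open>The factors are replaced one by one; the prefix \<open>a\<close> collects those already
  treated, and null differences vanish between any two factors.\<close>

lemma multilinear_zero:
  assumes "\<And>ys. list_all2 reduced ls ys \<Longrightarrow> lin mom (a * prod_of ys) = 0"
    and "list_all2 (\<lambda>b x. \<exists>y. reduced_span b y \<and> null (x - y)) ls xs"
  shows "lin mom (a * prod_of xs) = 0"
  using assms
proof (induction ls arbitrary: a xs)
  case Nil
  from Nil(2) Nil(1)[of "[]"] show ?case by simp
next
  case (Cons b ls)
  then obtain x xs' where xs: "xs = x # xs'" "list_all2 (\<lambda>b x. \<exists>y. reduced_span b y \<and> null (x - y)) ls xs'"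
    and "\<exists>y. reduced_span b y \<and> null (x - y)" by (auto simp: list_all2_Cons1)
  then obtain y where y: "reduced_span b y" "null (x - y)" by blast
  have red: "lin mom (a * g * prod_of xs') = 0" if "reduced b g" for g
  proof (rule Cons.IH[OF _ xs(2)])
    fix ys assume "list_all2 reduced ls ys"
    then show "lin mom (a * g * prod_of ys) = 0"
      using Cons.prems(1)[of "g # ys"] that by (simp add: mult.assoc)
  qed
  from y(1) have "lin mom (a * y * prod_of xs') = 0"
  proof induction
    case (3 x c)
    then show ?case by (simp add: scalar_left_commute[of a] mult.assoc lin_scalar)
  qed (simp_all add: red distrib_left distrib_right lin_add)
  moreover have "lin mom (a * (x - y) * prod_of xs') = 0" using y(2) by (simp add: null_def)
  ultimately show ?case by (simp add: xs(1) algebra_simps lin_diff)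
qed

lemma free_class_algebras:
  assumes S: "\<And>b. S b \<subseteq> code ` class_algebra b"
  shows "free_subalgebras B \<psi> S"
  unfolding free_subalgebras_def
proof (intro allI impI)
  fix xs assume xs: "xs \<noteq> [] \<and> (\<forall>(i, a)\<in>set xs. a \<in> S i \<and> \<psi> a = 0) \<and> distinct_adj (map fst xs)"
  have "\<forall>z\<in>set xs. \<exists>x. snd z = code x \<and> x \<in> class_algebra (fst z) \<and> lin mom x = 0"
  proof
    fix z assume z: "z \<in> set xs"
    then have "snd z \<in> S (fst z)" "\<psi> (snd z) = 0" using xs by auto
    then have "snd z \<in> code ` class_algebra (fst z)" "\<psi> (snd z) = 0" using S by auto
    then show "\<exists>x. snd z = code x \<and> x \<in> class_algebra (fst z) \<and> lin mom x = 0"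
      using \<psi>_code by fastforce
  qed
  then obtain f where f: "\<And>z. z \<in> set xs \<Longrightarrow> snd z = code (f z) \<and> f z \<in> class_algebra (fst z) \<and> lin mom (f z) = 0" by metis
  have "foldr (\<otimes>\<^bsub>B\<^esub>) (map snd zs) \<one>\<^bsub>B\<^esub> = code (prod_of (map f zs))" if "set zs \<subseteq> set xs" for zs
    using that by (induction zs) (auto simp: B_simps f)
  then have "\<psi> (foldr (\<otimes>\<^bsub>B\<^esub>) (map snd xs) \<one>\<^bsub>B\<^esub>) = lin mom (1 * prod_of (map f xs))" by (simp add: \<psi>_code)
  also have "\<dots> = 0"
  proof (rule multilinear_zero)
    fix ys assume "list_all2 reduced (map fst xs) ys"
    then show "lin mom (1 * prod_of ys) = 0" using reduced_product_zero[of "map fst xs" ys] xs by simp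
  next
    show "list_all2 (\<lambda>b x. \<exists>y. reduced_span b y \<and> null (x - y)) (map fst xs) (map f xs)"
      using f centred_class_algebra by (auto simp: list_all2_conv_all_nth)
  qed
  finally show "\<psi> (foldr (\<otimes>\<^bsub>B\<^esub>) (map snd xs) \<one>\<^bsub>B\<^esub>) = 0" .
qed

lemma generated_class_algebra:
  assumes "a \<in> class_algebra b"
  shows "generated_star_subalgebra B {code a} \<subseteq> code ` class_algebra b"
proof -
  have "unital_star_subalgebra B (code ` class_algebra b)"
    unfolding unital_star_subalgebra_def
    using monoid_algebra_mult[OF class_star_submonoid] monoid_algebra_one[OF class_star_submonoid]
      monoid_algebra_pstar[OF class_star_submonoid] monoid_algebra_scalar[OF class_star_submonoid]
    by (auto simp: class_algebra_def B_carrier B_simps intro!: imageI monoid_algebra_add)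
  then show ?thesis using assms unfolding generated_star_subalgebra_def by blast
qed

lemma star_free_code:
  assumes "a \<in> class_algebra True" "b \<in> class_algebra False"
  shows "star_free B \<psi> (code a) (code b)"
  unfolding star_free_def
  by (rule free_class_algebras) (use assms generated_class_algebra in \<open>auto split: if_splits\<close>)

end

end

section \<open>Counting pairings\<close>

lemma insert_arch_inject:
  assumes "j \<le> 2 * arcs s" "j \<le> 2 * arcs t"
  shows "insert_arch j s = insert_arch j t \<longleftrightarrow> s = t"
proof
  assume "insert_arch j s = insert_arch j t"
  then have "take j (dyck s) @ True # False # drop j (dyck s) = take j (dyck t) @ True # False # drop j (dyck t)"
    using dyck_insert_arch assms by metis
  then have "take j (dyck s) = take j (dyck t) \<and> drop j (dyck s) = drop j (dyck t)"
    using assms by (subst (asm) append_eq_append_conv) auto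
  then show "s = t" by (metis append_take_drop_id dyck_inj)
qed simp

lemma finite_pairings: "finite {t. 2 * arcs t = k}"
proof (rule finite_imageD)
  have "finite {xs :: bool list. set xs \<subseteq> UNIV \<and> length xs = k}" by (rule finite_lists_length_eq) simp
  then show "finite (dyck ` {t. 2 * arcs t = k})" by (rule finite_subset[rotated]) auto
  show "inj_on dyck {t. 2 * arcs t = k}" by (auto intro: inj_onI dyck_inj)
qed

context colour_system
begin

abbreviation "NC w \<equiv> {t. matches t w}"

lemma finite_NC [simp]: "finite (NC w)"
  by (rule finite_subset[OF _ finite_pairings[of "length w"]]) (auto simp: matches_length)

lemma V_expand: "V w f \<Longrightarrow> \<exists>a. \<forall>i\<in>idx w. f i = (\<Sum>t\<in>NC w. a t * pairing_tensor t i)"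
proof (induction rule: V.induct)
  case (pairing t w)
  have "pairing_tensor t i = (\<Sum>s\<in>NC w. (if s = t then 1 else 0) * pairing_tensor s i)" for i
    using pairing by (simp add: if_distrib[of "\<lambda>x. x * _"] cong: if_cong)
  then show ?case by (intro exI[of _ "\<lambda>s. if s = t then 1 else 0"]) blast
next
  case (add w f g)
  then obtain a b where "\<forall>i\<in>idx w. f i = (\<Sum>t\<in>NC w. a t * pairing_tensor t i)"
    "\<forall>i\<in>idx w. g i = (\<Sum>t\<in>NC w. b t * pairing_tensor t i)" by blast
  then have "\<forall>i\<in>idx w. f i + g i = (\<Sum>t\<in>NC w. (a t + b t) * pairing_tensor t i)"
    by (simp add: distrib_right sum.distrib del: sum_mult_of_bool_eq)
  then show ?case by (intro exI[of _ "\<lambda>t. a t + b t"])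
next
  case (scale w f c)
  then obtain a where "\<forall>i\<in>idx w. f i = (\<Sum>t\<in>NC w. a t * pairing_tensor t i)" by blast
  then have "\<forall>i\<in>idx w. c * f i = (\<Sum>t\<in>NC w. (c * a t) * pairing_tensor t i)"
    by (simp add: sum_distrib_left mult.assoc del: sum_mult_of_bool_eq)
  then show ?case by (intro exI[of _ "\<lambda>t. c * a t"])
next
  case (zero w)
  have "\<forall>i\<in>idx w. 0 = (\<Sum>t\<in>NC w. 0 * pairing_tensor t i)" by simp
  then show ?case by (intro exI[of _ "\<lambda>t. 0"])
next
  case (ext w f g)
  then obtain a where "\<forall>i\<in>idx w. f i = (\<Sum>t\<in>NC w. a t * pairing_tensor t i)" by blast
  then have "\<forall>i\<in>idx w. g i = (\<Sum>t\<in>NC w. a t * pairing_tensor t i)" using ext.hyps by (metis (no_types, lifting))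
  then show ?case by (intro exI[of _ a])
qed

text \<open>Test vectors are products of the vectors \<open>(1, \<plusminus>\<i>)\<close>: their pairing with an arch vanishes exactly
  when the signs agree, which makes the pairing of noncrossing pairings with Dyck words triangular.\<close>

definition sign_weight :: "('c \<Rightarrow> nat) \<Rightarrow> ('c \<Rightarrow> nat) \<Rightarrow> bool list \<Rightarrow> 'c list \<Rightarrow> nat list \<Rightarrow> complex" where
  "sign_weight \<alpha> \<beta> D w i = prod_list (map (\<lambda>(b, c, a). if a = \<alpha> c then 1 else if a = \<beta> c then (if b then \<i> else - \<i>) else 0)
     (zip D (zip w i)))"

lemma sum_sign_weight:
  assumes ab: "\<And>c. \<alpha> c \<in> ix c" "\<And>c. \<beta> c \<in> ix c" "\<And>c. \<alpha> c \<noteq> \<beta> c" "\<And>c. \<alpha> (bar c) = \<alpha> c" "\<And>c. \<beta> (bar c) = \<beta> c"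
    and "matches t w" "length D = length w"
  shows "(\<Sum>i\<in>idx w. sign_weight \<alpha> \<beta> D w i * pairing_tensor t i) = (if fits (\<noteq>) t D then 2 ^ arcs t else 0)"
  using assms(6-)
proof (induction t arbitrary: w D rule: pairing_insert_induct)
  case Empty
  then show ?case by (simp add: sign_weight_def)
next
  case (insert k t)
  obtain u c v where w: "w = u @ c # bar c # v" "length u = k" "matches t (u @ v)"
    by (rule matches_insert_archE[OF insert.prems(1) insert.hyps])
  have "length u < length D" using w insert.prems by simp
  then obtain D1 b D' where D: "D = D1 @ b # D'" "length D1 = k" using w(2) split_list_length by metis
  then have "length D' = Suc (length v)" using w insert.prems by simp
  then obtain b' D2 where D': "D' = b' # D2" "length D2 = length v" by (cases D') auto
  have arch: "(\<Sum>a\<in>ix c. sign_weight \<alpha> \<beta> D w (i @ a # a # j)) =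
      (if b \<noteq> b' then 2 else 0) * sign_weight \<alpha> \<beta> (D1 @ D2) (u @ v) (i @ j)"
    if "length i = k" for i j
  proof -
    let ?f = "\<lambda>b a. if a = \<alpha> c then 1 else if a = \<beta> c then (if b then \<i> else - \<i>) else 0"
    have "sign_weight \<alpha> \<beta> D w (i @ a # a # j) = ?f b a * ?f b' a * sign_weight \<alpha> \<beta> (D1 @ D2) (u @ v) (i @ j)" for a
      using that w(2) D(2) unfolding sign_weight_def w(1) D(1) D'(1) by (simp add: ab)
    moreover have "(\<Sum>a\<in>ix c. ?f b a * ?f b' a) = (\<Sum>a\<in>{\<alpha> c, \<beta> c}. ?f b a * ?f b' a)"
      using ab(1,2) by (intro sum.mono_neutral_right) auto
    moreover have "\<dots> = (if b \<noteq> b' then 2 else 0)" using ab(3)[of c] ab(3)[of c, symmetric] by (cases b; cases b') simp_all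
    ultimately show ?thesis by (simp only: sum_distrib_right[symmetric])
  qed
  have "(\<Sum>i\<in>idx w. sign_weight \<alpha> \<beta> D w i * pairing_tensor (insert_arch k t) i) =
    (\<Sum>i\<in>idx u. \<Sum>j\<in>idx v. (\<Sum>a\<in>ix c. sign_weight \<alpha> \<beta> D w (i @ a # a # j)) * pairing_tensor t (i @ j))"
    using sum_insert_arch[OF w(2) insert.hyps, where F = "sign_weight \<alpha> \<beta> D w" and c = c and v = v] by (simp only: w(1))
  also have "\<dots> = (\<Sum>i\<in>idx u. \<Sum>j\<in>idx v. (if b \<noteq> b' then 2 else 0) * (sign_weight \<alpha> \<beta> (D1 @ D2) (u @ v) (i @ j) * pairing_tensor t (i @ j)))"
    by (intro sum.cong refl) (simp only: arch length_idx w(2) mult.assoc)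
  also have "\<dots> = (if b \<noteq> b' then 2 else 0) * (\<Sum>i\<in>idx (u @ v). sign_weight \<alpha> \<beta> (D1 @ D2) (u @ v) i * pairing_tensor t i)"
    by (simp only: sum_idx_append sum_distrib_left)
  also have "\<dots> = (if b \<noteq> b' then 2 else 0) * (if fits (\<noteq>) t (D1 @ D2) then 2 ^ arcs t else 0)"
    using insert.IH[OF w(3), of "D1 @ D2"] D D' w(2) by simp
  also have "\<dots> = (if fits (\<noteq>) (insert_arch k t) D then 2 ^ arcs (insert_arch k t) else 0)"
    using fits_insert_arch[OF D(2) insert.hyps, of "(\<noteq>)" b b' D2] by (simp add: D(1) D'(1) arcs_insert_arch insert.hyps)
  finally show ?case .
qed

text \<open>Among the pairings with nonzero coefficient take the one with the largest Dyck word: its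
  test vector annihilates all the others by \<open>fits_dyck_bits\<close>.\<close>

lemma pairing_tensors_independent:
  assumes "\<And>c. \<exists>a\<in>ix c. \<exists>b\<in>ix c. a \<noteq> b"
    and zero: "\<And>i. i \<in> idx w \<Longrightarrow> (\<Sum>t\<in>NC w. a t * pairing_tensor t i) = 0"
    and "matches t w"
  shows "a t = 0"
proof (rule ccontr)
  assume "a t \<noteq> 0"
  \<comment> \<open>The two indices are chosen as functions of the set \<open>ix c\<close>, so that
    a colour and its dual receive the same ones.\<close>
  have "\<forall>S. \<exists>p. (\<exists>a\<in>S. \<exists>b\<in>S. a \<noteq> b) \<longrightarrow> fst p \<in> S \<and> snd p \<in> S \<and> fst p \<noteq> (snd p :: nat)" by force
  then obtain p :: "nat set \<Rightarrow> nat \<times> nat" where p: "\<forall>S. (\<exists>a\<in>S. \<exists>b\<in>S. a \<noteq> b) \<longrightarrow> fst (p S) \<in> S \<and> snd (p S) \<in> S \<and> fst (p S) \<noteq> snd (p S)"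
    by metis
  define \<alpha> \<beta> where "\<alpha> c = fst (p (ix c))" and "\<beta> c = snd (p (ix c))" for c
  have ab: "\<alpha> c \<in> ix c" "\<beta> c \<in> ix c" "\<alpha> c \<noteq> \<beta> c" "\<alpha> (bar c) = \<alpha> c" "\<beta> (bar c) = \<beta> c" for c
    using p assms(1)[of c] by (auto simp: \<alpha>_def \<beta>_def)
  let ?S = "{t \<in> NC w. a t \<noteq> 0}"
  have "finite ?S" "?S \<noteq> {}" using assms(3) \<open>a t \<noteq> 0\<close> by auto
  then obtain s where s: "s \<in> ?S" "\<And>t. t \<in> ?S \<Longrightarrow> bits (dyck t) \<le> bits (dyck s)"
    using obtains_MAX[of ?S "\<lambda>t. bits (dyck t)"] by (metis (no_types, lifting) Max_ge finite_imageI imageI)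
  have len: "length (dyck s) = length w" using s(1) by (auto simp: matches_length)
  have "0 = (\<Sum>i\<in>idx w. sign_weight \<alpha> \<beta> (dyck s) w i * (\<Sum>t\<in>NC w. a t * pairing_tensor t i))"
    by (simp only: zero mult_zero_right sum.neutral_const cong: sum.cong)
  also have "\<dots> = (\<Sum>t\<in>NC w. a t * (\<Sum>i\<in>idx w. sign_weight \<alpha> \<beta> (dyck s) w i * pairing_tensor t i))"
    unfolding sum_distrib_left by (subst sum.swap) (simp only: mult.left_commute)
  also have "\<dots> = (\<Sum>t\<in>NC w. if t = s then a s * 2 ^ arcs s else 0)"
  proof (rule sum.cong[OF refl])
    fix t assume t: "t \<in> NC w"
    have "a t = 0" if "fits (\<noteq>) t (dyck s)" "t \<noteq> s"
    proof (rule ccontr)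
      assume "a t \<noteq> 0"
      then have "bits (dyck t) \<le> bits (dyck s)" using t s(2) by blast
      then have "dyck t = dyck s" using fits_dyck_bits[OF that(1)] by auto
      then show False using that(2) dyck_inj by blast
    qed
    then show "a t * (\<Sum>i\<in>idx w. sign_weight \<alpha> \<beta> (dyck s) w i * pairing_tensor t i) = (if t = s then a s * 2 ^ arcs s else 0)"
      using sum_sign_weight[OF ab, of t w "dyck s"] t len fits_dyck_append[of s] by auto
  qed
  also have "\<dots> = a s * 2 ^ arcs s" using s(1) by simp
  finally show False using s(1) by simp
qed

lemma E_expand:
  "\<exists>a. \<forall>i\<in>idx w. \<forall>j\<in>idx w. E w i j = (\<Sum>t\<in>NC w. pairing_tensor t i * a t j)"
proof -
  have ex: "\<forall>j\<in>idx w. \<exists>a. \<forall>i\<in>idx w. E w i j = (\<Sum>t\<in>NC w. a t * pairing_tensor t i)"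
    using V_expand[OF E_column] by blast
  from bchoice[OF ex] obtain a where "\<And>i j. i \<in> idx w \<Longrightarrow> j \<in> idx w \<Longrightarrow> E w i j = (\<Sum>t\<in>NC w. a j t * pairing_tensor t i)"
    by (elim exE) blast
  then show ?thesis by (intro exI[of _ "\<lambda>t j. a j t"]) (simp add: mult.commute del: sum_of_bool_mult_eq sum_mult_of_bool_eq)
qed

lemma E_zero: "NC w = {} \<Longrightarrow> E w i j = 0"
  using E_expand[of w] E_outside[of i w j] by (cases "i \<in> idx w \<and> j \<in> idx w") auto

text \<open>The trace of a projection is the dimension of its range. As \<open>E\<close> fixes the
  independent pairing vectors, its coefficients \<open>a\<close> form their dual system, and each
  pairing contributes 1.\<close>

lemma E_trace:
  assumes "\<And>c. \<exists>a\<in>ix c. \<exists>b\<in>ix c. a \<noteq> b"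
  shows "(\<Sum>i\<in>idx w. E w i i) = of_nat (card (NC w))"
proof -
  obtain a where a: "\<And>i j. i \<in> idx w \<Longrightarrow> j \<in> idx w \<Longrightarrow> E w i j = (\<Sum>t\<in>NC w. pairing_tensor t i * a t j)"
    using E_expand by blast
  have dual: "(\<Sum>j\<in>idx w. a t j * pairing_tensor s j) = (if t = s then 1 else 0)" if s: "s \<in> NC w" and t: "t \<in> NC w" for s t
  proof -
    have "(\<Sum>j\<in>idx w. a t j * pairing_tensor s j) - (if t = s then 1 else 0) = 0"
    proof (rule pairing_tensors_independent[of w "\<lambda>t. (\<Sum>j\<in>idx w. a t j * pairing_tensor s j) - (if t = s then 1 else 0)", OF assms])
      fix i assume i: "i \<in> idx w"
      have "pairing_tensor s i = (\<Sum>j\<in>idx w. (\<Sum>t\<in>NC w. pairing_tensor t i * a t j) * pairing_tensor s j)"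
        using E_apply[OF V.pairing i, of s] s a[OF i] by (simp del: sum_of_bool_mult_eq sum_mult_of_bool_eq)
      also have "\<dots> = (\<Sum>t\<in>NC w. (\<Sum>j\<in>idx w. a t j * pairing_tensor s j) * pairing_tensor t i)"
        unfolding sum_distrib_right by (subst sum.swap) (simp only: mult.commute mult.left_commute)
      finally have "(\<Sum>t\<in>NC w. (\<Sum>j\<in>idx w. a t j * pairing_tensor s j) * pairing_tensor t i) = pairing_tensor s i" ..
      moreover have "(\<Sum>t\<in>NC w. (if t = s then 1 else 0) * pairing_tensor t i) = pairing_tensor s i"
        using s by (simp add: if_distrib[of "\<lambda>x. x * _"] cong: if_cong)
      ultimately show "(\<Sum>t\<in>NC w. ((\<Sum>j\<in>idx w. a t j * pairing_tensor s j) - (if t = s then 1 else 0)) * pairing_tensor t i) = 0"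
        by (simp only: left_diff_distrib sum_subtractf diff_self)
    qed (use t in simp)
    then show ?thesis by simp
  qed
  have "(\<Sum>i\<in>idx w. E w i i) = (\<Sum>i\<in>idx w. \<Sum>t\<in>NC w. pairing_tensor t i * a t i)"
    by (intro sum.cong refl a)
  also have "\<dots> = (\<Sum>t\<in>NC w. \<Sum>i\<in>idx w. a t i * pairing_tensor t i)"
    by (subst sum.swap) (simp only: mult.commute)
  also have "\<dots> = (\<Sum>t\<in>NC w. 1)" by (intro sum.cong refl) (simp only: dual refl if_True)
  finally show ?thesis by simp
qed

text \<open>Drawn on opposite sides of a line, \<open>p\<close> and \<open>q\<close> form
  \<open>d\<close> closed loops. Removing an arch of \<open>q\<close> closes a loop only if
  \<open>p\<close> has the same arch; so all arches close loops exactly when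
  \<open>p = q\<close>.\<close>

lemma gram:
  assumes n: "\<And>c. card (ix c) = n" and "matches p w" "matches q w"
  shows "\<exists>d. (\<Sum>i\<in>idx w. pairing_tensor p i * pairing_tensor q i) = of_nat n ^ d \<and> d \<le> arcs q \<and> (d = arcs q \<longleftrightarrow> p = q)"
  using assms(2,3)
proof (induction q arbitrary: p w rule: pairing_insert_induct)
  case Empty
  then have "p = Empty" by (cases p) auto
  then show ?case using Empty by simp
next
  case (insert k q)
  obtain u c v where w: "w = u @ c # bar c # v" "length u = k" "matches q (u @ v)"
    by (rule matches_insert_archE[OF insert.prems(2) insert.hyps])
  have sum: "(\<Sum>i\<in>idx w. pairing_tensor p i * pairing_tensor (insert_arch k q) i) =
    (\<Sum>i\<in>idx u. \<Sum>j\<in>idx v. (\<Sum>a\<in>ix c. pairing_tensor p (i @ a # a # j)) * pairing_tensor q (i @ j))"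
    using sum_insert_arch[OF w(2) insert.hyps, where F = "pairing_tensor p" and c = c and v = v] by (simp only: w(1))
  show ?case
  proof (cases "\<exists>p'. p = insert_arch k p' \<and> matches p' (u @ v)")
    case True
    then obtain p' where p': "p = insert_arch k p'" "matches p' (u @ v)" by blast
    have k: "k \<le> 2 * arcs p'" using matches_length[OF p'(2)] w(2) by simp
    obtain d where d: "(\<Sum>i\<in>idx (u @ v). pairing_tensor p' i * pairing_tensor q i) = of_nat n ^ d" "d \<le> arcs q" "d = arcs q \<longleftrightarrow> p' = q"
      using insert.IH[OF p'(2) w(3)] by blast
    have "(\<Sum>a\<in>ix c. pairing_tensor p (i @ a # a # j)) = of_nat n * pairing_tensor p' (i @ j)" if "i \<in> idx u" for i j
      using fits_insert_arch[of i k p' "(=)" _ _ j] length_idx[OF that] w(2) k n by (simp add: p'(1))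
    then have "(\<Sum>i\<in>idx w. pairing_tensor p i * pairing_tensor (insert_arch k q) i) =
      (\<Sum>i\<in>idx u. \<Sum>j\<in>idx v. of_nat n * (pairing_tensor p' (i @ j) * pairing_tensor q (i @ j)))"
      unfolding sum by (simp only: mult.assoc cong: sum.cong)
    also have "\<dots> = of_nat n ^ Suc d"
      unfolding power_Suc d(1)[symmetric] sum_idx_append sum_distrib_left ..
    finally show ?thesis using d(2,3) p'(1) insert_arch_inject[OF k insert.hyps] arcs_insert_arch[OF insert.hyps] by (intro exI[of _ "Suc d"]) simp
  next
    case False
    then obtain p' where p': "matches p' (u @ v)"
      "\<And>i j. i \<in> idx u \<Longrightarrow> j \<in> idx v \<Longrightarrow> (\<Sum>a\<in>ix c. pairing_tensor p (i @ a # a # j)) = pairing_tensor p' (i @ j)"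
      using pairing_cap[of p u c v] insert.prems(1) w(1,2) by blast
    obtain d where d: "(\<Sum>i\<in>idx (u @ v). pairing_tensor p' i * pairing_tensor q i) = of_nat n ^ d" "d \<le> arcs q"
      using insert.IH[OF p'(1) w(3)] by blast
    have "(\<Sum>i\<in>idx w. pairing_tensor p i * pairing_tensor (insert_arch k q) i) =
      (\<Sum>i\<in>idx u. \<Sum>j\<in>idx v. pairing_tensor p' (i @ j) * pairing_tensor q (i @ j))"
      unfolding sum by (intro sum.cong refl) (simp only: p'(2))
    also have "\<dots> = of_nat n ^ d" unfolding d(1)[symmetric] sum_idx_append ..
    finally show ?thesis using d(2) False w(3) arcs_insert_arch[OF insert.hyps] by (intro exI[of _ d]) auto
  qed
qed

end

text \<open>With \<open>R n\<close> the total deviation of the matrix from the identity, the error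
  is at most \<open>R n\<close> times the size of the solution; once \<open>R n \<le> 1 / 2\<close>,
  that size is at most twice the size of \<open>b\<close>. This avoids inverse matrices.\<close>

lemma near_identity_system:
  fixes A :: "nat \<Rightarrow> 'a \<Rightarrow> 'a \<Rightarrow> complex" and x :: "nat \<Rightarrow> 'a \<Rightarrow> complex"
  assumes S: "finite S"
    and A: "\<And>p q. p \<in> S \<Longrightarrow> q \<in> S \<Longrightarrow> (\<lambda>n. A n q p) \<longlonglongrightarrow> (if p = q then 1 else 0)"
    and sys: "\<And>q. q \<in> S \<Longrightarrow> \<forall>\<^sub>F n in sequentially. (\<Sum>p\<in>S. A n q p * x n p) = b q"
    and q: "q \<in> S"
  shows "(\<lambda>n. x n q) \<longlonglongrightarrow> b q"
proof -
  define R where "R n = (\<Sum>q\<in>S. \<Sum>p\<in>S. cmod (A n q p - (if p = q then 1 else 0)))" for n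
  define X where "X n = (\<Sum>p\<in>S. cmod (x n p))" for n
  define C where "C = (\<Sum>p\<in>S. cmod (b p))"
  have R: "R \<longlonglongrightarrow> 0"
  proof -
    have "(\<lambda>n. \<Sum>q\<in>S. \<Sum>p\<in>S. cmod (A n q p - (if p = q then 1 else 0))) \<longlonglongrightarrow> (\<Sum>q\<in>S. \<Sum>p\<in>S. 0)"
      using A by (intro tendsto_sum tendsto_norm_zero LIM_zero) auto
    then show ?thesis by (simp add: R_def[abs_def])
  qed
  have all: "\<forall>\<^sub>F n in sequentially. \<forall>q\<in>S. (\<Sum>p\<in>S. A n q p * x n p) = b q"
    using sys S by (simp add: eventually_ball_finite)
  have total: "(\<Sum>q\<in>S. cmod (x n q - b q)) \<le> R n * X n" if "\<forall>q\<in>S. (\<Sum>p\<in>S. A n q p * x n p) = b q" for n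
  proof -
    have "cmod (x n q - b q) \<le> (\<Sum>p\<in>S. cmod (A n q p - (if p = q then 1 else 0))) * X n" if q: "q \<in> S" for q
    proof -
      have "(\<Sum>p\<in>S. (A n q p - (if p = q then 1 else 0)) * x n p) = (\<Sum>p\<in>S. A n q p * x n p) - (\<Sum>p\<in>S. if p = q then x n p else 0)"
        unfolding sum_subtractf[symmetric] by (intro sum.cong refl) (simp add: left_diff_distrib)
      also have "\<dots> = b q - x n q" using S q \<open>\<forall>q\<in>S. _ = b q\<close> by simp
      finally have "cmod (x n q - b q) = cmod (\<Sum>p\<in>S. (A n q p - (if p = q then 1 else 0)) * x n p)"
        by (simp add: norm_minus_commute)
      also have "\<dots> \<le> (\<Sum>p\<in>S. cmod (A n q p - (if p = q then 1 else 0)) * cmod (x n p))"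
        by (rule order.trans[OF norm_sum]) (simp add: norm_mult)
      also have "\<dots> \<le> (\<Sum>p\<in>S. cmod (A n q p - (if p = q then 1 else 0)) * X n)"
        unfolding X_def using S by (intro sum_mono mult_left_mono member_le_sum) auto
      finally show ?thesis by (simp add: sum_distrib_right)
    qed
    then have "(\<Sum>q\<in>S. cmod (x n q - b q)) \<le> (\<Sum>q\<in>S. (\<Sum>p\<in>S. cmod (A n q p - (if p = q then 1 else 0))) * X n)"
      by (rule sum_mono)
    then show ?thesis by (simp add: R_def sum_distrib_right)
  qed
  have bound: "cmod (x n q - b q) \<le> R n * (2 * C)" if n: "\<forall>q\<in>S. (\<Sum>p\<in>S. A n q p * x n p) = b q" "R n \<le> 1 / 2" for n
  proof -
    have R0: "0 \<le> R n" and X0: "0 \<le> X n" by (auto simp: R_def X_def intro!: sum_nonneg)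
    have "X n \<le> (\<Sum>q\<in>S. cmod (x n q - b q) + cmod (b q))"
      unfolding X_def by (intro sum_mono) (metis add.commute norm_triangle_sub)
    also have "\<dots> \<le> R n * X n + C" using total[OF n(1)] by (simp add: sum.distrib C_def)
    also have "\<dots> \<le> 1 / 2 * X n + C" using n(2) X0 by (intro add_right_mono mult_right_mono)
    finally have "X n \<le> 2 * C" by simp
    have "cmod (x n q - b q) \<le> (\<Sum>q\<in>S. cmod (x n q - b q))" using S q by (intro member_le_sum) auto
    also have "\<dots> \<le> R n * X n" by (rule total[OF n(1)])
    also have "\<dots> \<le> R n * (2 * C)" using \<open>X n \<le> 2 * C\<close> R0 by (rule mult_left_mono)
    finally show ?thesis .
  qed
  have "\<forall>\<^sub>F n in sequentially. R n < 1 / 2" by (rule order_tendstoD[OF R]) simp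
  with all have "\<forall>\<^sub>F n in sequentially. cmod (x n q - b q) \<le> R n * (2 * C)"
    by eventually_elim (intro bound, auto)
  moreover have "(\<lambda>n. R n * (2 * C)) \<longlonglongrightarrow> 0" using tendsto_mult_right[OF R, of "2 * C"] by simp
  ultimately have "(\<lambda>n. x n q - b q) \<longlonglongrightarrow> 0" by (rule Lim_null_comparison)
  then show ?thesis by (simp add: LIM_zero_iff)
qed

text \<open>That \<open>E\<close> fixes the pairing vectors is a linear system for its coefficients,
  with the Gram matrix divided by \<open>n ^ m\<close> as near-identity matrix. So the coefficients
  behave like the pairing tensors over \<open>n ^ m\<close>, and every pairing contributes its
  \<open>s ^ m\<close> admissible index lists.\<close>

lemma restricted_trace_limit:
  assumes bar: "\<And>c. bar (bar c) = c" and "k = 2 * m" "length w = k" and s: "s \<ge> 1"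
  shows "(\<lambda>n. of_nat n ^ m * (\<Sum>i\<in>listset (replicate k {1..s}). colour_system.E bar (\<lambda>_. {1..n}) w i i))
    \<longlonglongrightarrow> of_nat s ^ m * of_nat (card {t. fits (\<lambda>a b. b = bar a) t w})"
proof -
  have cs: "colour_system bar (\<lambda>_. {1..n})" for n
    by unfold_locales (auto simp: bar)
  let ?S = "{t. fits (\<lambda>a b. b = bar a) t w}"
  let ?X = "\<lambda>n. listset (map (\<lambda>_. {1..n}) w)"
  let ?E = "\<lambda>n. colour_system.E bar (\<lambda>_. {1..n}) w"
  have fin: "finite ?S" by (rule colour_system.finite_NC[OF cs])
  have arcs: "arcs t = m" if "t \<in> ?S" for t using that fits_length[of _ t w] assms(2,3) by auto
  have rep: "listset (replicate k {1..n}) = ?X n" for n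
    using assms(3) by (simp add: map_replicate_const)
  have mono: "?X s \<subseteq> ?X n" if "s \<le> n" for n
    using that by (induction w) (auto simp: set_Cons_def)
  have ex: "\<forall>n. \<exists>a. \<forall>i\<in>?X n. \<forall>j\<in>?X n. ?E n i j = (\<Sum>t\<in>?S. pairing_tensor t i * a t j)"
    using colour_system.E_expand[OF cs] by blast
  from choice[OF ex] obtain a where a: "\<And>n i j. i \<in> ?X n \<Longrightarrow> j \<in> ?X n \<Longrightarrow> ?E n i j = (\<Sum>t\<in>?S. pairing_tensor t i * a n t j)"
    by (elim exE) blast
  define G where "G n q p = (\<Sum>i\<in>?X n. pairing_tensor q i * pairing_tensor p i)" for n q p
  have limit: "(\<lambda>n. of_nat n ^ m * a n q j) \<longlonglongrightarrow> pairing_tensor q j" if j: "j \<in> ?X s" and q: "q \<in> ?S" for j q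
  proof (rule near_identity_system[OF fin _ _ q, where A = "\<lambda>n q p. G n q p / of_nat n ^ m"])
    fix p q assume pq: "p \<in> ?S" "q \<in> ?S"
    show "(\<lambda>n. G n q p / of_nat n ^ m) \<longlonglongrightarrow> (if p = q then 1 else 0)"
    proof (cases "p = q")
      case True
      have "G n q p = of_nat n ^ m" for n
        using colour_system.gram[OF cs, of n n q w p] pq arcs[OF pq(1)] True by (auto simp: G_def)
      then have "\<forall>\<^sub>F n in sequentially. 1 = G n q p / of_nat n ^ m"
        by (intro eventually_sequentiallyI[of 1]) simp
      then show ?thesis using True by (intro Lim_transform_eventually[OF tendsto_const]) simp_all
    next
      case False
      have "cmod (G n q p / of_nat n ^ m) \<le> 1 / real n" if n: "n \<ge> 1" for n
      proof -
        obtain d where d: "G n q p = of_nat n ^ d" "d \<le> m" "d \<noteq> m"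
          using colour_system.gram[OF cs, of n n q w p] pq arcs[OF pq(1)] False by (auto simp: G_def)
        then have "real n ^ Suc d \<le> real n ^ m" using n by (intro power_increasing) auto
        then show ?thesis using n d(1) by (simp add: norm_divide norm_power field_simps)
      qed
      then have "\<forall>\<^sub>F n in sequentially. cmod (G n q p / of_nat n ^ m) \<le> 1 / real n"
        by (intro eventually_sequentiallyI)
      then have "(\<lambda>n. G n q p / of_nat n ^ m) \<longlonglongrightarrow> 0" by (rule Lim_null_comparison) (rule lim_1_over_n)
      then show ?thesis using False by simp
    qed
  next
    fix q assume q: "q \<in> ?S"
    show "\<forall>\<^sub>F n in sequentially. (\<Sum>p\<in>?S. G n q p / of_nat n ^ m * (of_nat n ^ m * a n p j)) = pairing_tensor q j"
      using eventually_ge_at_top[of s]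
    proof eventually_elim
      case (elim n)
      have j': "j \<in> ?X n" using j mono[OF elim] by blast
      have "(\<Sum>p\<in>?S. G n q p / of_nat n ^ m * (of_nat n ^ m * a n p j)) = (\<Sum>p\<in>?S. G n q p * a n p j)"
        using elim s by (intro sum.cong refl) (simp add: field_simps)
      also have "\<dots> = (\<Sum>i\<in>?X n. (\<Sum>p\<in>?S. pairing_tensor p i * a n p j) * pairing_tensor q i)"
        unfolding G_def sum_distrib_right by (subst sum.swap) (simp only: mult.commute mult.left_commute)
      also have "\<dots> = (\<Sum>i\<in>?X n. ?E n i j * pairing_tensor q i)"
        by (intro sum.cong refl) (simp only: a j')
      also have "\<dots> = cnj (\<Sum>i\<in>?X n. ?E n j i * pairing_tensor q i)"
        by (simp only: cnj_sum complex_cnj_mult cnj_of_bool colour_system.E_cnj[OF cs])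
      also have "\<dots> = pairing_tensor q j"
        using colour_system.E_apply[OF cs colour_system.V.pairing[OF cs] j', of q] q by (simp del: sum_of_bool_mult_eq sum_mult_of_bool_eq One_nat_def)
      finally show ?case .
    qed
  qed
  have "(\<lambda>n. \<Sum>i\<in>?X s. \<Sum>t\<in>?S. pairing_tensor t i * (of_nat n ^ m * a n t i)) \<longlonglongrightarrow>
      (\<Sum>i\<in>?X s. \<Sum>t\<in>?S. pairing_tensor t i * pairing_tensor t i)"
    by (intro tendsto_sum tendsto_mult_left limit)
  also have "(\<Sum>i\<in>?X s. \<Sum>t\<in>?S. pairing_tensor t i * pairing_tensor t i) = (\<Sum>t\<in>?S. of_nat s ^ m)"
  proof (subst sum.swap, rule sum.cong[OF refl])
    fix t assume t: "t \<in> ?S"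
    then show "(\<Sum>i\<in>?X s. pairing_tensor t i * pairing_tensor t i) = of_nat s ^ m"
      using colour_system.gram[OF cs, of s s t w t] arcs[OF t] by auto
  qed
  also have "\<dots> = of_nat s ^ m * of_nat (card ?S)" by simp
  finally have lim: "(\<lambda>n. \<Sum>i\<in>?X s. \<Sum>t\<in>?S. pairing_tensor t i * (of_nat n ^ m * a n t i)) \<longlonglongrightarrow> of_nat s ^ m * of_nat (card ?S)" .
  show ?thesis
  proof (rule Lim_transform_eventually[OF lim])
    show "\<forall>\<^sub>F n in sequentially. (\<Sum>i\<in>?X s. \<Sum>t\<in>?S. pairing_tensor t i * (of_nat n ^ m * a n t i)) =
      of_nat n ^ m * (\<Sum>i\<in>listset (replicate k {1..s}). ?E n i i)"
      using eventually_ge_at_top[of s]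
    proof eventually_elim
      case (elim n)
      have "(\<Sum>i\<in>?X s. \<Sum>t\<in>?S. pairing_tensor t i * (of_nat n ^ m * a n t i)) = (\<Sum>i\<in>?X s. of_nat n ^ m * ?E n i i)"
      proof (rule sum.cong[OF refl])
        fix i assume "i \<in> ?X s"
        then have i: "i \<in> ?X n" using mono[OF elim] by blast
        show "(\<Sum>t\<in>?S. pairing_tensor t i * (of_nat n ^ m * a n t i)) = of_nat n ^ m * ?E n i i"
          unfolding a[OF i i] sum_distrib_left by (simp only: mult.left_commute)
      qed
      then show ?case by (simp only: rep sum_distrib_left)
    qed
  qed
qed

section \<open>The semicircle law\<close>

definition catalan :: "nat \<Rightarrow> nat" where
  "catalan m = card {t. arcs t = m}"

lemma finite_arcs: "finite {t. arcs t = m}"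
  using finite_pairings[of "2 * m"] by simp

lemma catalan_Suc: "catalan (Suc m) = (\<Sum>i\<le>m. catalan i * catalan (m - i))"
proof -
  have "{t. arcs t = Suc m} = (\<Union>i\<le>m. (\<lambda>(l, r). Arch l r) ` ({t. arcs t = i} \<times> {t. arcs t = m - i}))"
  proof (rule Set.set_eqI)
    fix t
    show "t \<in> {t. arcs t = Suc m} \<longleftrightarrow> t \<in> (\<Union>i\<le>m. (\<lambda>(l, r). Arch l r) ` ({t. arcs t = i} \<times> {t. arcs t = m - i}))"
    proof (cases t)
      case (Arch l r)
      have "\<exists>x\<in>{..m}. Arch l r \<in> (\<lambda>(l, r). Arch l r) ` ({t. arcs t = x} \<times> {t. arcs t = m - x})" if "arcs l + arcs r = m"
        using that by (intro bexI[of _ "arcs l"] image_eqI[of _ _ "(l, r)"]) auto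
      then show ?thesis using Arch by auto
    qed auto
  qed
  also have "card \<dots> = (\<Sum>i\<le>m. card ((\<lambda>(l, r). Arch l r) ` ({t. arcs t = i} \<times> {t. arcs t = m - i})))"
    by (intro card_UN_disjoint) (auto simp: finite_arcs)
  also have "\<dots> = (\<Sum>i\<le>m. catalan i * catalan (m - i))"
    unfolding catalan_def by (intro sum.cong refl, subst card_image) (auto simp: inj_on_def card_cartesian_product)
  finally show ?thesis by (simp add: catalan_def)
qed

text \<open>With \<open>C\<close> the generating series, \<open>D = 1 - 2 X C\<close> satisfies \<open>D\<^sup>2 = 1 - 4 X\<close>, hence
  \<open>(1 - 4 X) D' = - 2 D\<close>.\<close>

lemma catalan_recursion: "real (m + 2) * real (catalan (Suc m)) = real (4 * m + 2) * real (catalan m)"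
proof -
  define C where "C = Abs_fps (\<lambda>m. real (catalan m))"
  define D where "D = 1 - 2 * (fps_X * C)"
  have "catalan 0 = 1"
  proof -
    have "{t. arcs t = 0} = {Empty}" by (auto elim: arcs.elims)
    then show ?thesis by (simp add: catalan_def)
  qed
  then have C: "C = 1 + fps_X * (C * C)"
  proof (intro fps_ext)
    fix n
    show "fps_nth C n = fps_nth (1 + fps_X * (C * C)) n"
    proof (cases n)
      case (Suc k)
      have "fps_nth (1 + fps_X * (C * C)) n = fps_nth (C * C) k" by (simp add: Suc)
      also have "\<dots> = fps_nth C n" by (simp add: Suc C_def catalan_Suc fps_mult_nth atMost_atLeast0)
      finally show ?thesis ..
    qed (simp add: C_def \<open>catalan 0 = 1\<close>)
  qed
  have "D * D = 1 - 4 * fps_X * (C - fps_X * (C * C))"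
    by (simp add: D_def algebra_simps)
  also have "C - fps_X * (C * C) = 1" using C by (simp add: algebra_simps)
  finally have DD: "D * D = 1 - 4 * fps_X" by simp
  have "fps_deriv (D * D) = - 4" unfolding DD by (simp add: numeral_fps_const)
  then have D': "D * fps_deriv D + fps_deriv D * D = -4" by simp
  then have "2 * (D * D * fps_deriv D) = - 4 * D"
    by (metis (no_types, lifting) mult.assoc mult.commute mult_2 distrib_left)
  then have "2 * ((1 - 4 * fps_X) * fps_deriv D) = 2 * (- 2 * D)" unfolding DD by simp
  then have eq: "(1 - 4 * fps_X) * fps_deriv D = - 2 * D" by (simp only: mult_cancel_left) simp
  have "fps_nth ((1 - 4 * fps_X) * fps_deriv D) (Suc m) = real (m + 2) * fps_nth D (m + 2) - 4 * real (m + 1) * fps_nth D (Suc m)"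
    by (simp add: left_diff_distrib mult.assoc numeral_fps_const)
  moreover have "fps_nth (- 2 * D) (Suc m) = - 2 * fps_nth D (Suc m)" by (simp add: numeral_fps_const)
  moreover have "fps_nth D (Suc k) = - 2 * real (catalan k)" for k by (simp add: D_def C_def numeral_fps_const)
  ultimately have "real (m + 2) * (- 2 * real (catalan (Suc m))) - 4 * real (m + 1) * (- 2 * real (catalan m)) = - 2 * (- 2 * real (catalan m))"
    using eq by (simp only: Suc_eq_plus1[symmetric] add_2_eq_Suc')
  then show ?thesis by (simp add: algebra_simps)
qed

definition semicircle_integral :: "nat \<Rightarrow> real" where
  "semicircle_integral k = integral {-2..2} (\<lambda>t. t ^ k * sqrt (4 - t\<^sup>2))"

lemma semicircle_integrable: "(\<lambda>t. t ^ k * sqrt (4 - t\<^sup>2)) integrable_on {-2..2::real}"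
  by (intro integrable_continuous_real continuous_intros)

lemma semicircle_sqrt_deriv:
  assumes "t \<in> {-2<..<2::real}"
  shows "((\<lambda>t. sqrt (4 - t\<^sup>2)) has_real_derivative (- t / sqrt (4 - t\<^sup>2))) (at t)" and "0 < 4 - t\<^sup>2"
proof -
  show "0 < 4 - t\<^sup>2" using assms power_strict_mono[of "\<bar>t\<bar>" 2 2] by (simp add: abs_less_iff)
  then show "((\<lambda>t. sqrt (4 - t\<^sup>2)) has_real_derivative (- t / sqrt (4 - t\<^sup>2))) (at t)"
    by (auto intro!: derivative_eq_intros simp: field_simps)
qed

lemma semicircle_integral_0: "semicircle_integral 0 = 2 * pi"
proof -
  have "((\<lambda>t. sqrt (4 - t\<^sup>2)) has_integral
      ((2 * sqrt (4 - 2\<^sup>2) / 2 + 2 * arcsin (2 / 2)) - (- 2 * sqrt (4 - (- 2)\<^sup>2) / 2 + 2 * arcsin (- 2 / 2)))) {-2..2::real}"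
  proof (rule fundamental_theorem_of_calculus_interior[where f = "\<lambda>t. t * sqrt (4 - t\<^sup>2) / 2 + 2 * arcsin (t / 2)"])
    show "continuous_on {-2..2} (\<lambda>t::real. t * sqrt (4 - t\<^sup>2) / 2 + 2 * arcsin (t / 2))"
      by (intro continuous_intros) auto
  next
    fix t :: real assume t: "t \<in> {-2<..<2}"
    note s = semicircle_sqrt_deriv[OF t]
    have "sqrt (1 - (t / 2)\<^sup>2) = sqrt (4 - t\<^sup>2) / 2"
      using real_sqrt_divide[of "4 - t\<^sup>2" 4] by (simp add: power_divide diff_divide_distrib)
    moreover have "sqrt (4 - t\<^sup>2) * sqrt (4 - t\<^sup>2) = 4 - t\<^sup>2" "sqrt (4 - t\<^sup>2) > 0" using s(2) by auto
    ultimately show "((\<lambda>t. t * sqrt (4 - t\<^sup>2) / 2 + 2 * arcsin (t / 2)) has_vector_derivative sqrt (4 - t\<^sup>2)) (at t)"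
      unfolding has_real_derivative_iff_has_vector_derivative[symmetric]
      using t by (auto intro!: derivative_eq_intros s(1) simp: field_simps power2_eq_square)
  qed simp
  then have "semicircle_integral 0 = 2 * pi" unfolding semicircle_integral_def by (simp add: integral_unique)
  then show ?thesis .
qed

lemma semicircle_integral_1: "semicircle_integral 1 = 0"
proof -
  have "((\<lambda>t. t ^ 1 * sqrt (4 - t\<^sup>2)) has_integral
      (- ((4 - 2\<^sup>2) * sqrt (4 - 2\<^sup>2)) / 3 - - ((4 - (- 2)\<^sup>2) * sqrt (4 - (- 2)\<^sup>2)) / 3)) {-2..2::real}"
  proof (rule fundamental_theorem_of_calculus_interior[where f = "\<lambda>t. - ((4 - t\<^sup>2) * sqrt (4 - t\<^sup>2)) / 3"])
    fix t :: real assume t: "t \<in> {-2<..<2}"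
    note s = semicircle_sqrt_deriv[OF t]
    have "sqrt (4 - t\<^sup>2) * sqrt (4 - t\<^sup>2) = 4 - t\<^sup>2" "sqrt (4 - t\<^sup>2) > 0" using s(2) by auto
    then show "((\<lambda>t. - ((4 - t\<^sup>2) * sqrt (4 - t\<^sup>2)) / 3) has_vector_derivative t ^ 1 * sqrt (4 - t\<^sup>2)) (at t)"
      unfolding has_real_derivative_iff_has_vector_derivative[symmetric]
      by (auto intro!: derivative_eq_intros s(1) simp: field_simps)
  qed (auto intro!: continuous_intros)
  then show ?thesis unfolding semicircle_integral_def by (simp add: integral_unique)
qed

text \<open>The function \<open>?F\<close> vanishes at both ends of the interval, and its derivative
  is a combination of the two integrands.\<close>

lemma semicircle_integral_recursion:
  "real (k + 4) * semicircle_integral (k + 2) = real (4 * (k + 1)) * semicircle_integral k"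
proof -
  let ?F = "\<lambda>t::real. t ^ (k + 1) * ((4 - t\<^sup>2) * sqrt (4 - t\<^sup>2))"
  let ?f = "\<lambda>t::real. real (4 * (k + 1)) * (t ^ k * sqrt (4 - t\<^sup>2)) - real (k + 4) * (t ^ (k + 2) * sqrt (4 - t\<^sup>2))"
  have "(?f has_integral (?F 2 - ?F (- 2))) {-2..2::real}"
  proof (rule fundamental_theorem_of_calculus_interior)
    fix t :: real assume t: "t \<in> {-2<..<2}"
    note s = semicircle_sqrt_deriv[OF t]
    define r where "r = sqrt (4 - t\<^sup>2)"
    have r: "r * r = 4 - t\<^sup>2" "r > 0" using s(2) by (auto simp: r_def)
    have "(?F has_real_derivative (real (k + 1) * t ^ k * ((4 - t\<^sup>2) * r) + (- (2 * t) * r + - t / r * (4 - t\<^sup>2)) * t ^ (k + 1))) (at t)"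
    proof -
      have "((\<lambda>t. t ^ (k + 1)) has_real_derivative real (k + 1) * t ^ k) (at t)" using DERIV_pow[of "k + 1" t] by simp
      moreover have "((\<lambda>t. 4 - t\<^sup>2) has_real_derivative - (2 * t)) (at t)" by (auto intro!: derivative_eq_intros)
      ultimately show ?thesis using DERIV_mult[OF _ DERIV_mult[OF _ s(1)]] unfolding r_def by blast
    qed
    moreover have "- t / r * (4 - t\<^sup>2) = - t * r" unfolding r(1)[symmetric] using r(2) by simp
    ultimately have "(?F has_real_derivative (real (k + 1) * t ^ k * ((4 - t\<^sup>2) * r) + (- (2 * t) * r + - t * r) * t ^ (k + 1))) (at t)"
      by simp
    moreover have "real (k + 1) * t ^ k * ((4 - t\<^sup>2) * r) + (- (2 * t) * r + - t * r) * t ^ (k + 1) =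
      real (4 * (k + 1)) * (t ^ k * r) - real (k + 4) * (t ^ (k + 2) * r)"
      by (simp add: algebra_simps power2_eq_square)
    ultimately show "(?F has_vector_derivative ?f t) (at t)"
      unfolding has_real_derivative_iff_has_vector_derivative[symmetric] r_def by simp
  qed (auto intro!: continuous_intros)
  then have "integral {-2..2} ?f = 0" by (simp add: integral_unique)
  moreover have "integral {-2..2} ?f = real (4 * (k + 1)) * semicircle_integral k - real (k + 4) * semicircle_integral (k + 2)"
    unfolding semicircle_integral_def
    using semicircle_integrable[of k] semicircle_integrable[of "k + 2"]
    by (subst integral_diff) (auto intro: integrable_on_cmult_left)
  ultimately show ?thesis by simp
qed

text \<open>For even exponents the integrals obey the Catalan recursion up to the factor
  \<open>2 * pi\<close>; for odd ones both sides are 0.\<close>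

lemma semicircle_moment:
  "integral {-2..2} (\<lambda>t. t ^ k * (sqrt (4 - t\<^sup>2) / (2 * pi))) = real (card {t. 2 * arcs t = k})"
proof -
  have even: "semicircle_integral (2 * m) = 2 * pi * real (catalan m)" for m
  proof (induction m)
    case 0
    have "{t. arcs t = 0} = {Empty}" by (auto elim: arcs.elims)
    then show ?case by (simp add: semicircle_integral_0 catalan_def)
  next
    case (Suc m)
    have "real (2 * m + 4) * semicircle_integral (2 * Suc m) = real (4 * (2 * m + 1)) * (2 * pi * real (catalan m))"
      using semicircle_integral_recursion[of "2 * m"] Suc by simp
    also have "\<dots> = 2 * (2 * pi) * (real (4 * m + 2) * real (catalan m))" by (simp add: algebra_simps)
    also have "\<dots> = real (2 * m + 4) * (2 * pi * real (catalan (Suc m)))"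
      unfolding catalan_recursion[symmetric] by (simp add: algebra_simps)
    finally show ?case by (simp only: mult_cancel_left) simp
  qed
  have odd: "semicircle_integral (2 * m + 1) = 0" for m
  proof (induction m)
    case (Suc m)
    then show ?case using semicircle_integral_recursion[of "2 * m + 1"] by simp
  qed (simp add: semicircle_integral_1[simplified])
  have "integral {-2..2} (\<lambda>t. t ^ k * (sqrt (4 - t\<^sup>2) / (2 * pi))) = semicircle_integral k / (2 * pi)"
    unfolding semicircle_integral_def integral_divide[symmetric] by simp
  also have "\<dots> = real (card {t. 2 * arcs t = k})"
  proof (cases "even k")
    case True
    then obtain m where "k = 2 * m" by (elim evenE)
    then show ?thesis by (simp add: even catalan_def)
  next
    case False
    then obtain m where k: "k = 2 * m + 1" by (elim oddE)
    then have "{t. 2 * arcs t = k} = {}" by auto presburger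
    then show ?thesis using odd[of m] k by simp
  qed
  finally show ?thesis .
qed

section \<open>Circular limits\<close>

lemma listset_replicate_mono: "S \<subseteq> T \<Longrightarrow> listset (replicate k S) \<subseteq> listset (replicate k T)"
proof (induction k)
  case (Suc k)
  then show ?case unfolding replicate_Suc listset.simps set_Cons_def by blast
qed simp

lemma (in haar_system) star_moment_diagonal:
  assumes haar: "haar_functional n p h" and S: "S \<subseteq> {1..n}"
    and x: "x = scalar (of_real c) * (\<Sum>i\<in>S. letter i i False)"
  shows "star_moment C h (emb x) w =
    of_real c ^ length w * (\<Sum>i\<in>listset (replicate (length w) S). E (map cl w) i i)"
proof -
  have state: "state C h" using haar by (simp add: haar_functional_def)
  have xA: "x \<in> A" unfolding x using S by (intro closed letter_in) auto
  have sub: "listset (replicate k S) \<subseteq> ixs k" for k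
    using S by (rule listset_replicate_mono)
  have "star_moment C h (emb x) w = lin (restrict_state h) (word_product x w)"
    using star_moment_emb[OF xA, of h w] lin_restrict_state[OF state] by simp
  also have "\<dots> = of_real c ^ length w * (\<Sum>i\<in>listset (replicate (length w) S). lin (restrict_state h) (entry w i i))"
    unfolding word_product_diagonal[OF x] by (simp add: lin_scalar lin_sum)
  also have "(\<Sum>i\<in>listset (replicate (length w) S). lin (restrict_state h) (entry w i i)) =
    (\<Sum>i\<in>listset (replicate (length w) S). E (map cl w) i i)"
  proof (rule sum.cong[OF refl])
    fix i assume "i \<in> listset (replicate (length w) S)"
    then have i: "i \<in> ixs (length w)" using sub by blast
    then show "lin (restrict_state h) (entry w i i) = E (map cl w) i i"
      using lin_restrict_state[OF state entry_in[OF i i]] haar_moment[OF haar i i] by simp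
  qed
  finally show ?thesis .
qed

lemma (in moment_system) null_adjoint:
  assumes "col i False = col i True"
  shows "null (letter i j False - letter i j True)"
proof (rule nullI)
  fix m m'
  have "colours (Word [((i, j), False)]) = colours (Word [((i, j), True)])"
    "rows (Word [((i, j), False)]) = rows (Word [((i, j), True)])"
    "columns (Word [((i, j), False)]) = columns (Word [((i, j), True)])"
    using assms by (simp_all add: colours_def rows_def columns_def)
  then have "mom (m + Word [((i, j), False)] + m') = mom (m + Word [((i, j), True)] + m')"
    by (simp only: mom_def word_add)
  then show "lin mom (mon m * (letter i j False - letter i j True) * mon m') = 0"
    by (simp add: letter_def left_diff_distrib right_diff_distrib lin_diff mult_single)
qed

section \<open>Moments of the Haar functionals of the two quantum groups\<close>

lemma haar_system_u: "haar_system n (norm_u n) (relators_u n) (\<lambda>e e'. e' = (\<not> e)) Not (\<lambda>e. e)"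
proof -
  interpret moment_system Not "\<lambda>_. {1..n}" "\<lambda>_ e. e"
    by unfold_locales auto
  interpret cstar_seminormed "words n" "norm_u n"
    using norm_u_cstar star_submonoid_words by unfold_locales
  have pair: "null ((\<Sum>k=1..n. letter i k e * letter j k (\<not> e)) - delta i j)"
    "null ((\<Sum>k=1..n. letter k i e * letter k j (\<not> e)) - delta i j)" if "i \<in> {1..n}" "j \<in> {1..n}" for i j e
    using null_pair[where i = i and j = j and e = e and e' = "\<not> e" and c = e]
      null_pair_transposed[where i = i and j = j and e = e and e' = "\<not> e" and c = e] that by blast+
  show ?thesis
  proof unfold_locales
    show "unitary_relations n (\<lambda>e e'. e' = (\<not> e)) (norm_u n)"
      using norm_u_relator by (intro unitary_relations_u) blast
    show "relators_u n \<subseteq> A"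
      unfolding relators_u_def unitary_relators_def gen_letter pstar_letter
      by (auto intro!: closed(6) closed(8) closed(3) letter_in delta_in)
    show "null r" if "r \<in> relators_u n" for r
      using that pair[of _ _ False] pair[of _ _ True]
      by (auto simp: relators_u_def unitary_relators_def gen_letter pstar_letter)
    show "q x \<le> norm_u n x" if "cstar_seminorm (words n) q" "\<forall>r\<in>relators_u n. q r = 0" "x \<in> A" for q x
      using norm_u_greatest that by blast
  qed (auto simp: norm_u_cstar norm_u_relator)
qed

text \<open>In place of the two colours \<open>True\<close> and \<open>False\<close> dual to each
  other there is one self-dual colour, so every pairing of even length matches and generators equal
  their adjoints modulo null elements.\<close>

lemma haar_system_o: "haar_system n (norm_o n) (relators_o n) (\<lambda>e e'. True) (\<lambda>_. ()) (\<lambda>e. ())"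
proof -
  interpret moment_system "\<lambda>_. ()" "\<lambda>_. {1..n}" "\<lambda>_ e. ()"
    by unfold_locales auto
  interpret cstar_seminormed "words n" "norm_o n"
    using norm_o_cstar star_submonoid_words by unfold_locales
  have pair: "null ((\<Sum>k=1..n. letter i k False * letter j k False) - delta i j)"
    "null ((\<Sum>k=1..n. letter k i False * letter k j False) - delta i j)" if "i \<in> {1..n}" "j \<in> {1..n}" for i j
    using null_pair[where i = i and j = j and e = False and e' = False and c = "()"]
      null_pair_transposed[where i = i and j = j and e = False and e' = False and c = "()"] that by blast+
  show ?thesis
  proof unfold_locales
    show "unitary_relations n (\<lambda>e e'. True) (norm_o n)"
      using norm_o_relator by (intro unitary_relations_o norm_o_cstar) blast
    show "relators_o n \<subseteq> A"
      unfolding relators_o_def gen_letter pstar_letter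
      by (auto intro!: closed(6) closed(8) closed(3) letter_in delta_in)
    show "null r" if "r \<in> relators_o n" for r
      using that pair null_adjoint by (auto simp: relators_o_def gen_letter pstar_letter)
    show "q x \<le> norm_o n x" if "cstar_seminorm (words n) q" "\<forall>r\<in>relators_o n. q r = 0" "x \<in> A" for q x
      using norm_o_greatest that by blast
  qed (auto simp: norm_o_cstar norm_o_relator)
qed

abbreviation "E\<^sub>u n \<equiv> colour_system.E Not (\<lambda>_. {1..n})"
abbreviation "E\<^sub>o n \<equiv> colour_system.E (\<lambda>_. ()) (\<lambda>_. {1..n})"

lemma star_moment_u:
  assumes "haar_u n h" "s \<le> n"
  shows "star_moment (A_u n) h (complex_of_real c \<odot>\<^bsub>A_u n\<^esub> u_var s n) w =
    of_real c ^ length w * (\<Sum>i\<in>listset (replicate (length w) {1..s}). E\<^sub>u n w i i)"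
    and "star_moment (A_u n) h (u_var s n) w = (\<Sum>i\<in>listset (replicate (length w) {1..s}). E\<^sub>u n w i i)"
    and "u_var s n \<in> carrier (A_u n)"
proof -
  interpret haar_system n "norm_u n" "relators_u n" "\<lambda>e e'. e' = (\<not> e)" Not "\<lambda>e. e" by (rule haar_system_u)
  let ?x = "\<Sum>i\<in>{1..s}. letter i i False"
  have x: "?x \<in> A" using assms(2) by (intro closed letter_in) auto
  have u: "u_var s n = emb ?x"
    unfolding u_var_def A_u_def v_gen_def gen_letter using assms(2) by (intro emb_finsum letter_in) auto
  have haar: "haar_functional n (norm_u n) h" using assms(1) by (simp add: haar_u_def)
  have S: "{1..s} \<subseteq> {1..n}" using assms(2) by auto
  show "star_moment (A_u n) h (complex_of_real c \<odot>\<^bsub>A_u n\<^esub> u_var s n) w =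
    of_real c ^ length w * (\<Sum>i\<in>listset (replicate (length w) {1..s}). E\<^sub>u n w i i)"
    unfolding u A_u_def emb_smult[OF x] using star_moment_diagonal[OF haar S refl, of c w] by (simp only: map_ident)
  show "star_moment (A_u n) h (u_var s n) w = (\<Sum>i\<in>listset (replicate (length w) {1..s}). E\<^sub>u n w i i)"
    unfolding u A_u_def using star_moment_diagonal[OF haar S, of ?x 1 w]
    by (simp only: of_real_1 scalar_1 mult_1_left power_one map_ident)
  show "u_var s n \<in> carrier (A_u n)" unfolding u A_u_def by (rule emb_in[OF x])
qed

lemma star_moment_o:
  assumes "haar_o n h" "s \<le> n"
  shows "star_moment (A_o n) h (o_var s n) w =
    (\<Sum>i\<in>listset (replicate (length w) {1..s}). E\<^sub>o n (replicate (length w) ()) i i)"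
proof -
  interpret haar_system n "norm_o n" "relators_o n" "\<lambda>e e'. True" "\<lambda>_. ()" "\<lambda>e. ()" by (rule haar_system_o)
  let ?x = "\<Sum>i\<in>{1..s}. letter i i False"
  have u: "o_var s n = emb ?x"
    unfolding o_var_def A_o_def u_gen_def gen_letter using assms(2) by (intro emb_finsum letter_in) auto
  have haar: "haar_functional n (norm_o n) h" using assms(1) by (simp add: haar_o_def)
  have S: "{1..s} \<subseteq> {1..n}" using assms(2) by auto
  show ?thesis
    unfolding u A_o_def using star_moment_diagonal[OF haar S, of ?x 1 w]
    by (simp only: of_real_1 scalar_1 mult_1_left power_one map_replicate_const)
qed

lemma (in moment_system) code_power: "code x [^]\<^bsub>B\<^esub> (k::nat) = code (x ^ k)"
proof -
  interpret star_algebra B by (rule B_star_algebra)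
  show ?thesis by (induction k) (simp_all add: B_simps power_Suc2 del: power_Suc)
qed

lemma word_product_colours:
  fixes g :: "'k \<Rightarrow> complex" and ix :: "'k \<Rightarrow> nat set"
  assumes x: "x = (\<Sum>c\<in>K. scalar (g c) * (\<Sum>i\<in>ix c. letter i i False))"
  shows "word_product x w = (\<Sum>W\<in>listset (replicate (length w) K).
    scalar (prod_list (map2 (\<lambda>e c. if e then cnj (g c) else g c) w W)) * (\<Sum>i\<in>listset (map ix W). entry w i i))"
proof (induction w)
  case Nil
  show ?case by (simp add: word_product_def)
next
  case (Cons e w)
  let ?g = "\<lambda>c. if e then cnj (g c) else g c"
  let ?z = "\<lambda>c. \<Sum>i\<in>ix c. letter i i e"
  let ?p = "\<lambda>w W. prod_list (map2 (\<lambda>e c. if e then cnj (g c) else g c) w W)"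
  have star: "(if e then pstar x else x) = (\<Sum>c\<in>K. scalar (?g c) * ?z c)"
    by (cases e) (simp_all add: x pstar_mult pstar_sum pstar_letter scalar_commute)
  have step: "scalar (?g c) * ?z c * (scalar (?p w W) * (\<Sum>i\<in>listset (map ix W). entry w i i)) =
    scalar (?p (e # w) (c # W)) * (\<Sum>i\<in>listset (map ix (c # W)). entry (e # w) i i)" for c W
  proof -
    have "?z c * (\<Sum>i\<in>listset (map ix W). entry w i i) = (\<Sum>i\<in>listset (map ix (c # W)). entry (e # w) i i)"
      unfolding sum_product list.map sum_listset_Cons entry_Cons ..
    moreover have "scalar (?g c) * ?z c * (scalar (?p w W) * (\<Sum>i\<in>listset (map ix W). entry w i i)) =
      scalar (?g c * ?p w W) * (?z c * (\<Sum>i\<in>listset (map ix W). entry w i i))"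
      by (simp only: mult.assoc scalar_left_commute[of "?z c"] scalar_scalar)
    ultimately show ?thesis by simp
  qed
  have "word_product x (e # w) = (if e then pstar x else x) * word_product x w" by (simp add: word_product_def)
  also have "\<dots> = (\<Sum>c\<in>K. \<Sum>W\<in>listset (replicate (length w) K).
      scalar (?p (e # w) (c # W)) * (\<Sum>i\<in>listset (map ix (c # W)). entry (e # w) i i))"
    unfolding star Cons sum_product step ..
  finally show ?case
    unfolding list.size add_Suc_right add_0_right replicate_Suc sum_listset_Cons .
qed

text \<open>Two free semicircular variables as sums of two diagonal entries each, in two different colours:
  by \<open>E_trace\<close> their moments only see the number of noncrossing pairings.\<close>

lemma circular_space:
  "\<exists>(B :: space) \<psi> x y. star_prob_space B \<psi> \<and> semicircular B \<psi> x \<and> semicircular B \<psi> y \<and> star_free B \<psi> x y \<and>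
    (\<forall>w. star_moment B \<psi> (complex_of_real (1 / sqrt 2) \<odot>\<^bsub>B\<^esub> (x \<oplus>\<^bsub>B\<^esub> \<i> \<odot>\<^bsub>B\<^esub> y)) w =
      of_nat (card {t. fits (\<lambda>a b. b = (\<not> a)) t w}))"
proof -
  \<comment> \<open>Colour \<open>c\<close> is self-dual and owns the rows \<open>2 * c\<close> and
    \<open>Suc (2 * c)\<close>, from which \<open>i div 2\<close> recovers it. Two indices per
    colour make \<open>E_trace\<close> applicable.\<close>
  let ?ix = "\<lambda>c::nat. {2 * c, Suc (2 * c)}"
  interpret moment_system "\<lambda>c::nat. c" ?ix "\<lambda>i e. i div 2"
    by unfold_locales auto
  note bar_bar [simp del] ix_bar [simp del]
  have eq: "(\<lambda>a b :: nat. b = a) = (=)" by (auto simp: fun_eq_iff)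
  define z where "z c = (\<Sum>i\<in>?ix c. letter i i False)" for c
  have trace: "(\<Sum>i\<in>idx W. lin mom (entry es i i)) = of_nat (card {t. fits (=) t W})" if "length es = length W" for W es
  proof -
    have "lin mom (entry es i i) = E W i i" if i: "i \<in> idx W" for i
    proof -
      have "map (\<lambda>i. i div 2) i = W"
        using i
      proof (induction W arbitrary: i)
        case (Cons c W)
        then obtain a j where i: "i = a # j" "a \<in> ?ix c" "j \<in> idx W" unfolding list.map listset.simps set_Cons_def by blast
        then have "a div 2 = c" by (elim insertE emptyE) simp_all
        then show ?case unfolding i(1) list.map Cons.IH[OF i(3)] by simp
      qed simp
      moreover have "map2 (\<lambda>i (e::bool). i div 2) i es = map (\<lambda>i. i div 2) i"
        using length_idx[OF i] \<open>length es = length W\<close> by (intro nth_equalityI) auto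
      ultimately show ?thesis using mom_entry[of i es i] length_idx[OF i] \<open>length es = length W\<close> by simp
    qed
    then have "(\<Sum>i\<in>idx W. lin mom (entry es i i)) = (\<Sum>i\<in>idx W. E W i i)" by simp
    also have "\<dots> = of_nat (card (NC W))" by (rule E_trace) auto
    finally show ?thesis by (simp only: eq)
  qed
  have semicircular: "semicircular B \<psi> (code (z c))" for c
    unfolding semicircular_def
  proof (intro conjI allI)
    show "code (z c) \<in> carrier B" by (simp add: B_carrier)
    have "null (\<Sum>i\<in>?ix c. letter i i False - letter i i True)" by (intro null_sum null_adjoint) auto
    then have "null (- 1 * (\<Sum>i\<in>?ix c. letter i i False - letter i i True) * 1)" by (rule null_mult)
    then have "null (pstar (z c) - z c)"
      by (simp add: z_def pstar_add pstar_letter algebra_simps)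
    then show "star B (code (z c)) = code (z c)" by (simp add: B_star code_eq_iff)
  next
    fix k
    have z: "z c = scalar (of_real 1) * (\<Sum>i\<in>?ix c. letter i i False)" by (simp add: z_def)
    have power: "z c ^ k = word_product (z c) (replicate k False)"
      by (induction k) (simp_all add: word_product_def)
    have "lin mom (z c ^ k) = (\<Sum>i\<in>idx (replicate k c). lin mom (entry (replicate k False) i i))"
      unfolding power word_product_diagonal[OF z] by (simp add: lin_sum)
    also have "\<dots> = of_nat (card {t. fits (=) t (replicate k c)})" by (rule trace) simp
    also have "{t. fits (=) t (replicate k c)} = {t. 2 * arcs t = k}"
      by (auto intro: fits_replicate dest: fits_length)
    finally show "\<psi> (code (z c) [^]\<^bsub>B\<^esub> k) = of_real (integral {-2..2} (\<lambda>t. t ^ k * (sqrt (4 - t\<^sup>2) / (2 * pi))))"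
      by (simp only: code_power \<psi>_code semicircle_moment of_real_of_nat_eq)
  qed
  have free: "star_free B \<psi> (code (z 0)) (code (z 1))"
  proof (rule star_free_code[where \<kappa> = "\<lambda>c. c = 0"])
    show "z 0 \<in> class_algebra (\<lambda>c. c = 0) True" "z 1 \<in> class_algebra (\<lambda>c. c = 0) False"
      unfolding z_def class_algebra_def[of "\<lambda>c. c = 0", OF refl] letter_def
      by (auto intro!: monoid_algebra_sum monoid_algebra_single simp: colours_def simp del: sum.insert)
  qed simp
  define g :: "nat \<Rightarrow> complex" where "g c = of_real (1 / sqrt 2) * (if c = 0 then 1 else \<i>)" for c
  define a where "a = (\<Sum>c\<in>{0, 1}. scalar (g c) * z c)"
  have a: "complex_of_real (1 / sqrt 2) \<odot>\<^bsub>B\<^esub> (code (z 0) \<oplus>\<^bsub>B\<^esub> \<i> \<odot>\<^bsub>B\<^esub> code (z 1)) = code a"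
    by (simp add: B_simps a_def g_def distrib_left scalar_scalar)
  have moments: "star_moment B \<psi> (code a) w = of_nat (card {t. fits (\<lambda>a b. b = (\<not> a)) t w})" for w
  proof -
    let ?k = "length w" and ?T = "{t. 2 * arcs t = length w}"
    \<comment> \<open>A choice \<open>W\<close> of one of the two variables in each factor has a
      coefficient that is a sign weight over the indices 0 and 1, so \<open>sum_sign_weight\<close>
      evaluates the sum over \<open>W\<close>. The tags are negated because a starred factor
      contributes \<open>- \<i>\<close>.\<close>
    interpret aux: colour_system "\<lambda>_. ()" "\<lambda>_. {0, 1}" by unfold_locales auto
    note aux.bar_bar [simp del] aux.ix_bar [simp del]
    let ?s = "\<lambda>W. aux.sign_weight (\<lambda>_. 0) (\<lambda>_. 1) (map Not w) (replicate ?k ()) W"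
    have coef: "prod_list (map2 (\<lambda>e c. if e then cnj (g c) else g c) w W) = of_real (1 / sqrt 2) ^ ?k * ?s W"
      if "W \<in> listset (replicate ?k {0, 1})" for W
      using that unfolding aux.sign_weight_def
      by (induction w arbitrary: W) (auto simp: set_Cons_def g_def)
    have expand: "word_product a w = (\<Sum>W\<in>listset (replicate ?k {0, 1}).
      scalar (prod_list (map2 (\<lambda>e c. if e then cnj (g c) else g c) w W)) * (\<Sum>i\<in>idx W. entry w i i))"
      by (rule word_product_colours) (simp only: a_def z_def)
    have "star_moment B \<psi> (code a) w = (\<Sum>W\<in>listset (replicate ?k {0, 1}).
        of_real (1 / sqrt 2) ^ ?k * ?s W * of_nat (card {t. fits (=) t W}))"
      unfolding star_moment_B expand lin_sum
    proof (rule sum.cong[OF refl])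
      fix W assume W: "W \<in> listset (replicate ?k {0, 1::nat})"
      then have "length w = length W" using length_listset[OF W] by simp
      then show "lin mom (scalar (prod_list (map2 (\<lambda>e c. if e then cnj (g c) else g c) w W)) * (\<Sum>i\<in>idx W. entry w i i)) =
        of_real (1 / sqrt 2) ^ ?k * ?s W * of_nat (card {t. fits (=) t W})"
        by (simp only: coef[OF W] lin_scalar lin_sum trace)
    qed
    also have "\<dots> = (\<Sum>W\<in>listset (replicate ?k {0, 1}). \<Sum>t\<in>?T. of_real (1 / sqrt 2) ^ ?k * (?s W * pairing_tensor t W))"
    proof (rule sum.cong[OF refl])
      fix W assume W: "W \<in> listset (replicate ?k {0, 1::nat})"
      have "{t. fits (=) t W} = {t \<in> ?T. fits (=) t W}" using length_listset[OF W] fits_length[of "(=)" _ W] by auto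
      then have "of_nat (card {t. fits (=) t W}) = (\<Sum>t\<in>?T. pairing_tensor t W)"
        using finite_pairings by (simp add: sum_of_bool_eq Int_def)
      then show "of_real (1 / sqrt 2) ^ ?k * ?s W * of_nat (card {t. fits (=) t W}) =
        (\<Sum>t\<in>?T. of_real (1 / sqrt 2) ^ ?k * (?s W * pairing_tensor t W))"
        by (simp only: sum_distrib_left mult.assoc)
    qed
    also have "\<dots> = (\<Sum>t\<in>?T. of_real (1 / sqrt 2) ^ ?k * (\<Sum>W\<in>aux.idx (replicate ?k ()). ?s W * pairing_tensor t W))"
      unfolding sum_distrib_left map_replicate by (rule sum.swap)
    also have "\<dots> = (\<Sum>t\<in>?T. of_bool (fits (\<noteq>) t (map Not w)))"
    proof (rule sum.cong[OF refl])
      fix t assume t: "t \<in> ?T"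
      have "(\<Sum>W\<in>aux.idx (replicate ?k ()). ?s W * pairing_tensor t W) = (if fits (\<noteq>) t (map Not w) then 2 ^ arcs t else 0)"
        using t by (intro aux.sum_sign_weight) (auto intro!: fits_replicate)
      moreover have "complex_of_real (1 / sqrt 2) ^ ?k * 2 ^ arcs t = 1"
      proof -
        have "?k = 2 * arcs t" using t by simp
        then show ?thesis by (simp add: power_mult power_divide flip: of_real_power)
      qed
      ultimately show "of_real (1 / sqrt 2) ^ ?k * (\<Sum>W\<in>aux.idx (replicate ?k ()). ?s W * pairing_tensor t W) =
        of_bool (fits (\<noteq>) t (map Not w))" by simp
    qed
    also have "\<dots> = of_nat (card {t \<in> ?T. fits (\<noteq>) t (map Not w)})"
      using finite_pairings by (simp add: sum_of_bool_eq Int_def)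
    also have "{t \<in> ?T. fits (\<noteq>) t (map Not w)} = {t. fits (\<lambda>a b. b = (\<not> a)) t w}"
    proof -
      have "fits (\<noteq>) t (map Not w) \<longleftrightarrow> fits (\<lambda>a b. b = (\<not> a)) t w" for t
        unfolding fits_map by (rule arg_cong[of _ _ "\<lambda>R. fits R t w"]) (auto simp: fun_eq_iff)
      moreover have "2 * arcs t = length w" if "fits (\<lambda>a b. b = (\<not> a)) t w" for t
        using fits_length[OF that] by simp
      ultimately show ?thesis by auto
    qed
    finally show ?thesis .
  qed
  show ?thesis
    using B_space semicircular[of 0] semicircular[of 1] free moments unfolding a[symmetric] by blast
qed

lemma circular_moments:
  assumes "a \<in> carrier A" "\<And>w. star_moment A \<phi> a w = of_nat (card {t. fits (\<lambda>a b. b = (\<not> a)) t w})"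
  shows "circular A \<phi> a"
  using assms circular_space unfolding circular_def same_star_distribution_def by metis

lemma circular_u:
  assumes "2 \<le> n" "haar_u n h"
  shows "circular (A_u n) h (u_var n n)"
proof (rule circular_moments)
  interpret colour_system Not "\<lambda>_. {1..n}" by unfold_locales auto
  show "u_var n n \<in> carrier (A_u n)" using star_moment_u(3)[OF assms(2)] by simp
  fix w
  have "star_moment (A_u n) h (u_var n n) w = (\<Sum>i\<in>idx w. E w i i)"
    using star_moment_u(2)[OF assms(2), of n w] by (simp only: map_replicate_const order.refl)
  also have "\<dots> = of_nat (card (NC w))" using assms(1) by (intro E_trace bexI[of _ 1] bexI[of _ 2]) auto
  finally show "star_moment (A_u n) h (u_var n n) w = of_nat (card {t. fits (\<lambda>a b. b = (\<not> a)) t w})" .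
qed

lemma asymptotically_circular:
  fixes hu :: "nat \<Rightarrow> elem \<Rightarrow> complex"
  assumes haar: "\<And>n. 2 \<le> n \<Longrightarrow> haar_u n (hu n)" and s: "1 \<le> s"
  shows "\<exists>(B :: space) \<psi> c. star_prob_space B \<psi> \<and> circular B \<psi> c \<and>
    (\<forall>w. (\<lambda>n. star_moment (A_u n) (hu n) (complex_of_real (sqrt (real n / real s)) \<odot>\<^bsub>A_u n\<^esub> u_var s n) w)
       \<longlonglongrightarrow> star_moment B \<psi> c w)"
proof -
  obtain B :: space and \<psi> x y where B: "star_prob_space B \<psi>" "semicircular B \<psi> x" "semicircular B \<psi> y" "star_free B \<psi> x y"
    "\<And>w. star_moment B \<psi> (complex_of_real (1 / sqrt 2) \<odot>\<^bsub>B\<^esub> (x \<oplus>\<^bsub>B\<^esub> \<i> \<odot>\<^bsub>B\<^esub> y)) w =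
      of_nat (card {t. fits (\<lambda>a b. b = (\<not> a)) t w})"
    using circular_space by blast
  define c where "c = complex_of_real (1 / sqrt 2) \<odot>\<^bsub>B\<^esub> (x \<oplus>\<^bsub>B\<^esub> \<i> \<odot>\<^bsub>B\<^esub> y)"
  interpret star_algebra B using B(1) by (simp add: star_prob_space_def)
  have "c \<in> carrier B" using B(2,3) unfolding c_def semicircular_def by (auto simp: complex_ring_def)
  then have "circular B \<psi> c" using B unfolding c_def by (intro circular_moments)
  moreover have "(\<lambda>n. star_moment (A_u n) (hu n) (complex_of_real (sqrt (real n / real s)) \<odot>\<^bsub>A_u n\<^esub> u_var s n) w)
       \<longlonglongrightarrow> star_moment B \<psi> c w" for w
  proof -
    let ?k = "length w" and ?N = "card {t. fits (\<lambda>a b. b = (\<not> a)) t w}"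
    let ?tr = "\<lambda>n. \<Sum>i\<in>listset (replicate ?k {1..s}). E\<^sub>u n w i i"
    have "(\<lambda>n. complex_of_real (sqrt (real n / real s)) ^ ?k * ?tr n) \<longlonglongrightarrow> of_nat ?N"
    proof (cases "even ?k")
      case True
      then obtain m where m: "?k = 2 * m" by (elim evenE)
      have "(\<lambda>n. of_nat n ^ m * ?tr n / of_nat s ^ m) \<longlonglongrightarrow> of_nat s ^ m * of_nat ?N / of_nat s ^ m"
        using s by (intro tendsto_divide restricted_trace_limit[OF _ m refl] tendsto_const) auto
      moreover have "of_nat n ^ m * ?tr n / of_nat s ^ m = complex_of_real (sqrt (real n / real s)) ^ ?k * ?tr n" for n
        unfolding m power_mult of_real_power[symmetric] by (simp add: power_divide)
      ultimately show ?thesis using s by simp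
    next
      case False
      \<comment> \<open>Words of odd length admit no pairing, so both the moments and the claimed
        limit are 0.\<close>
      then have none: "{t. fits (\<lambda>a b. b = (\<not> a)) t w} = {}" using fits_length[of _ _ w] by auto
      have "E\<^sub>u n w i i = 0" for n i
      proof -
        interpret colour_system Not "\<lambda>_. {1..n}" by unfold_locales auto
        show ?thesis using none by (rule E_zero)
      qed
      then show ?thesis by (simp add: none)
    qed
    moreover have "\<forall>\<^sub>F n in sequentially. complex_of_real (sqrt (real n / real s)) ^ ?k * ?tr n =
      star_moment (A_u n) (hu n) (complex_of_real (sqrt (real n / real s)) \<odot>\<^bsub>A_u n\<^esub> u_var s n) w"
      using star_moment_u(1)[OF haar, of _ s _ w] by (intro eventually_sequentiallyI[of "max 2 s"]) simp
    ultimately have "(\<lambda>n. star_moment (A_u n) (hu n) (complex_of_real (sqrt (real n / real s)) \<odot>\<^bsub>A_u n\<^esub> u_var s n) w)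
       \<longlonglongrightarrow> of_nat ?N" by (rule Lim_transform_eventually)
    then show ?thesis by (simp only: c_def B(5))
  qed
  ultimately show ?thesis using B(1) by blast
qed

section \<open>The free polar decomposition\<close>

text \<open>A projection kernel is determined by its space. If \<open>\<sigma>\<close> matches
  pairing vectors with pairing vectors in both directions, the kernel pulled back along
  \<open>\<sigma>\<close> projects onto the fixed vectors of \<open>w\<close>.\<close>

lemma colour_system_transport:
  assumes cs: "colour_system bar ix" "colour_system bar' ix'"
    and bij: "bij_betw \<sigma> (listset (map ix w)) (listset (map ix' W))"
    and down: "\<And>t. fits (\<lambda>a b. b = bar' a) t W \<Longrightarrow>
      \<exists>s. fits (\<lambda>a b. b = bar a) s w \<and> (\<forall>i\<in>listset (map ix w). fits (=) t (\<sigma> i) \<longleftrightarrow> fits (=) s i)"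
    and up: "\<And>s. fits (\<lambda>a b. b = bar a) s w \<Longrightarrow>
      \<exists>t. fits (\<lambda>a b. b = bar' a) t W \<and> (\<forall>i\<in>listset (map ix w). fits (=) t (\<sigma> i) \<longleftrightarrow> fits (=) s i)"
    and ij: "i \<in> listset (map ix w)" "j \<in> listset (map ix w)"
  shows "colour_system.E bar ix w i j = colour_system.E bar' ix' W (\<sigma> i) (\<sigma> j)"
proof -
  interpret X: colour_system bar ix by (rule cs(1))
  interpret Y: colour_system bar' ix' by (rule cs(2))
  let ?r = "inv_into (X.idx w) \<sigma>"
  have \<sigma>: "\<sigma> i \<in> Y.idx W" "?r (\<sigma> i) = i" if "i \<in> X.idx w" for i
    using that bij bij_betw_inv_into_left[OF bij] by (auto dest: bij_betwE)
  have r: "?r J \<in> X.idx w" "\<sigma> (?r J) = J" if "J \<in> Y.idx W" for J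
    using that bij_betw_inv_into[OF bij] bij_betw_inv_into_right[OF bij] by (auto dest: bij_betwE)
  have V_down: "X.V w (\<lambda>i. f (\<sigma> i))" if V: "Y.V W f" for f
  proof -
    obtain a where a: "\<forall>J\<in>Y.idx W. f J = (\<Sum>t\<in>Y.NC W. a t * pairing_tensor t J)"
      using Y.V_expand[OF V] by blast
    have "X.V w (\<lambda>i. pairing_tensor t (\<sigma> i))" if "t \<in> Y.NC W" for t
    proof -
      obtain s where s: "X.matches s w" "\<forall>i\<in>X.idx w. fits (=) t (\<sigma> i) \<longleftrightarrow> fits (=) s i"
        using down[of t] \<open>t \<in> Y.NC W\<close> by blast
      from X.V.pairing[OF s(1)] show ?thesis by (rule X.V.ext) (simp add: s(2))
    qed
    then have "X.V w (\<lambda>i. \<Sum>t\<in>Y.NC W. a t * pairing_tensor t (\<sigma> i))" by (intro X.V_sum X.V.scale)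
    then show ?thesis by (rule X.V.ext) (simp only: a \<sigma>)
  qed
  have V_up: "Y.V W (\<lambda>J. g (?r J))" if V: "X.V w g" for g
  proof -
    obtain a where a: "\<forall>i\<in>X.idx w. g i = (\<Sum>s\<in>X.NC w. a s * pairing_tensor s i)"
      using X.V_expand[OF V] by blast
    have "Y.V W (\<lambda>J. pairing_tensor s (?r J))" if "s \<in> X.NC w" for s
    proof -
      obtain t where t: "Y.matches t W" "\<forall>i\<in>X.idx w. fits (=) t (\<sigma> i) \<longleftrightarrow> fits (=) s i"
        using up[of s] \<open>s \<in> X.NC w\<close> by blast
      have eq: "fits (=) t J \<longleftrightarrow> fits (=) s (?r J)" if "J \<in> Y.idx W" for J
        using t(2)[rule_format, OF r(1)[OF that]] r(2)[OF that] by simp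
      from Y.V.pairing[OF t(1)] show ?thesis by (rule Y.V.ext) (simp add: eq)
    qed
    then have "Y.V W (\<lambda>J. \<Sum>s\<in>X.NC w. a s * pairing_tensor s (?r J))" by (intro Y.V_sum Y.V.scale)
    then show ?thesis by (rule Y.V.ext) (simp only: a r)
  qed
  have "projection_kernel (X.idx w) {f. X.V w f} (\<lambda>i j. Y.E W (\<sigma> i) (\<sigma> j))"
    unfolding projection_kernel_def
  proof (intro conjI ballI)
    fix i j show "Y.E W (\<sigma> i) (\<sigma> j) = cnj (Y.E W (\<sigma> j) (\<sigma> i))" by (simp add: Y.E_cnj)
  next
    fix j assume "j \<in> X.idx w"
    then show "(\<lambda>i. Y.E W (\<sigma> i) (\<sigma> j)) \<in> {f. X.V w f}" using V_down[OF Y.E_column] \<sigma>(1) by blast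
  next
    fix f i assume f: "f \<in> {f. X.V w f}" and i: "i \<in> X.idx w"
    have "(\<Sum>j\<in>X.idx w. Y.E W (\<sigma> i) (\<sigma> j) * f j) = (\<Sum>j\<in>X.idx w. Y.E W (\<sigma> i) (\<sigma> j) * f (?r (\<sigma> j)))"
      by (intro sum.cong refl) (simp only: \<sigma>)
    also have "\<dots> = (\<Sum>J\<in>Y.idx W. Y.E W (\<sigma> i) J * f (?r J))"
      by (rule sum.reindex_bij_betw[OF bij, of "\<lambda>J. Y.E W (\<sigma> i) J * f (?r J)"])
    also have "\<dots> = f i" using Y.E_apply[OF V_up \<sigma>(1)[OF i], of f] f \<sigma>(2)[OF i] by simp
    finally show "(\<Sum>j\<in>X.idx w. Y.E W (\<sigma> i) (\<sigma> j) * f j) = f i" .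
  qed
  from X.E_unique[OF this ij] show ?thesis .
qed

text \<open>The colours of \<open>z\<close>, \<open>z\<^sup>*\<close> are \<open>Some False\<close>, \<open>Some True\<close>, and that of the entries of \<open>o\<close> is \<open>None\<close>.
  An arch encloses an even number of letters, so in a word substituted for one in \<open>v = z o\<close> and
  \<open>v\<^sup>* = o z\<^sup>*\<close> two entries of \<open>o\<close> can be joined only if the parities of their positions differ; these
  parities tell \<open>v\<close> from \<open>v\<^sup>*\<close>.\<close>

fun substitute :: "bool list \<Rightarrow> bool option list" where
  "substitute [] = []"
| "substitute (e # w) = (if e then None # Some True # substitute w else Some False # None # substitute w)"

text \<open>The inserted 0 is the only index of the colours of \<open>z\<close>; its place in each
  pair follows \<open>substitute\<close>.\<close>

fun interleave :: "bool list \<Rightarrow> nat list \<Rightarrow> nat list" where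
  "interleave (e # w) (a # i) = (if e then a # 0 # interleave w i else 0 # a # interleave w i)"
| "interleave _ _ = []"

fun parities :: "bool \<Rightarrow> bool option list \<Rightarrow> bool list" where
  "parities b [] = []"
| "parities b (c # W) = (if c = None then b # parities (\<not> b) W else parities (\<not> b) W)"

fun kept :: "bool option list \<Rightarrow> nat list \<Rightarrow> nat list" where
  "kept (c # W) (a # i) = (if c = None then a # kept W i else kept W i)"
| "kept _ _ = []"

lemma substitute_append: "substitute (u @ v) = substitute u @ substitute v"
  by (induction u) auto

lemma length_substitute: "length (substitute w) = 2 * length w"
  by (induction w) auto

lemma interleave_append: "length i = length u \<Longrightarrow> interleave (u @ v) (i @ j) = interleave u i @ interleave v j"
  by (induction u i rule: list_induct2') auto

lemma length_interleave: "length i = length w \<Longrightarrow> length (interleave w i) = 2 * length w"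
  by (induction w i rule: list_induct2') auto

lemma parities_append: "parities b (u @ v) = parities b u @ parities (b \<noteq> odd (length u)) v"
  by (induction b u rule: parities.induct) auto

lemma kept_append: "length i = length u \<Longrightarrow> kept (u @ v) (i @ j) = kept u i @ kept v j"
  by (induction u i rule: list_induct2') auto

lemma length_kept: "length i = length W \<Longrightarrow> length (kept W i) = length (parities b W)"
  by (induction W i arbitrary: b rule: list_induct2') auto

lemma parities_substitute: "parities True (substitute w) = w"
  by (induction w) auto

lemma kept_interleave: "length i = length w \<Longrightarrow> kept (substitute w) (interleave w i) = i"
  by (induction w i rule: list_induct2') auto

abbreviation "zbar \<equiv> map_option Not"
abbreviation "zix n \<equiv> case_option {1..n} (\<lambda>_. {0::nat})"

lemma colour_system_z: "colour_system zbar (zix n)"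
  by unfold_locales (auto simp: option.map_comp comp_def option.map_ident split: option.splits)

text \<open>Every arch becomes two nested ones, the inner inserted just after the left foot of the
  outer. The order of the two letters decides whether \<open>z\<close> or \<open>o\<close> is
  outside, and the indices at \<open>z\<close> agree trivially.\<close>

lemma substitute_pairing:
  assumes "fits (\<lambda>a b. b = (\<not> a)) s w"
  shows "\<exists>t. fits (\<lambda>a b. b = zbar a) t (substitute w) \<and>
    (\<forall>i. length i = length w \<longrightarrow> (fits (=) t (interleave w i) \<longleftrightarrow> fits (=) s i))"
  using assms
proof (induction s arbitrary: w rule: pairing_insert_induct)
  case Empty
  then show ?case by (intro exI[of _ Empty]) simp
next
  case (insert k s)
  obtain u e e' v where w: "w = u @ e # e' # v" "length u = k" "e' = (\<not> e)" "fits (\<lambda>a b. b = (\<not> a)) s (u @ v)"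
    by (rule fits_insert_archE[OF insert.prems insert.hyps])
  obtain t where t: "fits (\<lambda>a b. b = zbar a) t (substitute (u @ v))"
    "\<And>i. length i = length (u @ v) \<Longrightarrow> fits (=) t (interleave (u @ v) i) \<longleftrightarrow> fits (=) s i"
    using insert.IH[OF w(4)] by blast
  let ?t = "insert_arch (Suc (2 * k)) (insert_arch (2 * k) t)"
  have k: "2 * k \<le> 2 * arcs t" using fits_length[OF t(1)] w(2) by (simp add: length_substitute)
  have fits: "fits R ?t (xs @ a # b # b' # a' # ys) \<longleftrightarrow> R a a' \<and> R b b' \<and> fits R t (xs @ ys)"
    if "length xs = 2 * k" for R :: "'a \<Rightarrow> 'a \<Rightarrow> bool" and xs a a' b b' ys
    using fits_insert_arch[of "xs @ [a]" "Suc (2 * k)" "insert_arch (2 * k) t" R b b' "a' # ys"]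
      fits_insert_arch[of xs "2 * k" t R a a' ys] that k by (auto simp: arcs_insert_arch)
  have "fits (\<lambda>a b. b = zbar a) ?t (substitute w)"
    using t(1) w(2,3) fits[of "substitute u" "\<lambda>a b. b = zbar a"]
    by (cases e) (simp_all add: w(1) substitute_append length_substitute)
  moreover have "fits (=) ?t (interleave w i) \<longleftrightarrow> fits (=) (insert_arch k s) i" if len: "length i = length w" for i
  proof -
    have "length u < length i" using len w(1) by simp
    then obtain i1 a i' where i: "i = i1 @ a # i'" "length i1 = k" using split_list_length w(2) by metis
    then have "length i' = Suc (length v)" using w len by simp
    then obtain b i2 where i': "i' = b # i2" "length i2 = length v" by (cases i') auto
    have "fits (=) t (interleave u i1 @ interleave v i2) \<longleftrightarrow> fits (=) s (i1 @ i2)"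
      using t(2)[of "i1 @ i2"] i(2) i'(2) w(2) interleave_append[of i1 u v i2] by simp
    then show ?thesis
      using fits[of "interleave u i1" "(=)"] fits_insert_arch[OF i(2) insert.hyps, of "(=)" a b i2] i(2) w(2,3)
      by (cases e) (simp_all add: w(1) i(1) i'(1) interleave_append length_interleave)
  qed
  ultimately show ?case by blast
qed

text \<open>An arch between letters of \<open>z\<close> is dropped: its two indices are both 0, and
  removing two neighbouring letters keeps the parities of the rest. An innermost arch between
  letters of \<open>o\<close> joins neighbours, which have opposite parities.\<close>

lemma parities_pairing:
  assumes "fits (\<lambda>a b. b = zbar a) t W"
  shows "\<exists>s. fits (\<lambda>a b. b = (\<not> a)) s (parities p W) \<and>
    (\<forall>i\<in>listset (map (zix n) W). fits (=) t i \<longleftrightarrow> fits (=) s (kept W i))"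
  using assms
proof (induction t arbitrary: W rule: pairing_insert_induct)
  case Empty
  then show ?case by (intro exI[of _ Empty]) simp
next
  case (insert k t)
  obtain u c c' v where W: "W = u @ c # c' # v" "length u = k" "c' = zbar c" "fits (\<lambda>a b. b = zbar a) t (u @ v)"
    by (rule fits_insert_archE[OF insert.prems insert.hyps])
  obtain s where s: "fits (\<lambda>a b. b = (\<not> a)) s (parities p (u @ v))"
    "\<And>i. i \<in> listset (map (zix n) (u @ v)) \<Longrightarrow> fits (=) t i \<longleftrightarrow> fits (=) s (kept (u @ v) i)"
    using insert.IH[OF W(4)] by blast
  interpret colour_system zbar "zix n" by (rule colour_system_z)
  have split: "\<exists>i1 a b i2. i = i1 @ a # b # i2 \<and> length i1 = k \<and> a \<in> zix n c \<and> b \<in> zix n c \<and>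
    (fits (=) t (i1 @ i2) \<longleftrightarrow> fits (=) s (kept u i1 @ kept v i2))" if i: "i \<in> idx W" for i
  proof -
    obtain i1 i' where i1: "i = i1 @ i'" "i1 \<in> idx u" "i' \<in> idx (c # c' # v)" "length i1 = length u"
      using i unfolding W(1) by (rule idx_appendE) blast
    then obtain a b i2 where i2: "i' = a # b # i2" "a \<in> zix n c" "b \<in> zix n c'" "i2 \<in> idx v"
      by (auto simp: set_Cons_def simp del: One_nat_def)
    have "i1 @ i2 \<in> idx (u @ v)" using i1 i2 by (simp only: idx_append_iff)
    then show ?thesis using s(2)[of "i1 @ i2"] i1 i2 W(2,3) kept_append[of i1 u v i2] ix_bar[of c] by auto
  qed
  show ?case
  proof (cases c)
    case (Some e)
    have "parities p W = parities p (u @ v)" using W(3) Some by (simp add: W(1) parities_append)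
    moreover have "fits (=) (insert_arch k t) i \<longleftrightarrow> fits (=) s (kept W i)" if "i \<in> idx W" for i
    proof -
      obtain i1 a b i2 where i: "i = i1 @ a # b # i2" "length i1 = k" "a \<in> zix n c" "b \<in> zix n c"
        "fits (=) t (i1 @ i2) \<longleftrightarrow> fits (=) s (kept u i1 @ kept v i2)" using split[OF \<open>i \<in> idx W\<close>] by blast
      then have "a = b" using Some by simp
      then show ?thesis using fits_insert_arch[OF i(2) insert.hyps, of "(=)" a b i2] i(5) W(3) Some i(2) W(2)
        by (simp add: i(1) W(1) kept_append)
    qed
    ultimately show ?thesis using s(1) by metis
  next
    case None
    let ?k = "length (parities p u)"
    have k: "?k \<le> 2 * arcs s" using fits_length[OF s(1)] by (simp add: parities_append)
    have "fits (\<lambda>a b. b = (\<not> a)) (insert_arch ?k s) (parities p W)"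
      using fits_insert_arch[OF refl k] s(1) W(3) None by (simp add: W(1) parities_append)
    moreover have "fits (=) (insert_arch k t) i \<longleftrightarrow> fits (=) (insert_arch ?k s) (kept W i)" if "i \<in> idx W" for i
    proof -
      obtain i1 a b i2 where i: "i = i1 @ a # b # i2" "length i1 = k"
        "fits (=) t (i1 @ i2) \<longleftrightarrow> fits (=) s (kept u i1 @ kept v i2)" using split[OF \<open>i \<in> idx W\<close>] by blast
      then show ?thesis using fits_insert_arch[OF i(2) insert.hyps, of "(=)" a b i2]
          fits_insert_arch[OF length_kept[of i1 u p] k, of "(=)" a b "kept v i2"] W(2,3) None
        by (simp add: W(1) kept_append)
    qed
    ultimately show ?thesis by blast
  qed
qed

lemma interleave_bij: "bij_betw (interleave w) (listset (map (\<lambda>_. {1..n}) w)) (listset (map (zix n) (substitute w)))"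
proof (rule bij_betw_byWitness[where f' = "kept (substitute w)"])
  have len: "length i = length w" if "i \<in> listset (map (\<lambda>_. {1..n}) w)" for i
    using length_listset[OF that] by simp
  show "\<forall>i\<in>listset (map (\<lambda>_. {1..n}) w). kept (substitute w) (interleave w i) = i"
    using len by (simp add: kept_interleave)
  have "J \<in> listset (map (zix n) (substitute w)) \<Longrightarrow>
    interleave w (kept (substitute w) J) = J \<and> kept (substitute w) J \<in> listset (map (\<lambda>_. {1..n}) w)" for J
  proof (induction w arbitrary: J)
    case (Cons e w)
    then show ?case by (cases e) (auto simp: set_Cons_def simp del: One_nat_def)
  qed simp
  then show "\<forall>J\<in>listset (map (zix n) (substitute w)). interleave w (kept (substitute w) J) = J"
    "kept (substitute w) ` listset (map (zix n) (substitute w)) \<subseteq> listset (map (\<lambda>_. {1..n}) w)" by blast+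
  have "i \<in> listset (map (\<lambda>_. {1..n}) w) \<Longrightarrow> interleave w i \<in> listset (map (zix n) (substitute w))" for i
  proof (induction w arbitrary: i)
    case (Cons e w)
    then show ?case by (cases e) (auto simp: set_Cons_def simp del: One_nat_def)
  qed simp
  then show "interleave w ` listset (map (\<lambda>_. {1..n}) w) \<subseteq> listset (map (zix n) (substitute w))" by blast
qed

lemma E_substitute:
  assumes ij: "i \<in> listset (map (\<lambda>_. {1..n}) w)" "j \<in> listset (map (\<lambda>_. {1..n}) w)"
  shows "E\<^sub>u n w i j = colour_system.E zbar (zix n) (substitute w) (interleave w i) (interleave w j)"
proof (rule colour_system_transport[OF _ colour_system_z interleave_bij _ _ ij])
  show "colour_system Not (\<lambda>_. {1..n})" by unfold_locales auto
  have len: "length i = length w" if "i \<in> listset (map (\<lambda>_. {1..n}) w)" for i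
    using length_listset[OF that] by simp
  show "\<exists>s. fits (\<lambda>a b. b = (\<not> a)) s w \<and> (\<forall>i\<in>listset (map (\<lambda>_. {1..n}) w). fits (=) t (interleave w i) \<longleftrightarrow> fits (=) s i)"
    if t: "fits (\<lambda>a b. b = zbar a) t (substitute w)" for t
  proof -
    obtain s where s: "fits (\<lambda>a b. b = (\<not> a)) s w"
      "\<And>J. J \<in> listset (map (zix n) (substitute w)) \<Longrightarrow> fits (=) t J \<longleftrightarrow> fits (=) s (kept (substitute w) J)"
      using parities_pairing[OF t, of True n] by (auto simp: parities_substitute)
    have "fits (=) t (interleave w i) \<longleftrightarrow> fits (=) s i" if "i \<in> listset (map (\<lambda>_. {1..n}) w)" for i
      using s(2)[OF bij_betwE[OF interleave_bij, rule_format, OF that]] kept_interleave[OF len[OF that]] by simp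
    with s(1) show ?thesis by blast
  qed
  show "\<exists>t. fits (\<lambda>a b. b = zbar a) t (substitute w) \<and> (\<forall>i\<in>listset (map (\<lambda>_. {1..n}) w). fits (=) t (interleave w i) \<longleftrightarrow> fits (=) s i)"
    if "fits (\<lambda>a b. b = (\<not> a)) s w" for s
    using substitute_pairing[OF that] len by blast
qed

lemma E_orthogonal:
  assumes ij: "i \<in> listset (replicate k {1..n})" "j \<in> listset (replicate k {1..n})"
  shows "E\<^sub>o n (replicate k ()) i j = colour_system.E zbar (zix n) (replicate k None) i j"
proof (rule colour_system_transport[OF _ colour_system_z, where \<sigma> = "\<lambda>i. i"])
  show "colour_system (\<lambda>_. ()) (\<lambda>_. {1..n})" by unfold_locales auto
  show "bij_betw (\<lambda>i. i) (listset (map (\<lambda>_. {1..n}) (replicate k ()))) (listset (map (zix n) (replicate k None)))"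
    by (simp add: bij_betw_def)
  show "i \<in> listset (map (\<lambda>_. {1..n}) (replicate k ()))" "j \<in> listset (map (\<lambda>_. {1..n}) (replicate k ()))"
    using ij by simp_all
  have fits: "fits (\<lambda>a b. b = ()) t (replicate k ()) \<longleftrightarrow> fits (\<lambda>a b. b = zbar a) t (replicate k None)" for t
    by (auto intro!: fits_replicate dest: fits_length)
  show "\<exists>s. fits (\<lambda>a b. b = ()) s (replicate k ()) \<and> (\<forall>i\<in>listset (map (\<lambda>_. {1..n}) (replicate k ())). fits (=) t i \<longleftrightarrow> fits (=) s i)"
    if "fits (\<lambda>a b. b = zbar a) t (replicate k None)" for t using that fits by blast
  show "\<exists>t. fits (\<lambda>a b. b = zbar a) t (replicate k None) \<and> (\<forall>i\<in>listset (map (\<lambda>_. {1..n}) (replicate k ())). fits (=) t i \<longleftrightarrow> fits (=) s i)"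
    if "fits (\<lambda>a b. b = ()) s (replicate k ())" for s using that fits by blast
qed

lemma word_product_polar:
  "word_product (letter 0 0 False * (\<Sum>a\<in>S. letter a a False)) w =
    (\<Sum>i\<in>listset (replicate (length w) S). entry (concat (map (\<lambda>e. [e, e]) w)) (interleave w i) (interleave w i))"
    (is "word_product ?x w = _")
proof (induction w)
  case Nil
  show ?case by (simp add: word_product_def)
next
  case (Cons e w)
  let ?es = "concat (map (\<lambda>e. [e, e]) w)"
  let ?l = "\<lambda>a. if e then letter a a True * letter 0 0 True else letter 0 0 False * letter a a False"
  have star: "(if e then pstar ?x else ?x) = (\<Sum>a\<in>S. ?l a)"
    by (cases e) (simp_all add: pstar_mult pstar_sum pstar_letter sum_distrib_left sum_distrib_right)
  have "word_product ?x (e # w) = (if e then pstar ?x else ?x) * word_product ?x w" by (simp add: word_product_def)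
  also have "\<dots> = (\<Sum>a\<in>S. \<Sum>i\<in>listset (replicate (length w) S). ?l a * entry ?es (interleave w i) (interleave w i))"
    unfolding star Cons sum_product ..
  also have "\<dots> = (\<Sum>a\<in>S. \<Sum>i\<in>listset (replicate (length w) S).
      entry (concat (map (\<lambda>e. [e, e]) (e # w))) (interleave (e # w) (a # i)) (interleave (e # w) (a # i)))"
    by (intro sum.cong refl) (cases e; simp add: entry_Cons mult.assoc)
  finally show ?case unfolding list.size add_Suc_right add_0_right replicate_Suc sum_listset_Cons .
qed

lemma polar_decomposition:
  assumes u: "haar_u n hu" and o: "haar_o n ho" and s: "s \<in> {1..n}"
  shows "\<exists>(B :: space) \<psi> z x. star_prob_space B \<psi> \<and> haar_unitary B \<psi> z \<and> x \<in> carrier B \<and>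
    same_star_distribution B \<psi> x (A_o n) ho (o_var s n) \<and> star_free B \<psi> z x \<and>
    same_star_distribution (A_u n) hu (u_var s n) B \<psi> (z \<otimes>\<^bsub>B\<^esub> x)"
proof -
  \<comment> \<open>Row 0 is reserved for \<open>z\<close>, with a colour that depends on the star
    tag; all other rows carry the self-dual colour of \<open>o\<close>.\<close>
  let ?col = "\<lambda>i e. if i = (0::nat) then Some e else None"
  interpret moment_system zbar "zix n" ?col
    by (intro moment_system.intro colour_system_z moment_system_axioms.intro) auto
  interpret B: star_algebra B by (rule B_star_algebra)
  note One_nat_def [simp del]
  define x where "x = (\<Sum>i\<in>{1..s}. letter i i False)"
  have sub: "listset (replicate k {1..s}) \<subseteq> listset (replicate k {1..n})" for k
    using s by (intro listset_replicate_mono) auto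
  have unitary: "code (letter 0 0 (\<not> e)) \<otimes>\<^bsub>B\<^esub> code (letter 0 0 e) = \<one>\<^bsub>B\<^esub>" for e
    using null_pair[of 0 "\<not> e" "Some (\<not> e)" 0 e] by (simp add: B_simps code_eq_iff delta_def)
  \<comment> \<open>A nonempty word in \<open>z\<close> alone, or in its adjoint alone, has a single
    colour that is not its own dual; no pairing matches it, so the projection is 0.\<close>
  have powers: "lin mom (letter 0 0 e ^ k) = 0" if "k > 0" for e k
  proof -
    have "letter 0 0 e ^ k = entry (replicate k e) (replicate k 0) (replicate k 0)"
      by (induction k) (simp_all add: entry_Cons)
    moreover have "map2 ?col (replicate k 0) (replicate k e) = replicate k (Some e)"
      by (simp add: zip_replicate)
    moreover have "NC (replicate k (Some e)) = {}"
    proof -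
      have False if t: "matches t (replicate k (Some e))" for t
      proof (cases t)
        case Empty
        then show ?thesis using t \<open>k > 0\<close> by simp
      next
        case (Arch l r)
        obtain a b ys zs where ab: "replicate k (Some e) = a # ys @ b # zs" "b = zbar a"
          using t unfolding Arch fits.simps by blast
        then have "a \<in> set (replicate k (Some e))" "b \<in> set (replicate k (Some e))" by simp_all
        then show False using ab(2) by auto
      qed
      then show ?thesis by blast
    qed
    ultimately show ?thesis using mom_entry[of "replicate k 0" "replicate k e" "replicate k 0"] E_zero by simp
  qed
  have haar: "haar_unitary B \<psi> (code (letter 0 0 False))"
    unfolding haar_unitary_def
  proof (intro conjI allI impI)
    show "code (letter 0 0 False) \<in> carrier B" by (simp add: B_carrier)
    show "star B (code (letter 0 0 False)) \<otimes>\<^bsub>B\<^esub> code (letter 0 0 False) = \<one>\<^bsub>B\<^esub>"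
      "code (letter 0 0 False) \<otimes>\<^bsub>B\<^esub> star B (code (letter 0 0 False)) = \<one>\<^bsub>B\<^esub>"
      using unitary[of False] unitary[of True] by (simp_all add: B_star pstar_letter)
    \<comment> \<open>Negative powers are formed with the inverse in the ring, which is thereby
      identified with a power of the starred letter.\<close>
    have inverse: "code (letter 0 0 (\<not> e) ^ k) \<otimes>\<^bsub>B\<^esub> code (letter 0 0 e ^ k) = \<one>\<^bsub>B\<^esub>" for k e
    proof (induction k)
      case (Suc k)
      have "code (letter 0 0 (\<not> e) ^ Suc k) \<otimes>\<^bsub>B\<^esub> code (letter 0 0 e ^ Suc k) =
        code (letter 0 0 (\<not> e) ^ k) \<otimes>\<^bsub>B\<^esub> (code (letter 0 0 (\<not> e)) \<otimes>\<^bsub>B\<^esub> code (letter 0 0 e)) \<otimes>\<^bsub>B\<^esub> code (letter 0 0 e ^ k)"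
        unfolding B_mult by (simp only: power_Suc2[of "letter 0 0 (\<not> e)"] power_Suc[of "letter 0 0 e"] mult.assoc)
      then show ?case using Suc unfolding unitary by (simp add: B_carrier)
    qed (simp add: B_simps)
    fix m :: int assume m: "m \<noteq> 0"
    show "\<psi> (code (letter 0 0 False) [^]\<^bsub>B\<^esub> m) = 0"
    proof (cases "m < 0")
      case True
      have "inv\<^bsub>B\<^esub> (code (letter 0 0 False ^ nat (- m))) = code (letter 0 0 True ^ nat (- m))"
        by (rule monoid.inv_char[OF ring.is_monoid[OF star_algebra.axioms(1)[OF B_star_algebra]]]) (use inverse[of False] inverse[of True] in \<open>simp_all add: B_carrier\<close>)
      then show ?thesis using True powers[of "nat (- m)" True] by (simp add: int_pow_def2 code_power \<psi>_code)
    next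
      case False
      then show ?thesis using m powers[of "nat m" False] by (simp add: int_pow_def2 code_power \<psi>_code)
    qed
  qed
  have free: "star_free B \<psi> (code (letter 0 0 False)) (code x)"
  proof (rule star_free_code[where \<kappa> = "\<lambda>c. c \<noteq> None"])
    show "letter 0 0 False \<in> class_algebra (\<lambda>c. c \<noteq> None) True" "x \<in> class_algebra (\<lambda>c. c \<noteq> None) False"
      unfolding x_def class_algebra_def[of "\<lambda>c. c \<noteq> None", OF option.map_disc_iff[THEN arg_cong[of _ _ Not]]] letter_def
      by (auto intro!: monoid_algebra_sum monoid_algebra_single simp: colours_def)
  qed simp
  have orthogonal: "same_star_distribution B \<psi> (code x) (A_o n) ho (o_var s n)"
    unfolding same_star_distribution_def
  proof
    fix w :: "bool list"
    let ?k = "length w"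
    have x: "x = scalar (of_real 1) * (\<Sum>i\<in>{1..s}. letter i i False)" by (simp add: x_def)
    have "star_moment B \<psi> (code x) w = (\<Sum>i\<in>listset (replicate ?k {1..s}). lin mom (entry w i i))"
      unfolding star_moment_B word_product_diagonal[OF x] by (simp add: lin_sum)
    also have "\<dots> = (\<Sum>i\<in>listset (replicate ?k {1..s}). E\<^sub>o n (replicate ?k ()) i i)"
    proof (rule sum.cong[OF refl])
      fix i assume i: "i \<in> listset (replicate ?k {1..s})"
      have "map2 ?col i w = replicate ?k None"
        using i
      proof (induction w arbitrary: i)
        case (Cons e w)
        then show ?case by (auto simp: set_Cons_def)
      qed simp
      then have "lin mom (entry w i i) = E (replicate ?k None) i i"
        using mom_entry[of i w i] length_listset[OF i] by simp
      then show "lin mom (entry w i i) = E\<^sub>o n (replicate ?k ()) i i"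
        using E_orthogonal[of i ?k n i] subsetD[OF sub i] by simp
    qed
    also have "\<dots> = star_moment (A_o n) ho (o_var s n) w"
      using star_moment_o[OF o, of s w] s by simp
    finally show "star_moment B \<psi> (code x) w = star_moment (A_o n) ho (o_var s n) w" .
  qed
  have "same_star_distribution (A_u n) hu (u_var s n) B \<psi> (code (letter 0 0 False) \<otimes>\<^bsub>B\<^esub> code x)"
    unfolding same_star_distribution_def
  proof
    fix w :: "bool list"
    let ?k = "length w" and ?es = "concat (map (\<lambda>e. [e, e]) w)"
    have "star_moment B \<psi> (code (letter 0 0 False) \<otimes>\<^bsub>B\<^esub> code x) w =
      (\<Sum>i\<in>listset (replicate ?k {1..s}). lin mom (entry ?es (interleave w i) (interleave w i)))"
      unfolding B_mult star_moment_B x_def word_product_polar lin_sum ..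
    also have "\<dots> = (\<Sum>i\<in>listset (replicate ?k {1..s}). E\<^sub>u n w i i)"
    proof (rule sum.cong[OF refl])
      fix i assume i: "i \<in> listset (replicate ?k {1..s})"
      have "map2 ?col (interleave w i) ?es = substitute w"
        using i
      proof (induction w arbitrary: i)
        case (Cons e w)
        then show ?case by (auto simp: set_Cons_def)
      qed simp
      moreover have "length ?es = 2 * ?k" by (induction w) auto
      ultimately have "lin mom (entry ?es (interleave w i) (interleave w i)) = E (substitute w) (interleave w i) (interleave w i)"
        using mom_entry[of "interleave w i" ?es "interleave w i"] length_listset[OF i] length_interleave[of i w] by simp
      moreover have "i \<in> listset (map (\<lambda>_. {1..n}) w)" using sub i by (auto simp: map_replicate_const)
      ultimately show "lin mom (entry ?es (interleave w i) (interleave w i)) = E\<^sub>u n w i i"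
        by (simp only: E_substitute)
    qed
    also have "\<dots> = star_moment (A_u n) hu (u_var s n) w"
      using star_moment_u(2)[OF u, of s w] s by simp
    finally show "star_moment (A_u n) hu (u_var s n) w = star_moment B \<psi> (code (letter 0 0 False) \<otimes>\<^bsub>B\<^esub> code x) w" ..
  qed
  then show ?thesis using B_space haar free orthogonal
    by (intro exI[of _ B] exI[of _ \<psi>] exI[of _ "code (letter 0 0 False)"] exI[of _ "code x"]) (auto simp: B_carrier)
qed

theorem theorem9p3:
  fixes hu ho :: "nat \<Rightarrow> elem \<Rightarrow> complex"
  assumes "\<And>n. 2 \<le> n \<Longrightarrow> haar_u n (hu n)"
    and "\<And>n. 2 \<le> n \<Longrightarrow> haar_o n (ho n)"
  shows
    "(\<forall>n\<ge>2. \<forall>s\<in>{1..n}.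
        \<exists>(B :: space) \<psi> z x.
          star_prob_space B \<psi> \<and> haar_unitary B \<psi> z \<and> x \<in> carrier B \<and>
          same_star_distribution B \<psi> x (A_o n) (ho n) (o_var s n) \<and>
          star_free B \<psi> z x \<and>
          same_star_distribution (A_u n) (hu n) (u_var s n) B \<psi> (z \<otimes>\<^bsub>B\<^esub> x)) \<and>
     (\<forall>n\<ge>2. circular (A_u n) (hu n) (u_var n n)) \<and>
     (\<forall>s\<ge>1. \<exists>(B :: space) \<psi> c.
        star_prob_space B \<psi> \<and> circular B \<psi> c \<and>
        (\<forall>w. (\<lambda>n. star_moment (A_u n) (hu n)
                (complex_of_real (sqrt (real n / real s)) \<odot>\<^bsub>A_u n\<^esub> u_var s n) w)
           \<longlonglongrightarrow> star_moment B \<psi> c w))"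
proof (intro conjI allI impI ballI)
  show "\<exists>(B :: space) \<psi> z x. star_prob_space B \<psi> \<and> haar_unitary B \<psi> z \<and> x \<in> carrier B \<and>
      same_star_distribution B \<psi> x (A_o n) (ho n) (o_var s n) \<and> star_free B \<psi> z x \<and>
      same_star_distribution (A_u n) (hu n) (u_var s n) B \<psi> (z \<otimes>\<^bsub>B\<^esub> x)"
    if "2 \<le> n" "s \<in> {1..n}" for n s
    by (rule polar_decomposition[OF assms[OF that(1)] that(2)])
  show "circular (A_u n) (hu n) (u_var n n)" if "2 \<le> n" for n
    by (rule circular_u[OF that assms(1)[OF that]])
  show "\<exists>(B :: space) \<psi> c. star_prob_space B \<psi> \<and> circular B \<psi> c \<and>
      (\<forall>w. (\<lambda>n. star_moment (A_u n) (hu n) (complex_of_real (sqrt (real n / real s)) \<odot>\<^bsub>A_u n\<^esub> u_var s n) w)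
         \<longlonglongrightarrow> star_moment B \<psi> c w)" if "1 \<le> s" for s
    by (rule asymptotically_circular[OF assms(1) that])
qed

end
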